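(* For all integers $N\ge 3$, the free unitary group $U^+_N$ is topologically generated by its quantum subgroups $U_N$ and $U^+_{N-1}$: $$U^+_N = \langle U_N,\ U^+_{N-1}\rangle.$$
   Context: A CQG algebra is a complex Hopf $*$-algebra $\mathcal{A}$ that is cosemisimple and whose unique unital (left and right) integral $h:\mathcal{A}\to\mathbb{C}$ is positive, i.e. $h(x^*x)\ge 0$ for all $x\in\mathcal{A}$. The category of compact quantum groups is the category dual to that of CQG algebras; $\mathcal{O}(G)$ denotes the CQG algebra attached to a compact quantum group $G$. For an ordinary compact group $G$, $\mathcal{O}(G)$ is the algebra of representative functions (generated by matrix entries of finite-dimensional representations). A quantum subgroup $H\le G$ means a quotient Hopf $*$-algebra $\mathcal{O}(G)\to\mathcal{O}(H)$. Topological generation: a family $G_i\le G$, $i\in I$, of quantum subgroups topologically generates $G$, written $G=\langle G_i,\ i\in I\rangle$, if the quotient maps $\mathcal{O}(G)\to\mathcal{O}(G_i)$, $i\in I$, do not all factor through one and the same proper quotient Hopf $*$-algebra of $\mathcal{O}(G)$. Free unitary group: for $N\ge 2$, $U^+_N$ is the compact quantum group whose CQG algebra $\mathcal{O}(U^+_N)$ is generated as a $*$-algebra by $u_{ij}$, $1\le i,j\le N$, subject to the relations that both matrices $u=(u_{ij})_{i,j}$ and $\overline{u}=(u_{ij}^* )_{i,j}$ in $M_N(\mathcal{O}(U^+_N))$ are unitary, with comultiplication $\Delta(u_{ij})=\sum_k u_{ik}\otimes u_{kj}$ and counit $\varepsilon(u_{ij})=\delta_{ij}$. The classical unitary group $U_N$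 is a quantum subgroup of $U^+_N$ by sending $u_{ij}$ to the $(i,j)$ coordinate function on $U_N$. The quantum group $U^+_{N-1}$ is a quantum subgroup of $U^+_N$ in the standard corner fashion: $u_{ij}\mapsto u_{ij}$ for $1\le i,j\le N-1$, $u_{NN}\mapsto 1$, and $u_{iN},u_{Ni}\mapsto 0$ for $1\le i\le N-1$. *)

theory Defs
  imports
    "HOL-Analysis.Analysis"
    "HOL-Library.Poly_Mapping"
    "HOL-Algebra.QuotRing"
    "HOL-Algebra.Module"
begin

section \<open>Complex *-algebras\<close>

record 'a star_alg = "(complex, 'a) module" +
  star :: "'a \<Rightarrow> 'a"

definition complex_alg :: "complex star_alg" where
  "complex_alg =
    \<lparr>carrier = UNIV, mult = (*), one = 1, zero = 0, add = (+), smult = (*), star = cnj\<rparr>"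

definition star_algebra :: "('a, 'r) star_alg_scheme \<Rightarrow> bool" where
  "star_algebra A \<longleftrightarrow>
    ring A \<and> module complex_alg A \<and>
    (\<forall>c. \<forall>x\<in>carrier A. \<forall>y\<in>carrier A.
      (c \<odot>\<^bsub>A\<^esub> x) \<otimes>\<^bsub>A\<^esub> y = c \<odot>\<^bsub>A\<^esub> (x \<otimes>\<^bsub>A\<^esub> y) \<and>
      x \<otimes>\<^bsub>A\<^esub> (c \<odot>\<^bsub>A\<^esub> y) = c \<odot>\<^bsub>A\<^esub> (x \<otimes>\<^bsub>A\<^esub> y)) \<and>
    star A \<in> carrier A \<rightarrow> carrier A \<and>
    (\<forall>x\<in>carrier A. star A (star A x) = x) \<and>
    (\<forall>c. \<forall>x\<in>carrier A. star A (c \<odot>\<^bsub>A\<^esub> x) = cnj c \<odot>\<^bsub>A\<^esub> star A x) \<and>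
    (\<forall>x\<in>carrier A. \<forall>y\<in>carrier A.
      star A (x \<oplus>\<^bsub>A\<^esub> y) = star A x \<oplus>\<^bsub>A\<^esub> star A y \<and>
      star A (x \<otimes>\<^bsub>A\<^esub> y) = star A y \<otimes>\<^bsub>A\<^esub> star A x)"

definition star_hom ::
  "('a, 'r) star_alg_scheme \<Rightarrow> ('b, 's) star_alg_scheme \<Rightarrow> ('a \<Rightarrow> 'b) \<Rightarrow> bool" where
  "star_hom A B f \<longleftrightarrow>
    f \<in> ring_hom A B \<and>
    (\<forall>c. \<forall>x\<in>carrier A. f (c \<odot>\<^bsub>A\<^esub> x) = c \<odot>\<^bsub>B\<^esub> f x) \<and>
    (\<forall>x\<in>carrier A. f (star A x) = star B (f x))"

text \<open>
  The quotient by a two-sided ideal \<open>I\<close> with \<open>star A ` I \<subseteq> I\<close>; such an \<open>I\<close> is a linear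
  subspace because the algebra is unital. Its elements are the cosets \<open>I +> x\<close>.
\<close>

definition star_quot :: "('a, 'r) star_alg_scheme \<Rightarrow> 'a set \<Rightarrow> 'a set star_alg" where
  "star_quot A I =
    \<lparr>carrier = carrier (A Quot I),
     mult = mult (A Quot I), one = one (A Quot I),
     zero = zero (A Quot I), add = add (A Quot I),
     smult = (\<lambda>c X. \<Union>x\<in>X. I +>\<^bsub>A\<^esub> (c \<odot>\<^bsub>A\<^esub> x)),
     star = (\<lambda>X. \<Union>x\<in>X. I +>\<^bsub>A\<^esub> star A x)\<rparr>"

text \<open>
  The *-algebra with basis a monoid \<open>M\<close> whose involution is the conjugate-linear extension of
  an anti-automorphism \<open>adj\<close> of \<open>M\<close>.
\<close>

definition monoid_star_alg ::
  "('m, 'r) monoid_scheme \<Rightarrow> ('m \<Rightarrow> 'm) \<Rightarrow> ('m \<Rightarrow>\<^sub>0 complex) star_alg" where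
  "monoid_star_alg M adj =
    \<lparr>carrier = {f. Poly_Mapping.keys f \<subseteq> carrier M},
     mult = (\<lambda>f g. \<Sum>u\<in>Poly_Mapping.keys f. \<Sum>v\<in>Poly_Mapping.keys g.
       Poly_Mapping.single (u \<otimes>\<^bsub>M\<^esub> v) (Poly_Mapping.lookup f u * Poly_Mapping.lookup g v)),
     one = Poly_Mapping.single \<one>\<^bsub>M\<^esub> 1,
     zero = 0,
     add = (+),
     smult = (\<lambda>c. Poly_Mapping.map ((*) c)),
     star = (\<lambda>f. \<Sum>u\<in>Poly_Mapping.keys f.
       Poly_Mapping.single (adj u) (cnj (Poly_Mapping.lookup f u)))\<rparr>"


section \<open>Tensor products\<close>

text \<open>
  The product and involution that \<open>A \<otimes> B\<close> should carry already exist on the vector space with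
  basis \<open>A \<times> B\<close>, as the monoid algebra of the product of the multiplicative monoids.
  A product of a bilinearity relation with a basis element is again a bilinearity relation,
  so the ideal generated by these relations is just their linear span, and the quotient is the
  usual algebraic tensor product.
\<close>

definition pair_alg ::
  "('a, 'r) star_alg_scheme \<Rightarrow> ('b, 's) star_alg_scheme \<Rightarrow> ('a \<times> 'b \<Rightarrow>\<^sub>0 complex) star_alg" where
  "pair_alg A B = monoid_star_alg (A \<times>\<times> B) (map_prod (star A) (star B))"

definition bilinear_relations ::
  "('a, 'r) star_alg_scheme \<Rightarrow> ('b, 's) star_alg_scheme \<Rightarrow> ('a \<times> 'b \<Rightarrow>\<^sub>0 complex) set" where
  "bilinear_relations A B =
    {Poly_Mapping.single (a \<oplus>\<^bsub>A\<^esub> a', b) 1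
       - Poly_Mapping.single (a, b) 1 - Poly_Mapping.single (a', b) 1 | a a' b.
       a \<in> carrier A \<and> a' \<in> carrier A \<and> b \<in> carrier B} \<union>
    {Poly_Mapping.single (a, b \<oplus>\<^bsub>B\<^esub> b') 1
       - Poly_Mapping.single (a, b) 1 - Poly_Mapping.single (a, b') 1 | a b b'.
       a \<in> carrier A \<and> b \<in> carrier B \<and> b' \<in> carrier B} \<union>
    {Poly_Mapping.single (c \<odot>\<^bsub>A\<^esub> a, b) 1 - Poly_Mapping.single (a, b) c | c a b.
       a \<in> carrier A \<and> b \<in> carrier B} \<union>
    {Poly_Mapping.single (a, c \<odot>\<^bsub>B\<^esub> b) 1 - Poly_Mapping.single (a, b) c | c a b.
       a \<in> carrier A \<and> b \<in> carrier B}"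

definition tensor_null ::
  "('a, 'r) star_alg_scheme \<Rightarrow> ('b, 's) star_alg_scheme \<Rightarrow> ('a \<times> 'b \<Rightarrow>\<^sub>0 complex) set" where
  "tensor_null A B = Idl\<^bsub>pair_alg A B\<^esub> (bilinear_relations A B)"

type_synonym ('a, 'b) tensor = "('a \<times> 'b \<Rightarrow>\<^sub>0 complex) set"

definition tensor_alg ::
  "('a, 'r) star_alg_scheme \<Rightarrow> ('b, 's) star_alg_scheme \<Rightarrow> ('a, 'b) tensor star_alg" where
  "tensor_alg A B = star_quot (pair_alg A B) (tensor_null A B)"

definition tens ::
  "('a, 'r) star_alg_scheme \<Rightarrow> ('b, 's) star_alg_scheme \<Rightarrow> 'a \<Rightarrow> 'b \<Rightarrow> ('a, 'b) tensor" where
  "tens A B a b = tensor_null A B +>\<^bsub>pair_alg A B\<^esub> Poly_Mapping.single (a, b) 1"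

text \<open>
  The linear map on a tensor product induced by a bilinear map \<open>\<phi>\<close> into \<open>C\<close>: it is evaluated on
  a representing formal sum, the value being independent of the representative when \<open>\<phi>\<close> is bilinear.
\<close>

definition tensor_lift ::
  "('c, 't) star_alg_scheme \<Rightarrow> ('a \<Rightarrow> 'b \<Rightarrow> 'c) \<Rightarrow> ('a, 'b) tensor \<Rightarrow> 'c" where
  "tensor_lift C \<phi> X =
    (let f = (SOME f. f \<in> X) in
      \<Oplus>\<^bsub>C\<^esub>p\<in>Poly_Mapping.keys f. Poly_Mapping.lookup f p \<odot>\<^bsub>C\<^esub> \<phi> (fst p) (snd p))"


section \<open>Hopf *-algebras and quantum subgroups\<close>

record 'a hopf_star_alg = "'a star_alg" +
  comult :: "'a \<Rightarrow> ('a, 'a) tensor"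
  counit :: "'a \<Rightarrow> complex"

text \<open>
  The antipode is uniquely determined and automatically preserved by bialgebra homomorphisms,
  so it is not part of the structure. Coassociativity compares
  \<open>(\<Delta> \<otimes> id) \<Delta> x\<close>, reassociated, with \<open>(id \<otimes> \<Delta>) \<Delta> x\<close> in \<open>A \<otimes> (A \<otimes> A)\<close>.
\<close>

definition hopf_star_algebra :: "('a, 'r) hopf_star_alg_scheme \<Rightarrow> bool" where
  "hopf_star_algebra A \<longleftrightarrow>
    star_algebra A \<and>
    star_hom A (tensor_alg A A) (comult A) \<and>
    star_hom A complex_alg (counit A) \<and>
    (\<forall>x\<in>carrier A.
      tensor_lift (tensor_alg A (tensor_alg A A))
        (\<lambda>a b. tensor_lift (tensor_alg A (tensor_alg A A))
           (\<lambda>c d. tens A (tensor_alg A A) c (tens A A d b)) (comult A a)) (comult A x) =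
      tensor_lift (tensor_alg A (tensor_alg A A))
        (\<lambda>a b. tens A (tensor_alg A A) a (comult A b)) (comult A x)) \<and>
    (\<forall>x\<in>carrier A.
      tensor_lift A (\<lambda>a b. counit A a \<odot>\<^bsub>A\<^esub> b) (comult A x) = x \<and>
      tensor_lift A (\<lambda>a b. counit A b \<odot>\<^bsub>A\<^esub> a) (comult A x) = x) \<and>
    (\<exists>S. S \<in> carrier A \<rightarrow> carrier A \<and>
      (\<forall>x\<in>carrier A. \<forall>y\<in>carrier A. S (x \<oplus>\<^bsub>A\<^esub> y) = S x \<oplus>\<^bsub>A\<^esub> S y) \<and>
      (\<forall>c. \<forall>x\<in>carrier A. S (c \<odot>\<^bsub>A\<^esub> x) = c \<odot>\<^bsub>A\<^esub> S x) \<and>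
      (\<forall>x\<in>carrier A.
        tensor_lift A (\<lambda>a b. S a \<otimes>\<^bsub>A\<^esub> b) (comult A x) = counit A x \<odot>\<^bsub>A\<^esub> \<one>\<^bsub>A\<^esub> \<and>
        tensor_lift A (\<lambda>a b. a \<otimes>\<^bsub>A\<^esub> S b) (comult A x) = counit A x \<odot>\<^bsub>A\<^esub> \<one>\<^bsub>A\<^esub>))"

definition hopf_star_hom ::
  "('a, 'r) hopf_star_alg_scheme \<Rightarrow> ('b, 's) hopf_star_alg_scheme \<Rightarrow> ('a \<Rightarrow> 'b) \<Rightarrow> bool" where
  "hopf_star_hom A B f \<longleftrightarrow>
    star_hom A B f \<and>
    (\<forall>x\<in>carrier A.
      comult B (f x) = tensor_lift (tensor_alg B B) (\<lambda>a b. tens B B (f a) (f b)) (comult A x) \<and>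
      counit B (f x) = counit A x)"

definition hopf_star_quotient ::
  "('a, 'r) hopf_star_alg_scheme \<Rightarrow> ('b, 's) hopf_star_alg_scheme \<Rightarrow> ('a \<Rightarrow> 'b) \<Rightarrow> bool" where
  "hopf_star_quotient A Q q \<longleftrightarrow>
    hopf_star_algebra Q \<and> hopf_star_hom A Q q \<and> q ` carrier A = carrier Q"

definition factors_through ::
  "('a, 'r) hopf_star_alg_scheme \<Rightarrow> ('b, 's) hopf_star_alg_scheme \<Rightarrow> ('a \<Rightarrow> 'b) \<Rightarrow>
   ('q, 't) hopf_star_alg_scheme \<Rightarrow> ('a \<Rightarrow> 'q) \<Rightarrow> bool" where
  "factors_through A B \<pi> Q q \<longleftrightarrow>
    (\<exists>\<psi>. hopf_star_hom Q B \<psi> \<and> (\<forall>x\<in>carrier A. \<pi> x = \<psi> (q x)))"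

text \<open>
  Topological generation of the quantum group of \<open>A\<close> by the two quantum subgroups given by quotient
  maps \<open>\<pi>\<^sub>1 : A \<rightarrow> B\<^sub>1\<close> and \<open>\<pi>\<^sub>2 : A \<rightarrow> B\<^sub>2\<close> (a two-member family, as the codomains may live on
  different types). A quotient is proper when the quotient map is not injective. Up to isomorphism
  every quotient of \<open>A\<close> has the cosets of the kernel as its elements, so it suffices to consider
  quotients on the type \<open>'a set\<close>.
\<close>

definition topologically_generated_by ::
  "('a, 'r) hopf_star_alg_scheme \<Rightarrow>
   ('b, 's) hopf_star_alg_scheme \<Rightarrow> ('a \<Rightarrow> 'b) \<Rightarrow>
   ('c, 't) hopf_star_alg_scheme \<Rightarrow> ('a \<Rightarrow> 'c) \<Rightarrow> bool" where
  "topologically_generated_by A B\<^sub>1 \<pi>\<^sub>1 B\<^sub>2 \<pi>\<^sub>2 \<longleftrightarrow>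
    \<not> (\<exists>(Q :: 'a set hopf_star_alg) q.
         hopf_star_quotient A Q q \<and> \<not> inj_on q (carrier A) \<and>
         factors_through A B\<^sub>1 \<pi>\<^sub>1 Q q \<and> factors_through A B\<^sub>2 \<pi>\<^sub>2 Q q)"


section \<open>*-algebras given by generators and relations\<close>

text \<open>The letter \<open>(x, False)\<close> stands for the generator \<open>x\<close> and \<open>(x, True)\<close> for its adjoint.\<close>

type_synonym 'x star_word = "('x \<times> bool) list"

definition free_star_alg :: "'x set \<Rightarrow> ('x star_word \<Rightarrow>\<^sub>0 complex) star_alg" where
  "free_star_alg X =
    monoid_star_alg \<lparr>carrier = lists (X \<times> UNIV), mult = (@), one = []\<rparr>
      (\<lambda>w. rev (map (apsnd Not) w))"

definition relation_ideal ::
  "'x set \<Rightarrow> ('x star_word \<Rightarrow>\<^sub>0 complex) set \<Rightarrow> ('x star_word \<Rightarrow>\<^sub>0 complex) set" where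
  "relation_ideal X R = Idl\<^bsub>free_star_alg X\<^esub> (R \<union> star (free_star_alg X) ` R)"

definition presented_star_alg ::
  "'x set \<Rightarrow> ('x star_word \<Rightarrow>\<^sub>0 complex) set \<Rightarrow> ('x star_word \<Rightarrow>\<^sub>0 complex) set star_alg" where
  "presented_star_alg X R = star_quot (free_star_alg X) (relation_ideal X R)"

definition presented_gen ::
  "'x set \<Rightarrow> ('x star_word \<Rightarrow>\<^sub>0 complex) set \<Rightarrow> 'x \<Rightarrow> ('x star_word \<Rightarrow>\<^sub>0 complex) set" where
  "presented_gen X R x =
    relation_ideal X R +>\<^bsub>free_star_alg X\<^esub> Poly_Mapping.single [(x, False)] 1"

text \<open>
  The *-homomorphism into \<open>B\<close> sending each generator \<open>x\<close> to \<open>\<phi> x\<close>; the value does not depend on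
  the representative when the elements \<open>\<phi> x\<close> satisfy the relations in \<open>B\<close>.
\<close>

primrec word_eval :: "('b, 'r) star_alg_scheme \<Rightarrow> ('x \<Rightarrow> 'b) \<Rightarrow> 'x star_word \<Rightarrow> 'b" where
  "word_eval B \<phi> [] = \<one>\<^bsub>B\<^esub>"
| "word_eval B \<phi> (l # w) =
    (if snd l then star B (\<phi> (fst l)) else \<phi> (fst l)) \<otimes>\<^bsub>B\<^esub> word_eval B \<phi> w"

definition presented_hom ::
  "('b, 'r) star_alg_scheme \<Rightarrow> ('x \<Rightarrow> 'b) \<Rightarrow> ('x star_word \<Rightarrow>\<^sub>0 complex) set \<Rightarrow> 'b" where
  "presented_hom B \<phi> Y =
    (let f = (SOME f. f \<in> Y) in
      \<Oplus>\<^bsub>B\<^esub>w\<in>Poly_Mapping.keys f. Poly_Mapping.lookup f w \<odot>\<^bsub>B\<^esub> word_eval B \<phi> w)"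


section \<open>The free unitary groups\<close>

text \<open>Matrix indices run over \<open>{..<N}\<close>.\<close>

type_synonym uplus_elem = "((nat \<times> nat) star_word \<Rightarrow>\<^sub>0 complex) set"

definition free_unitary_relations :: "nat \<Rightarrow> ((nat \<times> nat) star_word \<Rightarrow>\<^sub>0 complex) set" where
  "free_unitary_relations N =
    (let u = (\<lambda>i j. ((i, j), False)); u' = (\<lambda>i j. ((i, j), True));
         unit = (\<lambda>i j. Poly_Mapping.single [] (if i = j then 1 else 0))
     in
      {(\<Sum>k<N. Poly_Mapping.single [u i k, u' j k] 1) - unit i j | i j. i < N \<and> j < N} \<union>
      {(\<Sum>k<N. Poly_Mapping.single [u' k i, u k j] 1) - unit i j | i j. i < N \<and> j < N} \<union>
      {(\<Sum>k<N. Poly_Mapping.single [u' i k, u j k] 1) - unit i j | i j. i < N \<and> j < N} \<union>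
      {(\<Sum>k<N. Poly_Mapping.single [u k i, u' k j] 1) - unit i j | i j. i < N \<and> j < N})"

definition free_unitary_star_alg :: "nat \<Rightarrow> uplus_elem star_alg" where
  "free_unitary_star_alg N = presented_star_alg ({..<N} \<times> {..<N}) (free_unitary_relations N)"

definition free_unitary_gen :: "nat \<Rightarrow> nat \<Rightarrow> nat \<Rightarrow> uplus_elem" where
  "free_unitary_gen N i j =
    presented_gen ({..<N} \<times> {..<N}) (free_unitary_relations N) (i, j)"

definition free_unitary :: "nat \<Rightarrow> uplus_elem hopf_star_alg" where
  "free_unitary N =
    (let A = free_unitary_star_alg N; u = free_unitary_gen N in
      star_alg.extend A (hopf_star_alg.fields
        (presented_hom (tensor_alg A A)
          (\<lambda>(i, j). \<Oplus>\<^bsub>tensor_alg A A\<^esub>k\<in>{..<N}. tens A A (u i k) (u k j)))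
        (presented_hom complex_alg (\<lambda>(i, j). if i = j then 1 else 0))))"


section \<open>Compact groups and the classical unitary groups\<close>

text \<open>
  Finite-dimensional continuous representations \<open>G \<rightarrow> GL\<^sub>d(\<complex>)\<close> (the values are invertible
  since \<open>\<rho>\<close> is multiplicative and unital). Their matrix entries span the representative functions.
  Functions on the group are extended by \<open>0\<close> outside of it.
\<close>

definition continuous_rep ::
  "('g::topological_space, 'r) monoid_scheme \<Rightarrow> nat \<Rightarrow> ('g \<Rightarrow> nat \<Rightarrow> nat \<Rightarrow> complex) \<Rightarrow> bool" where
  "continuous_rep G d \<rho> \<longleftrightarrow>
    (\<forall>i<d. \<forall>j<d. continuous_on (carrier G) (\<lambda>g. \<rho> g i j)) \<and>
    (\<forall>i<d. \<forall>j<d. \<rho> \<one>\<^bsub>G\<^esub> i j = (if i = j then 1 else 0)) \<and>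
    (\<forall>g\<in>carrier G. \<forall>h\<in>carrier G. \<forall>i<d. \<forall>j<d.
      \<rho> (g \<otimes>\<^bsub>G\<^esub> h) i j = (\<Sum>k<d. \<rho> g i k * \<rho> h k j))"

definition representative_functions ::
  "('g::topological_space, 'r) monoid_scheme \<Rightarrow> ('g \<Rightarrow> complex) set" where
  "representative_functions G =
    {f. \<exists>d \<rho> c. continuous_rep G d \<rho> \<and>
      f = (\<lambda>g. if g \<in> carrier G then \<Sum>i<d. \<Sum>j<d. c i j * \<rho> g i j else 0)}"

definition representative_star_alg ::
  "('g::topological_space, 'r) monoid_scheme \<Rightarrow> ('g \<Rightarrow> complex) star_alg" where
  "representative_star_alg G =
    \<lparr>carrier = representative_functions G,
     mult = (\<lambda>f f' g. f g * f' g),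
     one = (\<lambda>g. if g \<in> carrier G then 1 else 0),
     zero = (\<lambda>g. 0),
     add = (\<lambda>f f' g. f g + f' g),
     smult = (\<lambda>c f g. c * f g),
     star = (\<lambda>f g. cnj (f g))\<rparr>"

text \<open>
  The comultiplication is \<open>\<Delta> f (g, h) = f (g h)\<close>, where \<open>O(G) \<otimes> O(G)\<close> is embedded into
  the functions on \<open>G \<times> G\<close>.
\<close>

definition representative_hopf ::
  "('g::topological_space, 'r) monoid_scheme \<Rightarrow> ('g \<Rightarrow> complex) hopf_star_alg" where
  "representative_hopf G =
    (let F = representative_star_alg G in
      star_alg.extend F (hopf_star_alg.fields
        (\<lambda>f. THE X. X \<in> carrier (tensor_alg F F) \<and>
          (\<forall>g\<in>carrier G. \<forall>h\<in>carrier G.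
            tensor_lift complex_alg (\<lambda>a b. a g * b h) X = f (g \<otimes>\<^bsub>G\<^esub> h)))
        (\<lambda>f. f \<one>\<^bsub>G\<^esub>)))"

text \<open>
  \<open>N \<times> N\<close> matrices are functions vanishing outside the index range, with the (product) topology of
  entrywise convergence.
\<close>

definition unitary_group :: "nat \<Rightarrow> (nat \<Rightarrow> nat \<Rightarrow> complex) monoid" where
  "unitary_group N =
    \<lparr>carrier = {g. (\<forall>i j. \<not> (i < N \<and> j < N) \<longrightarrow> g i j = 0) \<and>
       (\<forall>i<N. \<forall>j<N. (\<Sum>k<N. g i k * cnj (g j k)) = (if i = j then 1 else 0)) \<and>
       (\<forall>i<N. \<forall>j<N. (\<Sum>k<N. cnj (g k i) * g k j) = (if i = j then 1 else 0))},
     mult = (\<lambda>g h i j. if i < N \<and> j < N then \<Sum>k<N. g i k * h k j else 0),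
     one = (\<lambda>i j. if i < N \<and> j < N \<and> i = j then 1 else 0)\<rparr>"

definition unitary_coordinate ::
  "nat \<Rightarrow> nat \<Rightarrow> nat \<Rightarrow> (nat \<Rightarrow> nat \<Rightarrow> complex) \<Rightarrow> complex" where
  "unitary_coordinate N i j = (\<lambda>g. if g \<in> carrier (unitary_group N) then g i j else 0)"

definition to_unitary ::
  "nat \<Rightarrow> uplus_elem \<Rightarrow> (nat \<Rightarrow> nat \<Rightarrow> complex) \<Rightarrow> complex" where
  "to_unitary N =
    presented_hom (representative_hopf (unitary_group N)) (\<lambda>(i, j). unitary_coordinate N i j)"

text \<open>The corner embedding of the free unitary group of rank \<open>N - 1\<close>; the last index is \<open>N - 1\<close>.\<close>

definition to_corner :: "nat \<Rightarrow> uplus_elem \<Rightarrow> uplus_elem" where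
  "to_corner N =
    presented_hom (free_unitary (N - 1))
      (\<lambda>(i, j).
        if i < N - 1 \<and> j < N - 1 then free_unitary_gen (N - 1) i j
        else if i = N - 1 \<and> j = N - 1 then \<one>\<^bsub>free_unitary (N - 1)\<^esub>
        else \<zero>\<^bsub>free_unitary (N - 1)\<^esub>)"

end

theory Submission
  imports Defs
begin

text \<open>
  Let \<open>q\<close> be a quotient map through which both subgroup maps factor. The linear functionals that
  factor through \<open>q\<close> are closed under convolution and under the adjoint built from the antipode and
  the involution. They contain the evaluations at the points of \<open>U\<^sub>N\<close> and, through the corner, the
  functionals induced by \<open>u\<^sub>i\<^sub>j \<mapsto> \<delta>\<^sub>i\<^sub>j g\<^sub>i\<close>, where \<open>g\<^sub>0, g\<^sub>1\<close> are free generators of a free group and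
  the other \<open>g\<^sub>i\<close> are trivial; this is where \<open>N - 1 \<ge> 2\<close> is used. By the bicommutant theorem it suffices
  that a matrix intertwining these functionals intertwines every functional on the free unitary group,
  and by Frobenius reciprocity that certain vectors are combinations of noncrossing pairings. The
  vectors in question live on tensor words in the fundamental representation and its conjugate, are
  killed by the Lie algebra of \<open>U\<^sub>N\<close>, and are supported on words that are trivial in the free group.

  On two letters, subtracting an orthogonal projection leaves a vector all of whose contractions of
  neighbouring letters vanish, and such a vector is zero by a count of the terms of a Lie algebra
  equation at a word with a long reduced prefix. On \<open>N\<close> letters, subtracting pairings leaves a vector
  that vanishes on words in the first two letters; a word of the support with the fewest other letters
  and the longest gap between two of these violates a Lie algebra equation.
\<close>

section \<open>Letters and reduced words\<close>

text \<open>For \<open>U_N\<close> alone the invariant vectors include all pairings, the crossing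
  ones among them. A crossing pairing has words such as \<open>g0 g1 g0^-1 g1^-1\<close> in its
  support, and the free group sees that this word is not trivial: excluding such words is what the
  corner contributes. Conjugation by the permutation matrices in \<open>U_N\<close> moves the two
  free generators to any two indices, so that no larger free group is required. The quotient
  \<open>Q\<close> is an arbitrary Hopf *-algebra, and neither a Haar functional nor complete
  reducibility is at hand for it. The argument therefore works with functionals on words that vanish
  on the kernel of \<open>q\<close>. On the finitely many tensor words that occur in one element
  they form a *-algebra of finite matrices, for which the bicommutant theorem takes the place of
  complete reducibility. A nonzero element of the kernel would be detected by some functional on the
  free unitary group, and this functional would agree on the element with one that vanishes on the
  kernel.\<close>

text \<open>\<open>(i, False)\<close> is the basis vector \<open>e\<^sub>i\<close> of the fundamental representation, \<open>(i, True)\<close> the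
  one of its conjugate, and also the free group generator \<open>g\<^sub>i\<close> or its inverse.\<close>

type_synonym letter = "nat \<times> bool"

definition linv :: "letter \<Rightarrow> letter" where
  "linv l = (fst l, \<not> snd l)"

lemma linv_linv [simp]: "linv (linv l) = l"
  by (simp add: linv_def)

definition reduced_word :: "letter list \<Rightarrow> bool" where
  "reduced_word = successively (\<lambda>a b. b \<noteq> linv a)"

lemma reduced_simps [simp]:
  "reduced_word []" "reduced_word [l]" "reduced_word (l # m # w) \<longleftrightarrow> m \<noteq> linv l \<and> reduced_word (m # w)"
  by (auto simp: reduced_word_def)

lemma reduced_rev: "reduced_word (rev w) \<longleftrightarrow> reduced_word w"
proof -
  have "(\<lambda>a b. a \<noteq> linv b) = (\<lambda>a b. b \<noteq> linv a)"
    by (auto simp: fun_eq_iff)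
  then show ?thesis
    by (simp only: reduced_word_def successively_rev)
qed

lemma reduced_append:
  "reduced_word (v @ w) \<longleftrightarrow> reduced_word v \<and> reduced_word w \<and> (v = [] \<or> w = [] \<or> hd w \<noteq> linv (last v))"
  by (auto simp: reduced_word_def successively_append_iff)

text \<open>The free group acts on reduced words; the stack is the reversed reduction of the prefix read so far.\<close>

definition push :: "letter \<Rightarrow> letter list \<Rightarrow> letter list" where
  "push l st = (case st of [] \<Rightarrow> [l] | m # ms \<Rightarrow> if m = linv l then ms else l # st)"

lemma push_simps [simp]:
  "push l [] = [l]" "push l (m # ms) = (if m = linv l then ms else l # m # ms)"
  by (auto simp: push_def)

lemma reduced_ConsD: "reduced_word (l # w) \<Longrightarrow> reduced_word w"
  by (cases w) auto

lemma reduced_push: "reduced_word st \<Longrightarrow> reduced_word (push l st)"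
  by (cases st) (auto dest: reduced_ConsD)

lemma push_push_linv: "reduced_word st \<Longrightarrow> push (linv l) (push l st) = st"
proof (cases st)
  case (Cons m ms)
  assume "reduced_word st"
  then show ?thesis
    using Cons by (cases ms) auto
qed simp

lemma reduced_fold_push: "reduced_word st \<Longrightarrow> reduced_word (fold push w st)"
  by (induction w arbitrary: st) (auto simp: reduced_push)

lemma fold_push_inverse:
  "reduced_word st \<Longrightarrow> fold push (rev (map linv w)) (fold push w st) = st"
  by (induction w arbitrary: st) (auto simp: reduced_push push_push_linv)

lemma fold_push_inverse':
  assumes "reduced_word st"
  shows "fold push w (fold push (rev (map linv w)) st) = st"
  using fold_push_inverse[OF assms, of "rev (map linv w)"] by (simp add: rev_map comp_def)

lemma fold_push_inj:
  assumes "reduced_word s" "reduced_word t" "fold push w s = fold push w t"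
  shows "s = t"
  using fold_push_inverse[OF assms(1), of w, symmetric] fold_push_inverse[OF assms(2), of w]
  unfolding assms(3) by (rule trans)

lemma fold_push_reduced_append:
  "reduced_word (rev st @ w) \<Longrightarrow> fold push w st = rev w @ st"
proof (induction w arbitrary: st)
  case (Cons l w)
  have "push l st = l # st"
  proof (cases st)
    case (Cons m ms)
    then show ?thesis
      using Cons.prems by (auto simp: reduced_append)
  qed simp
  then show ?case
    using Cons.IH[of "l # st"] Cons.prems by simp
qed simp

lemma fold_push_reduced: "reduced_word w \<Longrightarrow> fold push w [] = rev w"
  using fold_push_reduced_append[of "[]" w] by simp

text \<open>The condition is imposed on all reduced stacks, not only on the empty one: the word acts
  as the identity. Deletion of a cancelling pair, removal of a common context and conjugation then
  follow from the group action alone, without uniqueness of normal forms.\<close>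

definition triv :: "letter list \<Rightarrow> bool" where
  "triv w \<longleftrightarrow> (\<forall>st. reduced_word st \<longrightarrow> fold push w st = st)"

lemma triv_delete:
  assumes "triv (v @ [l, linv l] @ w)"
  shows "triv (v @ w)"
  using assms by (auto simp: triv_def push_push_linv reduced_fold_push)

text \<open>Both middle words act as the inverse of the same element, the one determined by the
  common context \<open>P\<close>, \<open>R\<close>.\<close>

lemma triv_mid_eq:
  assumes "triv (P @ v @ R)" "triv (P @ w @ R)" "reduced_word st"
  shows "fold push v st = fold push w st"
proof -
  define s where "s = fold push (rev (map linv P)) st"
  have s: "reduced_word s" "fold push P s = st"
    using assms(3) by (simp_all add: s_def reduced_fold_push fold_push_inverse')
  have "fold push R (fold push v st) = s" "fold push R (fold push w st) = s"
    using assms s unfolding triv_def by auto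
  then show ?thesis
    using fold_push_inj[of "fold push v st" "fold push w st" R] assms(3)
    by (simp add: reduced_fold_push)
qed

text \<open>Rotation is conjugation in the free group. It makes the support condition on vectors
  cyclic.\<close>

lemma triv_rotate1:
  assumes "triv (v @ w)" shows "triv (w @ v)"
proof (unfold triv_def, intro allI impI)
  fix st assume st: "reduced_word st"
  define s where "s = fold push (rev (map linv v)) st"
  have s: "reduced_word s" "fold push v s = st"
    using st by (simp_all add: s_def reduced_fold_push fold_push_inverse')
  have "fold push w st = s"
    using assms s by (auto simp: triv_def)
  then show "fold push (w @ v) st = st"
    using s by simp
qed

text \<open>The exponent sum of the generator \<open>i\<close>, equally the weight of a basis word
  under the \<open>i\<close>-th coordinate of the diagonal torus of \<open>U_N\<close>.\<close>

definition net :: "nat \<Rightarrow> letter list \<Rightarrow> int" where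
  "net i w = (\<Sum>l\<leftarrow>w. if fst l = i then if snd l then - 1 else 1 else 0)"

lemma net_simps [simp]:
  "net i [] = 0"
  "net i (l # w) = (if fst l = i then if snd l then - 1 else 1 else 0) + net i w"
  "net i (v @ w) = net i v + net i w"
  by (auto simp: net_def)

lemma net_push: "net i (push l st) = net i (l # st)"
  by (cases st) (auto simp: linv_def)

lemma net_fold_push: "net i (fold push w st) = net i w + net i st"
  by (induction w arbitrary: st) (auto simp: net_push)

lemma triv_net: "triv w \<Longrightarrow> net i w = 0"
  using net_fold_push[of i w "[]"] by (auto simp: triv_def)

section \<open>Noncrossing pairings\<close>

text \<open>\<open>Arc e X Y\<close> joins its first point, of sign \<open>e\<close>, to a point of the opposite sign; \<open>X\<close> lies
  below this arc and \<open>Y\<close> to the right of it.\<close>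

datatype pairing = Empty | Arc bool pairing pairing

primrec sign_word :: "pairing \<Rightarrow> bool list" where
  "sign_word Empty = []"
| "sign_word (Arc e X Y) = e # sign_word X @ (\<not> e) # sign_word Y"

primrec matches :: "pairing \<Rightarrow> letter list \<Rightarrow> bool" where
  "matches Empty a \<longleftrightarrow> a = []"
| "matches (Arc e X Y) a \<longleftrightarrow>
    (\<exists>i b c. a = (i, e) # b @ (i, \<not> e) # c \<and> matches X b \<and> matches Y c)"

lemma matches_sign: "matches T a \<Longrightarrow> map snd a = sign_word T"
  by (induction T arbitrary: a) auto

lemma matches_length: "matches T a \<Longrightarrow> length a = length (sign_word T)"
  using matches_sign[of T a] by (metis length_map)

text \<open>The length of the part below the arc fixes where the arc ends, so the decomposition
  hidden in the existential quantifier of \<open>matches\<close> is unique.\<close>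

lemma matches_Arc:
  assumes "length b = length (sign_word X)"
  shows "matches (Arc e X Y) (l # b @ m # c) \<longleftrightarrow>
    snd l = e \<and> m = linv l \<and> matches X b \<and> matches Y c"
proof
  assume "matches (Arc e X Y) (l # b @ m # c)"
  then obtain i b' c' where *: "l # b @ m # c = (i, e) # b' @ (i, \<not> e) # c'"
    and m: "matches X b'" "matches Y c'"
    by auto
  have "length b = length b'"
    using assms m matches_length by metis
  with * m show "snd l = e \<and> m = linv l \<and> matches X b \<and> matches Y c"
    by (auto simp: linv_def)
next
  assume "snd l = e \<and> m = linv l \<and> matches X b \<and> matches Y c"
  then show "matches (Arc e X Y) (l # b @ m # c)"
    by (cases l) (auto simp: linv_def)
qed

definition pairings :: "bool list \<Rightarrow> pairing set" where
  "pairings x = {T. sign_word T = x}"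

text \<open>The word below the first arc is an initial piece of the tail and the word to its right a
  final piece; the length conditions in the unions keep the induction hypothesis applicable.\<close>

lemma finite_pairings: "finite (pairings x)"
proof (induction "length x" arbitrary: x rule: less_induct)
  case less
  have "pairings x \<subseteq> insert Empty ((\<lambda>(e, X, Y). Arc e X Y) ` (UNIV \<times>
     (\<Union>n\<in>{n. n \<le> length x \<and> length (take n (tl x)) < length x}. pairings (take n (tl x))) \<times>
     (\<Union>n\<in>{n. n \<le> length x \<and> length (drop n x) < length x}. pairings (drop n x))))" (is "_ \<subseteq> insert _ (_ ` (_ \<times> ?A \<times> ?B))")
  proof
    fix T assume T: "T \<in> pairings x"
    show "T \<in> insert Empty ((\<lambda>(e, X, Y). Arc e X Y) ` (UNIV \<times> ?A \<times> ?B))"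
    proof (cases T)
      case (Arc e X Y)
      then have x: "x = e # sign_word X @ (\<not> e) # sign_word Y"
        using T by (simp add: pairings_def)
      have "X \<in> ?A"
        by (rule UN_I[of "length (sign_word X)"]) (auto simp: x pairings_def)
      moreover have "Y \<in> ?B"
        by (rule UN_I[of "length (sign_word X) + 2"]) (auto simp: x pairings_def)
      ultimately show ?thesis
        using Arc by (intro insertI2 image_eqI[of _ _ "(e, X, Y)"]) auto
    qed simp
  qed
  moreover have "finite ?A" "finite ?B"
    using less by auto
  then have "finite (insert Empty ((\<lambda>(e :: bool, X, Y). Arc e X Y) ` (UNIV \<times> ?A \<times> ?B)))"
    by simp
  ultimately show ?case
    by (rule finite_subset)
qed

text \<open>\<open>T'\<close> is \<open>T\<close> with a small arc joining two new neighbouring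
  points. This operation is adjoint to contracting two neighbouring letters.\<close>

lemma pairing_insert:
  assumes "sign_word T = u @ z"
  shows "\<exists>T'. sign_word T' = u @ [e, \<not> e] @ z \<and>
    (\<forall>a l m b. length a = length u \<longrightarrow> snd l = e \<longrightarrow> snd m = (\<not> e) \<longrightarrow>
      (matches T' (a @ l # m # b) \<longleftrightarrow> m = linv l \<and> matches T (a @ b)))"
  using assms
proof (induction T arbitrary: u z)
  case Empty
  then show ?case
    by (intro exI[of _ "Arc e Empty Empty"]) (auto simp: linv_def prod_eq_iff)
next
  case (Arc f X Y)
  show ?case
  proof (cases u)
    case Nil
    then show ?thesis
      using Arc.prems
      by (intro exI[of _ "Arc e Empty (Arc f X Y)"]) (auto simp: linv_def prod_eq_iff)
  next
    case (Cons f' u')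
    then have eq: "sign_word X @ (\<not> f) # sign_word Y = u' @ z" and f': "f' = f"
      using Arc.prems by auto
    show ?thesis
    \<comment> \<open>The insertion point lies below the first arc, the place just before its right
      end included, or to the right of the arc.\<close>
    proof (cases "length u' \<le> length (sign_word X)")
      case True
      define z' where "z' = drop (length u') (sign_word X)"
      have X: "sign_word X = u' @ z'" and z: "z = z' @ (\<not> f) # sign_word Y"
      proof -
        obtain us where us: "sign_word X = u' @ us \<and> us @ (\<not> f) # sign_word Y = z \<or>
            sign_word X @ us = u' \<and> (\<not> f) # sign_word Y = us @ z"
          using eq unfolding append_eq_append_conv2 by blast
        moreover have "us = []" if "sign_word X @ us = u'"
          using True that by auto
        ultimately have "sign_word X = u' @ us" "z = us @ (\<not> f) # sign_word Y"
          by auto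
        then show "sign_word X = u' @ z'" "z = z' @ (\<not> f) # sign_word Y"
          by (simp_all add: z'_def)
      qed
      obtain X' where X': "sign_word X' = u' @ [e, \<not> e] @ z'"
        "\<forall>a l m b. length a = length u' \<longrightarrow> snd l = e \<longrightarrow> snd m = (\<not> e) \<longrightarrow>
          (matches X' (a @ l # m # b) \<longleftrightarrow> m = linv l \<and> matches X (a @ b))"
        using Arc.IH(1)[OF X] by blast
      have "matches (Arc f X' Y) (a @ l # m # b) \<longleftrightarrow> m = linv l \<and> matches (Arc f X Y) (a @ b)"
        if a: "length a = length u" and l: "snd l = e" "snd m = (\<not> e)" for a l m b
      proof -
        obtain g a' where a': "a = g # a'" "length a' = length u'"
          using a Cons by (cases a) auto
        show ?thesis
        proof (cases "length b > length z'")
          case True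
          then obtain b1 h b2 where b: "b = b1 @ h # b2" "length b1 = length z'"
            by (metis id_take_nth_drop length_take min.absorb4)
          have "matches (Arc f X' Y) (g # (a' @ l # m # b1) @ h # b2) \<longleftrightarrow>
              snd g = f \<and> h = linv g \<and> matches X' (a' @ l # m # b1) \<and> matches Y b2"
            using a' b X' by (intro matches_Arc) auto
          moreover have "matches (Arc f X Y) (g # (a' @ b1) @ h # b2) \<longleftrightarrow>
              snd g = f \<and> h = linv g \<and> matches X (a' @ b1) \<and> matches Y b2"
            using a' b X by (intro matches_Arc) auto
          moreover have "matches X' (a' @ l # m # b1) \<longleftrightarrow> m = linv l \<and> matches X (a' @ b1)"
            using X'(2) a'(2) l by blast
          ultimately show ?thesis
            unfolding a' b(1) by (simp del: matches.simps) blast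
        next
          case False
          \<comment> \<open>With so few letters after the insertion both words are too short for
            their pairings, and both sides are false.\<close>
          then have "length (a @ l # m # b) \<noteq> length (sign_word (Arc f X' Y))"
            "length (a @ b) \<noteq> length (sign_word (Arc f X Y))"
            using a' X X' by auto
          then show ?thesis
            using matches_length by metis
        qed
      qed
      then show ?thesis
        using X' z f' Cons by (intro exI[of _ "Arc f X' Y"]) auto
    next
      case False
      define u'' where "u'' = drop (Suc (length (sign_word X))) u'"
      have u': "u' = sign_word X @ (\<not> f) # u''" and Y: "sign_word Y = u'' @ z"
      proof -
        have "u' @ z = (sign_word X @ [\<not> f]) @ sign_word Y"
          using eq by simp
        then obtain us where "u' @ us = sign_word X @ [\<not> f] \<and> z = us @ sign_word Y \<or>
            u' = (sign_word X @ [\<not> f]) @ us \<and> us @ z = sign_word Y"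
          using append_eq_append_conv2[of u' z "sign_word X @ [\<not> f]" "sign_word Y"] by blast
        moreover have "us = []" if "u' @ us = sign_word X @ [\<not> f]"
          using arg_cong[OF that, of length] False by (cases us) auto
        ultimately show "u' = sign_word X @ (\<not> f) # u''" "sign_word Y = u'' @ z"
          by (auto simp: u''_def)
      qed
      obtain Y' where Y': "sign_word Y' = u'' @ [e, \<not> e] @ z"
        "\<forall>a l m b. length a = length u'' \<longrightarrow> snd l = e \<longrightarrow> snd m = (\<not> e) \<longrightarrow>
          (matches Y' (a @ l # m # b) \<longleftrightarrow> m = linv l \<and> matches Y (a @ b))"
        using Arc.IH(2)[OF Y] by blast
      have "matches (Arc f X Y') (a @ l # m # b) \<longleftrightarrow> m = linv l \<and> matches (Arc f X Y) (a @ b)"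
        if a: "length a = length u" and l: "snd l = e" "snd m = (\<not> e)" for a l m b
      proof -
        obtain g a' where a': "a = g # a'" "length a' = length u'"
          using a Cons by (cases a) auto
        then have "length (sign_word X) < length a'"
          using u' by simp
        then obtain a1 h a2 where a1: "a' = a1 @ h # a2" "length a1 = length (sign_word X)"
          by (metis id_take_nth_drop length_take min.absorb4)
        have "matches (Arc f X Y') (g # a1 @ h # (a2 @ l # m # b)) \<longleftrightarrow>
            snd g = f \<and> h = linv g \<and> matches X a1 \<and> matches Y' (a2 @ l # m # b)"
          using a1 by (intro matches_Arc) auto
        moreover have "matches (Arc f X Y) (g # a1 @ h # (a2 @ b)) \<longleftrightarrow>
            snd g = f \<and> h = linv g \<and> matches X a1 \<and> matches Y (a2 @ b)"
          using a1 by (intro matches_Arc) auto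
        moreover have "length a2 = length u''"
          using a' a1 u' by simp
        then have "matches Y' (a2 @ l # m # b) \<longleftrightarrow> m = linv l \<and> matches Y (a2 @ b)"
          using Y'(2) l by blast
        ultimately show ?thesis
          unfolding a'(1) a1(1) by (simp del: matches.simps) blast
      qed
      then show ?thesis
        using Y' u' f' Cons by (intro exI[of _ "Arc f X Y'"]) auto
    qed
  qed
qed

section \<open>Basis words of a tensor word and sums over them\<close>

definition vecs :: "nat \<Rightarrow> bool list \<Rightarrow> letter list set" where
  "vecs N x = {a. map snd a = x \<and> (\<forall>l\<in>set a. fst l < N)}"

lemma vecs_Nil [simp]: "vecs N [] = {[]}"
  by (auto simp: vecs_def)

lemma vecs_Cons: "vecs N (e # x) = (\<lambda>(k, a). (k, e) # a) ` ({..<N} \<times> vecs N x)"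
proof (intro equalityI subsetI)
  fix a assume "a \<in> vecs N (e # x)"
  then obtain k b where "a = (k, e) # b" "k < N" "b \<in> vecs N x"
    by (cases a) (auto simp: vecs_def)
  then show "a \<in> (\<lambda>(k, a). (k, e) # a) ` ({..<N} \<times> vecs N x)"
    by (intro image_eqI[of _ _ "(k, b)"]) auto
qed (auto simp: vecs_def)

lemma finite_vecs [simp]: "finite (vecs N x)"
  by (induction x) (auto simp: vecs_Cons)

lemma sum_vecs_Cons: "(\<Sum>a\<in>vecs N (e # x). h a) = (\<Sum>k<N. \<Sum>a\<in>vecs N x. h ((k, e) # a))"
proof -
  have "inj_on (\<lambda>(k, a). (k, e) # a) ({..<N} \<times> vecs N x)"
    by (auto simp: inj_on_def)
  then show ?thesis
    unfolding vecs_Cons by (subst sum.reindex) (auto simp: sum.cartesian_product case_prod_beta)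
qed

lemma sum_vecs_append:
  "(\<Sum>a\<in>vecs N (x @ y). h a) = (\<Sum>a\<in>vecs N x. \<Sum>b\<in>vecs N y. h (a @ b))"
  by (induction x arbitrary: h) (auto simp: sum_vecs_Cons)

lemma append_in_vecs: "a \<in> vecs N x \<Longrightarrow> b \<in> vecs N y \<Longrightarrow> a @ b \<in> vecs N (x @ y)"
  by (auto simp: vecs_def)

section \<open>Linear independence of the noncrossing pairings\<close>

text \<open>Among the words in the letters 0 and 1 that match \<open>T\<close>, read as lattice paths with steps \<open>weight e\<close>,
  \<open>dyck e T\<close> is the one of largest area.\<close>

definition weight :: "bool \<Rightarrow> letter \<Rightarrow> int" where
  "weight e l = (if (fst l = 0) = (snd l = e) then 1 else - 1)"

text \<open>Each step is counted once for every later step, which gives the sum of the heights at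
  the inner points of the path.\<close>

primrec area :: "bool \<Rightarrow> letter list \<Rightarrow> int" where
  "area e [] = 0"
| "area e (l # a) = weight e l * int (length a) + area e a"

definition tot :: "bool \<Rightarrow> letter list \<Rightarrow> int" where
  "tot e a = (\<Sum>l\<leftarrow>a. weight e l)"

lemma tot_simps [simp]:
  "tot e [] = 0" "tot e (l # a) = weight e l + tot e a" "tot e (a @ b) = tot e a + tot e b"
  by (auto simp: tot_def)

lemma area_append: "area e (a @ b) = area e a + tot e a * int (length b) + area e b"
  by (induction a) (auto simp: algebra_simps)

text \<open>An arc that opens with an up-step raises the path by one at
  \<open>length (sign_word X) + 1\<close> inner points.\<close>

primrec max_area :: "pairing \<Rightarrow> int" where
  "max_area Empty = 0"
| "max_area (Arc f X Y) = max_area X + max_area Y + int (length (sign_word X)) + 1"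

text \<open>The letter among 0 and 1 for which an arc opening with sign \<open>f\<close> starts with
  an up-step.\<close>

definition colour :: "bool \<Rightarrow> bool \<Rightarrow> nat" where
  "colour e f = (if f = e then 0 else 1)"

primrec dyck :: "bool \<Rightarrow> pairing \<Rightarrow> letter list" where
  "dyck e Empty = []"
| "dyck e (Arc f X Y) = (colour e f, f) # dyck e X @ (colour e f, \<not> f) # dyck e Y"

lemma weight_linv [simp]: "weight e (linv l) = - weight e l"
  by (auto simp: weight_def linv_def)

lemma weight_colour [simp]: "weight e (colour e f, f) = 1" "weight e (colour e f, \<not> f) = - 1"
  by (auto simp: weight_def colour_def)

lemma matches_dyck: "matches T (dyck e T)"
  by (induction T) auto

lemma dyck_sign: "map snd (dyck e T) = sign_word T"
  using matches_sign matches_dyck by blast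

lemma dyck_in_vecs: "dyck e T \<in> vecs 2 (sign_word T)"
proof -
  have "\<forall>l\<in>set (dyck e T). fst l < 2"
    by (induction T) (auto simp: colour_def)
  then show ?thesis
    by (simp add: vecs_def dyck_sign)
qed

lemma weight_up: "weight e (i, f) = 1 \<Longrightarrow> i < 2 \<Longrightarrow> i = colour e f"
  by (auto simp: weight_def colour_def split: if_splits)

text \<open>The two ends of an arc have opposite weights, so the words below and to the right return
  to height 0 and the arc adds its length with a sign. The maximum is reached only if every arc goes
  up, and on two letters this determines the letter of each arc.\<close>

lemma matches_area:
  assumes "matches T a"
  shows "tot e a = 0" "area e a \<le> max_area T"
    "area e a = max_area T \<Longrightarrow> \<forall>l\<in>set a. fst l < 2 \<Longrightarrow> a = dyck e T"
  using assms
proof (induction T arbitrary: a)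
  case (Arc f X Y)
  {
    fix a assume "matches (Arc f X Y) a"
    then obtain i b c where a: "a = (i, f) # b @ linv (i, f) # c" and m: "matches X b" "matches Y c"
      by (auto simp: linv_def)
    have t: "tot e b = 0" "tot e c = 0" "area e b \<le> max_area X" "area e c \<le> max_area Y"
      using Arc.IH m by auto
    have l: "length b = length (sign_word X)"
      using m matches_length by auto
    have w: "weight e (i, f) = 1 \<or> weight e (i, f) = - 1"
      by (auto simp: weight_def)
    have ar: "area e a = weight e (i, f) * (int (length b) + 1) + area e b + area e c"
      using t by (simp add: a area_append algebra_simps)
    have "tot e a = 0"
      using t by (simp add: a)
    moreover have le: "area e a \<le> max_area (Arc f X Y)"
      using w t l unfolding ar by (elim disjE) auto
    moreover have "a = dyck e (Arc f X Y)"
      if eq: "area e a = max_area (Arc f X Y)" and s: "\<forall>l\<in>set a. fst l < 2"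
    proof -
      have w1: "weight e (i, f) = 1"
        using w eq t l unfolding ar by (elim disjE) auto
      have "area e b = max_area X" "area e c = max_area Y"
        using eq t l unfolding ar w1 by auto
      then have "b = dyck e X" "c = dyck e Y"
        using Arc.IH(3,6) m s a by auto
      moreover have "i = colour e f"
        using weight_up[OF w1] s a by auto
      ultimately show ?thesis
        by (simp add: a linv_def)
    qed
    ultimately have "tot e a = 0 \<and> area e a \<le> max_area (Arc f X Y) \<and>
      (area e a = max_area (Arc f X Y) \<longrightarrow> (\<forall>l\<in>set a. fst l < 2) \<longrightarrow> a = dyck e (Arc f X Y))"
      by blast
  }
  note * = this
  show "matches (Arc f X Y) a \<Longrightarrow> tot e a = 0"
    "matches (Arc f X Y) a \<Longrightarrow> area e a \<le> max_area (Arc f X Y)"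
    "area e a = max_area (Arc f X Y) \<Longrightarrow> \<forall>l\<in>set a. fst l < 2 \<Longrightarrow> matches (Arc f X Y) a \<Longrightarrow>
      a = dyck e (Arc f X Y)"
    for a using * by blast+
qed auto

lemma area_dyck: "area e (dyck e T) = max_area T"
proof (induction T)
  case (Arc f X Y)
  have "tot e (dyck e X) = 0" "length (dyck e X) = length (sign_word X)"
    using matches_area(1) matches_length matches_dyck by blast+
  then show ?case
    using Arc by (simp add: area_append algebra_simps)
qed simp

lemma dyck_prefix_tot: "dyck e T = p @ q \<Longrightarrow> tot e p \<ge> 0"
proof (induction T arbitrary: p q)
  case (Arc f X Y)
  have X0: "tot e (dyck e X) = 0"
    using matches_area(1) matches_dyck by blast
  show ?case
  proof (cases p)
    case (Cons l p')
    then have eq: "dyck e X @ (colour e f, \<not> f) # dyck e Y = p' @ q" and l: "l = (colour e f, f)"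
      using Arc.prems by auto
    from eq[unfolded append_eq_append_conv2] obtain us where
      "dyck e X = p' @ us \<or> dyck e X @ us = p' \<and> (colour e f, \<not> f) # dyck e Y = us @ q"
      by blast
    then show ?thesis
    proof (elim disjE conjE)
      assume "dyck e X = p' @ us"
      then show ?thesis
        using Arc.IH(1) Cons l by auto
    next
      assume p': "dyck e X @ us = p'" and us: "(colour e f, \<not> f) # dyck e Y = us @ q"
      show ?thesis
      proof (cases us)
        case Nil
        then show ?thesis using p' X0 Cons l by auto
      next
        case Cons2: (Cons m us')
        then have "dyck e Y = us' @ q" "m = (colour e f, \<not> f)"
          using us by auto
        then show ?thesis
          using Arc.IH(2) Cons2 p' X0 Cons l by auto
      qed
    qed
  qed simp
qed simp

text \<open>A Dyck path determines its first return to zero: a second factorisation would give one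
  of the inner words a prefix of negative height.\<close>

lemma dyck_inj:
  "dyck e T = dyck e T' \<Longrightarrow> T = T'"
proof (induction T arbitrary: T')
  case Empty
  then show ?case by (cases T') auto
next
  case (Arc f X Y)
  have X0: "tot e (dyck e Z) = 0" for Z
    using matches_area(1) matches_dyck by blast
  obtain X' Y' where T': "T' = Arc f X' Y'"
    and eq: "dyck e X @ (colour e f, \<not> f) # dyck e Y = dyck e X' @ (colour e f, \<not> f) # dyck e Y'"
    using Arc.prems by (cases T') auto
  from eq[unfolded append_eq_append_conv2] obtain us where
    us: "dyck e X = dyck e X' @ us \<and> us @ (colour e f, \<not> f) # dyck e Y = (colour e f, \<not> f) # dyck e Y' \<or>
     dyck e X @ us = dyck e X' \<and> (colour e f, \<not> f) # dyck e Y = us @ (colour e f, \<not> f) # dyck e Y'"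
    by blast
  have "us = []"
  proof (rule ccontr)
    assume "us \<noteq> []"
    then obtain us' where us': "us = (colour e f, \<not> f) # us'"
      using us by (cases us) auto
    have "dyck e X = (dyck e X' @ [(colour e f, \<not> f)]) @ us' \<or>
      dyck e X' = (dyck e X @ [(colour e f, \<not> f)]) @ us'"
      using us us' by auto
    then show False
      using dyck_prefix_tot[of e X "dyck e X' @ [(colour e f, \<not> f)]" us']
        dyck_prefix_tot[of e X' "dyck e X @ [(colour e f, \<not> f)]" us'] X0 by (elim disjE) simp_all
  qed
  then have "dyck e X = dyck e X'" "dyck e Y = dyck e Y'"
    using us by auto
  then show ?case
    using Arc.IH T' by auto
qed

text \<open>The contribution of the letter 0 alone to the height. After all other letters have been
  dropped it is the exponent of \<open>(0, e)\<close> in the free group.\<close>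

definition dnet :: "bool \<Rightarrow> letter list \<Rightarrow> int" where
  "dnet e w = (if e then - net 0 w else net 0 w)"

lemma dnet_simps [simp]:
  "dnet e [] = 0" "dnet e (v @ w) = dnet e v + dnet e w"
  "dnet e (l # w) = (if fst l = 0 then if snd l = e then 1 else - 1 else 0) + dnet e w"
  by (auto simp: dnet_def)

text \<open>In a Dyck word the letter 0 opens an arc only with sign \<open>e\<close>, so every
  \<open>(0, \<not> e)\<close> comes after its partner.\<close>

lemma dyck_prefix_dnet: "dyck e T = p @ q \<Longrightarrow> dnet e p \<ge> 0 \<and> (q = [] \<longrightarrow> dnet e p = 0)"
proof (induction T arbitrary: p q)
  case (Arc f X Y)
  have X0: "dnet e (dyck e X) = 0"
    using Arc.IH(1)[of "dyck e X" "[]"] by simp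
  show ?case
  proof (cases p)
    case (Cons l p')
    then have eq: "dyck e X @ (colour e f, \<not> f) # dyck e Y = p' @ q" and l: "l = (colour e f, f)"
      using Arc.prems by auto
    from eq[unfolded append_eq_append_conv2] obtain us where
      "dyck e X = p' @ us \<and> us @ (colour e f, \<not> f) # dyck e Y = q \<or> dyck e X @ us = p' \<and> (colour e f, \<not> f) # dyck e Y = us @ q"
      by blast
    then show ?thesis
    proof (elim disjE conjE)
      assume "dyck e X = p' @ us" "us @ (colour e f, \<not> f) # dyck e Y = q"
      then show ?thesis
        using Arc.IH(1)[of p' us] Cons l by (auto simp: colour_def)
    next
      assume p': "dyck e X @ us = p'" and us: "(colour e f, \<not> f) # dyck e Y = us @ q"
      show ?thesis
      proof (cases us)
        case Nil
        then show ?thesis using p' X0 Cons l us by (auto simp: colour_def)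
      next
        case Cons2: (Cons m us')
        then have "dyck e Y = us' @ q" "m = (colour e f, \<not> f)"
          using us by auto
        then show ?thesis
          using Arc.IH(2)[of us' q] Cons2 p' X0 Cons l by (auto simp: colour_def)
      qed
    qed
  qed (use Arc.prems in auto)
qed simp

text \<open>The pairing functions are linearly independent because \<open>matches\<close> is triangular with
  respect to \<open>max_area\<close>; the leading words are Dyck words.\<close>

lemma pairing_span_dyck:
  fixes c :: "pairing \<Rightarrow> complex"
  assumes "T1 \<in> pairings y" "c T1 \<noteq> 0"
  shows "\<exists>b\<in>vecs 2 y. (\<Sum>T\<in>pairings y. c T * of_bool (matches T b)) \<noteq> 0 \<and>
    (\<forall>p q. b = p @ q \<longrightarrow> dnet e p \<ge> 0)"
proof -
  let ?A = "{T \<in> pairings y. c T \<noteq> 0}"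
  have fin: "finite ?A"
    by (simp add: finite_pairings)
  have "Max (max_area ` ?A) \<in> max_area ` ?A"
    using fin assms by (intro Max_in) auto
  then obtain T0 where T0A: "T0 \<in> ?A" and max: "max_area T0 = Max (max_area ` ?A)"
    by (metis (no_types, lifting) imageE)
  have "max_area T \<le> max_area T0" if "T \<in> ?A" for T
    unfolding max using fin that by (intro Max_ge) auto
  note T0 = T0A this
  let ?b = "dyck e T0"
  \<comment> \<open>A pairing with nonzero coefficient that matches the leading word has at least
    its area, by maximality exactly its area, and then the leading word is its own Dyck word
    too.\<close>
  have "c T * of_bool (matches T ?b) = (if T = T0 then c T0 else 0)" if T: "T \<in> pairings y" for T
  proof (cases "c T = 0 \<or> \<not> matches T ?b")
    case True
    then show ?thesis
      using matches_dyck by auto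
  next
    case False
    then have "max_area T \<le> max_area T0"
      using T T0 by auto
    moreover have "max_area T0 \<le> max_area T"
      using matches_area(2)[of T ?b e] False by (simp add: area_dyck)
    ultimately have "?b = dyck e T"
      using False matches_area(3)[of T ?b e] dyck_in_vecs[of e T0]
      by (auto simp: area_dyck vecs_def)
    then have "T0 = T"
      by (rule dyck_inj)
    then show ?thesis
      using matches_dyck by auto
  qed
  then have "(\<Sum>T\<in>pairings y. c T * of_bool (matches T ?b)) = (\<Sum>T\<in>pairings y. if T = T0 then c T0 else 0)"
    by (intro sum.cong) auto
  also have "\<dots> = c T0"
    using T0(1) finite_pairings[of y] by simp
  finally have "(\<Sum>T\<in>pairings y. c T * of_bool (matches T ?b)) \<noteq> 0"
    using T0(1) by simp
  moreover have "?b \<in> vecs 2 y"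
    using dyck_in_vecs[of e T0] T0(1) by (simp add: pairings_def)
  moreover have "\<forall>p q. ?b = p @ q \<longrightarrow> dnet e p \<ge> 0"
    using dyck_prefix_dnet by blast
  ultimately show ?thesis
    by blast
qed

section \<open>Invariant vectors\<close>

text \<open>\<open>shift_op\<close> is the action of a matrix unit of the complexified Lie algebra of \<open>U\<^sub>N\<close>.\<close>

definition shift_coeff :: "nat \<Rightarrow> nat \<Rightarrow> letter \<Rightarrow> complex" where
  "shift_coeff \<alpha> \<beta> l = (if l = (\<alpha>, False) then 1 else if l = (\<beta>, True) then - 1 else 0)"

definition shift_letter :: "nat \<Rightarrow> nat \<Rightarrow> letter \<Rightarrow> letter" where
  "shift_letter \<alpha> \<beta> l = (if snd l then (\<alpha>, True) else (\<beta>, False))"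

definition shift_op :: "nat \<Rightarrow> nat \<Rightarrow> (letter list \<Rightarrow> complex) \<Rightarrow> letter list \<Rightarrow> complex" where
  "shift_op \<alpha> \<beta> \<xi> a =
    (\<Sum>p<length a. shift_coeff \<alpha> \<beta> (a ! p) * \<xi> (a[p := shift_letter \<alpha> \<beta> (a ! p)]))"

lemma shift_op_Nil [simp]: "shift_op \<alpha> \<beta> \<xi> [] = 0"
  by (simp add: shift_op_def)

lemma shift_op_Cons: "shift_op \<alpha> \<beta> \<xi> (l # a) =
    shift_coeff \<alpha> \<beta> l * \<xi> (shift_letter \<alpha> \<beta> l # a) + shift_op \<alpha> \<beta> (\<lambda>a. \<xi> (l # a)) a"
  by (simp add: shift_op_def sum.lessThan_Suc_shift del: sum.lessThan_Suc)

lemma shift_op_append: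
  "shift_op \<alpha> \<beta> \<xi> (a @ b) = shift_op \<alpha> \<beta> (\<lambda>a. \<xi> (a @ b)) a + shift_op \<alpha> \<beta> (\<lambda>b. \<xi> (a @ b)) b"
  by (induction a arbitrary: \<xi>) (simp_all add: shift_op_Cons)

lemma shift_op_scale: "shift_op \<alpha> \<beta> (\<lambda>a. c * \<xi> a) a = c * shift_op \<alpha> \<beta> \<xi> a"
  by (simp add: shift_op_def sum_distrib_left algebra_simps)

lemma shift_op_diff: "shift_op \<alpha> \<beta> (\<lambda>a. \<xi> a - \<eta> a) a = shift_op \<alpha> \<beta> \<xi> a - shift_op \<alpha> \<beta> \<eta> a"
  by (simp add: shift_op_def sum_subtractf algebra_simps)

lemma shift_op_sum:
  "shift_op \<alpha> \<beta> (\<lambda>a. \<Sum>i\<in>I. \<xi> i a) a = (\<Sum>i\<in>I. shift_op \<alpha> \<beta> (\<xi> i) a)"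
  unfolding shift_op_def sum_distrib_left by (rule sum.swap)

lemma shift_op_cong:
  assumes "\<And>p. p < length a \<Longrightarrow> shift_coeff \<alpha> \<beta> (a ! p) \<noteq> 0 \<Longrightarrow>
    \<xi> (a[p := shift_letter \<alpha> \<beta> (a ! p)]) = \<eta> (a[p := shift_letter \<alpha> \<beta> (a ! p)])"
  shows "shift_op \<alpha> \<beta> \<xi> a = shift_op \<alpha> \<beta> \<eta> a"
  unfolding shift_op_def using assms by (intro sum.cong) auto

section \<open>Traceless vectors on two letters\<close>

definition bar :: "letter \<Rightarrow> letter" where
  "bar l = (1 - fst l, snd l)"

lemma bar_bar: "fst l < 2 \<Longrightarrow> bar (bar l) = l"
  by (cases l) (auto simp: bar_def)

text \<open>Truncated subtraction sends every index above 0 to 0, so the bound holds for all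
  letters, whereas \<open>bar\<close> is an involution only on the first two.\<close>

lemma fst_bar: "fst (bar l) < 2"
  by (auto simp: bar_def)

lemma fst_linv [simp]: "fst (linv l) = fst l"
  by (simp add: linv_def)

lemma bar_linv: "bar (linv l) = linv (bar l)"
  by (simp add: bar_def linv_def)

lemma bar_neq: "fst l < 2 \<Longrightarrow> bar l \<noteq> l"
  by (cases l) (auto simp: bar_def, presburger)

text \<open>Each use of \<open>tr\<close> changes the colour of a cancelling pair at the cost of a
  sign. In a chain the next letter then cancels with its successor, so the change of colour travels
  through the chain, one sign per step.\<close>

lemma chain_flip:
  fixes \<eta> :: "letter list \<Rightarrow> complex"
  assumes tr: "\<And>u v l. fst l < 2 \<Longrightarrow> \<eta> (u @ [l, linv l] @ v) = - \<eta> (u @ [bar l, linv (bar l)] @ v)"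
    and "successively (\<lambda>a b. b = linv (bar a)) (y # Q @ [n])" "fst y < 2"
  shows "\<eta> (P @ bar y # Q @ [n] @ v) = (- 1) ^ (length Q + 1) * \<eta> (P @ y # Q @ [bar n] @ v)"
  using assms(2,3)
proof (induction Q arbitrary: y P)
  case Nil
  then show ?case
    using tr[of "bar y" P v] by (simp add: bar_bar bar_linv fst_bar)
next
  case (Cons z Q)
  have z: "z = linv (bar y)" "bar z = linv y" "fst z < 2"
    using Cons.prems by (auto simp: bar_linv bar_bar fst_bar)
  have "\<eta> (P @ bar y # (z # Q) @ [n] @ v) = - \<eta> ((P @ [y]) @ bar z # Q @ [n] @ v)"
    using tr[of "bar y" P "Q @ [n] @ v"] Cons.prems z by (simp add: bar_bar fst_bar)
  also have "\<dots> = - ((- 1) ^ (length Q + 1) * \<eta> ((P @ [y]) @ z # Q @ [bar n] @ v))"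
    using Cons.IH[of z "P @ [y]"] Cons.prems z by simp
  finally show ?case
    by simp
qed

text \<open>The equation says that the word agrees with its own shift by two places, and
  \<open>linv\<close> after \<open>bar\<close> is an involution on two letters, so the second letter
  fixes the chain.\<close>

lemma chain_of_period:
  assumes "Q @ [n] = linv (bar y) # butlast (y # Q)" "fst y < 2"
  shows "successively (\<lambda>a b. b = linv (bar a)) (y # Q @ [n])"
  using assms
proof (induction Q arbitrary: y)
  case (Cons z Q)
  then have z: "z = linv (bar y)"
    by simp
  have "Q @ [n] = linv (bar z) # butlast (z # Q)"
    using Cons.prems z by (simp add: bar_linv bar_bar)
  then show ?case
    using Cons.IH[of z] z fst_bar by auto
qed simp

text \<open>The first middle word loses its last two letters and reduces to
  \<open>butlast (y # Q)\<close>. The second one represents the same element; as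
  \<open>Q @ [n]\<close> is reduced and one letter longer than this reduction, its first letter must
  cancel with \<open>bar y\<close>, and what remains is \<open>butlast (y # Q)\<close>. This is the
  period equation of \<open>chain_of_period\<close>.\<close>

lemma chain_of_triv:
  assumes "reduced_word (y # Q @ [n])" "bar n = linv (last (y # Q))" "fst y < 2"
    and triv: "triv (P @ (y # Q @ [bar n]) @ v)" "triv (P @ (bar y # Q @ [n]) @ v)"
  shows "successively (\<lambda>a b. b = linv (bar a)) (y # Q @ [n])"
proof -
  have eq: "fold push (y # Q @ [bar n]) [] = fold push (bar y # Q @ [n]) []"
    by (rule triv_mid_eq[OF triv]) simp
  define K where "K = butlast (y # Q)"
  have K: "y # Q = K @ [last (y # Q)]"
    unfolding K_def by (metis append_butlast_last_id list.discI)
  have "reduced_word K"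
    using assms(1) K by (metis append_Cons reduced_append)
  then have "fold push (y # Q @ [bar n]) [] = rev K"
    using arg_cong[OF K, of "\<lambda>w. fold push (w @ [bar n]) []"] assms(2)
    by (simp add: push_push_linv reduced_fold_push fold_push_reduced reduced_rev)
  then have eq: "fold push (Q @ [n]) [bar y] = rev K"
    using eq by simp
  obtain h t where ht: "Q @ [n] = h # t"
    by (cases "Q @ [n]") auto
  have red: "reduced_word (h # t)"
    using assms(1) ht by (metis reduced_ConsD)
  have "h = linv (bar y)"
  proof (rule ccontr)
    assume "h \<noteq> linv (bar y)"
    then have "reduced_word (rev [bar y] @ Q @ [n])"
      using red ht by simp
    then have "length (fold push (Q @ [n]) [bar y]) = length Q + 2"
      by (subst fold_push_reduced_append) auto
    then show False
      unfolding eq K_def length_rev length_butlast by simp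
  qed
  moreover from this have "t = K"
    using eq fold_push_reduced[of t] reduced_ConsD[OF red] unfolding ht by simp
  ultimately show ?thesis
    using ht assms(3) unfolding K_def by (intro chain_of_period) auto
qed

text \<open>The support of \<open>\<eta>\<close> is searched for a word with the longest reduced prefix. The next letter
  cancels; switching its colour gives a word at which \<open>shift_op\<close> has only terms equal to the
  original value.\<close>

lemma traceless_zero:
  fixes \<eta> :: "letter list \<Rightarrow> complex"
  assumes supp: "\<And>b. \<eta> b \<noteq> 0 \<Longrightarrow> triv b \<and> (\<forall>l\<in>set b. fst l < 2) \<and> length b = n" and "n > 0"
    and tr: "\<And>u v l. fst l < 2 \<Longrightarrow> \<eta> (u @ [l, linv l] @ v) = - \<eta> (u @ [bar l, linv (bar l)] @ v)"
    and E: "\<And>b. \<forall>l\<in>set b. fst l < 2 \<Longrightarrow> shift_op 0 1 \<eta> b = 0 \<and> shift_op 1 0 \<eta> b = 0"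
  shows "\<eta> b = 0"
proof (rule ccontr)
  assume nz: "\<eta> b \<noteq> 0"
  define good where "good m \<longleftrightarrow> m \<le> n \<and> (\<exists>b. \<eta> b \<noteq> 0 \<and> reduced_word (take m b))" for m
  have "good 0"
    using nz by (auto simp: good_def)
  then obtain m where m: "good m" "\<And>m'. good m' \<Longrightarrow> m' \<le> m"
    using GreatestI_nat[of good 0 n] Greatest_le_nat[of good _ n] good_def by blast
  obtain b where b: "\<eta> b \<noteq> 0" "reduced_word (take m b)" "m \<le> n"
    using m(1) by (auto simp: good_def)
  have tb: "triv b" "\<forall>l\<in>set b. fst l < 2" "length b = n"
    using supp[OF b(1)] by auto
  have "m \<noteq> n"
  proof
    assume "m = n"
    then have "fold push b [] = rev b"
      using b tb by (simp add: fold_push_reduced)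
    then show False
      using tb \<open>n > 0\<close> by (auto simp: triv_def)
  qed
  then have mn: "m < n"
    using b by simp
  define R c v where "R = take m b" and "c = b ! m" and "v = drop (Suc m) b"
  have bR: "b = R @ c # v" "length R = m"
    using mn tb by (auto simp: R_def c_def v_def id_take_nth_drop[symmetric])
  have fstc: "fst c < 2" and fstR: "\<forall>l\<in>set R. fst l < 2" and fstv: "\<forall>l\<in>set v. fst l < 2"
    using tb bR by auto
  have "\<not> reduced_word (R @ [c])"
  proof
    assume "reduced_word (R @ [c])"
    then have "good (Suc m)"
      using b mn bR unfolding good_def by (intro conjI exI[of _ b]) auto
    then show False
      using m(2) by fastforce
  qed
  then have Rne: "R \<noteq> []" and cR: "c = linv (last R)" and redR: "reduced_word R"
    using b(2) by (auto simp: reduced_append R_def[symmetric])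
  define n' where "n' = bar c"
  have n': "bar n' = c" "fst n' < 2" "n' \<noteq> linv (last R)"
    using fstc bar_neq[OF fstc] cR by (auto simp: n'_def bar_bar fst_bar)
  have red': "reduced_word (R @ [n'])"
    using redR n' by (simp add: reduced_append)
  define b' where "b' = R @ n' # v"
  \<comment> \<open>The indices are chosen so that on two letters the matrix unit acts on
    \<open>n'\<close> and on \<open>linv c\<close> only, and switches the colour of both.\<close>
  define \<alpha> \<beta> where "\<alpha> = (if snd c then fst c else 1 - fst c)" and "\<beta> = (if snd c then 1 - fst c else fst c)"
  have "shift_op \<alpha> \<beta> \<eta> b' = 0"
  proof -
    have "(\<alpha>, \<beta>) = (0, 1) \<or> (\<alpha>, \<beta>) = (1, 0)"
      using fstc by (auto simp: \<alpha>_def \<beta>_def)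
    moreover have "\<forall>l\<in>set b'. fst l < 2"
      using fstR fstv n' by (auto simp: b'_def)
    ultimately show ?thesis
      using E[of b'] by auto
  qed
  have coeff: "shift_coeff \<alpha> \<beta> l =
      (if l = n' \<or> l = linv c then if snd l then - 1 else 1 else 0)" if "fst l < 2" for l
    using fstc that by (cases c; cases l)
      (auto simp: shift_coeff_def \<alpha>_def \<beta>_def n'_def bar_def linv_def split: if_splits)
  have target: "shift_letter \<alpha> \<beta> l = bar l" if "l = n' \<or> l = linv c" for l
    using fstc that by (cases c; cases l)
      (auto simp: shift_letter_def \<alpha>_def \<beta>_def n'_def bar_def linv_def split: if_splits)
  define sc where "sc l = (if snd l then - 1 else 1 :: complex)" for l :: letter
  define z where "z = sc n' * \<eta> b"
  define t where "t p = shift_coeff \<alpha> \<beta> (b' ! p) * \<eta> (b'[p := shift_letter \<alpha> \<beta> (b' ! p)])" for p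
  have "t p = z \<or> t p = 0" if p: "p < length b'" for p
  proof (cases "t p = 0")
    case False
    define y where "y = b' ! p"
    have "fst y < 2"
      using p fstR fstv n' unfolding y_def b'_def by (metis Un_iff insert_iff nth_mem set_append list.set(2))
    have y: "y = n' \<or> y = linv c"
      using False coeff[OF \<open>fst y < 2\<close>] by (auto simp: t_def y_def split: if_splits)
    have tp: "t p = sc y * \<eta> (b'[p := bar y])"
      using y coeff[OF \<open>fst y < 2\<close>] target[OF y] by (auto simp: t_def y_def[symmetric] sc_def)
    then have nz': "\<eta> (b'[p := bar y]) \<noteq> 0"
      using False by auto
    consider "p = m" | "p > m" | "p < m"
      by linarith
    then show ?thesis
    proof cases
      case 1
      then have "y = n'" "b'[p := bar y] = b"
        using bR n' by (auto simp: y_def b'_def nth_append list_update_append)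
      then show ?thesis
        using tp by (simp add: z_def)
    next
      case 2
      \<comment> \<open>The change takes place behind \<open>n'\<close>, so the longer reduced
        prefix survives in a word of the support.\<close>
      have "take (Suc m) (b'[p := bar y]) = R @ [n']"
        using 2 bR by (auto simp: b'_def list_update_append split: nat.split)
      then have "good (Suc m)"
        unfolding good_def using mn nz' red' by (intro conjI exI[of _ "b'[p := bar y]"]) auto
      then show ?thesis
        using m(2) by fastforce
    next
      case 3
      \<comment> \<open>The change takes place inside the reduced prefix. The new support word and
        \<open>b\<close> differ only at \<open>y\<close> and at \<open>n'\<close>, which is the
        situation of \<open>chain_of_triv\<close>.\<close>
      define P Q where "P = take p R" and "Q = drop (Suc p) R"
      have R: "R = P @ y # Q" "length P = p"
        using 3 bR by (auto simp: P_def Q_def y_def b'_def nth_append id_take_nth_drop[symmetric])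
      have upd: "b'[p := bar y] = P @ (bar y # Q @ [n']) @ v"
        using R by (simp add: b'_def list_update_append)
      have bb: "b = P @ (y # Q @ [bar n']) @ v"
        using R bR n' by simp
      have ch: "successively (\<lambda>a b. b = linv (bar a)) (y # Q @ [n'])"
      proof (rule chain_of_triv)
        show "reduced_word (y # Q @ [n'])"
          using red' R by (simp add: reduced_append)
        show "bar n' = linv (last (y # Q))"
          using n' cR R by simp
        show "triv (P @ (y # Q @ [bar n']) @ v)"
          using tb bb by simp
        show "triv (P @ (bar y # Q @ [n']) @ v)"
          using supp[OF nz'] upd by simp
      qed fact
      have "\<eta> (b'[p := bar y]) = (- 1) ^ (length Q + 1) * \<eta> b"
        unfolding upd bb using chain_flip[OF tr ch \<open>fst y < 2\<close>, of P v] by simp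
      \<comment> \<open>Along a chain the signs of the letters alternate, and this compensates
        exactly for the signs produced by \<open>chain_flip\<close>.\<close>
      moreover have "sc y * (- 1) ^ (length Q + 1) = sc n'"
        using ch
      proof (induction Q arbitrary: y)
        case Nil
        then show ?case by (auto simp: sc_def linv_def bar_def)
      next
        case (Cons x Q)
        then have ch: "successively (\<lambda>a b. b = linv (bar a)) (x # Q @ [n'])" and "x = linv (bar y)"
          by auto
        then have "sc x = - sc y"
          by (simp add: sc_def linv_def bar_def)
        then show ?case
          using Cons.IH[OF ch] by simp
      qed
      ultimately have "t p = z"
        unfolding tp z_def by (metis mult.assoc)
      then show ?thesis ..
    qed
  qed simp
  then have "(\<Sum>p<length b'. t p) = (\<Sum>p<length b'. if t p = z then z else 0)"
    by (intro sum.cong) auto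
  also have "\<dots> = of_nat (card {p\<in>{..<length b'}. t p = z}) * z"
    by (simp add: sum.If_cases Int_def)
  finally have "of_nat (card {p\<in>{..<length b'}. t p = z}) * z = 0"
    using \<open>shift_op \<alpha> \<beta> \<eta> b' = 0\<close> by (simp add: shift_op_def t_def)
  moreover have "z \<noteq> 0"
    using b by (auto simp: z_def sc_def)
  \<comment> \<open>Restoring the letter \<open>c\<close> makes the number of terms equal to
    \<open>z\<close> positive, so the vanishing sum contradicts that \<open>z\<close> is not
    0.\<close>
  moreover have "t m = z"
  proof -
    have "b' ! m = n'" "b'[m := bar n'] = b"
      using bR n' by (auto simp: b'_def nth_append list_update_append)
    then show ?thesis
      using coeff[of n'] target[of n'] n' by (simp add: t_def z_def sc_def)
  qed
  ultimately show False
    using bR by (auto simp: b'_def card_eq_0_iff)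
qed

section \<open>Inner products over a finite set and orthogonal residuals\<close>

definition inner_on :: "'d set \<Rightarrow> ('d \<Rightarrow> complex) \<Rightarrow> ('d \<Rightarrow> complex) \<Rightarrow> complex" where
  "inner_on D f g = (\<Sum>d\<in>D. f d * cnj (g d))"

lemma inner_on_diff: "inner_on D (\<lambda>d. f d - g d) h = inner_on D f h - inner_on D g h"
  by (simp add: inner_on_def sum_subtractf algebra_simps)

lemma inner_on_scale: "inner_on D (\<lambda>d. c * f d) h = c * inner_on D f h"
  by (simp add: inner_on_def sum_distrib_left algebra_simps)

lemma inner_on_sum: "inner_on D (\<lambda>d. \<Sum>k\<in>J. f k d) h = (\<Sum>k\<in>J. inner_on D (f k) h)"
  unfolding inner_on_def sum_distrib_right by (rule sum.swap)

lemma inner_on_commute: "inner_on D f g = cnj (inner_on D g f)"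
  by (simp add: inner_on_def mult.commute)

lemma inner_on_cong: "(\<And>d. d \<in> D \<Longrightarrow> f d = f' d) \<Longrightarrow> (\<And>d. d \<in> D \<Longrightarrow> g d = g' d) \<Longrightarrow>
    inner_on D f g = inner_on D f' g'"
  by (simp add: inner_on_def)

lemma inner_on_self_zero:
  assumes "finite D" "inner_on D f f = 0" "d \<in> D"
  shows "f d = 0"
proof -
  have "(\<Sum>d\<in>D. (cmod (f d))\<^sup>2) = 0"
    using assms(2) by (simp add: inner_on_def complex_norm_square[symmetric] flip: of_real_sum of_real_power)
  then show ?thesis
    using assms by (simp add: sum_nonneg_eq_0_iff)
qed

lemma inner_on_right_comb:
  assumes "\<And>d. d \<in> D \<Longrightarrow> h d = (\<Sum>k\<in>J. c k * g k d)" "\<And>k. k \<in> J \<Longrightarrow> inner_on D f (g k) = 0"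
  shows "inner_on D f h = 0"
proof -
  have "inner_on D h f = inner_on D (\<lambda>d. \<Sum>k\<in>J. c k * g k d) f"
    using assms(1) by (intro inner_on_cong) auto
  also have "\<dots> = (\<Sum>k\<in>J. c k * cnj (inner_on D f (g k)))"
    by (simp add: inner_on_sum inner_on_scale inner_on_commute[of D _ f])
  also have "\<dots> = 0"
    using assms(2) by simp
  finally show ?thesis
    by (subst inner_on_commute) simp
qed

text \<open>Gram-Schmidt in coefficient form, for a family that may be linearly dependent: the new
  vector is first made orthogonal to the old ones, and the component of \<open>f\<close> along the
  result is removed.\<close>

lemma orthogonal_residual:
  fixes f :: "'d \<Rightarrow> complex"
  assumes "finite J" "finite D"
  shows "\<exists>c. \<forall>j\<in>J. inner_on D (\<lambda>d. f d - (\<Sum>k\<in>J. c k * g k d)) (g j) = 0"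
  using assms(1)
proof (induction J arbitrary: f rule: finite_induct)
  case (insert i J)
  obtain c1 where c1: "\<forall>j\<in>J. inner_on D (\<lambda>d. f d - (\<Sum>k\<in>J. c1 k * g k d)) (g j) = 0"
    using insert.IH by blast
  obtain c2 where c2: "\<forall>j\<in>J. inner_on D (\<lambda>d. g i d - (\<Sum>k\<in>J. c2 k * g k d)) (g j) = 0"
    using insert.IH by blast
  define t1 where "t1 d = f d - (\<Sum>k\<in>J. c1 k * g k d)" for d
  define t2 where "t2 d = g i d - (\<Sum>k\<in>J. c2 k * g k d)" for d
  \<comment> \<open>If \<open>t2\<close> has norm 0 this is 0 by the convention for division, and
    \<open>t2\<close> vanishes on \<open>D\<close> anyway.\<close>
  define \<mu> where "\<mu> = inner_on D t1 t2 / inner_on D t2 t2"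
  define c where "c k = (if k = i then \<mu> else c1 k - \<mu> * c2 k)" for k
  have res: "f d - (\<Sum>k\<in>insert i J. c k * g k d) = t1 d - \<mu> * t2 d" for d
  proof -
    have "(\<Sum>k\<in>J. c k * g k d) = (\<Sum>k\<in>J. c1 k * g k d) - \<mu> * (\<Sum>k\<in>J. c2 k * g k d)"
      unfolding sum_distrib_left sum_subtractf[symmetric]
      using insert.hyps by (intro sum.cong) (auto simp: c_def algebra_simps)
    then show ?thesis
      using insert.hyps by (simp add: t1_def t2_def c_def algebra_simps)
  qed
  have orth: "inner_on D (\<lambda>d. t1 d - \<mu> * t2 d) (g j) = 0" if "j \<in> J" for j
    using c1 c2 that by (simp add: inner_on_diff inner_on_scale t1_def[symmetric] t2_def[symmetric])
  have t2: "inner_on D (\<lambda>d. t1 d - \<mu> * t2 d) t2 = 0"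
  proof (cases "inner_on D t2 t2 = 0")
    case True
    then have "t2 d = 0" if "d \<in> D" for d
      using inner_on_self_zero[OF assms(2)] that by blast
    then show ?thesis
      by (simp add: inner_on_def)
  next
    case False
    moreover have "inner_on D (\<lambda>d. t1 d - \<mu> * t2 d) t2 = inner_on D t1 t2 - \<mu> * inner_on D t2 t2"
      by (simp add: inner_on_diff inner_on_scale)
    ultimately show ?thesis
      by (simp add: \<mu>_def)
  qed
  define t where "t d = t1 d - \<mu> * t2 d" for d
  define s where "s d = (\<Sum>k\<in>J. c2 k * g k d)" for d
  have "inner_on D t s = 0"
    by (rule inner_on_right_comb[of _ _ c2 g J]) (use orth in \<open>auto simp: s_def t_def[abs_def]\<close>)
  then have "inner_on D s t = 0"
    by (subst inner_on_commute) simp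
  moreover have "inner_on D t2 t = 0"
    using t2 by (subst inner_on_commute) (simp add: t_def[abs_def])
  moreover have "inner_on D t2 t = inner_on D (g i) t - inner_on D s t"
    unfolding inner_on_diff[symmetric] by (simp add: t2_def[abs_def] s_def)
  ultimately have "inner_on D (g i) t = 0"
    by simp
  then have "inner_on D (\<lambda>d. t1 d - \<mu> * t2 d) (g i) = 0"
    by (subst inner_on_commute) (simp add: t_def[abs_def])
  then show ?case
    using orth by (intro exI[of _ c]) (auto simp: res)
qed simp

text \<open>Only the generators 0 and 1 survive the filter; the permutations put any two indices in
  their place.\<close>

definition free_trivial :: "nat \<Rightarrow> letter list \<Rightarrow> bool" where
  "free_trivial N a \<longleftrightarrow>
    (\<forall>\<sigma>. \<sigma> permutes {..<N} \<longrightarrow> triv (filter (\<lambda>l. fst l < 2) (map (apfst \<sigma>) a)))"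

text \<open>Invariance under \<open>U\<^sub>N\<close> (the matrix units suffice because the support takes care of the
  diagonal) and under the free group. The permutations are those in \<open>U\<^sub>N\<close>.\<close>

definition invariant_vec :: "nat \<Rightarrow> bool list \<Rightarrow> (letter list \<Rightarrow> complex) \<Rightarrow> bool" where
  "invariant_vec N x \<xi> \<longleftrightarrow>
    (\<forall>a. \<xi> a \<noteq> 0 \<longrightarrow> a \<in> vecs N x \<and> free_trivial N a) \<and>
    (\<forall>\<alpha> \<beta> a. \<alpha> < N \<longrightarrow> \<beta> < N \<longrightarrow> \<alpha> \<noteq> \<beta> \<longrightarrow> (\<forall>l\<in>set a. fst l < N) \<longrightarrow> shift_op \<alpha> \<beta> \<xi> a = 0)"

lemma invariant_vec_diff:
  assumes "invariant_vec N x \<xi>" "invariant_vec N x \<eta>"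
  shows "invariant_vec N x (\<lambda>a. \<xi> a - \<eta> a)"
  unfolding invariant_vec_def
proof (intro conjI allI impI)
  fix a assume "\<xi> a - \<eta> a \<noteq> 0"
  then have "\<xi> a \<noteq> 0 \<or> \<eta> a \<noteq> 0"
    by auto
  then show "a \<in> vecs N x" "free_trivial N a"
    using assms unfolding invariant_vec_def by blast+
qed (use assms in \<open>auto simp: invariant_vec_def shift_op_diff\<close>)

lemma invariant_vec_sum:
  assumes "\<And>i. i \<in> I \<Longrightarrow> invariant_vec N x (\<xi> i)"
  shows "invariant_vec N x (\<lambda>a. \<Sum>i\<in>I. c i * \<xi> i a)"
  unfolding invariant_vec_def
proof (intro conjI allI impI)
  fix a assume "(\<Sum>i\<in>I. c i * \<xi> i a) \<noteq> 0"
  then obtain i where "i \<in> I" "\<xi> i a \<noteq> 0"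
    by (metis (mono_tags, lifting) mult_eq_0_iff sum.neutral)
  then show "a \<in> vecs N x" "free_trivial N a"
    using assms unfolding invariant_vec_def by blast+
qed (use assms in \<open>auto simp: invariant_vec_def shift_op_sum shift_op_scale\<close>)

section \<open>Pairing vectors are invariant\<close>

lemma matches_map: "matches T a \<Longrightarrow> matches T (map (apfst \<sigma>) a)"
  by (induction T arbitrary: a) fastforce+

text \<open>A noncrossing pairing of letters with their inverses is a scheme of cancellations, and
  the filter removes whole arcs from it.\<close>

lemma matches_triv: "matches T a \<Longrightarrow> triv (filter (\<lambda>l. fst l < 2) a)"
proof (induction T arbitrary: a)
  case (Arc e X Y)
  then obtain i b c where a: "a = (i, e) # b @ (i, \<not> e) # c"
    and t: "triv (filter (\<lambda>l. fst l < 2) b)" "triv (filter (\<lambda>l. fst l < 2) c)"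
    by auto
  then have "fold push (filter (\<lambda>l. fst l < 2) a) st = st" if "reduced_word st" for st
    using that push_push_linv[of st "(i, e)"]
    by (auto simp: triv_def linv_def reduced_push)
  then show ?case
    by (simp add: triv_def)
qed (simp add: triv_def)

lemma matches_free_trivial: "matches T a \<Longrightarrow> free_trivial N a"
  using matches_triv matches_map unfolding free_trivial_def by blast

text \<open>At the two ends of an arc the matrix unit acts on a vector and on its dual, and the two
  terms cancel; the words below and beside the arc are covered by the Leibniz rule and
  induction.\<close>

lemma shift_op_matches:
  assumes "\<alpha> \<noteq> \<beta>"
  shows "shift_op \<alpha> \<beta> (\<lambda>a. of_bool (matches T a)) a = 0"
proof (induction T arbitrary: a)
  case Empty
  then show ?case
    by (auto simp: shift_op_def)
next
  case (Arc e X Y)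
  show ?case
  proof (cases "length a = length (sign_word (Arc e X Y))")
    case True
    then obtain l a' where a': "a = l # a'" "length a' = length (sign_word X) + Suc (length (sign_word Y))"
      by (cases a) auto
    define b c' where "b = take (length (sign_word X)) a'" and "c' = drop (length (sign_word X)) a'"
    have "length c' = Suc (length (sign_word Y))" "length b = length (sign_word X)" "a' = b @ c'"
      using a' by (auto simp: b_def c'_def)
    then obtain m c where a: "a = l # b @ m # c" and lb: "length b = length (sign_word X)"
      using a' by (cases c') auto
    have "shift_op \<alpha> \<beta> (\<lambda>b. of_bool (matches (Arc e X Y) (l # b @ m # c))) b =
      shift_op \<alpha> \<beta> (\<lambda>b. of_bool (snd l = e \<and> m = linv l \<and> matches Y c) * of_bool (matches X b)) b"
      using lb by (intro shift_op_cong) (auto simp: matches_Arc simp del: matches.simps)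
    also have "\<dots> = 0"
      unfolding shift_op_scale Arc.IH by simp
    finally have 1: "shift_op \<alpha> \<beta> (\<lambda>b. of_bool (matches (Arc e X Y) (l # b @ m # c))) b = 0" .
    have "shift_op \<alpha> \<beta> (\<lambda>c. of_bool (matches (Arc e X Y) (l # b @ m # c))) c =
      shift_op \<alpha> \<beta> (\<lambda>c. of_bool (snd l = e \<and> m = linv l \<and> matches X b) * of_bool (matches Y c)) c"
      using lb by (intro shift_op_cong) (auto simp: matches_Arc simp del: matches.simps)
    also have "\<dots> = 0"
      unfolding shift_op_scale Arc.IH by simp
    finally have 2: "shift_op \<alpha> \<beta> (\<lambda>c. of_bool (matches (Arc e X Y) (l # b @ m # c))) c = 0" .
    have "shift_coeff \<alpha> \<beta> l * of_bool (matches (Arc e X Y) (shift_letter \<alpha> \<beta> l # b @ m # c)) +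
        shift_coeff \<alpha> \<beta> m * of_bool (matches (Arc e X Y) (l # b @ shift_letter \<alpha> \<beta> m # c)) = 0"
      unfolding matches_Arc[OF lb] using assms
      by (cases l; cases m) (auto simp: shift_coeff_def shift_letter_def linv_def of_bool_def)
    then show ?thesis
      using 1 2 unfolding a by (simp add: shift_op_Cons shift_op_append del: matches.simps)
  next
    case False
    then have "\<not> matches (Arc e X Y) (a[p := l])" for p l
      using matches_length[of "Arc e X Y" "a[p := l]"] by (auto simp del: matches.simps)
    then show ?thesis
      by (simp add: shift_op_def del: matches.simps)
  qed
qed

text \<open>Membership in \<open>vecs N x\<close> bounds the letters by \<open>N\<close>, which
  \<open>matches\<close> does not do.\<close>

definition pairing_vec :: "nat \<Rightarrow> bool list \<Rightarrow> pairing \<Rightarrow> letter list \<Rightarrow> complex" where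
  "pairing_vec N x T a = of_bool (a \<in> vecs N x \<and> matches T a)"

lemma letters_shift:
  assumes "\<forall>l\<in>set a. fst l < N" "\<alpha> < N" "\<beta> < N"
  shows "\<forall>l\<in>set (a[p := shift_letter \<alpha> \<beta> m]). fst l < N"
  using assms set_update_subset_insert[of a p] by (fastforce simp: shift_letter_def)

lemma invariant_pairing_vec:
  assumes "T \<in> pairings x"
  shows "invariant_vec N x (pairing_vec N x T)"
  unfolding invariant_vec_def
proof (intro conjI allI impI)
  fix a assume "pairing_vec N x T a \<noteq> 0"
  then show "a \<in> vecs N x" "free_trivial N a"
    using matches_free_trivial by (auto simp: pairing_vec_def)
next
  fix \<alpha> \<beta> :: nat and a :: "letter list"
  assume *: "\<alpha> < N" "\<beta> < N" "\<alpha> \<noteq> \<beta>" "\<forall>l\<in>set a. fst l < N"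
  have "shift_op \<alpha> \<beta> (pairing_vec N x T) a = shift_op \<alpha> \<beta> (\<lambda>a. of_bool (matches T a)) a"
  proof (rule shift_op_cong)
    fix p
    have "\<forall>l\<in>set (a[p := shift_letter \<alpha> \<beta> (a ! p)]). fst l < N"
      using * letters_shift by blast
    then show "pairing_vec N x T (a[p := shift_letter \<alpha> \<beta> (a ! p)]) =
        of_bool (matches T (a[p := shift_letter \<alpha> \<beta> (a ! p)]))"
      using matches_sign assms by (auto simp: pairing_vec_def vecs_def pairings_def)
  qed
  also have "\<dots> = 0"
    using * shift_op_matches by blast
  finally show "shift_op \<alpha> \<beta> (pairing_vec N x T) a = 0" .
qed

lemma less_2_split: "{..<2::nat} = {0, 1}"
  by auto

lemma invariant_vec_nonzeroD:
  assumes "invariant_vec N x \<xi>" "\<xi> a \<noteq> 0"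
  shows "a \<in> vecs N x" "free_trivial N a"
  using assms by (auto simp: invariant_vec_def)

lemma invariant_vec_shift:
  assumes "invariant_vec N x \<xi>" "\<alpha> < N" "\<beta> < N" "\<alpha> \<noteq> \<beta>" "\<forall>l\<in>set a. fst l < N"
  shows "shift_op \<alpha> \<beta> \<xi> a = 0"
  using assms by (auto simp: invariant_vec_def)

lemma free_trivial_triv:
  assumes "free_trivial N a" "\<forall>l\<in>set a. fst l < 2"
  shows "triv a"
proof -
  have "triv (filter (\<lambda>l. fst l < 2) (map (apfst id) a))"
    using assms(1) permutes_id[of "{..<N}"] unfolding free_trivial_def by blast
  moreover have "filter (\<lambda>l. fst l < 2) (map (apfst id) a) = a"
    using assms(2) by (simp add: apfst_id)
  ultimately show ?thesis
    by simp
qed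

section \<open>Contraction of neighbouring letters and the spanning theorem on two letters\<close>

definition contract :: "nat \<Rightarrow> bool \<Rightarrow> (letter list \<Rightarrow> complex) \<Rightarrow> letter list \<Rightarrow> complex" where
  "contract p e \<xi> b = (\<Sum>k<2. \<xi> (take p b @ [(k, e), (k, \<not> e)] @ drop p b))"

lemma contract_append:
  "length u = p \<Longrightarrow> contract p e \<xi> (u @ v) = (\<Sum>k<2. \<xi> (u @ [(k, e), (k, \<not> e)] @ v))"
  by (simp add: contract_def)

text \<open>By the Leibniz rule the action on the contraction differs from the contracted action
  only by the terms at the inserted pair.\<close>

lemma shift_op_contract:
  assumes "{\<alpha>, \<beta>} = {0, 1}" "length u = p"
    and "\<And>k. k < 2 \<Longrightarrow> shift_op \<alpha> \<beta> \<xi> (u @ [(k, e), (k, \<not> e)] @ v) = 0"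
  shows "shift_op \<alpha> \<beta> (contract p e \<xi>) (u @ v) = 0"
proof -
  let ?P = "\<lambda>k. [(k, e), (k, \<not> e)]"
  have "shift_op \<alpha> \<beta> (\<lambda>u. contract p e \<xi> (u @ v)) u =
      shift_op \<alpha> \<beta> (\<lambda>u. \<Sum>k<2. \<xi> (u @ ?P k @ v)) u"
    using assms(2) by (intro shift_op_cong) (simp add: contract_append)
  moreover have "shift_op \<alpha> \<beta> (\<lambda>v. contract p e \<xi> (u @ v)) v =
      shift_op \<alpha> \<beta> (\<lambda>v. \<Sum>k<2. \<xi> (u @ ?P k @ v)) v"
    using assms(2) by (intro shift_op_cong) (simp add: contract_append)
  ultimately have "shift_op \<alpha> \<beta> (contract p e \<xi>) (u @ v) =
    (\<Sum>k<2. shift_op \<alpha> \<beta> (\<lambda>u. \<xi> (u @ ?P k @ v)) u + shift_op \<alpha> \<beta> (\<lambda>v. \<xi> (u @ ?P k @ v)) v)"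
    by (simp add: shift_op_append shift_op_sum sum.distrib)
  also have "\<dots> = (\<Sum>k<2. shift_op \<alpha> \<beta> \<xi> (u @ ?P k @ v) -
      shift_op \<alpha> \<beta> (\<lambda>w. \<xi> (u @ w @ v)) (?P k))"
    by (intro sum.cong) (simp_all add: shift_op_append[of _ _ _ u] shift_op_append[of _ _ _ "?P _" v] del: append_Cons)
  also have "\<dots> = - (\<Sum>k<2. shift_op \<alpha> \<beta> (\<lambda>w. \<xi> (u @ w @ v)) (?P k))"
    using assms(3) by (simp add: sum_negf)
  \<comment> \<open>The sum over \<open>k\<close> of a basis vector tensor its dual is killed by
    every matrix unit: the one term from the vector and the one from the dual have opposite
    signs.\<close>
  also have "(\<Sum>k<2. shift_op \<alpha> \<beta> (\<lambda>w. \<xi> (u @ w @ v)) (?P k)) = 0"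
    using assms(1) by (cases e)
      (auto simp: less_2_split shift_op_Cons shift_coeff_def shift_letter_def doubleton_eq_iff)
  finally show ?thesis
    by simp
qed

text \<open>The removed pair is a letter and its inverse under every permutation of the two indices,
  so the support stays trivial.\<close>

lemma invariant_contract:
  assumes "invariant_vec 2 (u @ [e, \<not> e] @ z) \<xi>"
  shows "invariant_vec 2 (u @ z) (contract (length u) e \<xi>)"
  unfolding invariant_vec_def
proof (intro conjI allI impI)
  fix b assume "contract (length u) e \<xi> b \<noteq> 0"
  then obtain k where k: "k < 2" "\<xi> (take (length u) b @ [(k, e), (k, \<not> e)] @ drop (length u) b) \<noteq> 0"
    unfolding contract_def by (meson lessThan_iff sum.not_neutral_contains_not_neutral)
  let ?b = "take (length u) b" and ?c = "drop (length u) b"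
  note D = invariant_vec_nonzeroD[OF assms k(2)]
  have len: "length b = length u + length z"
    using D(1) by (auto simp: vecs_def dest: arg_cong[of _ _ length])
  then have "map snd ?b = u \<and> map snd ?c = z"
    using D(1) by (auto simp: vecs_def)
  then have "map snd (?b @ ?c) = u @ z"
    by (simp only: map_append)
  moreover have "\<forall>l\<in>set (?b @ ?c). fst l < 2"
    using D(1) unfolding vecs_def by (metis (no_types, lifting) Un_iff mem_Collect_eq set_append)
  ultimately show "b \<in> vecs 2 (u @ z)"
    by (simp add: vecs_def)
  show "free_trivial 2 b"
    unfolding free_trivial_def
  proof (intro allI impI)
    fix \<sigma> :: "nat \<Rightarrow> nat" assume \<sigma>: "\<sigma> permutes {..<2}"
    let ?f = "\<lambda>w. filter (\<lambda>l. fst l < 2) (map (apfst \<sigma>) w)"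
    have "triv (?f ?b @ ?f [(k, e), (k, \<not> e)] @ ?f ?c)"
      using D(2) \<sigma> unfolding free_trivial_def by (metis filter_append map_append)
    moreover have "?f [(k, e), (k, \<not> e)] = [(\<sigma> k, e), linv (\<sigma> k, e)]"
      using permutes_in_image[OF \<sigma>, of k] k by (simp add: linv_def)
    ultimately have "triv (?f ?b @ ?f ?c)"
      using triv_delete by metis
    then show "triv (?f b)"
      by (metis append_take_drop_id filter_append map_append)
  qed
next
  fix \<alpha> \<beta> :: nat and b :: "letter list"
  assume *: "\<alpha> < 2" "\<beta> < 2" "\<alpha> \<noteq> \<beta>" "\<forall>l\<in>set b. fst l < 2"
  show "shift_op \<alpha> \<beta> (contract (length u) e \<xi>) b = 0"
  proof (cases "length b = length u + length z")
    case True
    let ?b = "take (length u) b" and ?c = "drop (length u) b"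
    have l: "\<forall>l\<in>set ?b. fst l < 2" "\<forall>l\<in>set ?c. fst l < 2"
      using * by (auto dest: in_set_takeD in_set_dropD)
    have "shift_op \<alpha> \<beta> \<xi> (?b @ [(k, e), (k, \<not> e)] @ ?c) = 0" if "k < 2" for k
      using * l that by (intro invariant_vec_shift[OF assms]) auto
    moreover have "{\<alpha>, \<beta>} = {0, 1}"
      using * by auto
    ultimately have "shift_op \<alpha> \<beta> (contract (length u) e \<xi>) (?b @ ?c) = 0"
      using True by (intro shift_op_contract) auto
    then show ?thesis
      by simp
  next
    case False
    have "contract (length u) e \<xi> (b[p := l]) = 0" for p l
    proof -
      have "length (take (length u) (b[p := l]) @ [(k, e), (k, \<not> e)] @ drop (length u) (b[p := l])) \<noteq>
          length (u @ [e, \<not> e] @ z)" for k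
        using False by auto
      then have "\<xi> (take (length u) (b[p := l]) @ [(k, e), (k, \<not> e)] @ drop (length u) (b[p := l])) = 0" for k
        using invariant_vec_nonzeroD(1)[OF assms] unfolding vecs_def mem_Collect_eq
        by (metis length_map)
      then show ?thesis
        by (simp add: contract_def)
    qed
    then show ?thesis
      by (simp add: shift_op_def)
  qed
qed

text \<open>Contraction is adjoint to the insertion of a small arc from
  \<open>pairing_insert\<close>. \<open>T'\<close> does not depend on \<xi>.\<close>

lemma inner_contract:
  assumes "T \<in> pairings (u @ z)"
  shows "\<exists>T'\<in>pairings (u @ [e, \<not> e] @ z). \<forall>\<xi>.
    inner_on (vecs 2 (u @ z)) (contract (length u) e \<xi>) (pairing_vec 2 (u @ z) T) =
    inner_on (vecs 2 (u @ [e, \<not> e] @ z)) \<xi> (pairing_vec 2 (u @ [e, \<not> e] @ z) T')"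
proof -
  obtain T' where T': "sign_word T' = u @ [e, \<not> e] @ z"
    "\<And>a l m b. length a = length u \<Longrightarrow> snd l = e \<Longrightarrow> snd m = (\<not> e) \<Longrightarrow>
      (matches T' (a @ l # m # b) \<longleftrightarrow> m = linv l \<and> matches T (a @ b))"
    using pairing_insert[of T u z e] assms by (auto simp: pairings_def)
  have "inner_on (vecs 2 (u @ z)) (contract (length u) e \<xi>) (pairing_vec 2 (u @ z) T) =
    inner_on (vecs 2 (u @ [e, \<not> e] @ z)) \<xi> (pairing_vec 2 (u @ [e, \<not> e] @ z) T')" (is "?L = ?R") for \<xi>
  proof -
    have len: "a \<in> vecs 2 u \<Longrightarrow> length a = length u" for a
      by (auto simp: vecs_def)
    have "?L = (\<Sum>a\<in>vecs 2 u. \<Sum>b\<in>vecs 2 z. \<Sum>k<2. \<xi> (a @ [(k, e), (k, \<not> e)] @ b) * of_bool (matches T (a @ b)))"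
      unfolding inner_on_def sum_vecs_append
      by (intro sum.cong refl)
        (auto simp: pairing_vec_def append_in_vecs contract_append[OF len] sum_distrib_right)
    also have "\<dots> = (\<Sum>a\<in>vecs 2 u. \<Sum>k<2. \<Sum>b\<in>vecs 2 z. \<xi> (a @ [(k, e), (k, \<not> e)] @ b) * of_bool (matches T (a @ b)))"
      by (intro sum.cong refl sum.swap)
    also have "\<dots> = (\<Sum>a\<in>vecs 2 u. \<Sum>k<2. \<Sum>m<2. \<Sum>b\<in>vecs 2 z.
        \<xi> (a @ (k, e) # (m, \<not> e) # b) * of_bool (matches T' (a @ (k, e) # (m, \<not> e) # b)))"
    proof (intro sum.cong refl)
      fix a k assume a: "a \<in> vecs 2 u" and k: "k \<in> {..<2::nat}"
      have "(\<Sum>b\<in>vecs 2 z. \<xi> (a @ (k, e) # (m, \<not> e) # b) * of_bool (matches T' (a @ (k, e) # (m, \<not> e) # b))) =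
        (if m = k then (\<Sum>b\<in>vecs 2 z. \<xi> (a @ [(k, e), (k, \<not> e)] @ b) * of_bool (matches T (a @ b))) else 0)" for m
        using T'(2)[OF len[OF a], of "(k, e)" "(m, \<not> e)"] by (auto simp: linv_def)
      then show "(\<Sum>b\<in>vecs 2 z. \<xi> (a @ [(k, e), (k, \<not> e)] @ b) * of_bool (matches T (a @ b))) =
          (\<Sum>m<2. \<Sum>b\<in>vecs 2 z.
        \<xi> (a @ (k, e) # (m, \<not> e) # b) * of_bool (matches T' (a @ (k, e) # (m, \<not> e) # b)))"
        using k by simp
    qed
    also have "\<dots> = ?R"
    proof -
      have "a @ (k, e) # (m, \<not> e) # b \<in> vecs 2 (u @ [e, \<not> e] @ z)"
        if "a \<in> vecs 2 u" "k < 2" "m < 2" "b \<in> vecs 2 z" for a k m b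
        using that by (auto simp: vecs_def)
      then show ?thesis
        unfolding inner_on_def sum_vecs_append append_Cons append_Nil sum_vecs_Cons
        by (intro sum.cong refl) (simp add: pairing_vec_def)
    qed
    finally show ?thesis .
  qed
  then show ?thesis
    using T'(1) by (intro bexI[of _ T']) (auto simp: pairings_def)
qed

text \<open>Let \<zeta> be the residual of the projection to the pairing vectors. A contraction of
  \<zeta> is an invariant vector for a shorter word, hence by induction a combination of pairings;
  by adjointness it is also orthogonal to all pairings, so it is 0. Vanishing contractions are the
  sign rule that \<open>traceless_zero\<close> asks for.\<close>

theorem invariant_vec_2_span:
  assumes "invariant_vec 2 y \<eta>"
  shows "\<exists>c. \<forall>b. \<eta> b = (\<Sum>T\<in>pairings y. c T * pairing_vec 2 y T b)"
  using assms
proof (induction "length y" arbitrary: y \<eta> rule: less_induct)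
  case less
  let ?D = "vecs 2 y"
  obtain c where c: "\<forall>T\<in>pairings y.
      inner_on ?D (\<lambda>d. \<eta> d - (\<Sum>k\<in>pairings y. c k * pairing_vec 2 y k d)) (pairing_vec 2 y T) = 0"
    using orthogonal_residual[OF finite_pairings finite_vecs, of y 2 y \<eta> "pairing_vec 2 y"] by blast
  define \<zeta> where "\<zeta> d = \<eta> d - (\<Sum>k\<in>pairings y. c k * pairing_vec 2 y k d)" for d
  have orth: "inner_on ?D \<zeta> (pairing_vec 2 y T) = 0" if "T \<in> pairings y" for T
    using c that by (simp add: \<zeta>_def[abs_def])
  have inv: "invariant_vec 2 y \<zeta>"
    unfolding \<zeta>_def[abs_def]
    by (intro invariant_vec_diff less.prems invariant_vec_sum invariant_pairing_vec)
  have "\<zeta> b = 0" for b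
  proof (cases "y = []")
    case True
    have "Empty \<in> pairings y"
      using True by (simp add: pairings_def)
    then have "\<zeta> [] = 0"
      using orth[of Empty] True by (simp add: inner_on_def pairing_vec_def)
    then show ?thesis
      using invariant_vec_nonzeroD(1)[OF inv, of b] True by auto
  next
    case False
    show ?thesis
    proof (rule traceless_zero)
      show "triv b \<and> (\<forall>l\<in>set b. fst l < 2) \<and> length b = length y" if "\<zeta> b \<noteq> 0" for b
        using invariant_vec_nonzeroD[OF inv that] free_trivial_triv by (auto simp: vecs_def)
      show "shift_op 0 1 \<zeta> b = 0 \<and> shift_op 1 0 \<zeta> b = 0" if "\<forall>l\<in>set b. fst l < 2" for b
        using that by (auto intro: invariant_vec_shift[OF inv])
      show "\<zeta> (a @ [l, linv l] @ b) = - \<zeta> (a @ [bar l, linv (bar l)] @ b)" if l: "fst l < 2" for a b l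
      proof -
        define u z e where "u = map snd a" and "z = map snd b" and "e = snd l"
        have *: "y = u @ [e, \<not> e] @ z \<and> a \<in> vecs 2 u \<and> b \<in> vecs 2 z"
          if "\<zeta> (a @ [m, linv m] @ b) \<noteq> 0" "snd m = e" for m
          using invariant_vec_nonzeroD(1)[OF inv that(1)] that(2)
          by (auto simp: vecs_def u_def z_def linv_def)
        show ?thesis
        proof (cases "y = u @ [e, \<not> e] @ z \<and> a \<in> vecs 2 u \<and> b \<in> vecs 2 z")
          case 1: True
          define \<kappa> where "\<kappa> = contract (length u) e \<zeta>"
          have "invariant_vec 2 (u @ z) \<kappa>"
            unfolding \<kappa>_def using inv 1 by (intro invariant_contract) simp
          moreover have "length (u @ z) < length y"
            using 1 by simp
          ultimately obtain c' where c': "\<And>b. \<kappa> b = (\<Sum>T\<in>pairings (u @ z). c' T * pairing_vec 2 (u @ z) T b)"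
            using less.hyps[of "u @ z" \<kappa>] by blast
          have "inner_on (vecs 2 (u @ z)) \<kappa> (pairing_vec 2 (u @ z) T) = 0" if T: "T \<in> pairings (u @ z)" for T
          proof -
            obtain T' where "T' \<in> pairings y"
              "inner_on (vecs 2 (u @ z)) \<kappa> (pairing_vec 2 (u @ z) T) = inner_on ?D \<zeta> (pairing_vec 2 y T')"
              using inner_contract[OF T, of e] conjunct1[OF 1] unfolding \<kappa>_def by blast
            then show ?thesis
              using orth by simp
          qed
          then have "inner_on (vecs 2 (u @ z)) \<kappa> \<kappa> = 0"
            by (rule inner_on_right_comb[OF c'])
          then have "\<kappa> (a @ b) = 0"
            using 1 by (intro inner_on_self_zero[OF finite_vecs]) (auto intro: append_in_vecs)
          moreover have "length a = length u"
            by (simp add: u_def)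
          ultimately have "\<zeta> (a @ [(0, e), (0, \<not> e)] @ b) + \<zeta> (a @ [(1, e), (1, \<not> e)] @ b) = 0"
            unfolding \<kappa>_def by (simp add: contract_append less_2_split)
          moreover have "l = (0, e) \<or> l = (1, e)"
            using l by (cases l) (auto simp: e_def)
          ultimately show ?thesis
            by (auto simp: linv_def bar_def eq_neg_iff_add_eq_0 add.commute)
        next
          case False
          then have "\<zeta> (a @ [l, linv l] @ b) = 0" "\<zeta> (a @ [bar l, linv (bar l)] @ b) = 0"
            using *[of l] *[of "bar l"] by (auto simp: e_def bar_def simp del: append_Cons)
          then show ?thesis
            by simp
        qed
      qed
    qed (use False in auto)
  qed
  then show ?case
    by (intro exI[of _ c]) (simp add: \<zeta>_def)
qed

section \<open>From two letters to \<open>N\<close> letters\<close>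

abbreviation low :: "letter \<Rightarrow> bool" where
  "low l \<equiv> fst l < 2"

definition outs :: "letter list \<Rightarrow> nat" where
  "outs a = length (filter (\<lambda>l. \<not> low l) a)"

lemma outs_simps [simp]:
  "outs [] = 0" "outs (l # a) = (if low l then 0 else 1) + outs a" "outs (a @ b) = outs a + outs b"
  by (auto simp: outs_def)

lemma outs_rotate [simp]: "outs (rotate k a) = outs a"
proof (induction k)
  case (Suc k)
  have "outs (rotate1 b) = outs b" for b
    by (cases b) auto
  then show ?case
    using Suc by simp
qed simp

lemma outs_0: "outs a = 0 \<longleftrightarrow> (\<forall>l\<in>set a. low l)"
  by (auto simp: outs_def filter_empty_conv)

text \<open>The outer letters of \<open>a\<close>, those with index at least 2, stay frozen while
  the others are replaced in order by \<open>b\<close>. A position left over when \<open>b\<close>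
  runs out keeps its letter, a case that the length hypotheses below exclude.\<close>

primrec fill :: "letter list \<Rightarrow> letter list \<Rightarrow> letter list" where
  "fill [] b = []"
| "fill (l # a) b =
    (if low l then case b of [] \<Rightarrow> l # fill a [] | m # c \<Rightarrow> m # fill a c else l # fill a b)"

lemma fill_filter: "fill a (filter low a) = a"
  by (induction a) auto

lemma filter_fill:
  "length b = length (filter low a) \<Longrightarrow> \<forall>l\<in>set b. low l \<Longrightarrow> filter low (fill a b) = b"
  by (induction a arbitrary: b) (auto split: list.split)

lemma length_fill: "length (fill a b) = length a"
  by (induction a arbitrary: b) (auto split: list.split)

lemma set_fill: "set (fill a b) \<subseteq> set a \<union> set b"
proof (induction a arbitrary: b)
  case (Cons l a)
  have "set (fill a (tl b)) \<subseteq> set a \<union> set (tl b)" "set (fill a b) \<subseteq> set a \<union> set b"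
    by (rule Cons.IH)+
  then show ?case
    by (cases b) auto
qed simp

lemma letters_fill:
  "\<forall>l\<in>set a. fst l < N \<Longrightarrow> \<forall>l\<in>set b. fst l < N \<Longrightarrow> \<forall>l\<in>set (fill a b). fst l < N"
  using set_fill by blast

lemma outs_fill:
  assumes "length b = length (filter low a)" "\<forall>l\<in>set b. low l"
  shows "outs (fill a b) = outs a"
proof -
  have "length (filter low w) + outs w = length w" for w
    by (induction w) auto
  from this[of a] this[of "fill a b"] show ?thesis
    using filter_fill[OF assms] assms(1) by (simp add: length_fill)
qed

lemma sign_fill:
  "length b = length (filter low a) \<Longrightarrow>
    map snd (fill a b) = map snd a \<longleftrightarrow> map snd b = map snd (filter low a)"
  by (induction a arbitrary: b) (auto split: list.split)

lemma fill_append: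
  "length b \<ge> length (filter low u) \<Longrightarrow>
    fill (u @ v) b = fill u b @ fill v (drop (length (filter low u)) b)"
proof (induction u arbitrary: b)
  case (Cons l u)
  then show ?case
    by (cases "low l"; cases b) auto
qed simp

lemma fill_low: "\<forall>l\<in>set u. low l \<Longrightarrow> length b \<ge> length u \<Longrightarrow> fill u b = take (length u) b"
  by (induction u arbitrary: b) (auto split: list.split)

lemma shift_op_fill:
  assumes "\<alpha> < 2" "\<beta> < 2"
  shows "length b = length (filter low a) \<Longrightarrow> \<forall>l\<in>set b. low l \<Longrightarrow>
    shift_op \<alpha> \<beta> \<xi> (fill a b) = shift_op \<alpha> \<beta> (\<lambda>b. \<xi> (fill a b)) b"
proof (induction a arbitrary: b \<xi>)
  case (Cons l a)
  show ?case
  proof (cases "low l")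
    case True
    then obtain m c where b: "b = m # c"
      using Cons.prems by (cases b) auto
    then show ?thesis
      using True Cons.IH[of c "\<lambda>a. \<xi> (m # a)"] Cons.prems by (simp add: shift_op_Cons)
  next
    case False
    then have "shift_coeff \<alpha> \<beta> l = 0"
      using assms by (auto simp: shift_coeff_def)
    then show ?thesis
      using False Cons.IH[of b "\<lambda>a. \<xi> (l # a)"] Cons.prems by (simp add: shift_op_Cons)
  qed
qed simp

text \<open>A permutation of the first two indices extends by the identity and respects the
  distinction between frozen letters and the others.\<close>

lemma free_trivial_fill:
  assumes "free_trivial N (fill a b)" "N \<ge> 2" "length b = length (filter low a)" "\<forall>l\<in>set b. low l"
  shows "free_trivial 2 b"
  unfolding free_trivial_def
proof (intro allI impI)
  fix \<sigma> :: "nat \<Rightarrow> nat" assume \<sigma>: "\<sigma> permutes {..<2}"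
  then have "\<sigma> permutes {..<N}"
    using assms(2) by (auto intro: permutes_subset)
  then have "triv (filter low (map (apfst \<sigma>) (fill a b)))"
    using assms(1) by (auto simp: free_trivial_def)
  moreover have "filter low (map (apfst \<sigma>) w) = map (apfst \<sigma>) (filter low w)" for w
  proof (induction w)
    case (Cons l w)
    then show ?case
      using permutes_in_image[OF \<sigma>, of "fst l"] by (auto simp: lessThan_def)
  qed simp
  ultimately show "triv (filter low (map (apfst \<sigma>) b))"
    using filter_fill[OF assms(3,4)] assms(4) by (metis filter_True)
qed

text \<open>With the outer letters frozen, a vector depends on the others as an invariant vector on
  two letters, to which \<open>invariant_vec_2_span\<close> applies.\<close>

lemma invariant_fill:
  assumes "invariant_vec N (map snd a) \<zeta>" "N \<ge> 2" "a \<in> vecs N (map snd a)"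
  shows "invariant_vec 2 (map snd (filter low a))
    (\<lambda>b. if length b = length (filter low a) \<and> (\<forall>l\<in>set b. low l) then \<zeta> (fill a b) else 0)"
    (is "invariant_vec 2 ?y ?\<eta>")
  unfolding invariant_vec_def
proof (intro conjI allI impI)
  fix b assume "?\<eta> b \<noteq> 0"
  then have b: "length b = length (filter low a)" "\<forall>l\<in>set b. low l" "\<zeta> (fill a b) \<noteq> 0"
    by (auto split: if_splits)
  show "b \<in> vecs 2 ?y"
    using invariant_vec_nonzeroD(1)[OF assms(1) b(3)] b sign_fill[OF b(1)] by (auto simp: vecs_def)
  show "free_trivial 2 b"
    using invariant_vec_nonzeroD(2)[OF assms(1) b(3)] b assms free_trivial_fill by blast
next
  fix \<alpha> \<beta> :: nat and b :: "letter list"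
  assume *: "\<alpha> < 2" "\<beta> < 2" "\<alpha> \<noteq> \<beta>" "\<forall>l\<in>set b. low l"
  show "shift_op \<alpha> \<beta> ?\<eta> b = 0"
  proof (cases "length b = length (filter low a)")
    case True
    have "shift_op \<alpha> \<beta> ?\<eta> b = shift_op \<alpha> \<beta> (\<lambda>b. \<zeta> (fill a b)) b"
      using True letters_shift[OF *(4,1,2)] by (intro shift_op_cong) auto
    also have "\<dots> = shift_op \<alpha> \<beta> \<zeta> (fill a b)"
      using shift_op_fill[OF *(1,2) True *(4)] by simp
    also have "\<dots> = 0"
    proof (rule invariant_vec_shift[OF assms(1)])
      show "\<forall>l\<in>set (fill a b). fst l < N"
        using assms *(4) by (intro letters_fill) (auto simp: vecs_def)
    qed (use * assms in auto)
    finally show ?thesis .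
  qed (simp add: shift_op_def)
qed

text \<open>Triviality in the free group is stable under conjugation, and the Leibniz rule does not
  see the order of the tensor factors.\<close>

lemma invariant_rotate1:
  assumes "invariant_vec N (rotate1 x) \<xi>"
  shows "invariant_vec N x (\<lambda>a. \<xi> (rotate1 a))"
  unfolding invariant_vec_def
proof (intro conjI allI impI)
  fix a assume nz: "\<xi> (rotate1 a) \<noteq> 0"
  have "rotate1 (map snd a) = rotate1 x" "\<forall>l\<in>set a. fst l < N"
    using invariant_vec_nonzeroD(1)[OF assms nz] by (auto simp: vecs_def rotate1_map)
  then show "a \<in> vecs N x"
    using injD[OF inj_rotate1, of "map snd a" x] by (simp add: vecs_def)
  show "free_trivial N a"
    unfolding free_trivial_def
  proof (intro allI impI)
    fix \<sigma> assume "\<sigma> permutes {..<N}"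
    then have t: "triv (filter low (map (apfst \<sigma>) (rotate1 a)))"
      using invariant_vec_nonzeroD(2)[OF assms nz] by (auto simp: free_trivial_def)
    show "triv (filter low (map (apfst \<sigma>) a))"
    proof (cases a)
      case (Cons l a')
      then show ?thesis
        using triv_rotate1[of "filter low (map (apfst \<sigma>) a')" "filter low (map (apfst \<sigma>) [l])"] t
        by (auto split: if_splits)
    qed (use t in simp)
  qed
next
  fix \<alpha> \<beta> :: nat and a :: "letter list"
  assume *: "\<alpha> < N" "\<beta> < N" "\<alpha> \<noteq> \<beta>" "\<forall>l\<in>set a. fst l < N"
  have "shift_op \<alpha> \<beta> (\<lambda>a. \<xi> (rotate1 a)) a = shift_op \<alpha> \<beta> \<xi> (rotate1 a)"
    by (cases a) (simp_all add: shift_op_Cons shift_op_append)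
  also have "\<dots> = 0"
    using * by (intro invariant_vec_shift[OF assms]) auto
  finally show "shift_op \<alpha> \<beta> (\<lambda>a. \<xi> (rotate1 a)) a = 0" .
qed

lemma invariant_rotate:
  "invariant_vec N (rotate k x) \<xi> \<Longrightarrow> invariant_vec N x (\<lambda>a. \<xi> (rotate k a))"
  by (induction k arbitrary: \<xi>) (auto dest: invariant_rotate1)

text \<open>Since no prefix has negative exponent, the letters 0 only build up and reduce a power of
  \<open>(0, e)\<close> on top of \<open>st\<close> and never cancel into \<open>st\<close>.\<close>

lemma fold_push_dnet:
  assumes "\<And>p q. u = p @ q \<Longrightarrow> dnet e p \<ge> 0" "st \<noteq> []" "hd st \<noteq> (0, \<not> e)"
  shows "fold push (filter (\<lambda>l. fst l = 0) u) st = replicate (nat (dnet e u)) (0, e) @ st"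
  using assms(1)
proof (induction u rule: rev_induct)
  case (snoc l u)
  have IH: "fold push (filter (\<lambda>l. fst l = 0) u) st = replicate (nat (dnet e u)) (0, e) @ st"
    using snoc by (metis append_assoc)
  have nn: "dnet e u \<ge> 0" "dnet e (u @ [l]) \<ge> 0"
    using snoc.prems[of u "[l]"] snoc.prems[of "u @ [l]" "[]"] by auto
  obtain m ms where st: "st = m # ms" "m \<noteq> (0, \<not> e)"
    using assms by (cases st) auto
  consider "fst l \<noteq> 0" | "l = (0, e)" | "l = (0, \<not> e)"
    by (cases l) auto
  then show ?case
  proof cases
    case 2
    have "nat (dnet e u + 1) = Suc (nat (dnet e u))"
      using nn by simp
    moreover have "push (0, e) (replicate (nat (dnet e u)) (0, e) @ st) =
        (0, e) # replicate (nat (dnet e u)) (0, e) @ st"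
      using st by (cases "nat (dnet e u)") (auto simp: linv_def)
    ultimately show ?thesis
      using 2 IH by (simp add: add.commute)
  next
    case 3
    then have "dnet e u \<ge> 1"
      using nn by simp
    then obtain j where j: "nat (dnet e u) = Suc j" "nat (dnet e u - 1) = j"
      by (metis Suc_nat_eq_nat_zadd1 add.commute diff_add_cancel diff_ge_0_iff_ge)
    then show ?thesis
      using 3 IH by (simp add: linv_def)
  qed (use IH in simp)
qed simp

text \<open>Among all cyclic rotations of words in the support with the fewest letters outside
  \<open>{0, 1}\<close>, one is taken that starts with such a letter and has the longest gap to the next one.
  Inside the gap the word may be assumed to be part of a Dyck word.\<close>

lemma invariant_vec_zero:
  assumes inv: "invariant_vec N x \<xi>" and N: "N \<ge> 2"
    and zero: "\<And>a. \<forall>l\<in>set a. low l \<Longrightarrow> \<xi> a = 0"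
  shows "\<xi> a = 0"
proof (rule ccontr)
  assume "\<xi> a \<noteq> 0"
  then obtain a0 where a0: "\<xi> a0 \<noteq> 0" "\<And>b. \<xi> b \<noteq> 0 \<Longrightarrow> outs a0 \<le> outs b"
    using ex_has_least_nat[of "\<lambda>a. \<xi> a \<noteq> 0" a outs] by blast
  define s where "s = outs a0"
  have "s > 0"
    using zero[of a0] a0(1) outs_0[of a0] by (auto simp: s_def)
  define cand where "cand a \<longleftrightarrow> (\<exists>k. \<xi> (rotate k a) \<noteq> 0) \<and> outs a = s \<and> a \<noteq> [] \<and> \<not> low (hd a)" for a
  define gap where "gap a = length (takeWhile low (tl a))" for a :: "letter list"
  have "\<exists>a. cand a"
  proof -
    have "\<exists>l\<in>set a0. \<not> low l"
      using \<open>s > 0\<close> outs_0[of a0] by (auto simp: s_def)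
    then obtain u z v where a0': "a0 = u @ z # v" "\<not> low z"
      by (metis split_list)
    have "rotate (length (z # v)) ((z # v) @ u) = a0"
      by (simp only: rotate_append a0')
    then have "cand ((z # v) @ u)"
      using a0 a0' unfolding cand_def s_def by (intro conjI exI[of _ "length (z # v)"]) auto
    then show ?thesis ..
  qed
  moreover have "gap a < Suc (length x)" if "cand a" for a
  proof -
    obtain k where "\<xi> (rotate k a) \<noteq> 0"
      using \<open>cand a\<close> by (auto simp: cand_def)
    then have "map snd (rotate k a) = x"
      using invariant_vec_nonzeroD(1)[OF inv] by (auto simp: vecs_def)
    then have "length a = length x"
      by auto
    moreover have "gap a \<le> length (tl a)"
      unfolding gap_def by (rule length_takeWhile_le)
    ultimately show ?thesis
      by simp
  qed
  ultimately obtain a where a: "cand a" "\<And>b. cand b \<Longrightarrow> gap b \<le> gap a"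
    using ex_has_greatest_nat[of cand _ gap] by blast
  obtain k where k: "\<xi> (rotate k a) \<noteq> 0"
    using a(1) by (auto simp: cand_def)
  define \<zeta> where "\<zeta> b = \<xi> (rotate k b)" for b
  have "rotate k (map snd a) = x"
    using invariant_vec_nonzeroD(1)[OF inv k] by (simp add: vecs_def rotate_map)
  then have inv': "invariant_vec N (map snd a) \<zeta>"
    using invariant_rotate[of N k "map snd a"] inv unfolding \<zeta>_def[abs_def] by simp
  have \<zeta>a: "\<zeta> a \<noteq> 0"
    using k by (simp add: \<zeta>_def)
  have aN: "a \<in> vecs N (map snd a)"
    using invariant_vec_nonzeroD(1)[OF inv' \<zeta>a] .
  have min: "s \<le> outs b" if "\<zeta> b \<noteq> 0" for b
    using a0(2)[of "rotate k b"] that by (simp add: \<zeta>_def s_def)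
  obtain z a' where az: "a = z # a'" and z: "\<not> low z" and outs_a: "outs a = s"
    using a(1) by (cases a) (auto simp: cand_def)
  let ?y = "map snd (filter low a)"
  let ?\<eta> = "\<lambda>b. if length b = length (filter low a) \<and> (\<forall>l\<in>set b. low l) then \<zeta> (fill a b) else 0"
  obtain c where c: "\<And>b. ?\<eta> b = (\<Sum>T\<in>pairings ?y. c T * pairing_vec 2 ?y T b)"
    using invariant_vec_2_span[OF invariant_fill[OF inv' N aN]] by blast
  have "?\<eta> (filter low a) \<noteq> 0"
    using \<zeta>a by (simp add: fill_filter)
  then obtain T where "T \<in> pairings ?y" "c T \<noteq> 0"
    unfolding c by (metis (no_types, lifting) mult_zero_left sum.neutral)
  \<comment> \<open>The low letters of \<open>a\<close> are exchanged for a Dyck word in the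
    support, for which the sign of \<open>z\<close> is the direction in which the letter 0 counts
    positively.\<close>
  then obtain b where b: "b \<in> vecs 2 ?y" "(\<Sum>T\<in>pairings ?y. c T * of_bool (matches T b)) \<noteq> 0"
    "\<And>p q. b = p @ q \<Longrightarrow> dnet (snd z) p \<ge> 0"
    using pairing_span_dyck[of T ?y c "snd z"] by blast
  have "?\<eta> b \<noteq> 0"
    unfolding c using b by (simp add: pairing_vec_def)
  then have nz: "\<zeta> (fill a b) \<noteq> 0" and lb: "length b = length (filter low a)" "\<forall>l\<in>set b. low l"
    by (auto split: if_splits)
  define q0 r0 where "q0 = takeWhile low a'" and "r0 = dropWhile low a'"
  define q r where "q = take (length q0) b" and "r = fill r0 (drop (length q0) b)"
  have q0: "a' = q0 @ r0" "\<forall>l\<in>set q0. low l" "length q0 = gap a"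
    by (auto simp: q0_def r0_def gap_def az dest: set_takeWhileD)
  then have lq: "length b \<ge> length q0"
    using lb z by (simp add: az)
  then have ab: "fill a b = z # q @ r"
    using z q0 fill_append[of q0 b r0] fill_low[of q0 b] by (simp add: az q_def r_def filter_True)
  have hd_r: "r \<noteq> [] \<Longrightarrow> \<not> low (hd r)"
  proof (cases r0)
    case (Cons y r')
    then have "\<not> low y"
      using hd_dropWhile[of low a'] by (simp add: r0_def)
    then show ?thesis
      by (simp add: r_def Cons)
  qed (simp add: r_def)
  have low_q: "\<forall>l\<in>set q. low l"
    using lb by (auto simp: q_def dest: in_set_takeD)
  have outs_ab: "outs (z # q @ r) = s"
    using outs_a outs_fill[OF lb] unfolding ab by simp
  define e i where "e = snd z" and "i = fst z"
  have zi: "z = (i, e)" "i \<ge> 2" "i < N"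
    using z aN by (auto simp: e_def i_def vecs_def az)
  \<comment> \<open>The matrix unit turns \<open>(0, e)\<close> into \<open>z\<close>. In
    \<open>w\<close> the leading \<open>z\<close> has been replaced by \<open>(0, e)\<close>, so the
    term at position 0 is the nonzero value at \<open>fill a b\<close>.\<close>
  define \<alpha> \<beta> where "\<alpha> = (if e then i else 0)" and "\<beta> = (if e then 0 else i)"
  define w where "w = (0, e) # q @ r"
  define t where "t p = shift_coeff \<alpha> \<beta> (w ! p) * \<zeta> (w[p := shift_letter \<alpha> \<beta> (w ! p)])" for p
  have wN: "\<forall>l\<in>set w. fst l < N"
    using invariant_vec_nonzeroD(1)[OF inv' nz] N unfolding ab by (auto simp: w_def vecs_def)
  have "(\<Sum>p<length w. t p) = 0"
    using invariant_vec_shift[OF inv', of \<alpha> \<beta> w] wN zi N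
    by (auto simp: shift_op_def t_def \<alpha>_def \<beta>_def)
  moreover have "t p = 0" if p: "p < length w" "p \<noteq> 0" for p
  proof (rule ccontr)
    assume "t p \<noteq> 0"
    define l where "l = w ! p"
    have l: "l = (0, e) \<or> l = (i, \<not> e)" and nz': "\<zeta> (w[p := shift_letter \<alpha> \<beta> l]) \<noteq> 0"
      using \<open>t p \<noteq> 0\<close> by (cases l; auto simp: t_def l_def[symmetric] shift_coeff_def \<alpha>_def \<beta>_def split: if_splits)+
    define u v where "u = take (p - 1) (q @ r)" and "v = drop p (q @ r)"
    have qr: "q @ r = u @ l # v" "length u = p - 1"
      using p id_take_nth_drop[of "p - 1" "q @ r"] by (auto simp: u_def v_def l_def w_def)
    have w': "w[p := m] = (0, e) # u @ m # v" for m
      using p qr by (cases p) (auto simp: w_def list_update_append)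
    show False
    proof (cases "l = (0, e)")
      case False
      then have li: "l = (i, \<not> e)"
        using l by simp
      \<comment> \<open>\<open>w\<close> already has one outer letter fewer than
        \<open>fill a b\<close>, and this term removes another one, which falls below the minimum
        \<open>s\<close>.\<close>
      have "outs (w[p := shift_letter \<alpha> \<beta> l]) < outs (z # u @ l # v)"
        using z zi li by (simp add: w' shift_letter_def \<alpha>_def \<beta>_def)
      then show False
        using min[OF nz'] outs_ab qr by simp
    next
      case l0: True
      have "shift_letter \<alpha> \<beta> l = z"
        by (auto simp: l0 shift_letter_def \<alpha>_def \<beta>_def zi)
      then have nzw: "\<zeta> ((0, e) # u @ z # v) \<noteq> 0"
        using nz' w' by simp
      show False
      proof (cases "length u < length q")
        case True
        define n where "n = length u"
        have "take n (q @ r) = u"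
          using qr(1) by (simp add: n_def)
        then have ub: "take n b = u"
          using True by (simp add: q_def n_def)
        then have "b = u @ drop n b"
          using append_take_drop_id[of n b] by simp
        then have u_dnet: "dnet e p \<ge> 0" if "u = p @ p'" for p p'
          using b(3)[of p "p' @ drop n b"] that by (simp add: e_def)
        have low_u: "\<forall>l\<in>set u. low l"
          using lb(2) unfolding ub[symmetric] by (auto dest: in_set_takeD)
        \<comment> \<open>Under this transposition \<open>z\<close> becomes the free generator 1 and
          the letters of index 1 become trivial, so that inside the gap only the letters 0 are
          left.\<close>
        define \<sigma> where "\<sigma> = Transposition.transpose 1 i"
        have \<sigma>: "\<sigma> permutes {..<N}"
          unfolding \<sigma>_def using zi N by (intro permutes_swap_id) auto
        define f where "f a = filter low (map (apfst \<sigma>) a)" for a :: "letter list"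
        have fz: "f [z] = [(1, e)]" and f0: "f [(0, e)] = [(0, e)]"
          using zi by (auto simp: f_def \<sigma>_def Transposition.transpose_def)
        have fu: "f u = filter (\<lambda>l. fst l = 0) u"
          using low_u zi unfolding f_def \<sigma>_def
          by (induction u) (auto simp: Transposition.transpose_def less_2_cases_iff prod_eq_iff)
        have f_app: "f (a @ b) = f a @ f b" for a b
          by (simp add: f_def)
        have "triv (f (z # q @ r))" "triv (f ((0, e) # u @ z # v))"
          using invariant_vec_nonzeroD(2)[OF inv' nz] invariant_vec_nonzeroD(2)[OF inv' nzw] \<sigma> ab
          by (auto simp: free_trivial_def f_def)
        moreover have "f (z # q @ r) = [] @ ([(1, e)] @ f u @ [(0, e)]) @ f v"
          using f_app[of "[z]" "u @ [l] @ v"] f_app[of u "[l] @ v"] f_app[of "[l]" v] fz f0 l0 qr by simp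
        moreover have "f ((0, e) # u @ z # v) = [] @ ([(0, e)] @ f u @ [(1, e)]) @ f v"
          using f_app[of "[(0, e)]" "u @ [z] @ v"] f_app[of u "[z] @ v"] f_app[of "[z]" v] fz f0 by simp
        ultimately have "fold push ([(1, e)] @ f u @ [(0, e)]) [] = fold push ([(0, e)] @ f u @ [(1, e)]) []"
          by (intro triv_mid_eq[of "[]" _ "f v"]) auto
        then have "push (0, e) (fold push (f u) [(1, e)]) = push (1, e) (fold push (f u) [(0, e)])"
          by simp
        \<comment> \<open>Above the bottom letter both stacks carry the same nonnegative power of
          \<open>(0, e)\<close>, so the last letter pushed does not cancel: it is
          \<open>(0, e)\<close> on one side and \<open>(1, e)\<close> on the other.\<close>
        moreover have "fold push (f u) [(1, e)] = replicate (nat (dnet e u)) (0, e) @ [(1, e)]"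
          "fold push (f u) [(0, e)] = replicate (nat (dnet e u)) (0, e) @ [(0, e)]"
          unfolding fu using u_dnet by (intro fold_push_dnet; auto)+
        ultimately show False
          by (cases "nat (dnet e u)") (auto simp: linv_def)
      next
        case False
        define u' where "u' = drop (length q) u"
        have u: "u = q @ u'" "r = u' @ l # v"
        proof -
          have "take (length q) (q @ r) = take (length q) (u @ l # v)"
            "drop (length q) (q @ r) = drop (length q) (u @ l # v)"
            using qr(1) by simp_all
          then have "q = take (length q) u" "r = u' @ l # v"
            using False by (simp_all add: u'_def)
          then show "u = q @ u'" "r = u' @ l # v"
            unfolding u'_def by (metis append_take_drop_id)+
        qed
        obtain y u'' where y: "u' = y # u''" "\<not> low y"
          using hd_r u l0 by (cases u') auto
        have "\<exists>l\<in>set (z # v). \<not> low l"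
          using z by auto
        \<comment> \<open>\<open>z'\<close> is the last outer letter, possibly the moved
          \<open>z\<close> itself. After rotation to \<open>z'\<close> its gap contains
          \<open>m2\<close>, the new \<open>(0, e)\<close> and all of \<open>q\<close>, and is
          longer than the longest one.\<close>
        then obtain m1 z' m2 where m: "z # v = m1 @ z' # m2" "\<not> low z'" "\<forall>l\<in>set m2. low l"
          using split_list_last_prop[of "z # v" "\<lambda>l. \<not> low l"] by auto
        define w1 w2 where "w1 = (0, e) # q @ y # u'' @ m1" and "w2 = z' # m2"
        have ww: "(0, e) # u @ z # v = w1 @ w2"
          using m u y by (simp add: w1_def w2_def)
        have "rotate (length w2) (w2 @ w1) = w1 @ w2"
          by (rule rotate_append)
        then have "\<xi> (rotate (k + length w2) (w2 @ w1)) \<noteq> 0"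
          using nzw unfolding ww \<zeta>_def by (simp add: rotate_rotate[symmetric])
        moreover have "outs (w2 @ w1) = s"
        proof -
          have "outs (w2 @ w1) = outs ((0, e) # u @ z # v)"
            unfolding ww by simp
          also have "\<dots> = outs (z # u @ l # v)"
            using l0 by simp
          finally show ?thesis
            using outs_ab qr by simp
        qed
        ultimately have "cand (w2 @ w1)"
          using m unfolding cand_def by (intro conjI exI[of _ "k + length w2"]) (auto simp: w2_def)
        moreover have "gap (w2 @ w1) = length m2 + Suc (length q)"
          using m low_q y by (simp add: gap_def w1_def w2_def takeWhile_append2)
        moreover have "length q = gap a"
          using lq q0 by (simp add: q_def)
        ultimately show False
          using a(2)[of "w2 @ w1"] by simp
      qed
    qed
  qed
  then have "(\<Sum>p<length w. t p) = t 0"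
    by (subst sum.remove[of _ 0]) (auto simp: w_def)
  moreover have "t 0 \<noteq> 0"
  proof -
    have "shift_coeff \<alpha> \<beta> (0, e) \<noteq> 0" "shift_letter \<alpha> \<beta> (0, e) = z"
      by (auto simp: shift_coeff_def shift_letter_def \<alpha>_def \<beta>_def zi)
    then show ?thesis
      using nz ab by (simp add: t_def w_def)
  qed
  ultimately show False
    by simp
qed

text \<open>The coefficients found on words in the letters 0 and 1 are used on all letters. The
  difference vanishes on those words, as \<open>invariant_vec_zero\<close> requires.\<close>

theorem invariant_vec_span:
  assumes inv: "invariant_vec N x \<xi>" and N: "N \<ge> 2"
  shows "\<exists>c. \<forall>a. \<xi> a = (\<Sum>T\<in>pairings x. c T * pairing_vec N x T a)"
proof -
  let ?\<eta> = "\<lambda>b. if b \<in> vecs 2 x then \<xi> b else 0"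
  have "invariant_vec 2 x ?\<eta>"
    unfolding invariant_vec_def
  proof (intro conjI allI impI)
    fix b assume "?\<eta> b \<noteq> 0"
    then have b: "b \<in> vecs 2 x" "\<xi> b \<noteq> 0"
      by (auto split: if_splits)
    then have l: "\<forall>l\<in>set b. low l"
      by (auto simp: vecs_def)
    show "b \<in> vecs 2 x"
      by fact
    show "free_trivial 2 b"
      using free_trivial_fill[of N b b] invariant_vec_nonzeroD(2)[OF inv b(2)] l N
      by (metis fill_filter filter_True)
  next
    fix \<alpha> \<beta> :: nat and b :: "letter list"
    assume *: "\<alpha> < 2" "\<beta> < 2" "\<alpha> \<noteq> \<beta>" "\<forall>l\<in>set b. low l"
    have "shift_op \<alpha> \<beta> ?\<eta> b = shift_op \<alpha> \<beta> \<xi> b"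
    proof (rule shift_op_cong)
      fix p
      let ?b = "b[p := shift_letter \<alpha> \<beta> (b ! p)]"
      have "\<forall>l\<in>set ?b. low l"
        using letters_shift[OF *(4,1,2)] .
      then show "?\<eta> ?b = \<xi> ?b"
        using invariant_vec_nonzeroD(1)[OF inv, of ?b] by (auto simp: vecs_def)
    qed
    also have "\<dots> = 0"
      using * N by (intro invariant_vec_shift[OF inv]) auto
    finally show "shift_op \<alpha> \<beta> ?\<eta> b = 0" .
  qed
  then obtain c where c: "\<And>b. ?\<eta> b = (\<Sum>T\<in>pairings x. c T * pairing_vec 2 x T b)"
    using invariant_vec_2_span by blast
  define \<zeta> where "\<zeta> a = \<xi> a - (\<Sum>T\<in>pairings x. c T * pairing_vec N x T a)" for a
  have "\<zeta> a = 0" for a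
  proof (rule invariant_vec_zero[OF _ N])
    show inv': "invariant_vec N x \<zeta>"
      unfolding \<zeta>_def[abs_def]
      by (intro invariant_vec_diff inv invariant_vec_sum invariant_pairing_vec)
    show "\<zeta> a = 0" if "\<forall>l\<in>set a. low l" for a
    proof (cases "a \<in> vecs 2 x")
      case True
      then have "a \<in> vecs N x"
        using N by (auto simp: vecs_def)
      then show ?thesis
        using c[of a] True by (simp add: \<zeta>_def pairing_vec_def)
    next
      case False
      then show ?thesis
        using invariant_vec_nonzeroD(1)[OF inv', of a] that by (auto simp: vecs_def)
    qed
  qed
  then show ?thesis
    by (intro exI[of _ c]) (simp add: \<zeta>_def)
qed

section \<open>Functionals on words in the generators\<close>

type_synonym uword = "((nat \<times> nat) \<times> bool) list"

text \<open>The matrix entry in row \<open>a\<close> and column \<open>b\<close> of a tensor word in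
  the fundamental corepresentation and its conjugate; the signs are taken from
  \<open>a\<close>.\<close>

definition uw :: "letter list \<Rightarrow> letter list \<Rightarrow> uword" where
  "uw a b = map2 (\<lambda>l m. ((fst l, fst m), snd l)) a b"

lemma uw_simps [simp]:
  "uw [] b = []" "uw a [] = []" "uw (l # a) (m # b) = ((fst l, fst m), snd l) # uw a b"
  by (auto simp: uw_def)

lemma uw_append: "length a = length b \<Longrightarrow> uw (a @ c) (b @ d) = uw a b @ uw c d"
  by (simp add: uw_def)

definition adj :: "uword \<Rightarrow> uword" where
  "adj w = rev (map (apsnd Not) w)"

lemma adj_simps [simp]: "adj [] = []" "adj (l # w) = adj w @ [apsnd Not l]" "adj (v @ w) = adj w @ adj v"
  by (auto simp: adj_def)

lemma adj_adj [simp]: "adj (adj w) = w"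
  by (induction w) (auto simp: apsnd_def map_prod_def split: prod.splits)

definition uwords :: "nat \<Rightarrow> uword set" where
  "uwords N = lists (({..<N} \<times> {..<N}) \<times> UNIV)"

lemma uwords_simps [simp]:
  "[] \<in> uwords N" "l # w \<in> uwords N \<longleftrightarrow> fst (fst l) < N \<and> snd (fst l) < N \<and> w \<in> uwords N"
  "v @ w \<in> uwords N \<longleftrightarrow> v \<in> uwords N \<and> w \<in> uwords N"
  by (auto simp: uwords_def mem_Times_iff)

lemma adj_uwords [simp]: "adj w \<in> uwords N \<longleftrightarrow> w \<in> uwords N"
  by (induction w) auto

lemma uw_uwords: "\<forall>l\<in>set a. fst l < N \<Longrightarrow> \<forall>l\<in>set b. fst l < N \<Longrightarrow> uw a b \<in> uwords N"
proof (induction a arbitrary: b)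
  case (Cons l a)
  then show ?case
    using Cons.IH[of "tl b"] by (cases b) auto
qed simp

lemma uw_vecs: "a \<in> vecs N x \<Longrightarrow> b \<in> vecs N y \<Longrightarrow> uw a b \<in> uwords N"
  by (intro uw_uwords) (auto simp: vecs_def)

lemma length_vecs: "a \<in> vecs N x \<Longrightarrow> length a = length x"
  by (auto simp: vecs_def)

definition row :: "uword \<Rightarrow> letter list" where
  "row w = map (\<lambda>l. (fst (fst l), snd l)) w"

definition col :: "uword \<Rightarrow> letter list" where
  "col w = map (\<lambda>l. (snd (fst l), snd l)) w"

lemma uw_row_col: "uw (row w) (col w) = w"
  by (induction w) (auto simp: row_def col_def)

lemma row_col_vecs: "w \<in> uwords N \<Longrightarrow> row w \<in> vecs N (map snd w) \<and> col w \<in> vecs N (map snd w)"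
  by (induction w) (auto simp: row_def col_def vecs_def)

lemma row_uw: "map snd a = map snd b \<Longrightarrow> row (uw a b) = a"
proof (induction a arbitrary: b)
  case (Cons l a)
  then show ?case
    by (cases b) (auto simp: row_def prod_eq_iff)
qed (simp add: row_def)

lemma col_uw: "map snd a = map snd b \<Longrightarrow> col (uw a b) = b"
proof (induction a arbitrary: b)
  case (Cons l a)
  then show ?case
    by (cases b) (auto simp: col_def prod_eq_iff)
qed (simp add: col_def)

section \<open>Functionals on the free unitary group as functions on words\<close>

text \<open>Functions on words that satisfy the defining relations of the free unitary group in every
  context, that is, linear functionals on the presented algebra.\<close>

definition unitary_functional :: "nat \<Rightarrow> (uword \<Rightarrow> complex) \<Rightarrow> bool" where
  "unitary_functional N \<phi> \<longleftrightarrow> (\<forall>v\<in>uwords N. \<forall>w\<in>uwords N. \<forall>i<N. \<forall>j<N. \<forall>e.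
    (\<Sum>k<N. \<phi> (v @ [((i, k), e), ((j, k), \<not> e)] @ w)) = (if i = j then \<phi> (v @ w) else 0) \<and>
    (\<Sum>k<N. \<phi> (v @ [((k, i), e), ((k, j), \<not> e)] @ w)) = (if i = j then \<phi> (v @ w) else 0))"

lemma unitary_functionalD:
  assumes "unitary_functional N \<phi>" "v \<in> uwords N" "w \<in> uwords N" "i < N" "j < N"
  shows "(\<Sum>k<N. \<phi> (v @ ((i, k), e) # ((j, k), \<not> e) # w)) = (if i = j then \<phi> (v @ w) else 0)"
    "(\<Sum>k<N. \<phi> (v @ ((k, i), e) # ((k, j), \<not> e) # w)) = (if i = j then \<phi> (v @ w) else 0)"
  using assms by (auto simp: unitary_functional_def)

lemma vecs_ConsE:
  assumes "a \<in> vecs N (e # x)"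
  obtains i b where "a = (i, e) # b" "i < N" "b \<in> vecs N x"
  using assms by (auto simp: vecs_Cons)

lemma vecs_appendE:
  assumes "a \<in> vecs N (x @ y)"
  obtains b c where "a = b @ c" "b \<in> vecs N x" "c \<in> vecs N y"
proof -
  have "map snd (take (length x) a) = x" "map snd (drop (length x) a) = y"
    using assms by (auto simp: vecs_def simp flip: take_map drop_map)
  then show ?thesis
    using assms that[of "take (length x) a" "drop (length x) a"]
    by (auto simp: vecs_def dest: in_set_takeD in_set_dropD)
qed

text \<open>The matrix of a whole tensor word is unitary. The outer letters are moved into the
  context \<open>v\<close>, \<open>w\<close>, so that the inner product collapses first.\<close>

lemma row_unitary:
  assumes \<phi>: "unitary_functional N \<phi>"
  shows "v \<in> uwords N \<Longrightarrow> w \<in> uwords N \<Longrightarrow> c \<in> vecs N x \<Longrightarrow> d \<in> vecs N x \<Longrightarrow>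
    (\<Sum>b\<in>vecs N x. \<phi> (v @ uw c b @ adj (uw d b) @ w)) = (if c = d then \<phi> (v @ w) else 0)"
proof (induction x arbitrary: v w c d)
  case (Cons e x)
  obtain i c' where c: "c = (i, e) # c'" "i < N" "c' \<in> vecs N x"
    using Cons.prems(3) by (rule vecs_ConsE)
  obtain j d' where d: "d = (j, e) # d'" "j < N" "d' \<in> vecs N x"
    using Cons.prems(4) by (rule vecs_ConsE)
  have "(\<Sum>b\<in>vecs N (e # x). \<phi> (v @ uw c b @ adj (uw d b) @ w)) =
      (\<Sum>k<N. \<Sum>b\<in>vecs N x. \<phi> ((v @ [((i, k), e)]) @ uw c' b @ adj (uw d' b) @ (((j, k), \<not> e) # w)))"
    by (simp add: sum_vecs_Cons c d)
  also have "\<dots> = (\<Sum>k<N. if c' = d' then \<phi> ((v @ [((i, k), e)]) @ ((j, k), \<not> e) # w) else 0)"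
    using Cons.prems c d by (intro sum.cong refl Cons.IH) auto
  also have "\<dots> = (if c = d then \<phi> (v @ w) else 0)"
    using unitary_functionalD(1)[OF \<phi> Cons.prems(1,2) c(2) d(2), of e] c d
    by (cases "c' = d'") simp_all
  finally show ?case .
qed simp

lemma col_unitary:
  assumes \<phi>: "unitary_functional N \<phi>"
  shows "v \<in> uwords N \<Longrightarrow> w \<in> uwords N \<Longrightarrow> c \<in> vecs N x \<Longrightarrow> d \<in> vecs N x \<Longrightarrow>
    (\<Sum>b\<in>vecs N x. \<phi> (v @ adj (uw b c) @ uw b d @ w)) = (if c = d then \<phi> (v @ w) else 0)"
proof (induction x arbitrary: v w c d)
  case (Cons e x)
  obtain i c' where c: "c = (i, e) # c'" "i < N" "c' \<in> vecs N x"
    using Cons.prems(3) by (rule vecs_ConsE)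
  obtain j d' where d: "d = (j, e) # d'" "j < N" "d' \<in> vecs N x"
    using Cons.prems(4) by (rule vecs_ConsE)
  have "(\<Sum>b\<in>vecs N (e # x). \<phi> (v @ adj (uw b c) @ uw b d @ w)) =
      (\<Sum>k<N. \<Sum>b\<in>vecs N x. \<phi> ((v @ adj (uw b c')) @ ((k, i), \<not> e) # ((k, j), \<not> \<not> e) # (uw b d' @ w)))"
    by (simp add: sum_vecs_Cons c d)
  also have "\<dots> =
      (\<Sum>b\<in>vecs N x. \<Sum>k<N. \<phi> ((v @ adj (uw b c')) @ ((k, i), \<not> e) # ((k, j), \<not> \<not> e) # (uw b d' @ w)))"
    by (rule sum.swap)
  also have "\<dots> = (\<Sum>b\<in>vecs N x. if i = j then \<phi> ((v @ adj (uw b c')) @ (uw b d' @ w)) else 0)"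
    using Cons.prems c d by (intro sum.cong refl unitary_functionalD(2)[OF \<phi>]) (auto simp: uw_vecs)
  also have "\<dots> = (if c = d then \<phi> (v @ w) else 0)"
    using Cons.IH[OF Cons.prems(1,2) c(3) d(3)] c d by (cases "i = j") simp_all
  finally show ?case .
qed simp

text \<open>The end points of the outer arc are moved into the context. Once the parts to its right
  and below it have been removed by induction, the end points are neighbours and a defining relation
  applies.\<close>

lemma pairing_invariant:
  assumes \<phi>: "unitary_functional N \<phi>"
  shows "v \<in> uwords N \<Longrightarrow> w \<in> uwords N \<Longrightarrow> a \<in> vecs N (sign_word T) \<Longrightarrow>
    (\<Sum>b\<in>vecs N (sign_word T). \<phi> (v @ uw a b @ w) * of_bool (matches T b)) =
    of_bool (matches T a) * \<phi> (v @ w)"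
proof (induction T arbitrary: v w a)
  case (Arc e X Y)
  obtain i a' where a: "a = (i, e) # a'" "i < N" "a' \<in> vecs N (sign_word X @ (\<not> e) # sign_word Y)"
    using Arc.prems(3) by (auto elim: vecs_ConsE)
  obtain a1 a'' where a': "a' = a1 @ a''" "a1 \<in> vecs N (sign_word X)" "a'' \<in> vecs N ((\<not> e) # sign_word Y)"
    using a(3) by (rule vecs_appendE)
  obtain j a2 where a'': "a'' = (j, \<not> e) # a2" "j < N" "a2 \<in> vecs N (sign_word Y)"
    using a'(3) by (rule vecs_ConsE)
  have m: "matches (Arc e X Y) ((k, e) # b1 @ (k', \<not> e) # b2) \<longleftrightarrow> k' = k \<and> matches X b1 \<and> matches Y b2"
    if "b1 \<in> vecs N (sign_word X)" for k k' b1 b2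
    using matches_Arc[OF length_vecs[OF that], of e Y "(k, e)" "(k', \<not> e)" b2] by (auto simp: linv_def)
  have len: "length a1 = length b1" if "b1 \<in> vecs N (sign_word X)" for b1
    using length_vecs[OF that] length_vecs[OF a'(2)] by simp
  have "(\<Sum>b\<in>vecs N (sign_word (Arc e X Y)). \<phi> (v @ uw a b @ w) * of_bool (matches (Arc e X Y) b)) =
    (\<Sum>k<N. \<Sum>b1\<in>vecs N (sign_word X). \<Sum>k'<N. \<Sum>b2\<in>vecs N (sign_word Y).
      \<phi> (v @ ((i, k), e) # uw a1 b1 @ ((j, k'), \<not> e) # uw a2 b2 @ w) *
      (of_bool (k' = k) * of_bool (matches X b1) * of_bool (matches Y b2)))"
    unfolding sign_word.simps sum_vecs_Cons sum_vecs_append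
    by (intro sum.cong refl) (simp add: a a' a'' uw_append[OF len] m del: matches.simps)
  also have "\<dots> = (\<Sum>k<N. \<Sum>b1\<in>vecs N (sign_word X). \<Sum>k'<N. of_bool (k' = k) *
      (of_bool (matches X b1) * (\<Sum>b2\<in>vecs N (sign_word Y).
      \<phi> ((v @ ((i, k), e) # uw a1 b1 @ [((j, k'), \<not> e)]) @ uw a2 b2 @ w) * of_bool (matches Y b2))))"
    by (intro sum.cong refl) (simp add: sum_distrib_left mult_ac)
  also have "\<dots> = (\<Sum>k<N. \<Sum>b1\<in>vecs N (sign_word X). \<Sum>k'<N. of_bool (k' = k) *
      (of_bool (matches X b1) * (of_bool (matches Y a2) *
      \<phi> ((v @ ((i, k), e) # uw a1 b1 @ [((j, k'), \<not> e)]) @ w))))"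
    using Arc.prems a a' a'' by (intro sum.cong refl arg_cong2[of _ _ _ _ "(*)"] Arc.IH(2)) (auto simp: uw_vecs)
  also have "\<dots> = (\<Sum>k<N. \<Sum>b1\<in>vecs N (sign_word X).
      of_bool (matches X b1) * (of_bool (matches Y a2) *
      \<phi> ((v @ ((i, k), e) # uw a1 b1 @ [((j, k), \<not> e)]) @ w)))"
  proof (intro sum.cong refl)
    fix k b1 assume "k \<in> {..<N}"
    then show "(\<Sum>k'<N. of_bool (k' = k) * (of_bool (matches X b1) * (of_bool (matches Y a2) *
      \<phi> ((v @ ((i, k), e) # uw a1 b1 @ [((j, k'), \<not> e)]) @ w)))) = of_bool (matches X b1) *
      (of_bool (matches Y a2) * \<phi> ((v @ ((i, k), e) # uw a1 b1 @ [((j, k), \<not> e)]) @ w))"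
      by (subst sum.remove[of _ k]) (auto intro!: sum.neutral)
  qed
  also have "\<dots> = of_bool (matches Y a2) * (\<Sum>k<N. \<Sum>b1\<in>vecs N (sign_word X).
      \<phi> ((v @ [((i, k), e)]) @ uw a1 b1 @ (((j, k), \<not> e) # w)) * of_bool (matches X b1))"
    by (simp add: sum_distrib_left mult_ac)
  also have "(\<Sum>k<N. \<Sum>b1\<in>vecs N (sign_word X).
      \<phi> ((v @ [((i, k), e)]) @ uw a1 b1 @ (((j, k), \<not> e) # w)) * of_bool (matches X b1)) =
      (\<Sum>k<N. of_bool (matches X a1) * \<phi> ((v @ [((i, k), e)]) @ (((j, k), \<not> e) # w)))"
    using Arc.prems a a' a'' by (intro sum.cong refl Arc.IH(1)) auto
  also have "\<dots> = of_bool (matches X a1) * (\<Sum>k<N. \<phi> (v @ ((i, k), e) # ((j, k), \<not> e) # w))"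
    by (simp add: sum_distrib_left)
  also have "\<dots> = of_bool (matches X a1) * (if i = j then \<phi> (v @ w) else 0)"
    using unitary_functionalD(1)[OF \<phi> Arc.prems(1,2) a(2) a''(2)] by simp
  finally have L: "(\<Sum>b\<in>vecs N (sign_word (Arc e X Y)). \<phi> (v @ uw a b @ w) * of_bool (matches (Arc e X Y) b)) =
    of_bool (matches Y a2) * (of_bool (matches X a1) * (if i = j then \<phi> (v @ w) else 0))" .
  have "of_bool (matches (Arc e X Y) a) =
      of_bool (matches Y a2) * (of_bool (matches X a1) * (if i = j then 1 else 0 :: complex))"
    unfolding a a' a'' using m[OF a'(2), of i j a2] by (auto simp del: matches.simps)
  then show ?case
    unfolding L by auto
qed simp

section \<open>Functionals from the points of \<open>U_N\<close> and from the free group\<close>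

definition ev :: "(nat \<Rightarrow> nat \<Rightarrow> complex) \<Rightarrow> uword \<Rightarrow> complex" where
  "ev g w = (\<Prod>l\<leftarrow>w. if snd l then cnj (g (fst (fst l)) (snd (fst l))) else g (fst (fst l)) (snd (fst l)))"

lemma ev_simps [simp]:
  "ev g [] = 1"
  "ev g (l # w) = (if snd l then cnj (g (fst (fst l)) (snd (fst l))) else g (fst (fst l)) (snd (fst l))) * ev g w"
  "ev g (v @ w) = ev g v * ev g w"
  by (auto simp: ev_def)

lemma ev_adj: "ev g (adj w) = cnj (ev g w)"
  by (induction w) auto

lemma unitary_functional_ev:
  assumes "g \<in> carrier (unitary_group N)"
  shows "unitary_functional N (ev g)"
proof -
  have r: "(\<Sum>k<N. g i k * cnj (g j k)) = (if i = j then 1 else 0)"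
    and c: "(\<Sum>k<N. cnj (g k i) * g k j) = (if i = j then 1 else 0)" if "i < N" "j < N" for i j
    using assms that by (auto simp: unitary_group_def)
  have "(\<Sum>k<N. ev g [((i, k), e), ((j, k), \<not> e)]) = (if i = j then 1 else 0) \<and>
    (\<Sum>k<N. ev g [((k, i), e), ((k, j), \<not> e)]) = (if i = j then 1 else 0)" if "i < N" "j < N" for i j e
    using r[of i j] r[of j i] c[of i j] c[of j i] that by (cases e) (auto simp: mult.commute)
  note * = this
  have split: "(\<Sum>k<N. ev g (v @ h k @ w)) = ev g v * (\<Sum>k<N. ev g (h k)) * ev g w" for v w h
    by (simp add: sum_distrib_left sum_distrib_right mult_ac)
  show ?thesis
    unfolding unitary_functional_def split using * by auto
qed

text \<open>A matrix coefficient of \<open>u\<^sub>i\<^sub>j \<mapsto> \<delta>\<^sub>i\<^sub>j g\<^sub>i\<close> in the regular representation of the free group on \<open>g\<^sub>0, g\<^sub>1\<close>,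
  with \<open>g\<^sub>i = 1\<close> for \<open>i \<ge> 2\<close>.\<close>

definition tor :: "letter list \<Rightarrow> letter list \<Rightarrow> uword \<Rightarrow> complex" where
  "tor s t w = of_bool ((\<forall>l\<in>set w. fst (fst l) = snd (fst l)) \<and> fold push (filter low (row w)) s = t)"

lemma unitary_functional_tor:
  assumes s: "reduced_word s"
  shows "unitary_functional N (tor s t)"
  unfolding unitary_functional_def
proof (intro ballI allI impI conjI)
  fix v w i j e assume ij: "i < N" "j < N"
  \<comment> \<open>The two letters push a generator and its inverse, or are both dropped by the
    filter.\<close>
  have can: "fold push (filter low (row (v @ [((i, i), e), ((i, i), \<not> e)] @ w))) s =
      fold push (filter low (row (v @ w))) s"
    using push_push_linv[OF reduced_fold_push[OF s], of "(i, e)"] by (auto simp: row_def linv_def)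
  show "(\<Sum>k<N. tor s t (v @ [((i, k), e), ((j, k), \<not> e)] @ w)) = (if i = j then tor s t (v @ w) else 0)"
  proof -
    have "(\<Sum>k<N. tor s t (v @ [((i, k), e), ((j, k), \<not> e)] @ w)) =
      (\<Sum>k<N. if k = i then (if i = j then tor s t (v @ w) else 0) else 0)"
      using can by (intro sum.cong refl) (auto simp: tor_def simp del: append.simps)
    then show ?thesis
      using ij by simp
  qed
  show "(\<Sum>k<N. tor s t (v @ [((k, i), e), ((k, j), \<not> e)] @ w)) = (if i = j then tor s t (v @ w) else 0)"
  proof -
    have "(\<Sum>k<N. tor s t (v @ [((k, i), e), ((k, j), \<not> e)] @ w)) =
      (\<Sum>k<N. if k = i then (if i = j then tor s t (v @ w) else 0) else 0)"
      using can by (intro sum.cong refl) (auto simp: tor_def simp del: append.simps)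
    then show ?thesis
      using ij by simp
  qed
qed

section \<open>Plane rotations and their derivative\<close>

definition rot :: "nat \<Rightarrow> nat \<Rightarrow> nat \<Rightarrow> real \<Rightarrow> nat \<Rightarrow> nat \<Rightarrow> real" where
  "rot N \<alpha> \<beta> t i j =
    (if i < N \<and> j < N then
      if i = \<alpha> then if j = \<alpha> then cos t else if j = \<beta> then sin t else 0
      else if i = \<beta> then if j = \<alpha> then - sin t else if j = \<beta> then cos t else 0
      else of_bool (i = j)
    else 0)"

lemma sum_two:
  assumes "\<alpha> < N" "\<beta> < N" "\<alpha> \<noteq> (\<beta>::nat)"
  shows "(\<Sum>k<N. f k) = f \<alpha> + f \<beta> + (\<Sum>k\<in>{..<N} - {\<alpha>, \<beta>}. f k :: 'a::comm_monoid_add)"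
proof -
  have "(\<Sum>k<N. f k) = f \<alpha> + (\<Sum>k\<in>{..<N} - {\<alpha>}. f k)"
    using assms by (intro sum.remove) auto
  also have "(\<Sum>k\<in>{..<N} - {\<alpha>}. f k) = f \<beta> + (\<Sum>k\<in>{..<N} - {\<alpha>} - {\<beta>}. f k)"
    using assms by (intro sum.remove) auto
  also have "{..<N} - {\<alpha>} - {\<beta>} = {..<N} - {\<alpha>, \<beta>}"
    by auto
  finally show ?thesis
    by (simp add: add.assoc)
qed

lemma rot_unitary:
  assumes "\<alpha> < N" "\<beta> < N" "\<alpha> \<noteq> \<beta>"
  shows "(\<lambda>i j. complex_of_real (rot N \<alpha> \<beta> t i j)) \<in> carrier (unitary_group N)"
proof -
  have cs: "cos t * cos t + sin t * sin t = 1" "sin t * sin t + cos t * cos t = 1"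
    using sin_cos_squared_add[of t] by (simp_all add: power2_eq_square algebra_simps)
  have rest: "(\<Sum>k\<in>{..<N} - {\<alpha>, \<beta>}. rot N \<alpha> \<beta> t i k * rot N \<alpha> \<beta> t j k) =
      of_bool (i = j \<and> i \<noteq> \<alpha> \<and> i \<noteq> \<beta>)" if "i < N" "j < N" for i j
  proof -
    have "(\<Sum>k\<in>{..<N} - {\<alpha>, \<beta>}. rot N \<alpha> \<beta> t i k * rot N \<alpha> \<beta> t j k) =
      (\<Sum>k\<in>{..<N} - {\<alpha>, \<beta>}. if k = i then of_bool (i = j \<and> i \<noteq> \<alpha> \<and> i \<noteq> \<beta>) else 0)"
      using that by (intro sum.cong) (auto simp: rot_def)
    then show ?thesis
      using that by auto
  qed
  have r: "(\<Sum>k<N. rot N \<alpha> \<beta> t i k * rot N \<alpha> \<beta> t j k) = of_bool (i = j)" if "i < N" "j < N" for i j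
    unfolding sum_two[OF assms] rest[OF that] using assms that cs by (auto simp: rot_def)
  have "rot N \<alpha> \<beta> t k i = rot N \<alpha> \<beta> (- t) i k" for i k
    using assms by (auto simp: rot_def)
  note tr = this
  have rest': "(\<Sum>k\<in>{..<N} - {\<alpha>, \<beta>}. rot N \<alpha> \<beta> t k i * rot N \<alpha> \<beta> t k j) =
      of_bool (i = j \<and> i \<noteq> \<alpha> \<and> i \<noteq> \<beta>)" if "i < N" "j < N" for i j
  proof -
    have "(\<Sum>k\<in>{..<N} - {\<alpha>, \<beta>}. rot N \<alpha> \<beta> t k i * rot N \<alpha> \<beta> t k j) =
      (\<Sum>k\<in>{..<N} - {\<alpha>, \<beta>}. if k = i then of_bool (i = j \<and> i \<noteq> \<alpha> \<and> i \<noteq> \<beta>) else 0)"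
      using that by (intro sum.cong) (auto simp: rot_def)
    then show ?thesis
      using that by auto
  qed
  have c: "(\<Sum>k<N. rot N \<alpha> \<beta> t k i * rot N \<alpha> \<beta> t k j) = of_bool (i = j)" if "i < N" "j < N" for i j
    unfolding sum_two[OF assms] rest'[OF that] using assms that cs by (auto simp: rot_def)
  have zero: "rot N \<alpha> \<beta> t i j = 0" if "\<not> (i < N \<and> j < N)" for i j
    using that by (auto simp: rot_def)
  show ?thesis
    using r c zero by (simp add: unitary_group_def flip: of_real_mult of_real_sum)
qed

lemma rot_0: "\<alpha> \<noteq> \<beta> \<Longrightarrow> i < N \<Longrightarrow> j < N \<Longrightarrow> rot N \<alpha> \<beta> 0 i j = of_bool (i = j)"
  by (auto simp: rot_def)

definition rot_deriv :: "nat \<Rightarrow> nat \<Rightarrow> nat \<Rightarrow> nat \<Rightarrow> real" where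
  "rot_deriv \<alpha> \<beta> i j = (if i = \<alpha> \<and> j = \<beta> then 1 else if i = \<beta> \<and> j = \<alpha> then - 1 else 0)"

lemma rot_has_derivative:
  assumes "\<alpha> < N" "\<beta> < N" "\<alpha> \<noteq> \<beta>"
  shows "((\<lambda>t. rot N \<alpha> \<beta> t i j) has_real_derivative rot_deriv \<alpha> \<beta> i j) (at 0)"
proof -
  have "(cos has_real_derivative 0) (at 0)" "(sin has_real_derivative 1) (at 0)"
    "((\<lambda>t. - sin t) has_real_derivative - 1) (at (0::real))"
    by (auto intro!: derivative_eq_intros)
  moreover have "(\<lambda>t. rot N \<alpha> \<beta> t i j) =
    (if i < N \<and> j < N then
      if i = \<alpha> then if j = \<alpha> then cos else if j = \<beta> then sin else (\<lambda>_. 0)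
      else if i = \<beta> then if j = \<alpha> then (\<lambda>t. - sin t) else if j = \<beta> then cos else (\<lambda>_. 0)
      else (\<lambda>_. of_bool (i = j))
    else (\<lambda>_. 0))"
    by (auto simp: rot_def fun_eq_iff)
  ultimately show ?thesis
    using assms by (auto simp: rot_deriv_def)
qed

lemma ev_id:
  assumes "length a = length b" "\<And>i j. i < N \<Longrightarrow> j < N \<Longrightarrow> g i j = of_bool (i = j)"
    "\<forall>l\<in>set a. fst l < N" "\<forall>l\<in>set b. fst l < N"
  shows "ev g (uw a b) = of_bool (map fst a = map fst b)"
  using assms
proof (induction a b rule: list_induct2)
  case (Cons l a m b)
  have "g (fst l) (fst m) = of_bool (fst l = fst m)"
    using Cons.prems by (intro Cons.prems(1)) auto
  moreover have "ev g (uw a b) = of_bool (map fst a = map fst b)"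
    using Cons.prems by (intro Cons.IH) auto
  ultimately show ?case
    by simp
qed simp

lemma vecs_eq_iff: "a \<in> vecs N x \<Longrightarrow> b \<in> vecs N x \<Longrightarrow> map fst a = map fst b \<longleftrightarrow> a = b"
  by (auto simp: vecs_def intro: pair_list_eqI)

text \<open>The generator of the rotation is the difference of two opposite matrix units, and the
  product rule over the letters matches \<open>shift_op_Cons\<close>. As the rotation is real,
  conjugate letters turn in the same way; the signs in \<open>shift_coeff\<close> account for
  this.\<close>

lemma rotation_derivative:
  assumes ab: "\<alpha> < N" "\<beta> < N" "\<alpha> \<noteq> \<beta>"
  shows "a \<in> vecs N x \<Longrightarrow>
    ((\<lambda>t. \<Sum>b\<in>vecs N x. ev (\<lambda>i j. complex_of_real (rot N \<alpha> \<beta> t i j)) (uw a b) * \<xi> b)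
      has_vector_derivative shift_op \<alpha> \<beta> \<xi> a - shift_op \<beta> \<alpha> \<xi> a) (at 0)"
proof (induction x arbitrary: a \<xi>)
  case (Cons e x)
  define G where "G t i j = complex_of_real (rot N \<alpha> \<beta> t i j)" for t i j
  obtain i a' where a: "a = (i, e) # a'" "i < N" "a' \<in> vecs N x"
    using Cons.prems by (rule vecs_ConsE)
  define H where "H k t = (\<Sum>b\<in>vecs N x. ev (G t) (uw a' b) * \<xi> ((k, e) # b))" for k t
  define D where "D k = shift_op \<alpha> \<beta> (\<lambda>b. \<xi> ((k, e) # b)) a' - shift_op \<beta> \<alpha> (\<lambda>b. \<xi> ((k, e) # b)) a'" for k
  have eq: "(\<Sum>b\<in>vecs N (e # x). ev (G t) (uw a b) * \<xi> b) = (\<Sum>k<N. G t i k * H k t)" for t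
    unfolding sum_vecs_Cons H_def sum_distrib_left
    by (intro sum.cong refl) (simp add: a G_def mult_ac)
  have H0: "H k 0 = \<xi> ((k, e) # a')" for k
  proof -
    have "H k 0 = (\<Sum>b\<in>vecs N x. if b = a' then \<xi> ((k, e) # a') else 0)"
      unfolding H_def
    proof (intro sum.cong refl)
      fix b assume b: "b \<in> vecs N x"
      have "ev (G 0) (uw a' b) = of_bool (map fst a' = map fst b)"
        using a(3) b length_vecs[OF a(3)] length_vecs[OF b] ab
        by (intro ev_id[of _ _ N]) (auto simp: vecs_def G_def rot_0)
      then show "ev (G 0) (uw a' b) * \<xi> ((k, e) # b) = (if b = a' then \<xi> ((k, e) # a') else 0)"
        using vecs_eq_iff[OF a(3) b] by auto
    qed
    then show ?thesis
      using a(3) by simp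
  qed
  have "((\<lambda>t. G t i k * H k t) has_vector_derivative
      G 0 i k * D k + complex_of_real (rot_deriv \<alpha> \<beta> i k) * H k 0) (at 0)" for k
  proof (rule has_vector_derivative_mult)
    show "((\<lambda>t. G t i k) has_vector_derivative complex_of_real (rot_deriv \<alpha> \<beta> i k)) (at 0)"
      unfolding G_def by (rule has_vector_derivative_of_real[OF rot_has_derivative[OF ab]])
    show "(H k has_vector_derivative D k) (at 0)"
      using Cons.IH[OF a(3), of "\<lambda>b. \<xi> ((k, e) # b)"] unfolding H_def[abs_def] D_def G_def .
  qed
  then have "((\<lambda>t. \<Sum>k<N. G t i k * H k t) has_vector_derivative
      (\<Sum>k<N. G 0 i k * D k + complex_of_real (rot_deriv \<alpha> \<beta> i k) * H k 0)) (at 0)"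
    by (intro has_vector_derivative_sum)
  moreover have "(\<Sum>k<N. G 0 i k * D k + complex_of_real (rot_deriv \<alpha> \<beta> i k) * H k 0) =
      shift_op \<alpha> \<beta> \<xi> a - shift_op \<beta> \<alpha> \<xi> a"
  proof -
    have "(\<Sum>k<N. G 0 i k * D k) = (\<Sum>k<N. if k = i then D i else 0)"
      using a(2) ab by (intro sum.cong) (auto simp: G_def rot_0)
    also have "\<dots> = D i"
      using a(2) by simp
    finally have 1: "(\<Sum>k<N. G 0 i k * D k) = D i" .
    have 2: "(\<Sum>k<N. complex_of_real (rot_deriv \<alpha> \<beta> i k) * H k 0) =
        (if i = \<alpha> then \<xi> ((\<beta>, e) # a') else if i = \<beta> then - \<xi> ((\<alpha>, e) # a') else 0)"
      unfolding sum_two[OF ab] H0 using ab by (auto simp: rot_deriv_def intro!: sum.neutral)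
    show ?thesis
      unfolding sum.distrib 1 2 unfolding a(1) shift_op_Cons D_def using ab
      by (cases e) (auto simp: shift_coeff_def shift_letter_def)
  qed
  moreover have "G t = (\<lambda>i j. complex_of_real (rot N \<alpha> \<beta> t i j))" for t
    by (simp add: G_def fun_eq_iff)
  ultimately show ?case
    using eq by simp
qed simp

section \<open>Intertwiners as invariant vectors\<close>

definition intertwines ::
  "nat \<Rightarrow> bool list \<Rightarrow> bool list \<Rightarrow> (letter list \<Rightarrow> letter list \<Rightarrow> complex) \<Rightarrow> (uword \<Rightarrow> complex) \<Rightarrow> bool" where
  "intertwines N x y T \<phi> \<longleftrightarrow> (\<forall>a\<in>vecs N x. \<forall>b\<in>vecs N y.
    (\<Sum>c\<in>vecs N x. \<phi> (uw a c) * T c b) = (\<Sum>c\<in>vecs N y. T a c * \<phi> (uw c b)))"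

definition dual :: "letter list \<Rightarrow> letter list" where
  "dual a = rev (map linv a)"

lemma dual_dual [simp]: "dual (dual a) = a"
  by (simp add: dual_def rev_map comp_def)

definition dual_sign :: "bool list \<Rightarrow> bool list" where
  "dual_sign y = rev (map Not y)"

lemma dual_vecs: "b \<in> vecs N y \<Longrightarrow> dual b \<in> vecs N (dual_sign y)"
  by (auto simp: vecs_def dual_def dual_sign_def rev_map linv_def)

lemma dual_sign_dual_sign [simp]: "dual_sign (dual_sign y) = y"
  by (simp add: dual_sign_def rev_map comp_def)

lemma sum_vecs_dual: "(\<Sum>b\<in>vecs N (dual_sign y). h b) = (\<Sum>b\<in>vecs N y. h (dual b))"
  by (rule sum.reindex_bij_witness[of _ dual dual]) (use dual_vecs[of _ N "dual_sign y"] dual_vecs in auto)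

lemma uw_dual: "length a = length b \<Longrightarrow> uw (dual a) (dual b) = adj (uw a b)"
proof (induction a b rule: list_induct2)
  case (Cons l a m b)
  have "uw (dual (l # a)) (dual (m # b)) = uw (dual a @ [linv l]) (dual b @ [linv m])"
    by (simp add: dual_def)
  also have "\<dots> = uw (dual a) (dual b) @ uw [linv l] [linv m]"
    using Cons.hyps by (intro uw_append) (simp add: dual_def)
  finally show ?case
    using Cons.IH by (simp add: linv_def)
qed (simp add: dual_def)

text \<open>Frobenius reciprocity: intertwiners from \<open>y\<close> to \<open>x\<close> are invariant vectors for \<open>x\<close>
  followed by the dual of \<open>y\<close>.\<close>

definition flatten :: "nat \<Rightarrow> bool list \<Rightarrow> bool list \<Rightarrow> (letter list \<Rightarrow> letter list \<Rightarrow> complex) \<Rightarrow> letter list \<Rightarrow> complex" where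
  "flatten N x y T d = (if d \<in> vecs N (x @ dual_sign y) then T (take (length x) d) (dual (drop (length x) d)) else 0)"

lemma flatten_append:
  assumes "a \<in> vecs N x" "b \<in> vecs N y"
  shows "flatten N x y T (a @ dual b) = T a b"
  using append_in_vecs[OF assms(1) dual_vecs[OF assms(2)]] length_vecs[OF assms(1)]
  by (simp add: flatten_def)

lemma sum_flatten:
  "(\<Sum>d\<in>vecs N (x @ dual_sign y). h d * flatten N x y T d) = (\<Sum>a\<in>vecs N x. \<Sum>b\<in>vecs N y. h (a @ dual b) * T a b)"
  unfolding sum_vecs_append sum_vecs_dual by (intro sum.cong refl) (simp add: flatten_append)

text \<open>\<open>ev g\<close> is multiplicative, so for the unitary matrices of the two tensor
  words the commutation relation becomes invariance of \<open>T\<close> under multiplication by one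
  matrix and by the adjoint of the other.\<close>

lemma flatten_ev_invariant:
  assumes g: "g \<in> carrier (unitary_group N)" and T: "intertwines N x y T (ev g)"
    and a: "a \<in> vecs N x" and b: "b \<in> vecs N y"
  shows "(\<Sum>d\<in>vecs N (x @ dual_sign y). ev g (uw (a @ dual b) d) * flatten N x y T d) = T a b"
proof -
  have split: "uw (a @ dual b) (a' @ dual b') = uw a a' @ adj (uw b b')"
    if "a' \<in> vecs N x" "b' \<in> vecs N y" for a' b'
    using length_vecs[OF a] length_vecs[OF b] length_vecs[OF that(1)] length_vecs[OF that(2)]
    by (simp add: uw_append uw_dual)
  have "(\<Sum>d\<in>vecs N (x @ dual_sign y). ev g (uw (a @ dual b) d) * flatten N x y T d) =
      (\<Sum>a'\<in>vecs N x. \<Sum>b'\<in>vecs N y. ev g (uw a a' @ adj (uw b b')) * T a' b')"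
    unfolding sum_flatten by (intro sum.cong refl) (simp add: split)
  also have "\<dots> = (\<Sum>b'\<in>vecs N y. cnj (ev g (uw b b')) * (\<Sum>a'\<in>vecs N x. ev g (uw a a') * T a' b'))"
    unfolding sum_distrib_left by (subst sum.swap) (intro sum.cong refl, simp add: ev_adj mult_ac)
  also have "\<dots> = (\<Sum>b'\<in>vecs N y. cnj (ev g (uw b b')) * (\<Sum>c\<in>vecs N y. T a c * ev g (uw c b')))"
    using T a by (simp add: intertwines_def)
  also have "\<dots> = (\<Sum>c\<in>vecs N y. T a c * (\<Sum>b'\<in>vecs N y. ev g ([] @ uw c b' @ adj (uw b b') @ [])))"
    unfolding sum_distrib_left by (subst sum.swap) (intro sum.cong refl, simp add: ev_adj mult_ac)
  also have "\<dots> = (\<Sum>c\<in>vecs N y. T a c * (if c = b then 1 else 0))"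
    using row_unitary[OF unitary_functional_ev[OF g], of "[]" "[]" _ y b] b
    by (intro sum.cong refl arg_cong2[of _ _ _ _ "(*)"]) simp
  also have "\<dots> = T a b"
    using b by (simp add: if_distrib[of "(*) _"] cong: if_cong)
  finally show ?thesis .
qed

lemma row_uw_vecs: "a \<in> vecs N x \<Longrightarrow> c \<in> vecs N x \<Longrightarrow> row (uw a c) = a"
  by (intro row_uw) (auto simp: vecs_def)

lemma diagonal_uw: "length a = length c \<Longrightarrow> (\<forall>l\<in>set (uw a c). fst (fst l) = snd (fst l)) \<longleftrightarrow> map fst a = map fst c"
  by (induction a c rule: list_induct2) auto

lemma tor_uw:
  assumes "a \<in> vecs N x" "c \<in> vecs N x"
  shows "tor s t (uw a c) = of_bool (a = c \<and> fold push (filter low a) s = t)"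
  using assms diagonal_uw[of a c] vecs_eq_iff[OF assms] row_uw_vecs[OF assms]
  by (auto simp: tor_def length_vecs)

text \<open>The free group functionals are diagonal in the basis of words, so a nonzero entry of
  \<open>T\<close> forces the two diagonal values to coincide.\<close>

lemma intertwines_tor:
  assumes "intertwines N x y T (tor s t)" "a \<in> vecs N x" "b \<in> vecs N y" "T a b \<noteq> 0"
  shows "fold push (filter low a) s = t \<longleftrightarrow> fold push (filter low b) s = t"
proof -
  have "(\<Sum>c\<in>vecs N x. tor s t (uw a c) * T c b) =
      (\<Sum>c\<in>vecs N x. if c = a then of_bool (fold push (filter low a) s = t) * T a b else 0)"
    using assms(2) by (intro sum.cong refl) (auto simp: tor_uw)
  also have "\<dots> = of_bool (fold push (filter low a) s = t) * T a b"
    using assms(2) by simp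
  finally have 1: "(\<Sum>c\<in>vecs N x. tor s t (uw a c) * T c b) = of_bool (fold push (filter low a) s = t) * T a b" .
  have "(\<Sum>c\<in>vecs N y. T a c * tor s t (uw c b)) =
      (\<Sum>c\<in>vecs N y. if c = b then T a b * of_bool (fold push (filter low b) s = t) else 0)"
    using assms(3) by (intro sum.cong refl) (auto simp: tor_uw)
  also have "\<dots> = T a b * of_bool (fold push (filter low b) s = t)"
    using assms(3) by simp
  finally have 2: "(\<Sum>c\<in>vecs N y. T a c * tor s t (uw c b)) = T a b * of_bool (fold push (filter low b) s = t)" .
  have "of_bool (fold push (filter low a) s = t) * T a b = T a b * of_bool (fold push (filter low b) s = t)"
    using assms(1-3) unfolding intertwines_def 1[symmetric] 2[symmetric] by blast
  then show ?thesis
    using assms(4) by (cases "fold push (filter low a) s = t"; cases "fold push (filter low b) s = t") auto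
qed

text \<open>A transposition moves \<open>i\<close> to the free generator 0, whose exponent sum in a
  trivial word is 0.\<close>

lemma free_trivial_net:
  assumes "free_trivial N d" "i < N"
  shows "net i d = 0"
proof -
  have "Transposition.transpose 0 i permutes {..<N}"
    using assms(2) by (intro permutes_swap_id) auto
  then have "triv (filter low (map (apfst (Transposition.transpose 0 i)) d))"
    using assms(1) by (auto simp: free_trivial_def)
  then have "net 0 (filter low (map (apfst (Transposition.transpose 0 i)) d)) = 0"
    by (rule triv_net)
  also have "net 0 (filter low (map (apfst (Transposition.transpose 0 i)) d)) = net i d"
  proof (induction d)
    case (Cons l d)
    have "Transposition.transpose 0 i (fst l) = 0 \<longleftrightarrow> fst l = i"
      by (auto simp: Transposition.transpose_def)
    then show ?case
      using Cons by auto
  qed simp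
  finally show ?thesis .
qed

lemma net_update:
  "p < length a \<Longrightarrow> net i (a[p := m]) = net i a - net i [a ! p] + net i [m]"
proof (induction a arbitrary: p)
  case (Cons l a)
  then show ?case
    by (cases p) auto
qed simp

text \<open>Each term lowers the exponent sum of \<alpha> by one and raises that of \<beta> by one,
  and it must arrive at exponent sums 0.\<close>

lemma shift_op_net:
  assumes "shift_op \<alpha> \<beta> \<xi> a \<noteq> 0" "\<alpha> \<noteq> \<beta>" "\<And>d. \<xi> d \<noteq> 0 \<Longrightarrow> net \<alpha> d = 0 \<and> net \<beta> d = 0"
  shows "net \<beta> a = - 1" "net \<alpha> a = 1"
proof -
  obtain p where p: "p < length a" "shift_coeff \<alpha> \<beta> (a ! p) \<noteq> 0" "\<xi> (a[p := shift_letter \<alpha> \<beta> (a ! p)]) \<noteq> 0"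
    using assms(1) unfolding shift_op_def by (metis (no_types, lifting) lessThan_iff mult_zero_left mult_zero_right sum.neutral)
  have "net \<alpha> (a[p := shift_letter \<alpha> \<beta> (a ! p)]) = 0 \<and> net \<beta> (a[p := shift_letter \<alpha> \<beta> (a ! p)]) = 0"
    using assms(3) p(3) by blast
  then show "net \<beta> a = - 1" "net \<alpha> a = 1"
    using p(2) assms(2) unfolding net_update[OF p(1)]
    by (auto simp: shift_coeff_def shift_letter_def split: if_splits)
qed

text \<open>Differentiating a rotation gives the difference of two opposite matrix units. Their terms live
  on words with different exponent sums, so each of them vanishes on its own.\<close>

theorem intertwiner_spread:
  assumes N: "N \<ge> 2"
    and U: "\<And>g. g \<in> carrier (unitary_group N) \<Longrightarrow> intertwines N x y T (ev g)"
    and F: "\<And>s t. reduced_word s \<Longrightarrow> intertwines N x y T (tor s t)"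
    and \<phi>: "unitary_functional N \<phi>"
  shows "intertwines N x y T \<phi>"
proof -
  define z where "z = x @ dual_sign y"
  define \<xi> where "\<xi> = flatten N x y T"
  have \<xi>_inv: "(\<Sum>d\<in>vecs N z. ev g (uw d0 d) * \<xi> d) = \<xi> d0"
    if g: "g \<in> carrier (unitary_group N)" and d0: "d0 \<in> vecs N z" for g d0
  proof -
    obtain a b where ab: "d0 = a @ b" "a \<in> vecs N x" "b \<in> vecs N (dual_sign y)"
      using d0 unfolding z_def by (rule vecs_appendE)
    have b: "dual b \<in> vecs N y" "b = dual (dual b)"
      using dual_vecs[OF ab(3)] by simp_all
    then show ?thesis
      using flatten_ev_invariant[OF g U[OF g] ab(2) b(1)] flatten_append[OF ab(2) b(1), of T]
      unfolding z_def \<xi>_def ab(1) by simp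
  qed
  have supp: "d \<in> vecs N z" if "\<xi> d \<noteq> 0" for d
    using that by (auto simp: \<xi>_def flatten_def z_def split: if_splits)
  \<comment> \<open>The second half of \<open>d\<close> is the formal inverse of a word that acts on
    every stack as the first half does.\<close>
  have tr: "triv (filter low d)" if nz: "\<xi> d \<noteq> 0" for d
  proof -
    obtain a b' where ab': "d = a @ b'" "a \<in> vecs N x" "b' \<in> vecs N (dual_sign y)"
      using supp[OF nz] unfolding z_def by (rule vecs_appendE)
    define b where "b = dual b'"
    have b: "b \<in> vecs N y" "b' = dual b"
      using dual_vecs[OF ab'(3)] by (simp_all add: b_def)
    have T: "T a b \<noteq> 0"
      using nz flatten_append[OF ab'(2) b(1), of T] by (simp add: \<xi>_def ab'(1) b(2))
    have "filter low (dual b) = rev (map linv (filter low b))"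
      by (simp add: dual_def rev_filter[symmetric] filter_map comp_def)
    moreover have "fold push (filter low a) s = fold push (filter low b) s" if "reduced_word s" for s
      using intertwines_tor[OF F[OF that] ab'(2) b(1) T] by blast
    ultimately show ?thesis
      unfolding triv_def ab'(1) b(2) by (simp add: fold_push_inverse)
  qed
  have perm: "\<xi> (map (apfst \<sigma>) d) = \<xi> d" if \<sigma>: "\<sigma> permutes {..<N}" and d: "d \<in> vecs N z" for \<sigma> d
  proof -
    \<comment> \<open>The permutation matrix of \<sigma>, a point of \<open>U_N\<close> that
      permutes the basis words.\<close>
    define g where "g i j = (if i < N \<and> j < N then of_bool (i = \<sigma> j) else 0 :: complex)" for i j
    have \<sigma>N: "\<sigma> j < N \<longleftrightarrow> j < N" for j
      using permutes_in_image[OF \<sigma>, of j] by simp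
    have inj: "\<sigma> i = \<sigma> j \<longleftrightarrow> i = j" for i j
      using permutes_inj[OF \<sigma>] by (auto dest: injD)
    have "(\<Sum>k<N. g i k * cnj (g j k)) = (if i = j then 1 else 0)" if "i < N" "j < N" for i j
    proof -
      have "(\<Sum>k<N. g i k * cnj (g j k)) = (\<Sum>k<N. if k = Hilbert_Choice.inv \<sigma> i then of_bool (i = j) else 0)"
        using that permutes_inverses[OF \<sigma>] by (intro sum.cong) (auto simp: g_def)
      moreover have "Hilbert_Choice.inv \<sigma> i < N"
        using permutes_in_image[OF permutes_inv[OF \<sigma>], of i] that by simp
      ultimately show ?thesis
        by simp
    qed
    moreover have "(\<Sum>k<N. cnj (g k i) * g k j) = (if i = j then 1 else 0)" if "i < N" "j < N" for i j
    proof -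
      have "(\<Sum>k<N. cnj (g k i) * g k j) = (\<Sum>k<N. if k = \<sigma> i then of_bool (i = j) else 0)"
        using that inj by (intro sum.cong) (auto simp: g_def)
      then show ?thesis
        using that \<sigma>N by simp
    qed
    ultimately have g: "g \<in> carrier (unitary_group N)"
      by (auto simp: unitary_group_def g_def)
    have evg: "ev g (uw c b) = of_bool (map fst c = map (\<sigma> \<circ> fst) b)"
      if "length c = length b" "\<forall>l\<in>set c. fst l < N" "\<forall>l\<in>set b. fst l < N" for c b
      using that by (induction c b rule: list_induct2) (auto simp: g_def)
    let ?d = "map (apfst \<sigma>) d"
    have d': "?d \<in> vecs N z"
      using d \<sigma>N by (auto simp: vecs_def comp_def)
    have "\<xi> ?d = (\<Sum>b\<in>vecs N z. ev g (uw ?d b) * \<xi> b)"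
      using \<xi>_inv[OF g d'] by simp
    also have "\<dots> = (\<Sum>b\<in>vecs N z. if b = d then \<xi> d else 0)"
    proof (intro sum.cong refl)
      fix b assume b: "b \<in> vecs N z"
      have "ev g (uw ?d b) = of_bool (map fst ?d = map (\<sigma> \<circ> fst) b)"
        using b d' length_vecs[OF b] length_vecs[OF d'] by (intro evg) (auto simp: vecs_def)
      also have "map fst ?d = map (\<sigma> \<circ> fst) b \<longleftrightarrow> map fst d = map fst b"
      proof -
        have "map fst ?d = map \<sigma> (map fst d)" "map (\<sigma> \<circ> fst) b = map \<sigma> (map fst b)"
          by auto
        then show ?thesis
          using inj_map_eq_map[OF permutes_inj[OF \<sigma>]] by metis
      qed
      finally show "ev g (uw ?d b) * \<xi> b = (if b = d then \<xi> d else 0)"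
        using vecs_eq_iff[OF d b] by auto
    qed
    also have "\<dots> = \<xi> d"
      using d by simp
    finally show ?thesis .
  qed
  have ft: "free_trivial N d" if "\<xi> d \<noteq> 0" for d
    unfolding free_trivial_def using tr perm supp[OF that] that by metis
  have inv: "invariant_vec N z \<xi>"
    unfolding invariant_vec_def
  proof (intro conjI allI impI)
    fix \<alpha> \<beta> :: nat and a :: "letter list"
    assume ab: "\<alpha> < N" "\<beta> < N" "\<alpha> \<noteq> \<beta>" and a: "\<forall>l\<in>set a. fst l < N"
    show "shift_op \<alpha> \<beta> \<xi> a = 0"
    proof (cases "a \<in> vecs N z")
      case True
      have "((\<lambda>t. \<xi> a) has_vector_derivative shift_op \<alpha> \<beta> \<xi> a - shift_op \<beta> \<alpha> \<xi> a) (at (0::real))"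
        using rotation_derivative[OF ab True, of \<xi>] \<xi>_inv[OF rot_unitary[OF ab] True] by simp
      then have eq: "shift_op \<alpha> \<beta> \<xi> a - shift_op \<beta> \<alpha> \<xi> a = 0"
        by (rule vector_derivative_unique_at) (rule has_vector_derivative_const)
      show ?thesis
      proof (rule ccontr)
        assume nz: "shift_op \<alpha> \<beta> \<xi> a \<noteq> 0"
        have net: "net \<alpha> d = 0 \<and> net \<beta> d = 0" if "\<xi> d \<noteq> 0" for d
          using free_trivial_net[OF ft[OF that]] ab by blast
        have "net \<beta> a = - 1"
          by (rule shift_op_net(1)[OF nz ab(3) net])
        moreover have "net \<beta> a = 1"
          using eq nz ab(3) net by (intro shift_op_net(2)[of \<beta> \<alpha> \<xi>]) auto
        ultimately show False
          by simp
      qed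
    next
      case False
      then have sg: "map snd a \<noteq> z"
        using a by (auto simp: vecs_def)
      have "\<xi> (a[p := shift_letter \<alpha> \<beta> (a ! p)]) = 0" if "p < length a" for p
      proof -
        have "map snd (a[p := shift_letter \<alpha> \<beta> (a ! p)]) = map snd a"
          using that by (simp add: map_update shift_letter_def list_update_same_conv)
        then show ?thesis
          using sg supp by (fastforce simp: vecs_def)
      qed
      then show ?thesis
        by (simp add: shift_op_def)
    qed
  qed (use supp ft in auto)
  obtain c where c: "\<And>d. \<xi> d = (\<Sum>P\<in>pairings z. c P * pairing_vec N z P d)"
    using invariant_vec_span[OF inv N] by blast
  \<comment> \<open>\<phi> need not be multiplicative, so invariance has to be available inside a
    product with a further word \<open>w\<close>. It holds there because it holds for every
    pairing.\<close>
  have \<xi>_\<phi>: "(\<Sum>d\<in>vecs N z. \<phi> (uw d0 d @ w) * \<xi> d) = \<xi> d0 * \<phi> w"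
    if d0: "d0 \<in> vecs N z" and w: "w \<in> uwords N" for d0 w
  proof -
    have "(\<Sum>d\<in>vecs N z. \<phi> (uw d0 d @ w) * \<xi> d) =
      (\<Sum>P\<in>pairings z. c P * (\<Sum>d\<in>vecs N z. \<phi> ([] @ uw d0 d @ w) * of_bool (matches P d)))"
      unfolding c sum_distrib_left
      by (subst sum.swap) (intro sum.cong refl, simp add: pairing_vec_def mult_ac)
    also have "\<dots> = (\<Sum>P\<in>pairings z. c P * (of_bool (matches P d0) * \<phi> ([] @ w)))"
    proof (intro sum.cong refl arg_cong2[of _ _ _ _ "(*)"])
      fix P assume "P \<in> pairings z"
      then have "sign_word P = z"
        by (simp add: pairings_def)
      then show "(\<Sum>d\<in>vecs N z. \<phi> ([] @ uw d0 d @ w) * of_bool (matches P d)) =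
          of_bool (matches P d0) * \<phi> ([] @ w)"
        using pairing_invariant[OF \<phi>, of "[]" w d0 P] d0 w by simp
    qed
    also have "\<dots> = \<xi> d0 * \<phi> w"
      unfolding c sum_distrib_right using d0
      by (intro sum.cong refl) (simp add: pairing_vec_def mult_ac)
    finally show ?thesis .
  qed
  show ?thesis
    unfolding intertwines_def
  proof (intro ballI)
    fix a b assume a: "a \<in> vecs N x" and b: "b \<in> vecs N y"
    have split: "uw (a @ dual e) (a' @ dual b') = uw a a' @ adj (uw e b')"
      if "a' \<in> vecs N x" "b' \<in> vecs N y" "e \<in> vecs N y" for a' b' e
      using length_vecs[OF a] length_vecs[OF that(3)] length_vecs[OF that(1)] length_vecs[OF that(2)]
      by (simp add: uw_append uw_dual)
    have "(\<Sum>c\<in>vecs N y. T a c * \<phi> (uw c b)) = (\<Sum>e\<in>vecs N y. \<xi> (a @ dual e) * \<phi> (uw e b))"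
      by (intro sum.cong refl) (simp add: \<xi>_def flatten_append a)
    \<comment> \<open>Invariance is applied in front of \<open>uw e b\<close>. Splitting
      \<open>d\<close> puts an adjoint word next to \<open>uw e b\<close>, and the sum over
      \<open>e\<close> will collapse by \<open>col_unitary\<close>.\<close>
    also have "\<dots> = (\<Sum>e\<in>vecs N y. \<Sum>d\<in>vecs N z. \<phi> (uw (a @ dual e) d @ uw e b) * \<xi> d)"
      using \<xi>_\<phi> append_in_vecs[OF a dual_vecs] b by (intro sum.cong refl) (simp add: z_def uw_vecs)
    also have "\<dots> = (\<Sum>e\<in>vecs N y. \<Sum>a'\<in>vecs N x. \<Sum>b'\<in>vecs N y. \<phi> (uw a a' @ adj (uw e b') @ uw e b) * T a' b')"
      unfolding z_def \<xi>_def sum_flatten by (intro sum.cong refl) (simp add: split)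
    also have "\<dots> = (\<Sum>a'\<in>vecs N x. \<Sum>b'\<in>vecs N y. \<Sum>e\<in>vecs N y. \<phi> (uw a a' @ adj (uw e b') @ uw e b) * T a' b')"
      by (subst sum.swap) (intro sum.cong refl sum.swap)
    also have "\<dots> = (\<Sum>a'\<in>vecs N x. \<Sum>b'\<in>vecs N y. (if b' = b then \<phi> (uw a a') else 0) * T a' b')"
    proof (intro sum.cong refl)
      fix a' b' assume "a' \<in> vecs N x" and b': "b' \<in> vecs N y"
      then have "(\<Sum>e\<in>vecs N y. \<phi> (uw a a' @ adj (uw e b') @ uw e b @ [])) = (if b' = b then \<phi> (uw a a' @ []) else 0)"
        using a b by (intro col_unitary[OF \<phi>]) (auto simp: uw_vecs)
      then show "(\<Sum>e\<in>vecs N y. \<phi> (uw a a' @ adj (uw e b') @ uw e b) * T a' b') =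
          (if b' = b then \<phi> (uw a a') else 0) * T a' b'"
        by (simp flip: sum_distrib_right)
    qed
    also have "\<dots> = (\<Sum>a'\<in>vecs N x. \<phi> (uw a a') * T a' b)"
    proof (intro sum.cong refl)
      fix a'
      have "(\<Sum>b'\<in>vecs N y. (if b' = b then \<phi> (uw a a') else 0) * T a' b') =
          (\<Sum>b'\<in>vecs N y. if b' = b then \<phi> (uw a a') * T a' b else 0)"
        by (intro sum.cong) auto
      then show "(\<Sum>b'\<in>vecs N y. (if b' = b then \<phi> (uw a a') else 0) * T a' b') = \<phi> (uw a a') * T a' b"
        using b by simp
    qed
    finally show "(\<Sum>c\<in>vecs N x. \<phi> (uw a c) * T c b) = (\<Sum>c\<in>vecs N y. T a c * \<phi> (uw c b))"
      by simp
  qed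
qed

section \<open>The bicommutant\<close>

definition fun_subspace :: "('d \<Rightarrow> complex) set \<Rightarrow> bool" where
  "fun_subspace M \<longleftrightarrow> (\<lambda>_. 0) \<in> M \<and> (\<forall>m\<in>M. \<forall>k\<in>M. (\<lambda>d. m d + k d) \<in> M) \<and>
    (\<forall>c. \<forall>m\<in>M. (\<lambda>d. c * m d) \<in> M)"

lemma fun_subspace_add: "fun_subspace M \<Longrightarrow> m \<in> M \<Longrightarrow> k \<in> M \<Longrightarrow> (\<lambda>d. m d + k d) \<in> M"
  by (simp add: fun_subspace_def)

lemma fun_subspace_scale: "fun_subspace M \<Longrightarrow> m \<in> M \<Longrightarrow> (\<lambda>d. c * m d) \<in> M"
  by (simp add: fun_subspace_def)

lemma fun_subspace_sum:
  assumes "fun_subspace M" "\<And>i. i \<in> I \<Longrightarrow> m i \<in> M"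
  shows "(\<lambda>d. \<Sum>i\<in>I. c i * m i d) \<in> M"
proof (cases "finite I")
  case True
  then show ?thesis
    using assms(2)
  proof (induction I rule: finite_induct)
    case (insert i I)
    then have "(\<lambda>d. c i * m i d) \<in> M" "(\<lambda>d. \<Sum>i\<in>I. c i * m i d) \<in> M"
      using fun_subspace_scale[OF assms(1)] by simp_all
    from fun_subspace_add[OF assms(1) this]
    show ?case
      using insert.hyps by simp
  qed (use assms in \<open>simp add: fun_subspace_def\<close>)
qed (use assms in \<open>simp add: fun_subspace_def\<close>)

lemma fun_subspace_diff:
  assumes "fun_subspace M" "m \<in> M" "k \<in> M"
  shows "(\<lambda>d. m d - k d) \<in> M"
proof -
  have "(\<lambda>d. m d + - 1 * k d) \<in> M"
    using fun_subspace_add[OF assms(1,2) fun_subspace_scale[OF assms(1,3)]] .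
  then show ?thesis
    by simp
qed

text \<open>Gaussian elimination on the points of \<open>D\<close>: at a new point either all
  members vanish, or one of them serves as a pivot that clears the value there.\<close>

lemma fun_subspace_finite_span:
  assumes "finite D" "fun_subspace M"
  shows "\<exists>J. finite J \<and> J \<subseteq> M \<and> (\<forall>m\<in>M. \<exists>c. \<forall>d\<in>D. m d = (\<Sum>k\<in>J. c k * k d))"
  using assms
proof (induction D arbitrary: M rule: finite_induct)
  case (insert x D)
  show ?case
  proof (cases "\<forall>m\<in>M. m x = 0")
    case True
    obtain J where J: "finite J" "J \<subseteq> M" "\<forall>m\<in>M. \<exists>c. \<forall>d\<in>D. m d = (\<Sum>k\<in>J. c k * k d)"
      using insert.IH[OF insert.prems] by blast
    have "\<exists>c. \<forall>d\<in>insert x D. m d = (\<Sum>k\<in>J. c k * k d)" if m: "m \<in> M" for m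
    proof -
      obtain c where "\<forall>d\<in>D. m d = (\<Sum>k\<in>J. c k * k d)"
        using J m by blast
      moreover have "m x = 0" "(\<Sum>k\<in>J. c k * k x) = 0"
        using True J(2) m by (auto intro!: sum.neutral)
      ultimately show ?thesis
        by (intro exI[of _ c]) simp
    qed
    then show ?thesis
      using J by blast
  next
    case False
    then obtain m0 where m0: "m0 \<in> M" "m0 x \<noteq> 0"
      by blast
    define M' where "M' = {m \<in> M. m x = 0}"
    have sub': "fun_subspace M'"
      using insert.prems unfolding fun_subspace_def M'_def by auto
    obtain J where J: "finite J" "J \<subseteq> M'" "\<forall>m\<in>M'. \<exists>c. \<forall>d\<in>D. m d = (\<Sum>k\<in>J. c k * k d)"
      using insert.IH[OF sub'] by blast
    have nJ: "m0 \<notin> J"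
      using J m0 by (auto simp: M'_def)
    have "\<exists>c. \<forall>d\<in>insert x D. m d = (\<Sum>k\<in>insert m0 J. c k * k d)" if m: "m \<in> M" for m
    proof -
      define r where "r = m x / m0 x"
      have "(\<lambda>d. r * m0 d) \<in> M"
        by (rule fun_subspace_scale[OF insert.prems m0(1)])
      then have "(\<lambda>d. m d - r * m0 d) \<in> M'"
        using fun_subspace_diff[OF insert.prems m] m0 by (simp add: M'_def r_def)
      then obtain c where c: "\<forall>d\<in>D. m d - r * m0 d = (\<Sum>k\<in>J. c k * k d)"
        using bspec[OF J(3)] by auto
      have "(\<Sum>k\<in>insert m0 J. (c(m0 := r)) k * k d) = r * m0 d + (\<Sum>k\<in>J. c k * k d)" for d
      proof -
        have "(\<Sum>k\<in>J. (c(m0 := r)) k * k d) = (\<Sum>k\<in>J. c k * k d)"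
          using nJ by (intro sum.cong) auto
        then show ?thesis
          using J(1) nJ by simp
      qed
      moreover have "(\<Sum>k\<in>J. c k * k x) = 0"
        using J(2) by (intro sum.neutral) (auto simp: M'_def)
      moreover have "m x = r * m0 x"
        using m0 by (simp add: r_def)
      ultimately have "\<forall>d\<in>insert x D. m d = (\<Sum>k\<in>insert m0 J. (c(m0 := r)) k * k d)"
        using c by (simp add: algebra_simps)
      then show ?thesis
        by blast
    qed
    moreover have "insert m0 J \<subseteq> M"
      using J m0 by (auto simp: M'_def)
    ultimately show ?thesis
      using J(1) by (intro exI[of _ "insert m0 J"]) blast
  qed
qed auto

lemma orthogonal_projection:
  assumes "finite D" "fun_subspace M"
  shows "\<exists>P\<in>M. \<forall>m\<in>M. inner_on D (\<lambda>d. f d - P d) m = 0"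
proof -
  obtain J where J: "finite J" "J \<subseteq> M" "\<forall>m\<in>M. \<exists>c. \<forall>d\<in>D. m d = (\<Sum>k\<in>J. c k * k d)"
    using fun_subspace_finite_span[OF assms] by blast
  obtain c where c: "\<forall>j\<in>J. inner_on D (\<lambda>d. f d - (\<Sum>k\<in>J. c k * k d)) j = 0"
    using orthogonal_residual[OF J(1) assms(1), of f "\<lambda>k. k"] by blast
  have 1: "inner_on D (\<lambda>d. f d - (\<Sum>k\<in>J. c k * k d)) m = 0" if "m \<in> M" for m
  proof -
    from bspec[OF J(3) that] obtain c' where c': "\<forall>d\<in>D. m d = (\<Sum>k\<in>J. c' k * k d)" ..
    show ?thesis
      using c'[rule_format] c[rule_format]
      by (rule inner_on_right_comb[where g = "\<lambda>k. k" and c = c' and J = J])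
  qed
  have 2: "(\<lambda>d. \<Sum>k\<in>J. c k * k d) \<in> M"
    using J by (intro fun_subspace_sum[OF assms(2)]) auto
  show ?thesis
    by (rule bexI[OF _ 2]) (simp add: 1)
qed

lemma inner_on_member_zero:
  assumes "finite D" "m \<in> M" "\<And>d. d \<in> D \<Longrightarrow> X d = m d" "\<And>k. k \<in> M \<Longrightarrow> inner_on D X k = 0" "d \<in> D"
  shows "X d = 0"
proof -
  have "inner_on D X X = inner_on D X m"
    using assms(3) by (intro inner_on_cong) auto
  then show ?thesis
    using assms inner_on_self_zero by metis
qed

definition mat_mult :: "'i set \<Rightarrow> ('i \<times> 'i \<Rightarrow> complex) \<Rightarrow> ('i \<times> 'i \<Rightarrow> complex) \<Rightarrow> 'i \<times> 'i \<Rightarrow> complex" where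
  "mat_mult S m k = (\<lambda>(a, b). \<Sum>c\<in>S. m (a, c) * k (c, b))"

text \<open>The projection onto \<open>M\<close> commutes with left multiplications by \<open>M\<close>, so its blocks lie in the
  commutant.\<close>

theorem bicommutant:
  fixes M :: "('i \<times> 'i \<Rightarrow> complex) set"
  assumes fin: "finite S" and sub: "fun_subspace M"
    and one: "\<exists>m\<in>M. \<forall>a\<in>S. \<forall>b\<in>S. m (a, b) = of_bool (a = b)"
    and mult: "\<And>m k. m \<in> M \<Longrightarrow> k \<in> M \<Longrightarrow> \<exists>h\<in>M. \<forall>a\<in>S. \<forall>b\<in>S. h (a, b) = mat_mult S m k (a, b)"
    and adj: "\<And>m. m \<in> M \<Longrightarrow> \<exists>h\<in>M. \<forall>a\<in>S. \<forall>b\<in>S. h (a, b) = cnj (m (b, a))"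
    and comm: "\<And>T. (\<And>m a b. m \<in> M \<Longrightarrow> a \<in> S \<Longrightarrow> b \<in> S \<Longrightarrow> mat_mult S T m (a, b) = mat_mult S m T (a, b)) \<Longrightarrow>
      (\<And>a b. a \<in> S \<Longrightarrow> b \<in> S \<Longrightarrow> mat_mult S T n (a, b) = mat_mult S n T (a, b))"
  shows "\<exists>m\<in>M. \<forall>a\<in>S. \<forall>b\<in>S. m (a, b) = n (a, b)"
proof -
  let ?D = "S \<times> S"
  have finD: "finite ?D"
    using fin by simp
  \<comment> \<open>\<open>E c d\<close> is a matrix unit, \<open>P c d\<close> its projection onto
    \<open>M\<close>, and \<open>R c d\<close> the residual.\<close>
  define E where "E c d p = (of_bool (p = (c, d)) :: complex)" for c d :: 'i and p
  have "\<forall>c d. \<exists>P\<in>M. \<forall>m\<in>M. inner_on ?D (\<lambda>p. E c d p - P p) m = 0"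
    using orthogonal_projection[OF finD sub] by blast
  then obtain P where P: "\<And>c d. P c d \<in> M" "\<And>c d m. m \<in> M \<Longrightarrow> inner_on ?D (\<lambda>p. E c d p - P c d p) m = 0"
    by metis
  define R where "R c d p = E c d p - P c d p" for c d p
  have R: "inner_on ?D (R c d) m = 0" if "m \<in> M" for c d m
    using P(2)[OF that] by (simp add: R_def[abs_def])
  \<comment> \<open>The orthogonal complement of \<open>M\<close> is stable under left
    multiplication by \<open>M\<close>, since \<open>M\<close> is closed under products and
    adjoints.\<close>
  have left: "inner_on ?D (mat_mult S m (R c d)) k = 0" if m: "m \<in> M" and k: "k \<in> M" for m k c d
  proof -
    obtain m' where m': "m' \<in> M" "\<forall>a\<in>S. \<forall>b\<in>S. m' (a, b) = cnj (m (b, a))"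
      using adj[OF m] by blast
    obtain h where h: "h \<in> M" "\<forall>a\<in>S. \<forall>b\<in>S. h (a, b) = mat_mult S m' k (a, b)"
      using mult[OF m'(1) k] by blast
    have "inner_on ?D (mat_mult S m (R c d)) k =
        (\<Sum>e\<in>S. \<Sum>b\<in>S. \<Sum>a\<in>S. m (e, a) * R c d (a, b) * cnj (k (e, b)))"
      unfolding inner_on_def mat_mult_def sum.cartesian_product'
      by (intro sum.cong refl) (simp add: sum_distrib_right)
    also have "\<dots> = (\<Sum>b\<in>S. \<Sum>e\<in>S. \<Sum>a\<in>S. m (e, a) * R c d (a, b) * cnj (k (e, b)))"
      by (rule sum.swap)
    also have "\<dots> = (\<Sum>b\<in>S. \<Sum>a\<in>S. \<Sum>e\<in>S. m (e, a) * R c d (a, b) * cnj (k (e, b)))"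
      by (intro sum.cong refl sum.swap)
    also have "\<dots> = (\<Sum>b\<in>S. \<Sum>a\<in>S. R c d (a, b) * cnj (h (a, b)))"
      using h(2) m'(2) by (intro sum.cong refl) (simp add: mat_mult_def sum_distrib_left mult_ac)
    also have "\<dots> = (\<Sum>a\<in>S. \<Sum>b\<in>S. R c d (a, b) * cnj (h (a, b)))"
      by (rule sum.swap)
    also have "\<dots> = inner_on ?D (R c d) h"
      unfolding inner_on_def sum.cartesian_product' ..
    finally show ?thesis
      using R[OF h(1)] by simp
  qed
  \<comment> \<open>The projection commutes with left multiplication by \<open>m\<close>, and
    \<open>m\<close> times \<open>E c d\<close> is the sum of \<open>m (a, c)\<close> times
    \<open>E a d\<close>.\<close>
  have key: "(\<Sum>a\<in>S. m (a, c) * P a d (e, b)) = (\<Sum>a\<in>S. m (e, a) * P c d (a, b))"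
    if m: "m \<in> M" and S: "c \<in> S" "d \<in> S" "e \<in> S" "b \<in> S" for m c d e b
  proof -
    define X where "X p = (\<Sum>a\<in>S. m (a, c) * P a d p) - mat_mult S m (P c d) p" for p
    obtain h where h: "h \<in> M" "\<forall>a\<in>S. \<forall>b\<in>S. h (a, b) = mat_mult S m (P c d) (a, b)"
      using mult[OF m P(1)] by blast
    have "X (e, b) = 0"
    proof (rule inner_on_member_zero[OF finD])
      show "(\<lambda>p. (\<Sum>a\<in>S. m (a, c) * P a d p) - h p) \<in> M"
        using P(1) h by (intro fun_subspace_diff[OF sub] fun_subspace_sum[OF sub]) auto
      show "X p = (\<Sum>a\<in>S. m (a, c) * P a d p) - h p" if "p \<in> ?D" for p
        using h that by (auto simp: X_def)
      show "inner_on ?D X k = 0" if k: "k \<in> M" for k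
      proof -
        have "X p = mat_mult S m (R c d) p - (\<Sum>a\<in>S. m (a, c) * R a d p)" if p: "p \<in> ?D" for p
        proof -
          obtain e b where eb: "p = (e, b)" "e \<in> S" "b \<in> S"
            using p by auto
          have "mat_mult S m (E c d) p = (\<Sum>a\<in>S. if a = c then m (e, c) * of_bool (b = d) else 0)"
            unfolding mat_mult_def eb prod.case by (intro sum.cong refl) (auto simp: E_def)
          moreover have "(\<Sum>a\<in>S. m (a, c) * E a d p) = (\<Sum>a\<in>S. if a = e then m (e, c) * of_bool (b = d) else 0)"
            unfolding eb by (intro sum.cong refl) (auto simp: E_def)
          ultimately have "mat_mult S m (E c d) p = (\<Sum>a\<in>S. m (a, c) * E a d p)"
            using S eb fin by simp
          moreover have "mat_mult S m (R c d) p = mat_mult S m (E c d) p - mat_mult S m (P c d) p"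
            by (simp add: mat_mult_def R_def right_diff_distrib sum_subtractf eb)
          moreover have "(\<Sum>a\<in>S. m (a, c) * R a d p) = (\<Sum>a\<in>S. m (a, c) * E a d p) - (\<Sum>a\<in>S. m (a, c) * P a d p)"
            by (simp add: R_def right_diff_distrib sum_subtractf)
          ultimately show ?thesis
            by (simp add: X_def)
        qed
        then have "inner_on ?D X k = inner_on ?D (\<lambda>p. mat_mult S m (R c d) p - (\<Sum>a\<in>S. m (a, c) * R a d p)) k"
          by (intro inner_on_cong) auto
        then show ?thesis
          using left[OF m k] R[OF k] by (simp add: inner_on_diff inner_on_sum inner_on_scale)
      qed
    qed (use S in auto)
    then show ?thesis
      by (simp add: X_def mat_mult_def)
  qed
  \<comment> \<open>The identity matrix is the sum of the \<open>E c c\<close>, and it lies in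
    \<open>M\<close>, so it is its own projection.\<close>
  have one': "(\<Sum>c\<in>S. P c c (a, b)) = of_bool (a = b)" if "a \<in> S" "b \<in> S" for a b
  proof -
    obtain i where i: "i \<in> M" "\<forall>a\<in>S. \<forall>b\<in>S. i (a, b) = of_bool (a = b)"
      using one by blast
    define X where "X p = i p - (\<Sum>c\<in>S. 1 * P c c p)" for p
    have "X (a, b) = 0"
    proof (rule inner_on_member_zero[OF finD])
      show "X \<in> M"
        unfolding X_def[abs_def] using P(1) i by (intro fun_subspace_diff[OF sub] fun_subspace_sum[OF sub]) auto
      show "inner_on ?D X k = 0" if k: "k \<in> M" for k
      proof -
        have "X p = (\<Sum>c\<in>S. 1 * R c c p)" if p: "p \<in> ?D" for p
        proof -
          obtain e b where eb: "p = (e, b)" "e \<in> S" "b \<in> S"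
            using p by auto
          have "(\<Sum>c\<in>S. E c c p) = (\<Sum>c\<in>S. if c = e then of_bool (e = b) else 0)"
            unfolding eb by (intro sum.cong refl) (auto simp: E_def)
          then have "(\<Sum>c\<in>S. E c c p) = i p"
            using i eb fin by simp
          then show ?thesis
            by (simp add: X_def R_def sum_subtractf)
        qed
        then have "inner_on ?D X k = inner_on ?D (\<lambda>p. \<Sum>c\<in>S. 1 * R c c p) k"
          by (intro inner_on_cong) auto
        then show ?thesis
          unfolding inner_on_sum inner_on_scale using R[OF k] by simp
      qed
    qed (use that in auto)
    then show ?thesis
      using i that by (simp add: X_def)
  qed
  have keyn: "(\<Sum>a\<in>S. n (e, a) * P c d (a, b)) = (\<Sum>a\<in>S. n (a, c) * P a d (e, b))"
    if S: "c \<in> S" "d \<in> S" "e \<in> S" "b \<in> S" for c d e b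
  proof -
    \<comment> \<open>For fixed \<open>b\<close>, \<open>d\<close> this block of the projection
      commutes with \<open>M\<close> by \<open>key\<close>, hence with \<open>n\<close>.\<close>
    define T where "T = (\<lambda>(e, a). P a d (e, b))"
    have "mat_mult S T n (e, c) = mat_mult S n T (e, c)"
    proof (rule comm)
      fix m e c assume "m \<in> M" "e \<in> S" "c \<in> S"
      then show "mat_mult S T m (e, c) = mat_mult S m T (e, c)"
        using key[of m c d e b] S by (simp add: mat_mult_def T_def mult.commute)
    qed (use S in auto)
    then show ?thesis
      by (simp add: mat_mult_def T_def mult.commute)
  qed
  \<comment> \<open>This is the projection of \<open>n\<close> onto \<open>M\<close>; the rest shows
    that it equals \<open>n\<close>.\<close>
  define m where "m p = (\<Sum>c\<in>S. 1 * (\<Sum>a\<in>S. n (a, c) * P a c p))" for p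
  have "m \<in> M"
    unfolding m_def[abs_def] using P(1) by (intro fun_subspace_sum[OF sub]) auto
  moreover have "m (e, b) = n (e, b)" if eb: "e \<in> S" "b \<in> S" for e b
  proof -
    have "m (e, b) = (\<Sum>c\<in>S. \<Sum>a\<in>S. n (e, a) * P c c (a, b))"
      using keyn eb by (simp add: m_def)
    also have "\<dots> = (\<Sum>a\<in>S. n (e, a) * (\<Sum>c\<in>S. P c c (a, b)))"
      unfolding sum_distrib_left by (rule sum.swap)
    also have "\<dots> = (\<Sum>a\<in>S. if a = b then n (e, b) else 0)"
      using one' eb by (intro sum.cong refl) auto
    also have "\<dots> = n (e, b)"
      using eb fin by simp
    finally show ?thesis .
  qed
  ultimately show ?thesis
    by blast
qed

section \<open>Convolution and adjoint of functionals\<close>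

definition conv :: "nat \<Rightarrow> (uword \<Rightarrow> complex) \<Rightarrow> (uword \<Rightarrow> complex) \<Rightarrow> uword \<Rightarrow> complex" where
  "conv N \<phi> \<psi> w = (\<Sum>c\<in>vecs N (map snd w). \<phi> (uw (row w) c) * \<psi> (uw c (col w)))"

text \<open>On the matrix of a tensor word \<open>conv\<close> is the matrix product and
  \<open>dagger\<close> the conjugate transpose.\<close>

definition dagger :: "(uword \<Rightarrow> complex) \<Rightarrow> uword \<Rightarrow> complex" where
  "dagger \<phi> w = cnj (\<phi> (uw (col w) (row w)))"

lemma conv_uw:
  assumes "a \<in> vecs N x" "b \<in> vecs N x"
  shows "conv N \<phi> \<psi> (uw a b) = (\<Sum>c\<in>vecs N x. \<phi> (uw a c) * \<psi> (uw c b))"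
proof -
  have "map snd a = map snd b" "map snd a = x"
    using assms by (auto simp: vecs_def)
  moreover have "map snd (uw a b) = map snd (row (uw a b))"
    by (simp add: row_def)
  ultimately show ?thesis
    by (simp add: conv_def row_uw col_uw)
qed

text \<open>The values on \<open>W\<close> are entries of block matrices. A matrix commuting with
  all of those from \<open>A\<close> consists of intertwiners between the tensor words in question,
  and by \<open>intertwiner_spread\<close> these also commute with the matrix of \<psi>.\<close>

theorem functional_approximation:
  assumes N: "N \<ge> 2" and sub: "fun_subspace A"
    and conv: "\<And>\<phi> \<psi>. \<phi> \<in> A \<Longrightarrow> \<psi> \<in> A \<Longrightarrow> conv N \<phi> \<psi> \<in> A"
    and dag: "\<And>\<phi>. \<phi> \<in> A \<Longrightarrow> dagger \<phi> \<in> A"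
    and U: "\<And>g. g \<in> carrier (unitary_group N) \<Longrightarrow> ev g \<in> A"
    and F: "\<And>s t. reduced_word s \<Longrightarrow> tor s t \<in> A"
    and \<psi>: "unitary_functional N \<psi>"
    and W: "finite W" "W \<subseteq> uwords N"
  shows "\<exists>\<phi>\<in>A. \<forall>w\<in>W. \<phi> w = \<psi> w"
proof -
  define X where "X = (\<lambda>w. map snd w) ` W"
  define S where "S = (\<Union>x\<in>X. vecs N x)"
  have fin: "finite S"
    using W by (simp add: S_def X_def)
  \<comment> \<open>There is one diagonal block for each sign word of \<open>W\<close>. The
    commutant is not block diagonal: its blocks relate different tensor words.\<close>
  define mat where "mat \<phi> = (\<lambda>(a, b). if map snd a = map snd b then \<phi> (uw a b) else 0)"
    for \<phi> :: "uword \<Rightarrow> complex" and a b :: "letter list"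
  have S_iff: "a \<in> S \<longleftrightarrow> map snd a \<in> X \<and> a \<in> vecs N (map snd a)" for a
    by (auto simp: S_def vecs_def)
  have sum_S: "(\<Sum>c\<in>S. if map snd c = x then h c else 0) = (\<Sum>c\<in>vecs N x. h c)" if "x \<in> X" for x and h :: "_ \<Rightarrow> complex"
  proof -
    have "(\<Sum>c\<in>S. if map snd c = x then h c else 0) = (\<Sum>c\<in>{c\<in>S. map snd c = x}. h c)"
      using fin by (simp add: sum.inter_filter)
    also have "{c\<in>S. map snd c = x} = vecs N x"
      using that by (auto simp: S_def vecs_def)
    finally show ?thesis .
  qed
  have left: "mat_mult S (mat \<phi>) T (a, b) = (\<Sum>c\<in>vecs N (map snd a). \<phi> (uw a c) * T (c, b))" if "a \<in> S" for \<phi> T a b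
    using that sum_S[of "map snd a" "\<lambda>c. \<phi> (uw a c) * T (c, b)"]
    unfolding mat_mult_def mat_def S_iff by (simp add: if_distrib[of "\<lambda>x. x * _"] eq_commute cong: if_cong)
  have right: "mat_mult S T (mat \<phi>) (a, b) = (\<Sum>c\<in>vecs N (map snd b). T (a, c) * \<phi> (uw c b))" if "b \<in> S" for \<phi> T a b
    using that sum_S[of "map snd b" "\<lambda>c. T (a, c) * \<phi> (uw c b)"]
    unfolding mat_mult_def mat_def S_iff by (simp add: if_distrib[of "(*) _"] cong: if_cong)
  have "\<exists>m\<in>mat ` A. \<forall>a\<in>S. \<forall>b\<in>S. m (a, b) = mat \<psi> (a, b)"
  proof (rule bicommutant[OF fin])
    have add: "(\<lambda>d. mat \<phi> d + mat \<phi>' d) = mat (\<lambda>w. \<phi> w + \<phi>' w)"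
      and scale: "(\<lambda>d. c * mat \<phi> d) = mat (\<lambda>w. c * \<phi> w)" and zero: "(\<lambda>_. 0) = mat (\<lambda>_. 0)" for \<phi> \<phi>' c
      by (auto simp: mat_def fun_eq_iff)
    show "fun_subspace (mat ` A)"
      using sub unfolding fun_subspace_def add scale ball_simps
      by (auto simp: add scale zero)
    \<comment> \<open>The identity of \<open>U_N\<close> supplies the unit: evaluation there is the
      counit.\<close>
    define i where "i a b = (of_bool (a < N \<and> b < N \<and> a = b) :: complex)" for a b
    have "(\<Sum>k<N. i a k * cnj (i b k)) = (if a = b then 1 else 0)" "(\<Sum>k<N. cnj (i k a) * i k b) = (if a = b then 1 else 0)"
      if "a < N" "b < N" for a b
    proof -
      have "(\<Sum>k<N. i a k * cnj (i b k)) = (\<Sum>k<N. if k = a then of_bool (a = b) else 0)"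
        "(\<Sum>k<N. cnj (i k a) * i k b) = (\<Sum>k<N. if k = a then of_bool (a = b) else 0)"
        by (auto simp: i_def intro!: sum.cong)
      then show "(\<Sum>k<N. i a k * cnj (i b k)) = (if a = b then 1 else 0)" "(\<Sum>k<N. cnj (i k a) * i k b) = (if a = b then 1 else 0)"
        using that by auto
    qed
    then have "i \<in> carrier (unitary_group N)"
      by (auto simp: unitary_group_def i_def)
    then have "mat (ev i) \<in> mat ` A"
      using U by blast
    moreover have "mat (ev i) (a, b) = of_bool (a = b)" if "a \<in> S" "b \<in> S" for a b
    proof (cases "map snd a = map snd b")
      case True
      have "ev i (uw a b) = of_bool (map fst a = map fst b)"
        using that arg_cong[OF True, of length]
        by (intro ev_id[of _ _ N]) (auto simp: i_def S_iff vecs_def)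
      then show ?thesis
        using True by (auto simp: mat_def intro: pair_list_eqI)
    qed (auto simp: mat_def)
    ultimately show "\<exists>m\<in>mat ` A. \<forall>a\<in>S. \<forall>b\<in>S. m (a, b) = of_bool (a = b)"
      by blast
    show "\<exists>h\<in>mat ` A. \<forall>a\<in>S. \<forall>b\<in>S. h (a, b) = mat_mult S m k (a, b)" if mk: "m \<in> mat ` A" "k \<in> mat ` A" for m k
    proof -
      obtain \<phi> \<phi>' where \<phi>: "m = mat \<phi>" "k = mat \<phi>'" "\<phi> \<in> A" "\<phi>' \<in> A"
        using mk by blast
      have "mat (conv N \<phi> \<phi>') (a, b) = mat_mult S m k (a, b)" if ab: "a \<in> S" "b \<in> S" for a b
        unfolding \<phi> left[OF ab(1)] using ab
        by (auto simp: mat_def S_iff conv_uw[of a N "map snd a" b] vecs_def intro!: sum.cong sum.neutral)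
      then show ?thesis
        using conv[OF \<phi>(3,4)] by blast
    qed
    show "\<exists>h\<in>mat ` A. \<forall>a\<in>S. \<forall>b\<in>S. h (a, b) = cnj (m (b, a))" if m: "m \<in> mat ` A" for m
    proof -
      obtain \<phi> where \<phi>: "m = mat \<phi>" "\<phi> \<in> A"
        using m by blast
      have "mat (dagger \<phi>) (a, b) = cnj (m (b, a))" for a b
        by (auto simp: \<phi> mat_def dagger_def row_uw col_uw)
      then show ?thesis
        using dag[OF \<phi>(2)] by blast
    qed
    fix T a b
    assume T: "\<And>m a b. m \<in> mat ` A \<Longrightarrow> a \<in> S \<Longrightarrow> b \<in> S \<Longrightarrow> mat_mult S T m (a, b) = mat_mult S m T (a, b)"
      and ab: "a \<in> S" "b \<in> S"
    have inS: "c \<in> S" if "x \<in> X" "c \<in> vecs N x" for c x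
      using that by (auto simp: S_def)
    have "intertwines N x y (\<lambda>a b. T (a, b)) \<phi>" if \<phi>: "\<phi> \<in> A" and xy: "x \<in> X" "y \<in> X" for \<phi> x y
      unfolding intertwines_def
    proof (intro ballI)
      fix a b assume a: "a \<in> vecs N x" and b: "b \<in> vecs N y"
      have "mat_mult S T (mat \<phi>) (a, b) = mat_mult S (mat \<phi>) T (a, b)"
        using T \<phi> inS[OF xy(1) a] inS[OF xy(2) b] by blast
      moreover have "map snd a = x" "map snd b = y"
        using a b by (auto simp: vecs_def)
      ultimately show "(\<Sum>c\<in>vecs N x. \<phi> (uw a c) * T (c, b)) = (\<Sum>c\<in>vecs N y. T (a, c) * \<phi> (uw c b))"
        unfolding left[OF inS[OF xy(1) a]] right[OF inS[OF xy(2) b]] by simp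
    qed
    then have "intertwines N (map snd a) (map snd b) (\<lambda>a b. T (a, b)) \<psi>"
      using ab U F by (intro intertwiner_spread[OF N _ _ \<psi>]) (auto simp: S_iff)
    then show "mat_mult S T (mat \<psi>) (a, b) = mat_mult S (mat \<psi>) T (a, b)"
      using ab unfolding left[OF ab(1)] right[OF ab(2)] intertwines_def S_iff by simp
  qed
  then obtain \<phi> where \<phi>: "\<phi> \<in> A" "\<forall>a\<in>S. \<forall>b\<in>S. mat \<phi> (a, b) = mat \<psi> (a, b)"
    by blast
  have "\<phi> w = \<psi> w" if w: "w \<in> W" for w
  proof -
    have "row w \<in> S" "col w \<in> S"
      using row_col_vecs[of w N] w W by (auto simp: S_def X_def)
    then have "mat \<phi> (row w, col w) = mat \<psi> (row w, col w)"
      using \<phi> by blast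
    moreover have "map snd (row w) = map snd (col w)"
      by (simp add: row_def col_def)
    ultimately show ?thesis
      by (simp add: mat_def uw_row_col)
  qed
  then show ?thesis
    using \<phi>(1) by blast
qed

section \<open>Linear extension from a basis\<close>

definition lin :: "('m \<Rightarrow> complex) \<Rightarrow> ('m \<Rightarrow>\<^sub>0 complex) \<Rightarrow> complex" where
  "lin \<phi> f = (\<Sum>u\<in>Poly_Mapping.keys f. Poly_Mapping.lookup f u * \<phi> u)"

lemma lin_superset:
  assumes "finite A" "Poly_Mapping.keys f \<subseteq> A"
  shows "lin \<phi> f = (\<Sum>u\<in>A. Poly_Mapping.lookup f u * \<phi> u)"
  unfolding lin_def using assms by (intro sum.mono_neutral_left) (auto simp: in_keys_iff)

lemma lin_add [simp]: "lin \<phi> (f + g) = lin \<phi> f + lin \<phi> g"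
proof -
  let ?A = "Poly_Mapping.keys f \<union> Poly_Mapping.keys g"
  have "lin \<phi> (f + g) = (\<Sum>u\<in>?A. Poly_Mapping.lookup (f + g) u * \<phi> u)"
    by (rule lin_superset) (auto dest: subsetD[OF keys_add])
  also have "\<dots> = (\<Sum>u\<in>?A. Poly_Mapping.lookup f u * \<phi> u) + (\<Sum>u\<in>?A. Poly_Mapping.lookup g u * \<phi> u)"
    by (simp add: lookup_add distrib_right sum.distrib)
  also have "\<dots> = lin \<phi> f + lin \<phi> g"
    by (intro arg_cong2[of _ _ _ _ "(+)"] lin_superset[symmetric]) auto
  finally show ?thesis .
qed

lemma lin_zero [simp]: "lin \<phi> 0 = 0"
  by (simp add: lin_def)

lemma lin_sum: "lin \<phi> (\<Sum>i\<in>I. f i) = (\<Sum>i\<in>I. lin \<phi> (f i))"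
  by (induction I rule: infinite_finite_induct) auto

lemma lin_single [simp]: "lin \<phi> (Poly_Mapping.single u c) = c * \<phi> u"
  by (simp add: lin_def)

lemma lookup_scale [simp]:
  "Poly_Mapping.lookup (Poly_Mapping.map ((*) c) f) u = (c :: complex) * Poly_Mapping.lookup f u"
  by (simp add: map.rep_eq when_def)

lemma lin_scale [simp]: "lin \<phi> (Poly_Mapping.map ((*) c) f) = c * lin \<phi> f"
proof -
  have "lin \<phi> (Poly_Mapping.map ((*) c) f) =
      (\<Sum>u\<in>Poly_Mapping.keys f. Poly_Mapping.lookup (Poly_Mapping.map ((*) c) f) u * \<phi> u)"
    by (rule lin_superset) (auto simp: in_keys_iff)
  then show ?thesis
    by (simp add: lin_def sum_distrib_left mult.assoc)
qed

lemma lin_uminus [simp]: "lin \<phi> (- f) = - lin \<phi> f"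
  using lin_add[of \<phi> f "- f"] by (simp add: add_eq_0_iff del: lin_add)

lemma lin_diff [simp]: "lin \<phi> (f - g) = lin \<phi> f - lin \<phi> g"
  using lin_add[of \<phi> f "- g"] by (simp del: lin_add)

lemma lin_cong:
  assumes "\<And>u. u \<in> Poly_Mapping.keys f \<Longrightarrow> \<phi> u = \<psi> u"
  shows "lin \<phi> f = lin \<psi> f"
  unfolding lin_def using assms by simp

lemma lin_fun_add: "lin (\<lambda>u. \<phi> u + \<psi> u) f = lin \<phi> f + lin \<psi> f"
  by (simp add: lin_def distrib_left sum.distrib)

lemma lin_fun_scale: "lin (\<lambda>u. c * \<phi> u) f = c * lin \<phi> f"
  by (simp add: lin_def sum_distrib_left mult_ac)

lemma lin_indicator: "lin (\<lambda>u. of_bool (u = w)) f = Poly_Mapping.lookup f w"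
proof -
  have "lin (\<lambda>u. of_bool (u = w)) f = (\<Sum>u\<in>insert w (Poly_Mapping.keys f). Poly_Mapping.lookup f u * of_bool (u = w))"
    by (rule lin_superset) auto
  also have "\<dots> = (\<Sum>u\<in>insert w (Poly_Mapping.keys f). if u = w then Poly_Mapping.lookup f w else 0)"
    by (intro sum.cong) auto
  finally show ?thesis
    by simp
qed

text \<open>Elements are compared through all functionals: under \<open>lin\<close> a product
  becomes a nested evaluation, which reduces identities in the algebra to identities between basis
  elements.\<close>

lemma lin_eqI: "(\<And>\<phi>. lin \<phi> f = lin \<phi> g) \<Longrightarrow> f = g"
  by (rule poly_mapping_eqI) (simp flip: lin_indicator)

lemma lin_swap: "lin (\<lambda>u. lin (\<lambda>v. \<phi> u v) g) f = lin (\<lambda>v. lin (\<lambda>u. \<phi> u v) f) g"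
  unfolding lin_def sum_distrib_left by (subst sum.swap) (simp add: mult_ac)

lemma keys_subset_lin:
  "(\<And>\<phi>. (\<And>u. u \<in> C \<Longrightarrow> \<phi> u = 0) \<Longrightarrow> lin \<phi> f = 0) \<Longrightarrow> Poly_Mapping.keys f \<subseteq> C"
  unfolding in_keys_iff subset_iff
  by (metis (mono_tags, lifting) lin_indicator of_bool_eq(1))

section \<open>The *-algebra of a monoid\<close>

lemma monoid_star_alg_simps [simp]:
  "carrier (monoid_star_alg M \<tau>) = {f. Poly_Mapping.keys f \<subseteq> carrier M}"
  "\<one>\<^bsub>monoid_star_alg M \<tau>\<^esub> = Poly_Mapping.single \<one>\<^bsub>M\<^esub> 1"
  "\<zero>\<^bsub>monoid_star_alg M \<tau>\<^esub> = 0"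
  "f \<oplus>\<^bsub>monoid_star_alg M \<tau>\<^esub> g = f + g"
  "c \<odot>\<^bsub>monoid_star_alg M \<tau>\<^esub> f = Poly_Mapping.map ((*) c) f"
  by (simp_all add: monoid_star_alg_def)

lemma lin_mult [simp]:
  "lin \<phi> (f \<otimes>\<^bsub>monoid_star_alg M \<tau>\<^esub> g) = lin (\<lambda>u. lin (\<lambda>v. \<phi> (u \<otimes>\<^bsub>M\<^esub> v)) g) f"
  unfolding monoid_star_alg_def monoid.simps lin_sum lin_single
  unfolding lin_def sum_distrib_left by (simp add: mult_ac)

lemma lin_star [simp]:
  "lin \<phi> (star (monoid_star_alg M \<tau>) f) = cnj (lin (\<lambda>u. cnj (\<phi> (\<tau> u))) f)"
proof -
  have "star (monoid_star_alg M \<tau>) f =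
      (\<Sum>u\<in>Poly_Mapping.keys f. Poly_Mapping.single (\<tau> u) (cnj (Poly_Mapping.lookup f u)))"
    by (simp add: monoid_star_alg_def)
  then show ?thesis
    unfolding lin_def[of _ f] by (simp add: lin_sum)
qed

lemma complex_alg_cring: "cring complex_alg"
proof (rule cringI)
  show "abelian_group complex_alg"
    by (rule abelian_groupI) (auto simp: complex_alg_def intro: exI[of _ "- _"] add.left_inverse)
  show "comm_monoid complex_alg"
    by (rule comm_monoidI) (auto simp: complex_alg_def)
qed (auto simp: complex_alg_def algebra_simps)

lemma star_algebraI:
  assumes "ring A"
    and "\<And>c x. x \<in> carrier A \<Longrightarrow> c \<odot>\<^bsub>A\<^esub> x \<in> carrier A"
    and "\<And>c d x. x \<in> carrier A \<Longrightarrow> (c + d) \<odot>\<^bsub>A\<^esub> x = c \<odot>\<^bsub>A\<^esub> x \<oplus>\<^bsub>A\<^esub> d \<odot>\<^bsub>A\<^esub> x"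
    and "\<And>c x y. x \<in> carrier A \<Longrightarrow> y \<in> carrier A \<Longrightarrow> c \<odot>\<^bsub>A\<^esub> (x \<oplus>\<^bsub>A\<^esub> y) = c \<odot>\<^bsub>A\<^esub> x \<oplus>\<^bsub>A\<^esub> c \<odot>\<^bsub>A\<^esub> y"
    and "\<And>c d x. x \<in> carrier A \<Longrightarrow> (c * d) \<odot>\<^bsub>A\<^esub> x = c \<odot>\<^bsub>A\<^esub> (d \<odot>\<^bsub>A\<^esub> x)"
    and "\<And>x. x \<in> carrier A \<Longrightarrow> 1 \<odot>\<^bsub>A\<^esub> x = x"
    and "\<And>c x y. x \<in> carrier A \<Longrightarrow> y \<in> carrier A \<Longrightarrow> (c \<odot>\<^bsub>A\<^esub> x) \<otimes>\<^bsub>A\<^esub> y = c \<odot>\<^bsub>A\<^esub> (x \<otimes>\<^bsub>A\<^esub> y)"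
    and "\<And>c x y. x \<in> carrier A \<Longrightarrow> y \<in> carrier A \<Longrightarrow> x \<otimes>\<^bsub>A\<^esub> (c \<odot>\<^bsub>A\<^esub> y) = c \<odot>\<^bsub>A\<^esub> (x \<otimes>\<^bsub>A\<^esub> y)"
    and "\<And>x. x \<in> carrier A \<Longrightarrow> star A x \<in> carrier A"
    and "\<And>x. x \<in> carrier A \<Longrightarrow> star A (star A x) = x"
    and "\<And>c x. x \<in> carrier A \<Longrightarrow> star A (c \<odot>\<^bsub>A\<^esub> x) = cnj c \<odot>\<^bsub>A\<^esub> star A x"
    and "\<And>x y. x \<in> carrier A \<Longrightarrow> y \<in> carrier A \<Longrightarrow> star A (x \<oplus>\<^bsub>A\<^esub> y) = star A x \<oplus>\<^bsub>A\<^esub> star A y"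
    and "\<And>x y. x \<in> carrier A \<Longrightarrow> y \<in> carrier A \<Longrightarrow> star A (x \<otimes>\<^bsub>A\<^esub> y) = star A y \<otimes>\<^bsub>A\<^esub> star A x"
  shows "star_algebra A"
proof -
  interpret ring A by fact
  have "module complex_alg A"
    by (rule moduleI[OF complex_alg_cring abelian_group_axioms])
      (use assms in \<open>auto simp: complex_alg_def\<close>)
  then show ?thesis
    using assms unfolding star_algebra_def by auto
qed

lemma star_algebraD:
  assumes "star_algebra A"
  shows "ring A"
    "\<And>c x. x \<in> carrier A \<Longrightarrow> c \<odot>\<^bsub>A\<^esub> x \<in> carrier A"
    "\<And>c d x. x \<in> carrier A \<Longrightarrow> (c + d) \<odot>\<^bsub>A\<^esub> x = c \<odot>\<^bsub>A\<^esub> x \<oplus>\<^bsub>A\<^esub> d \<odot>\<^bsub>A\<^esub> x"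
    "\<And>c x y. x \<in> carrier A \<Longrightarrow> y \<in> carrier A \<Longrightarrow> c \<odot>\<^bsub>A\<^esub> (x \<oplus>\<^bsub>A\<^esub> y) = c \<odot>\<^bsub>A\<^esub> x \<oplus>\<^bsub>A\<^esub> c \<odot>\<^bsub>A\<^esub> y"
    "\<And>c d x. x \<in> carrier A \<Longrightarrow> (c * d) \<odot>\<^bsub>A\<^esub> x = c \<odot>\<^bsub>A\<^esub> (d \<odot>\<^bsub>A\<^esub> x)"
    "\<And>x. x \<in> carrier A \<Longrightarrow> 1 \<odot>\<^bsub>A\<^esub> x = x"
    "\<And>c x y. x \<in> carrier A \<Longrightarrow> y \<in> carrier A \<Longrightarrow> (c \<odot>\<^bsub>A\<^esub> x) \<otimes>\<^bsub>A\<^esub> y = c \<odot>\<^bsub>A\<^esub> (x \<otimes>\<^bsub>A\<^esub> y)"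
    "\<And>c x y. x \<in> carrier A \<Longrightarrow> y \<in> carrier A \<Longrightarrow> x \<otimes>\<^bsub>A\<^esub> (c \<odot>\<^bsub>A\<^esub> y) = c \<odot>\<^bsub>A\<^esub> (x \<otimes>\<^bsub>A\<^esub> y)"
    "\<And>x. x \<in> carrier A \<Longrightarrow> star A x \<in> carrier A"
    "\<And>x. x \<in> carrier A \<Longrightarrow> star A (star A x) = x"
    "\<And>c x. x \<in> carrier A \<Longrightarrow> star A (c \<odot>\<^bsub>A\<^esub> x) = cnj c \<odot>\<^bsub>A\<^esub> star A x"
    "\<And>x y. x \<in> carrier A \<Longrightarrow> y \<in> carrier A \<Longrightarrow> star A (x \<oplus>\<^bsub>A\<^esub> y) = star A x \<oplus>\<^bsub>A\<^esub> star A y"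
    "\<And>x y. x \<in> carrier A \<Longrightarrow> y \<in> carrier A \<Longrightarrow> star A (x \<otimes>\<^bsub>A\<^esub> y) = star A y \<otimes>\<^bsub>A\<^esub> star A x"
proof -
  have "module complex_alg A"
    using assms by (simp add: star_algebra_def)
  then interpret module complex_alg A .
  show "\<And>c x. x \<in> carrier A \<Longrightarrow> c \<odot>\<^bsub>A\<^esub> x \<in> carrier A"
    using smult_closed by (simp add: complex_alg_def)
  show "\<And>c d x. x \<in> carrier A \<Longrightarrow> (c + d) \<odot>\<^bsub>A\<^esub> x = c \<odot>\<^bsub>A\<^esub> x \<oplus>\<^bsub>A\<^esub> d \<odot>\<^bsub>A\<^esub> x"
    using smult_l_distr by (simp add: complex_alg_def)
  show "\<And>c x y. x \<in> carrier A \<Longrightarrow> y \<in> carrier A \<Longrightarrow> c \<odot>\<^bsub>A\<^esub> (x \<oplus>\<^bsub>A\<^esub> y) = c \<odot>\<^bsub>A\<^esub> x \<oplus>\<^bsub>A\<^esub> c \<odot>\<^bsub>A\<^esub> y"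
    using smult_r_distr by (simp add: complex_alg_def)
  show "\<And>c d x. x \<in> carrier A \<Longrightarrow> (c * d) \<odot>\<^bsub>A\<^esub> x = c \<odot>\<^bsub>A\<^esub> (d \<odot>\<^bsub>A\<^esub> x)"
    using smult_assoc1 by (simp add: complex_alg_def)
  show "\<And>x. x \<in> carrier A \<Longrightarrow> 1 \<odot>\<^bsub>A\<^esub> x = x"
    using smult_one by (simp add: complex_alg_def)
qed (use assms in \<open>auto simp: star_algebra_def Pi_iff\<close>)

text \<open>The axioms are tested by \<open>lin_eqI\<close>; closure of the carrier is tested by
  \<open>keys_subset_lin\<close>, that is, by functions that vanish on the monoid.\<close>

theorem star_algebra_monoid_star_alg:
  assumes M: "monoid M" and \<tau>: "\<And>u. u \<in> carrier M \<Longrightarrow> \<tau> u \<in> carrier M"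
    "\<And>u. u \<in> carrier M \<Longrightarrow> \<tau> (\<tau> u) = u"
    "\<And>u v. u \<in> carrier M \<Longrightarrow> v \<in> carrier M \<Longrightarrow> \<tau> (u \<otimes>\<^bsub>M\<^esub> v) = \<tau> v \<otimes>\<^bsub>M\<^esub> \<tau> u"
  shows "star_algebra (monoid_star_alg M \<tau>)"
proof -
  let ?A = "monoid_star_alg M \<tau>"
  interpret M: monoid M by fact
  have cong: "lin \<phi> f = lin \<psi> f" if "f \<in> carrier ?A" "\<And>u. u \<in> carrier M \<Longrightarrow> \<phi> u = \<psi> u" for \<phi> \<psi> f
    using that by (intro lin_cong) auto
  have zero: "lin \<phi> f = 0" if "f \<in> carrier ?A" "\<And>u. u \<in> carrier M \<Longrightarrow> \<phi> u = 0" for \<phi> f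
    using that unfolding lin_def by (intro sum.neutral) auto
  have mult_closed: "f \<otimes>\<^bsub>?A\<^esub> g \<in> carrier ?A" if "f \<in> carrier ?A" "g \<in> carrier ?A" for f g
  proof -
    have "Poly_Mapping.keys (f \<otimes>\<^bsub>?A\<^esub> g) \<subseteq> carrier M"
    proof (rule keys_subset_lin)
      fix \<phi> :: "_ \<Rightarrow> complex" assume "\<And>u. u \<in> carrier M \<Longrightarrow> \<phi> u = 0"
      then show "lin \<phi> (f \<otimes>\<^bsub>?A\<^esub> g) = 0"
        unfolding lin_mult using that by (intro zero) auto
    qed
    then show ?thesis
      by simp
  qed
  have star_closed: "star ?A f \<in> carrier ?A" if "f \<in> carrier ?A" for f
  proof -
    have "Poly_Mapping.keys (star ?A f) \<subseteq> carrier M"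
    proof (rule keys_subset_lin)
      fix \<phi> :: "_ \<Rightarrow> complex" assume "\<And>u. u \<in> carrier M \<Longrightarrow> \<phi> u = 0"
      then have "lin (\<lambda>u. cnj (\<phi> (\<tau> u))) f = 0"
        using that \<tau> by (intro zero) auto
      then show "lin \<phi> (star ?A f) = 0"
        by simp
    qed
    then show ?thesis
      by simp
  qed
  have add_closed: "f + g \<in> carrier ?A" if "f \<in> carrier ?A" "g \<in> carrier ?A" for f g
    using that keys_add[of f g] by auto
  have scale_closed: "Poly_Mapping.map ((*) c) f \<in> carrier ?A" if "f \<in> carrier ?A" for f c
    using that by (auto simp: in_keys_iff)
  have "ring ?A"
  proof (rule ringI)
    show "abelian_group ?A"
    proof (rule abelian_groupI)
      fix f assume "f \<in> carrier ?A"
      then show "\<exists>g\<in>carrier ?A. g \<oplus>\<^bsub>?A\<^esub> f = \<zero>\<^bsub>?A\<^esub>"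
        by (intro bexI[of _ "- f"]) (auto simp: in_keys_iff)
    qed (use add_closed in \<open>auto simp: add_ac\<close>)
    show "monoid ?A"
    proof (rule monoidI)
      fix f g h assume "f \<in> carrier ?A" "g \<in> carrier ?A" "h \<in> carrier ?A"
      then show "f \<otimes>\<^bsub>?A\<^esub> g \<otimes>\<^bsub>?A\<^esub> h = f \<otimes>\<^bsub>?A\<^esub> (g \<otimes>\<^bsub>?A\<^esub> h)"
        by (intro lin_eqI) (auto simp: M.m_assoc intro!: cong)
    next
      fix f assume "f \<in> carrier ?A"
      then show "\<one>\<^bsub>?A\<^esub> \<otimes>\<^bsub>?A\<^esub> f = f" "f \<otimes>\<^bsub>?A\<^esub> \<one>\<^bsub>?A\<^esub> = f"
        by (intro lin_eqI; auto intro!: cong)+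
    qed (use mult_closed in auto)
  qed (auto intro!: lin_eqI simp: lin_fun_add)
  then show ?thesis
  proof (rule star_algebraI)
    fix f assume f: "f \<in> carrier ?A"
    show "star ?A (star ?A f) = f"
      using f \<tau> by (intro lin_eqI) (auto intro!: cong)
    show "star ?A f \<in> carrier ?A"
      using f by (rule star_closed)
    fix g assume "g \<in> carrier ?A"
    with f show "star ?A (f \<otimes>\<^bsub>?A\<^esub> g) = star ?A g \<otimes>\<^bsub>?A\<^esub> star ?A f"
      by (intro lin_eqI) (auto simp: \<tau> lin_swap[of _ g f] intro!: cong)
  qed (use scale_closed in \<open>auto intro!: lin_eqI simp: lin_fun_scale algebra_simps\<close>)
qed

section \<open>Quotients by *-ideals\<close>

lemma star_quot_simps [simp]:
  "carrier (star_quot A I) = a_rcosets\<^bsub>A\<^esub> I"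
  "mult (star_quot A I) = rcoset_mult A I"
  "\<one>\<^bsub>star_quot A I\<^esub> = I +>\<^bsub>A\<^esub> \<one>\<^bsub>A\<^esub>"
  "\<zero>\<^bsub>star_quot A I\<^esub> = I"
  "add (star_quot A I) = set_add A"
  by (simp_all add: star_quot_def FactRing_def)

text \<open>Transport between records of different types that share their operations, such as the
  quotient ring and the *-algebra built on it.\<close>

lemma ring_cong:
  assumes "ring R" "carrier S = carrier R" "mult S = mult R" "one S = one R" "add S = add R" "zero S = zero R"
  shows "ring S"
proof -
  interpret ring R by fact
  show ?thesis
  proof (rule ringI)
    show "abelian_group S"
    proof (rule abelian_groupI)
      fix x assume "x \<in> carrier S"
      then show "\<exists>y\<in>carrier S. y \<oplus>\<^bsub>S\<^esub> x = \<zero>\<^bsub>S\<^esub>"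
        using l_neg by (intro bexI[of _ "\<ominus>\<^bsub>R\<^esub> x"]) (simp_all add: assms)
    next
      fix x y assume "x \<in> carrier S" "y \<in> carrier S"
      then show "x \<oplus>\<^bsub>S\<^esub> y = y \<oplus>\<^bsub>S\<^esub> x"
        by (simp add: assms a_comm)
    qed (simp_all add: assms a_assoc)
    show "monoid S"
      by (rule monoidI) (simp_all add: assms m_assoc)
  qed (simp_all add: assms l_distr r_distr)
qed

lemma ring_star_quot:
  assumes "ideal I A"
  shows "ring (star_quot A I)"
  by (rule ring_cong[OF ideal.quotient_is_ring[OF assms]]) (auto simp: FactRing_def)

context
  fixes A :: "('a, 'r) star_alg_scheme" and I
  assumes A: "star_algebra A" and I: "ideal I A" and star_I: "\<forall>x\<in>I. star A x \<in> I"
begin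

interpretation ideal I A by (rule I)

lemma ideal_scale: "x \<in> I \<Longrightarrow> c \<odot>\<^bsub>A\<^esub> x \<in> I"
proof -
  assume x: "x \<in> I"
  then have "(c \<odot>\<^bsub>A\<^esub> \<one>\<^bsub>A\<^esub>) \<otimes>\<^bsub>A\<^esub> x \<in> I"
    using star_algebraD(2)[OF A] by (intro I_l_closed) auto
  then show ?thesis
    using x Icarr star_algebraD(7)[OF A] by simp
qed

text \<open>Scalar multiplication preserves the ideal, so the union over representatives in
  \<open>star_quot\<close> is one coset repeated.\<close>

lemma coset_smult:
  assumes x: "x \<in> carrier A"
  shows "c \<odot>\<^bsub>star_quot A I\<^esub> (I +>\<^bsub>A\<^esub> x) = I +>\<^bsub>A\<^esub> (c \<odot>\<^bsub>A\<^esub> x)"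
proof -
  have "I +>\<^bsub>A\<^esub> (c \<odot>\<^bsub>A\<^esub> y) = I +>\<^bsub>A\<^esub> (c \<odot>\<^bsub>A\<^esub> x)" if y: "y \<in> I +>\<^bsub>A\<^esub> x" for y
  proof -
    obtain i where i: "i \<in> I" "y = i \<oplus>\<^bsub>A\<^esub> x"
      using y unfolding a_r_coset_def' by blast
    have "c \<odot>\<^bsub>A\<^esub> y = c \<odot>\<^bsub>A\<^esub> i \<oplus>\<^bsub>A\<^esub> c \<odot>\<^bsub>A\<^esub> x"
      using i x Icarr star_algebraD(4)[OF A] by simp
    then have "c \<odot>\<^bsub>A\<^esub> y \<in> I +>\<^bsub>A\<^esub> (c \<odot>\<^bsub>A\<^esub> x)"
      using ideal_scale[OF i(1)] unfolding a_r_coset_def' by blast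
    then show ?thesis
      using a_repr_independence[OF _ _ a_subgroup] star_algebraD(2)[OF A] x by metis
  qed
  then have "(\<Union>y\<in>I +>\<^bsub>A\<^esub> x. I +>\<^bsub>A\<^esub> (c \<odot>\<^bsub>A\<^esub> y)) = I +>\<^bsub>A\<^esub> (c \<odot>\<^bsub>A\<^esub> x)"
    by (intro UN_constant_eq[OF a_rcos_self[OF x]]) blast
  then show ?thesis
    by (simp add: star_quot_def)
qed

lemma coset_star:
  assumes x: "x \<in> carrier A"
  shows "star (star_quot A I) (I +>\<^bsub>A\<^esub> x) = I +>\<^bsub>A\<^esub> star A x"
proof -
  have "I +>\<^bsub>A\<^esub> star A y = I +>\<^bsub>A\<^esub> star A x" if y: "y \<in> I +>\<^bsub>A\<^esub> x" for y
  proof -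
    obtain i where i: "i \<in> I" "y = i \<oplus>\<^bsub>A\<^esub> x"
      using y unfolding a_r_coset_def' by blast
    have "star A y = star A i \<oplus>\<^bsub>A\<^esub> star A x"
      using i x Icarr star_algebraD(12)[OF A] by simp
    then have "star A y \<in> I +>\<^bsub>A\<^esub> star A x"
      using bspec[OF star_I i(1)] unfolding a_r_coset_def' by blast
    then show ?thesis
      using a_repr_independence[OF _ _ a_subgroup] star_algebraD(9)[OF A] x by metis
  qed
  then have "(\<Union>y\<in>I +>\<^bsub>A\<^esub> x. I +>\<^bsub>A\<^esub> star A y) = I +>\<^bsub>A\<^esub> star A x"
    by (intro UN_constant_eq[OF a_rcos_self[OF x]]) blast
  then show ?thesis
    by (simp add: star_quot_def)
qed

lemma coset_add: "x \<in> carrier A \<Longrightarrow> y \<in> carrier A \<Longrightarrow>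
    (I +>\<^bsub>A\<^esub> x) \<oplus>\<^bsub>star_quot A I\<^esub> (I +>\<^bsub>A\<^esub> y) = I +>\<^bsub>A\<^esub> (x \<oplus>\<^bsub>A\<^esub> y)"
  by (simp add: a_rcos_sum)

lemma coset_mult: "x \<in> carrier A \<Longrightarrow> y \<in> carrier A \<Longrightarrow>
    (I +>\<^bsub>A\<^esub> x) \<otimes>\<^bsub>star_quot A I\<^esub> (I +>\<^bsub>A\<^esub> y) = I +>\<^bsub>A\<^esub> (x \<otimes>\<^bsub>A\<^esub> y)"
  by (simp add: rcoset_mult_add)

lemma coset_carrier: "x \<in> carrier A \<Longrightarrow> I +>\<^bsub>A\<^esub> x \<in> carrier (star_quot A I)"
  by (simp add: a_rcosetsI a_subset)

lemma coset_carrierE: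
  assumes "X \<in> carrier (star_quot A I)"
  obtains x where "x \<in> carrier A" "X = I +>\<^bsub>A\<^esub> x"
  using assms by (auto simp: A_RCOSETS_def')

theorem star_algebra_star_quot: "star_algebra (star_quot A I)"
proof (rule star_algebraI[OF ring_star_quot[OF I]])
  note D = star_algebraD[OF A]
  fix X assume "X \<in> carrier (star_quot A I)"
  then obtain x where x: "x \<in> carrier A" and X: "X = I +>\<^bsub>A\<^esub> x"
    by (rule coset_carrierE)
  note S = coset_smult coset_star coset_add coset_mult coset_carrier
  show "c \<odot>\<^bsub>star_quot A I\<^esub> X \<in> carrier (star_quot A I)"
    "(c + d) \<odot>\<^bsub>star_quot A I\<^esub> X = c \<odot>\<^bsub>star_quot A I\<^esub> X \<oplus>\<^bsub>star_quot A I\<^esub> d \<odot>\<^bsub>star_quot A I\<^esub> X"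
    "(c * d) \<odot>\<^bsub>star_quot A I\<^esub> X = c \<odot>\<^bsub>star_quot A I\<^esub> (d \<odot>\<^bsub>star_quot A I\<^esub> X)"
    "1 \<odot>\<^bsub>star_quot A I\<^esub> X = X"
    "star (star_quot A I) X \<in> carrier (star_quot A I)"
    "star (star_quot A I) (star (star_quot A I) X) = X"
    "star (star_quot A I) (c \<odot>\<^bsub>star_quot A I\<^esub> X) = cnj c \<odot>\<^bsub>star_quot A I\<^esub> star (star_quot A I) X" for c d
    unfolding X using x by (simp_all add: S D del: star_quot_simps)
  fix Y assume "Y \<in> carrier (star_quot A I)"
  then obtain y where y: "y \<in> carrier A" and Y: "Y = I +>\<^bsub>A\<^esub> y"
    by (rule coset_carrierE)
  show "c \<odot>\<^bsub>star_quot A I\<^esub> (X \<oplus>\<^bsub>star_quot A I\<^esub> Y) = c \<odot>\<^bsub>star_quot A I\<^esub> X \<oplus>\<^bsub>star_quot A I\<^esub> c \<odot>\<^bsub>star_quot A I\<^esub> Y"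
    "(c \<odot>\<^bsub>star_quot A I\<^esub> X) \<otimes>\<^bsub>star_quot A I\<^esub> Y = c \<odot>\<^bsub>star_quot A I\<^esub> (X \<otimes>\<^bsub>star_quot A I\<^esub> Y)"
    "X \<otimes>\<^bsub>star_quot A I\<^esub> (c \<odot>\<^bsub>star_quot A I\<^esub> Y) = c \<odot>\<^bsub>star_quot A I\<^esub> (X \<otimes>\<^bsub>star_quot A I\<^esub> Y)"
    "star (star_quot A I) (X \<oplus>\<^bsub>star_quot A I\<^esub> Y) = star (star_quot A I) X \<oplus>\<^bsub>star_quot A I\<^esub> star (star_quot A I) Y"
    "star (star_quot A I) (X \<otimes>\<^bsub>star_quot A I\<^esub> Y) = star (star_quot A I) Y \<otimes>\<^bsub>star_quot A I\<^esub> star (star_quot A I) X" for c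
    unfolding X Y using x y by (simp_all add: S D del: star_quot_simps)
qed

end

text \<open>The elements whose adjoint lies in the generated ideal form an ideal themselves, and
  this ideal contains the generators.\<close>

lemma star_stable_genideal:
  assumes A: "star_algebra A" and G: "G \<subseteq> carrier A" and star_G: "\<And>x. x \<in> G \<Longrightarrow> star A x \<in> G"
    and x: "x \<in> Idl\<^bsub>A\<^esub> G"
  shows "star A x \<in> Idl\<^bsub>A\<^esub> G"
proof -
  note D = star_algebraD[OF A]
  interpret ring A by (rule D(1))
  interpret J: ideal "Idl\<^bsub>A\<^esub> G" A
    by (rule genideal_ideal[OF G])
  have zero: "star A \<zero>\<^bsub>A\<^esub> = \<zero>\<^bsub>A\<^esub>"
    using D(12)[of "\<zero>\<^bsub>A\<^esub>" "\<zero>\<^bsub>A\<^esub>"] D(9)[of "\<zero>\<^bsub>A\<^esub>"] by simp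
  have neg: "star A (\<ominus>\<^bsub>A\<^esub> y) = \<ominus>\<^bsub>A\<^esub> star A y" if "y \<in> carrier A" for y
    using D(12)[of "\<ominus>\<^bsub>A\<^esub> y" y] D(9) that zero
    by (metis a_inv_closed l_neg minus_equality)
  let ?L = "{y \<in> carrier A. star A y \<in> Idl\<^bsub>A\<^esub> G}"
  have "ideal ?L A"
  proof (rule idealI[OF D(1)])
    show "subgroup ?L (add_monoid A)"
      by (rule subgroup.intro) (auto simp: D zero neg simp flip: a_inv_def)
    show "y \<otimes>\<^bsub>A\<^esub> z \<in> ?L" "z \<otimes>\<^bsub>A\<^esub> y \<in> ?L" if "z \<in> ?L" "y \<in> carrier A" for y z
      using that by (auto simp: D J.I_l_closed J.I_r_closed)
  qed
  moreover have "G \<subseteq> ?L"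
    using G star_G genideal_self[OF G] by auto
  ultimately have "Idl\<^bsub>A\<^esub> G \<subseteq> ?L"
    by (rule genideal_minimal)
  then show ?thesis
    using x by blast
qed

section \<open>Linear functionals and bilinear forms\<close>

definition linear_functional :: "('a, 'r) star_alg_scheme \<Rightarrow> ('a \<Rightarrow> complex) \<Rightarrow> bool" where
  "linear_functional A \<theta> \<longleftrightarrow>
    (\<forall>x\<in>carrier A. \<forall>y\<in>carrier A. \<theta> (x \<oplus>\<^bsub>A\<^esub> y) = \<theta> x + \<theta> y) \<and>
    (\<forall>c. \<forall>x\<in>carrier A. \<theta> (c \<odot>\<^bsub>A\<^esub> x) = c * \<theta> x)"

definition bilinear_form ::
  "('a, 'r) star_alg_scheme \<Rightarrow> ('b, 's) star_alg_scheme \<Rightarrow> ('a \<Rightarrow> 'b \<Rightarrow> complex) \<Rightarrow> bool" where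
  "bilinear_form A B \<beta> \<longleftrightarrow> (\<forall>b\<in>carrier B. linear_functional A (\<lambda>a. \<beta> a b)) \<and>
    (\<forall>a\<in>carrier A. linear_functional B (\<beta> a))"

lemma linear_functional_zero:
  assumes "linear_functional A \<theta>" "\<zero>\<^bsub>A\<^esub> \<in> carrier A" "\<zero>\<^bsub>A\<^esub> \<oplus>\<^bsub>A\<^esub> \<zero>\<^bsub>A\<^esub> = \<zero>\<^bsub>A\<^esub>"
  shows "\<theta> \<zero>\<^bsub>A\<^esub> = 0"
proof -
  have "\<theta> (\<zero>\<^bsub>A\<^esub> \<oplus>\<^bsub>A\<^esub> \<zero>\<^bsub>A\<^esub>) = \<theta> \<zero>\<^bsub>A\<^esub> + \<theta> \<zero>\<^bsub>A\<^esub>"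
    using assms(1,2) unfolding linear_functional_def by blast
  then show ?thesis
    using assms(3) by simp
qed

lemma linear_functional_finsum:
  assumes A: "abelian_monoid A" and \<theta>: "linear_functional A \<theta>"
    and "finite S" "\<And>i. i \<in> S \<Longrightarrow> f i \<in> carrier A"
  shows "(\<Oplus>\<^bsub>A\<^esub>i\<in>S. f i) \<in> carrier A \<and> \<theta> (\<Oplus>\<^bsub>A\<^esub>i\<in>S. f i) = (\<Sum>i\<in>S. \<theta> (f i))"
proof -
  interpret abelian_monoid A by fact
  show ?thesis
    using assms(3,4)
  proof (induction S rule: finite_induct)
    case empty
    show ?case
      using linear_functional_zero[OF \<theta>] by simp
  next
    case (insert i S)
    have fi: "f i \<in> carrier A" "f \<in> S \<rightarrow> carrier A"
      using insert.prems by auto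
    have "(\<Oplus>\<^bsub>A\<^esub>j\<in>insert i S. f j) = f i \<oplus>\<^bsub>A\<^esub> (\<Oplus>\<^bsub>A\<^esub>j\<in>S. f j)"
      using insert.hyps fi by (intro finsum_insert) auto
    then show ?case
      using insert fi \<theta> by (simp add: linear_functional_def)
  qed
qed

lemma linear_functional_mult:
  assumes A: "star_algebra A" and \<theta>: "linear_functional A \<theta>" and y: "y \<in> carrier A"
  shows "linear_functional A (\<lambda>x. \<theta> (x \<otimes>\<^bsub>A\<^esub> y))" "linear_functional A (\<lambda>x. \<theta> (y \<otimes>\<^bsub>A\<^esub> x))"
proof -
  interpret ring A by (rule star_algebraD(1)[OF A])
  show "linear_functional A (\<lambda>x. \<theta> (x \<otimes>\<^bsub>A\<^esub> y))" "linear_functional A (\<lambda>x. \<theta> (y \<otimes>\<^bsub>A\<^esub> x))"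
    using \<theta> y unfolding linear_functional_def by (auto simp: l_distr r_distr star_algebraD[OF A])
qed

lemma bilinear_formD:
  assumes "bilinear_form A B \<beta>"
  shows "a \<in> carrier A \<Longrightarrow> a' \<in> carrier A \<Longrightarrow> b \<in> carrier B \<Longrightarrow> \<beta> (a \<oplus>\<^bsub>A\<^esub> a') b = \<beta> a b + \<beta> a' b"
    "a \<in> carrier A \<Longrightarrow> b \<in> carrier B \<Longrightarrow> b' \<in> carrier B \<Longrightarrow> \<beta> a (b \<oplus>\<^bsub>B\<^esub> b') = \<beta> a b + \<beta> a b'"
    "a \<in> carrier A \<Longrightarrow> b \<in> carrier B \<Longrightarrow> \<beta> (c \<odot>\<^bsub>A\<^esub> a) b = c * \<beta> a b"
    "a \<in> carrier A \<Longrightarrow> b \<in> carrier B \<Longrightarrow> \<beta> a (c \<odot>\<^bsub>B\<^esub> b) = c * \<beta> a b"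
  using assms unfolding bilinear_form_def linear_functional_def by auto

lemma bilinear_formI:
  assumes "\<And>a a' b. a \<in> carrier A \<Longrightarrow> a' \<in> carrier A \<Longrightarrow> b \<in> carrier B \<Longrightarrow> \<beta> (a \<oplus>\<^bsub>A\<^esub> a') b = \<beta> a b + \<beta> a' b"
    "\<And>a b b'. a \<in> carrier A \<Longrightarrow> b \<in> carrier B \<Longrightarrow> b' \<in> carrier B \<Longrightarrow> \<beta> a (b \<oplus>\<^bsub>B\<^esub> b') = \<beta> a b + \<beta> a b'"
    "\<And>a b c. a \<in> carrier A \<Longrightarrow> b \<in> carrier B \<Longrightarrow> \<beta> (c \<odot>\<^bsub>A\<^esub> a) b = c * \<beta> a b"
    "\<And>a b c. a \<in> carrier A \<Longrightarrow> b \<in> carrier B \<Longrightarrow> \<beta> a (c \<odot>\<^bsub>B\<^esub> b) = c * \<beta> a b"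
  shows "bilinear_form A B \<beta>"
  using assms unfolding bilinear_form_def linear_functional_def by auto

section \<open>The tensor product, tested by bilinear forms\<close>

lemma pair_alg_simps [simp]:
  "carrier (pair_alg A B) = {f. Poly_Mapping.keys f \<subseteq> carrier A \<times> carrier B}"
  "\<zero>\<^bsub>pair_alg A B\<^esub> = 0" "f \<oplus>\<^bsub>pair_alg A B\<^esub> g = f + g"
  "c \<odot>\<^bsub>pair_alg A B\<^esub> f = Poly_Mapping.map ((*) c) f"
  by (simp_all add: pair_alg_def)

lemma lin_pair_mult [simp]:
  "lin \<phi> (f \<otimes>\<^bsub>pair_alg A B\<^esub> g) =
    lin (\<lambda>p. lin (\<lambda>q. \<phi> (fst p \<otimes>\<^bsub>A\<^esub> fst q, snd p \<otimes>\<^bsub>B\<^esub> snd q)) g) f"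
  by (simp add: pair_alg_def DirProd_def case_prod_beta)

lemma lin_pair_star [simp]:
  "lin \<phi> (star (pair_alg A B) f) = cnj (lin (\<lambda>p. cnj (\<phi> (star A (fst p), star B (snd p)))) f)"
  by (simp add: pair_alg_def map_prod_def case_prod_beta)

context
  fixes A :: "('a, 'r) star_alg_scheme" and B :: "('b, 's) star_alg_scheme"
  assumes A: "star_algebra A" and B: "star_algebra B"
begin

interpretation A: ring A by (rule star_algebraD(1)[OF A])
interpretation B: ring B by (rule star_algebraD(1)[OF B])

lemma star_algebra_pair_alg: "star_algebra (pair_alg A B)"
  unfolding pair_alg_def
proof (rule star_algebra_monoid_star_alg)
  show "monoid (A \<times>\<times> B)"
    by (rule DirProd_monoid) (rule A.monoid_axioms B.monoid_axioms)+
qed (auto simp: star_algebraD[OF A] star_algebraD[OF B])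

lemma bilinear_relations_carrier: "bilinear_relations A B \<subseteq> carrier (pair_alg A B)"
  unfolding bilinear_relations_def
  by (auto simp: star_algebraD(2)[OF A] star_algebraD(2)[OF B]
      dest!: subsetD[OF keys_diff] split: if_splits)

lemma bilinear_relations_star:
  assumes "f \<in> bilinear_relations A B"
  shows "star (pair_alg A B) f \<in> bilinear_relations A B"
proof -
  note D = star_algebraD[OF A] star_algebraD[OF B]
  have single: "star (pair_alg A B) (Poly_Mapping.single (a, b) c) =
      Poly_Mapping.single (star A a, star B b) (cnj c)" for a b c
    by (rule lin_eqI) simp
  have diff: "star (pair_alg A B) (f - g) = star (pair_alg A B) f - star (pair_alg A B) g" for f g
    by (rule lin_eqI) simp
  consider (1) a a' b where "f = Poly_Mapping.single (a \<oplus>\<^bsub>A\<^esub> a', b) 1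
       - Poly_Mapping.single (a, b) 1 - Poly_Mapping.single (a', b) 1"
       "a \<in> carrier A" "a' \<in> carrier A" "b \<in> carrier B"
    | (2) a b b' where "f = Poly_Mapping.single (a, b \<oplus>\<^bsub>B\<^esub> b') 1
       - Poly_Mapping.single (a, b) 1 - Poly_Mapping.single (a, b') 1"
       "a \<in> carrier A" "b \<in> carrier B" "b' \<in> carrier B"
    | (3) c a b where "f = Poly_Mapping.single (c \<odot>\<^bsub>A\<^esub> a, b) 1 - Poly_Mapping.single (a, b) c"
       "a \<in> carrier A" "b \<in> carrier B"
    | (4) c a b where "f = Poly_Mapping.single (a, c \<odot>\<^bsub>B\<^esub> b) 1 - Poly_Mapping.single (a, b) c"
       "a \<in> carrier A" "b \<in> carrier B"
    using assms unfolding bilinear_relations_def by blast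
  then show ?thesis
  proof cases
    case 1
    have "star (pair_alg A B) f = Poly_Mapping.single (star A a \<oplus>\<^bsub>A\<^esub> star A a', star B b) 1
       - Poly_Mapping.single (star A a, star B b) 1 - Poly_Mapping.single (star A a', star B b) 1"
      using 1 by (simp add: single diff D)
    moreover have "star A a \<in> carrier A" "star A a' \<in> carrier A" "star B b \<in> carrier B"
      using 1 by (simp_all add: D)
    ultimately show ?thesis
      unfolding bilinear_relations_def by blast
  next
    case 2
    have "star (pair_alg A B) f = Poly_Mapping.single (star A a, star B b \<oplus>\<^bsub>B\<^esub> star B b') 1
       - Poly_Mapping.single (star A a, star B b) 1 - Poly_Mapping.single (star A a, star B b') 1"
      using 2 by (simp add: single diff D)
    moreover have "star A a \<in> carrier A" "star B b' \<in> carrier B" "star B b \<in> carrier B"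
      using 2 by (simp_all add: D)
    ultimately show ?thesis
      unfolding bilinear_relations_def by blast
  next
    case 3
    have "star (pair_alg A B) f = Poly_Mapping.single (cnj c \<odot>\<^bsub>A\<^esub> star A a, star B b) 1
       - Poly_Mapping.single (star A a, star B b) (cnj c)"
      using 3 by (simp add: single diff D)
    moreover have "star A a \<in> carrier A" "star B b \<in> carrier B"
      using 3 by (simp_all add: D)
    ultimately show ?thesis
      unfolding bilinear_relations_def by blast
  next
    case 4
    have "star (pair_alg A B) f = Poly_Mapping.single (star A a, cnj c \<odot>\<^bsub>B\<^esub> star B b) 1
       - Poly_Mapping.single (star A a, star B b) (cnj c)"
      using 4 by (simp add: single diff D)
    moreover have "star A a \<in> carrier A" "star B b \<in> carrier B"
      using 4 by (simp_all add: D)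
    ultimately show ?thesis
      unfolding bilinear_relations_def by blast
  qed
qed

lemma ideal_tensor_null: "ideal (tensor_null A B) (pair_alg A B)"
  unfolding tensor_null_def
  by (rule ring.genideal_ideal[OF star_algebraD(1)[OF star_algebra_pair_alg] bilinear_relations_carrier])

lemma tensor_null_star: "\<forall>f\<in>tensor_null A B. star (pair_alg A B) f \<in> tensor_null A B"
  unfolding tensor_null_def
  by (intro ballI star_stable_genideal[OF star_algebra_pair_alg bilinear_relations_carrier bilinear_relations_star])

lemma star_algebra_tensor_alg: "star_algebra (tensor_alg A B)"
  unfolding tensor_alg_def
  by (rule star_algebra_star_quot[OF star_algebra_pair_alg ideal_tensor_null tensor_null_star])

lemma bilinear_form_mult:
  assumes "bilinear_form A B \<beta>" "a \<in> carrier A" "b \<in> carrier B"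
  shows "bilinear_form A B (\<lambda>x y. \<beta> (a \<otimes>\<^bsub>A\<^esub> x) (b \<otimes>\<^bsub>B\<^esub> y))"
    "bilinear_form A B (\<lambda>x y. \<beta> (x \<otimes>\<^bsub>A\<^esub> a) (y \<otimes>\<^bsub>B\<^esub> b))"
  by (rule bilinear_formI;
      simp add: assms(2,3) A.r_distr B.r_distr A.l_distr B.l_distr bilinear_formD[OF assms(1)]
        star_algebraD[OF A] star_algebraD[OF B])+

text \<open>The elements killed by all bilinear forms form an ideal, since multiplication by a basis
  element turns a bilinear form into another one.\<close>

lemma tensor_null_vanish:
  assumes f: "f \<in> tensor_null A B" and \<beta>: "bilinear_form A B \<beta>"
  shows "lin (\<lambda>p. \<beta> (fst p) (snd p)) f = 0"
proof -
  let ?P = "pair_alg A B"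
  interpret P: ring ?P by (rule star_algebraD(1)[OF star_algebra_pair_alg])
  let ?J = "{f \<in> carrier ?P. \<forall>\<beta>. bilinear_form A B \<beta> \<longrightarrow> lin (\<lambda>p. \<beta> (fst p) (snd p)) f = 0}"
  have vanish: "lin (\<lambda>p. lin (\<lambda>q. h p q) g) f = 0"
    if "f \<in> carrier ?P" "\<And>p. p \<in> carrier A \<times> carrier B \<Longrightarrow> lin (h p) g = 0" for f g h
  proof -
    have "lin (\<lambda>p. lin (\<lambda>q. h p q) g) f = lin (\<lambda>p. 0) f"
      using that by (intro lin_cong) auto
    then show ?thesis
      by (simp add: lin_def)
  qed
  have "ideal ?J ?P"
  proof (rule idealI[OF P.ring_axioms])
    show "subgroup ?J (add_monoid ?P)"
    proof (rule P.add.subgroupI)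
      show "\<ominus>\<^bsub>?P\<^esub> f \<in> ?J" if f: "f \<in> ?J" for f
      proof -
        have "\<ominus>\<^bsub>?P\<^esub> f = - f"
          using f by (intro P.minus_equality) (auto simp: in_keys_iff)
        then show ?thesis
          using f by (auto simp: in_keys_iff)
      qed
      show "f \<oplus>\<^bsub>?P\<^esub> g \<in> ?J" if "f \<in> ?J" "g \<in> ?J" for f g
        using that P.a_closed[of f g] by simp
    qed (auto intro!: exI[of _ 0])
    fix f g assume f: "f \<in> ?J" and g: "g \<in> carrier ?P"
    have "lin (\<lambda>p. \<beta> (fst p) (snd p)) (g \<otimes>\<^bsub>?P\<^esub> f) = 0" if \<beta>: "bilinear_form A B \<beta>" for \<beta>
      unfolding lin_pair_mult fst_conv snd_conv
    proof (rule vanish[OF g])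
      fix p assume "p \<in> carrier A \<times> carrier B"
      then show "lin (\<lambda>q. \<beta> (fst p \<otimes>\<^bsub>A\<^esub> fst q) (snd p \<otimes>\<^bsub>B\<^esub> snd q)) f = 0"
        using f bilinear_form_mult(1)[OF \<beta>, of "fst p" "snd p"] by auto
    qed
    then show "g \<otimes>\<^bsub>?P\<^esub> f \<in> ?J"
      using f g P.m_closed[of g f] by simp
    have "lin (\<lambda>p. \<beta> (fst p) (snd p)) (f \<otimes>\<^bsub>?P\<^esub> g) = 0" if \<beta>: "bilinear_form A B \<beta>" for \<beta>
      unfolding lin_pair_mult fst_conv snd_conv lin_swap[of _ g f]
    proof (rule vanish[OF g])
      fix p assume "p \<in> carrier A \<times> carrier B"
      then show "lin (\<lambda>q. \<beta> (fst q \<otimes>\<^bsub>A\<^esub> fst p) (snd q \<otimes>\<^bsub>B\<^esub> snd p)) f = 0"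
        using f bilinear_form_mult(2)[OF \<beta>, of "fst p" "snd p"] by auto
    qed
    then show "f \<otimes>\<^bsub>?P\<^esub> g \<in> ?J"
      using f g P.m_closed[of f g] by simp
  qed
  moreover have "bilinear_relations A B \<subseteq> ?J"
  proof
    fix f assume f: "f \<in> bilinear_relations A B"
    have "lin (\<lambda>p. \<beta> (fst p) (snd p)) f = 0" if "bilinear_form A B \<beta>" for \<beta>
      using f unfolding bilinear_relations_def by (auto simp: bilinear_formD[OF that])
    then show "f \<in> ?J"
      using f bilinear_relations_carrier by blast
  qed
  ultimately have "tensor_null A B \<subseteq> ?J"
    unfolding tensor_null_def by (rule P.genideal_minimal)
  then show ?thesis
    using f \<beta> by blast
qed

text \<open>The scalar counterpart of \<open>tensor_lift\<close>, with the same choice of a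
  representative; \<open>tfun_coset\<close> removes the choice for bilinear forms.\<close>

definition tfun :: "('a \<Rightarrow> 'b \<Rightarrow> complex) \<Rightarrow> ('a, 'b) tensor \<Rightarrow> complex" where
  "tfun \<beta> X = lin (\<lambda>p. \<beta> (fst p) (snd p)) (SOME f. f \<in> X)"

lemma tensor_carrierE:
  assumes "X \<in> carrier (tensor_alg A B)"
  obtains f where "f \<in> carrier (pair_alg A B)" "X = tensor_null A B +>\<^bsub>pair_alg A B\<^esub> f"
  using coset_carrierE[OF star_algebra_pair_alg ideal_tensor_null tensor_null_star] assms
  unfolding tensor_alg_def by blast

lemma tensor_some:
  assumes "X \<in> carrier (tensor_alg A B)"
  shows "(SOME f. f \<in> X) \<in> X" "(SOME f. f \<in> X) \<in> carrier (pair_alg A B)"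
proof -
  interpret ideal "tensor_null A B" "pair_alg A B" by (rule ideal_tensor_null)
  obtain f where f: "f \<in> carrier (pair_alg A B)" "X = tensor_null A B +>\<^bsub>pair_alg A B\<^esub> f"
    using assms by (rule tensor_carrierE)
  have "f \<in> X"
    using a_rcos_self f by simp
  then show "(SOME f. f \<in> X) \<in> X"
    by (rule someI)
  moreover have "X \<subseteq> carrier (pair_alg A B)"
    using a_r_coset_subset_G[OF a_subset f(1)] f(2) by simp
  ultimately show "(SOME f. f \<in> X) \<in> carrier (pair_alg A B)"
    by blast
qed

lemma tfun_coset:
  assumes \<beta>: "bilinear_form A B \<beta>" and f: "f \<in> carrier (pair_alg A B)"
  shows "tfun \<beta> (tensor_null A B +>\<^bsub>pair_alg A B\<^esub> f) = lin (\<lambda>p. \<beta> (fst p) (snd p)) f"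
proof -
  let ?X = "tensor_null A B +>\<^bsub>pair_alg A B\<^esub> f"
  have "?X \<in> carrier (tensor_alg A B)"
    unfolding tensor_alg_def using coset_carrier[OF star_algebra_pair_alg ideal_tensor_null tensor_null_star f] .
  then have "(SOME f. f \<in> ?X) \<in> ?X"
    by (rule tensor_some)
  then obtain n where "n \<in> tensor_null A B" "(SOME f. f \<in> ?X) = n + f"
    unfolding a_r_coset_def' by auto
  then show ?thesis
    unfolding tfun_def using tensor_null_vanish[OF _ \<beta>] by simp
qed

lemma tens_carrier:
  assumes "a \<in> carrier A" "b \<in> carrier B"
  shows "tens A B a b \<in> carrier (tensor_alg A B)"
  unfolding tens_def tensor_alg_def
  using assms by (intro coset_carrier[OF star_algebra_pair_alg ideal_tensor_null tensor_null_star]) auto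

lemma tfun_tens:
  assumes "bilinear_form A B \<beta>" "a \<in> carrier A" "b \<in> carrier B"
  shows "tfun \<beta> (tens A B a b) = \<beta> a b"
  unfolding tens_def using assms by (subst tfun_coset) auto

lemma linear_functional_tfun:
  assumes \<beta>: "bilinear_form A B \<beta>"
  shows "linear_functional (tensor_alg A B) (tfun \<beta>)"
  unfolding linear_functional_def
proof (intro conjI ballI allI)
  note C = star_algebra_pair_alg ideal_tensor_null tensor_null_star
  have P: "ring (pair_alg A B)"
    by (rule star_algebraD(1)[OF star_algebra_pair_alg])
  fix X assume "X \<in> carrier (tensor_alg A B)"
  then obtain f where f: "f \<in> carrier (pair_alg A B)" "X = tensor_null A B +>\<^bsub>pair_alg A B\<^esub> f"
    by (rule tensor_carrierE)
  have scale: "Poly_Mapping.map ((*) c) f \<in> carrier (pair_alg A B)" for c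
    using star_algebraD(2)[OF star_algebra_pair_alg f(1), of c] by simp
  show "tfun \<beta> (c \<odot>\<^bsub>tensor_alg A B\<^esub> X) = c * tfun \<beta> X" for c
    unfolding f(2) tensor_alg_def coset_smult[OF C f(1)] tfun_coset[OF \<beta> f(1)]
    using tfun_coset[OF \<beta> scale[of c]] by simp
  fix Y assume "Y \<in> carrier (tensor_alg A B)"
  then obtain g where g: "g \<in> carrier (pair_alg A B)" "Y = tensor_null A B +>\<^bsub>pair_alg A B\<^esub> g"
    by (rule tensor_carrierE)
  have add: "f + g \<in> carrier (pair_alg A B)"
    using ring.ring_simprules(1)[OF P f(1) g(1)] by simp
  show "tfun \<beta> (X \<oplus>\<^bsub>tensor_alg A B\<^esub> Y) = tfun \<beta> X + tfun \<beta> Y"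
    unfolding f(2) g(2) tensor_alg_def coset_add[OF C f(1) g(1)] tfun_coset[OF \<beta> f(1)] tfun_coset[OF \<beta> g(1)]
    using tfun_coset[OF \<beta> add] by simp
qed

lemma tfun_cong:
  assumes "X \<in> carrier (tensor_alg A B)"
    "\<And>a b. a \<in> carrier A \<Longrightarrow> b \<in> carrier B \<Longrightarrow> \<beta> a b = \<gamma> a b"
  shows "tfun \<beta> X = tfun \<gamma> X"
  unfolding tfun_def using assms tensor_some(2)[OF assms(1)] by (intro lin_cong) auto

lemma tfun_mult_tens:
  assumes \<beta>: "bilinear_form A B \<beta>" and "a \<in> carrier A" "b \<in> carrier B" and Y: "Y \<in> carrier (tensor_alg A B)"
  shows "tfun \<beta> (tens A B a b \<otimes>\<^bsub>tensor_alg A B\<^esub> Y) = tfun (\<lambda>c d. \<beta> (a \<otimes>\<^bsub>A\<^esub> c) (b \<otimes>\<^bsub>B\<^esub> d)) Y"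
proof -
  note C = star_algebra_pair_alg ideal_tensor_null tensor_null_star
  have P: "ring (pair_alg A B)"
    by (rule star_algebraD(1)[OF star_algebra_pair_alg])
  obtain g where g: "g \<in> carrier (pair_alg A B)" "Y = tensor_null A B +>\<^bsub>pair_alg A B\<^esub> g"
    using Y by (rule tensor_carrierE)
  have f: "Poly_Mapping.single (a, b) 1 \<in> carrier (pair_alg A B)"
    using assms by simp
  have \<beta>': "bilinear_form A B (\<lambda>c d. \<beta> (a \<otimes>\<^bsub>A\<^esub> c) (b \<otimes>\<^bsub>B\<^esub> d))"
    using assms by (intro bilinear_form_mult)
  show ?thesis
    unfolding tens_def g(2) tensor_alg_def coset_mult[OF C f g(1)] tfun_coset[OF \<beta>' g(1)]
    using tfun_coset[OF \<beta> ring.ring_simprules(5)[OF P f g(1)]] by simp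
qed

lemma star_tens:
  assumes "a \<in> carrier A" "b \<in> carrier B"
  shows "star (tensor_alg A B) (tens A B a b) = tens A B (star A a) (star B b)"
proof -
  note C = star_algebra_pair_alg ideal_tensor_null tensor_null_star
  have "star (pair_alg A B) (Poly_Mapping.single (a, b) 1) = Poly_Mapping.single (star A a, star B b) 1"
    by (rule lin_eqI) simp
  moreover have f: "Poly_Mapping.single (a, b) 1 \<in> carrier (pair_alg A B)"
    using assms by simp
  ultimately show ?thesis
    unfolding tens_def tensor_alg_def using coset_star[OF C f] by simp
qed

text \<open>Both sides evaluate the same representative, so the equation can be used before the
  choice is known to be immaterial.\<close>

lemma tensor_lift_functional:
  assumes C: "abelian_monoid C" "\<And>c x. x \<in> carrier C \<Longrightarrow> c \<odot>\<^bsub>C\<^esub> x \<in> carrier C"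
    and \<theta>: "linear_functional C \<theta>" and X: "X \<in> carrier (tensor_alg A B)"
    and \<phi>: "\<And>a b. a \<in> carrier A \<Longrightarrow> b \<in> carrier B \<Longrightarrow> \<phi> a b \<in> carrier C"
  shows "\<theta> (tensor_lift C \<phi> X) = tfun (\<lambda>a b. \<theta> (\<phi> a b)) X"
proof -
  define f where "f = (SOME f. f \<in> X)"
  have f: "Poly_Mapping.keys f \<subseteq> carrier A \<times> carrier B"
    using tensor_some(2)[OF X] by (simp add: f_def)
  have "\<theta> (tensor_lift C \<phi> X) =
      \<theta> (\<Oplus>\<^bsub>C\<^esub>p\<in>Poly_Mapping.keys f. Poly_Mapping.lookup f p \<odot>\<^bsub>C\<^esub> \<phi> (fst p) (snd p))"
    by (simp add: tensor_lift_def f_def Let_def)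
  also have "\<dots> = (\<Sum>p\<in>Poly_Mapping.keys f. \<theta> (Poly_Mapping.lookup f p \<odot>\<^bsub>C\<^esub> \<phi> (fst p) (snd p)))"
    using f by (intro conjunct2[OF linear_functional_finsum[OF C(1) \<theta>]] C(2) \<phi>) auto
  also have "\<dots> = (\<Sum>p\<in>Poly_Mapping.keys f. Poly_Mapping.lookup f p * \<theta> (\<phi> (fst p) (snd p)))"
    using \<theta> \<phi> f unfolding linear_functional_def by (intro sum.cong refl) auto
  finally show ?thesis
    by (simp add: tfun_def lin_def f_def)
qed

end

section \<open>The free *-algebra and the ideal of the unitarity relations\<close>

lemma star_algebra_free: "star_algebra (free_star_alg X)"
  unfolding free_star_alg_def
proof (rule star_algebra_monoid_star_alg)
  show "monoid \<lparr>carrier = lists (X \<times> UNIV), mult = (@), one = []\<rparr>"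
    by (rule monoidI) auto
qed (auto simp: rev_map comp_def apsnd_def map_prod_def case_prod_beta in_lists_conv_set mem_Times_iff)

lemma free_star_alg_simps [simp]:
  "carrier (free_star_alg ({..<N} \<times> {..<N})) = {f. Poly_Mapping.keys f \<subseteq> uwords N}"
  "\<one>\<^bsub>free_star_alg X\<^esub> = Poly_Mapping.single [] 1"
  "\<zero>\<^bsub>free_star_alg X\<^esub> = 0"
  "f \<oplus>\<^bsub>free_star_alg X\<^esub> g = f + g"
  "c \<odot>\<^bsub>free_star_alg X\<^esub> f = Poly_Mapping.map ((*) c) f"
  by (simp_all add: free_star_alg_def uwords_def)

lemma lin_free_mult [simp]:
  "lin \<phi> (f \<otimes>\<^bsub>free_star_alg X\<^esub> g) = lin (\<lambda>u. lin (\<lambda>v. \<phi> (u @ v)) g) f"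
  by (simp add: free_star_alg_def)

lemma lin_free_star [simp]:
  fixes f :: "uword \<Rightarrow>\<^sub>0 complex"
  shows "lin \<phi> (star (free_star_alg X) f) = cnj (lin (\<lambda>u. cnj (\<phi> (adj u))) f)"
  by (simp add: free_star_alg_def adj_def)

abbreviation free_alg :: "nat \<Rightarrow> (uword \<Rightarrow>\<^sub>0 complex) star_alg" where
  "free_alg N \<equiv> free_star_alg ({..<N} \<times> {..<N})"

abbreviation rel_ideal :: "nat \<Rightarrow> (uword \<Rightarrow>\<^sub>0 complex) set" where
  "rel_ideal N \<equiv> relation_ideal ({..<N} \<times> {..<N}) (free_unitary_relations N)"

text \<open>With both values of \<open>e\<close>, row and column relations comprise all four
  families in \<open>free_unitary_relations\<close>.\<close>

definition row_relation :: "nat \<Rightarrow> bool \<Rightarrow> nat \<Rightarrow> nat \<Rightarrow> uword \<Rightarrow>\<^sub>0 complex" where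
  "row_relation N e i j = (\<Sum>k<N. Poly_Mapping.single [((i, k), e), ((j, k), \<not> e)] 1) -
    Poly_Mapping.single [] (if i = j then 1 else 0)"

definition col_relation :: "nat \<Rightarrow> bool \<Rightarrow> nat \<Rightarrow> nat \<Rightarrow> uword \<Rightarrow>\<^sub>0 complex" where
  "col_relation N e i j = (\<Sum>k<N. Poly_Mapping.single [((k, i), e), ((k, j), \<not> e)] 1) -
    Poly_Mapping.single [] (if i = j then 1 else 0)"

lemma free_unitary_relations_eq:
  "free_unitary_relations N =
    {row_relation N e i j | e i j. i < N \<and> j < N} \<union> {col_relation N e i j | e i j. i < N \<and> j < N}"
proof -
  have "{r e i j | e i j. i < N \<and> j < N} =
      {r False i j | i j. i < N \<and> j < N} \<union> {r True i j | i j. i < N \<and> j < N}" for r :: "bool \<Rightarrow> nat \<Rightarrow> nat \<Rightarrow> uword \<Rightarrow>\<^sub>0 complex"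
    by (auto; metis (full_types))
  then show ?thesis
    by (simp add: free_unitary_relations_def Let_def row_relation_def col_relation_def Un_ac)
qed

lemma lin_relations:
  "lin \<phi> (row_relation N e i j) = (\<Sum>k<N. \<phi> [((i, k), e), ((j, k), \<not> e)]) - (if i = j then \<phi> [] else 0)"
  "lin \<phi> (col_relation N e i j) = (\<Sum>k<N. \<phi> [((k, i), e), ((k, j), \<not> e)]) - (if i = j then \<phi> [] else 0)"
  by (auto simp: row_relation_def col_relation_def lin_sum)

lemma star_relations:
  "star (free_star_alg X) (row_relation N e i j) = row_relation N e j i"
  "star (free_star_alg X) (col_relation N e i j) = col_relation N e j i"
  by (rule lin_eqI; auto simp: lin_relations)+

text \<open>The star exchanges \<open>i\<close> and \<open>j\<close> in a relation. Hence the
  *-ideal of the presentation is just the ideal generated by the relations.\<close>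

lemma star_free_unitary_relations:
  "star (free_star_alg X) ` free_unitary_relations N = free_unitary_relations N"
proof -
  have "star (free_star_alg X) f \<in> free_unitary_relations N" if "f \<in> free_unitary_relations N" for f
    using that unfolding free_unitary_relations_eq by (auto simp: star_relations)
  moreover have "\<exists>g\<in>free_unitary_relations N. f = star (free_star_alg X) g"
    if f: "f \<in> free_unitary_relations N" for f
  proof -
    obtain e i j where "i < N" "j < N" "f = row_relation N e i j \<or> f = col_relation N e i j"
      using f unfolding free_unitary_relations_eq by blast
    then show ?thesis
      unfolding free_unitary_relations_eq
      by (intro bexI[of _ "if f = row_relation N e i j then row_relation N e j i else col_relation N e j i"])
        (auto simp: star_relations)
  qed
  ultimately show ?thesis
    by blast
qed

lemma rel_ideal_eq: "rel_ideal N = Idl\<^bsub>free_alg N\<^esub> (free_unitary_relations N)"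
  by (simp add: relation_ideal_def star_free_unitary_relations)

lemma relations_carrier: "free_unitary_relations N \<subseteq> carrier (free_alg N)"
proof
  fix f assume "f \<in> free_unitary_relations N"
  then obtain e i j where ij: "i < N" "j < N" "f = row_relation N e i j \<or> f = col_relation N e i j"
    unfolding free_unitary_relations_eq by blast
  have "Poly_Mapping.keys f \<subseteq> uwords N"
    by (rule keys_subset_lin) (use ij in \<open>auto simp: lin_relations\<close>)
  then show "f \<in> carrier (free_alg N)"
    by simp
qed

lemma ideal_rel: "ideal (rel_ideal N) (free_alg N)"
  unfolding rel_ideal_eq
  by (rule ring.genideal_ideal[OF star_algebraD(1)[OF star_algebra_free] relations_carrier])

lemma rel_star: "\<forall>f\<in>rel_ideal N. star (free_alg N) f \<in> rel_ideal N"
  unfolding rel_ideal_eq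
  using star_stable_genideal[OF star_algebra_free relations_carrier] star_free_unitary_relations by blast

lemma rel_carrier: "f \<in> rel_ideal N \<Longrightarrow> f \<in> carrier (free_alg N)"
  using ideal.Icarr[OF ideal_rel] .

text \<open>The elements killed by \<phi> in every context form an ideal, because multiplication by
  a word only enlarges the context, and this ideal contains the relations.\<close>

lemma unitary_functional_vanish:
  assumes \<phi>: "unitary_functional N \<phi>" and f: "f \<in> rel_ideal N"
  shows "lin \<phi> f = 0"
proof -
  let ?F = "free_alg N"
  interpret F: ring ?F by (rule star_algebraD(1)[OF star_algebra_free])
  let ?J = "{f \<in> carrier ?F. \<forall>v\<in>uwords N. \<forall>w\<in>uwords N. lin (\<lambda>u. \<phi> (v @ u @ w)) f = 0}"
  have vanish: "lin (\<lambda>p. lin (\<lambda>q. h p q) g) f = 0"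
    if "f \<in> carrier ?F" "\<And>p. p \<in> uwords N \<Longrightarrow> lin (h p) g = 0" for f g h
  proof -
    have "lin (\<lambda>p. lin (\<lambda>q. h p q) g) f = lin (\<lambda>p. 0) f"
      using that by (intro lin_cong) auto
    then show ?thesis
      by (simp add: lin_def)
  qed
  have "ideal ?J ?F"
  proof (rule idealI[OF F.ring_axioms])
    show "subgroup ?J (add_monoid ?F)"
    proof (rule F.add.subgroupI)
      show "\<ominus>\<^bsub>?F\<^esub> f \<in> ?J" if f: "f \<in> ?J" for f
      proof -
        have "\<ominus>\<^bsub>?F\<^esub> f = - f"
          using f by (intro F.minus_equality) (auto simp: in_keys_iff)
        then show ?thesis
          using f by (auto simp: in_keys_iff)
      qed
      show "f \<oplus>\<^bsub>?F\<^esub> g \<in> ?J" if "f \<in> ?J" "g \<in> ?J" for f g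
        using that F.a_closed[of f g] by simp
    qed (auto intro!: exI[of _ 0])
    fix f g assume f: "f \<in> ?J" and g: "g \<in> carrier ?F"
    have "lin (\<lambda>u. \<phi> (v @ u @ w)) (g \<otimes>\<^bsub>?F\<^esub> f) = 0" if vw: "v \<in> uwords N" "w \<in> uwords N" for v w
      unfolding lin_free_mult
    proof (rule vanish[OF g])
      fix p assume "p \<in> uwords N"
      then have "lin (\<lambda>q. \<phi> ((v @ p) @ q @ w)) f = 0"
        using f vw by (simp del: append_assoc)
      then show "lin (\<lambda>q. \<phi> (v @ (p @ q) @ w)) f = 0"
        by simp
    qed
    then show "g \<otimes>\<^bsub>?F\<^esub> f \<in> ?J"
      using f g F.m_closed[of g f] by simp
    have "lin (\<lambda>u. \<phi> (v @ u @ w)) (f \<otimes>\<^bsub>?F\<^esub> g) = 0" if vw: "v \<in> uwords N" "w \<in> uwords N" for v w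
      unfolding lin_free_mult lin_swap[of _ g f]
    proof (rule vanish[OF g])
      fix p assume "p \<in> uwords N"
      then have "lin (\<lambda>q. \<phi> (v @ q @ (p @ w))) f = 0"
        using f vw by simp
      then show "lin (\<lambda>q. \<phi> (v @ (q @ p) @ w)) f = 0"
        by simp
    qed
    then show "f \<otimes>\<^bsub>?F\<^esub> g \<in> ?J"
      using f g F.m_closed[of f g] by simp
  qed
  moreover have "free_unitary_relations N \<subseteq> ?J"
  proof
    fix f assume f: "f \<in> free_unitary_relations N"
    then obtain e i j where ij: "i < N" "j < N" "f = row_relation N e i j \<or> f = col_relation N e i j"
      unfolding free_unitary_relations_eq by blast
    have "lin (\<lambda>u. \<phi> (v @ u @ w)) f = 0" if "v \<in> uwords N" "w \<in> uwords N" for v w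
      using ij(3) unitary_functionalD[OF \<phi> that ij(1,2), of e] by (auto simp: lin_relations)
    then show "f \<in> ?J"
      using f relations_carrier by blast
  qed
  ultimately have "rel_ideal N \<subseteq> ?J"
    unfolding rel_ideal_eq by (rule F.genideal_minimal)
  then have "lin (\<lambda>u. \<phi> ([] @ u @ [])) f = 0"
    using f uwords_simps(1) by blast
  then show ?thesis
    by simp
qed

text \<open>A relation multiplied by words on both sides stays in the ideal, so vanishing there
  gives the relations in every context.\<close>

lemma vanish_unitary_functional:
  assumes "\<And>f. f \<in> rel_ideal N \<Longrightarrow> lin \<phi> f = 0"
  shows "unitary_functional N \<phi>"
proof -
  interpret ideal "rel_ideal N" "free_alg N" by (rule ideal_rel)
  have ctx: "lin (\<lambda>u. \<phi> (v @ u @ w)) r = 0"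
    if "v \<in> uwords N" "w \<in> uwords N" "r \<in> free_unitary_relations N" for v w r
  proof -
    have "r \<in> rel_ideal N"
      using that genideal_self[OF relations_carrier] unfolding rel_ideal_eq by blast
    then have "Poly_Mapping.single v 1 \<otimes>\<^bsub>free_alg N\<^esub> (r \<otimes>\<^bsub>free_alg N\<^esub> Poly_Mapping.single w 1) \<in> rel_ideal N"
      using that by (intro I_l_closed I_r_closed) auto
    from assms[OF this] show ?thesis
      by simp
  qed
  have r: "row_relation N e i j \<in> free_unitary_relations N" "col_relation N e i j \<in> free_unitary_relations N"
    if "i < N" "j < N" for e i j
    using that unfolding free_unitary_relations_eq by blast+
  show ?thesis
    unfolding unitary_functional_def
  proof (intro ballI allI impI)
    fix v w i j e assume *: "v \<in> uwords N" "w \<in> uwords N" "i < N" "j < N"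
    show "(\<Sum>k<N. \<phi> (v @ [((i, k), e), ((j, k), \<not> e)] @ w)) = (if i = j then \<phi> (v @ w) else 0) \<and>
      (\<Sum>k<N. \<phi> (v @ [((k, i), e), ((k, j), \<not> e)] @ w)) = (if i = j then \<phi> (v @ w) else 0)"
      using ctx[OF *(1,2) r(1)[OF *(3,4)], of e] ctx[OF *(1,2) r(2)[OF *(3,4)], of e]
      by (simp add: lin_relations)
  qed
qed

section \<open>Classes of words and functionals on the presented algebra\<close>

definition cls :: "nat \<Rightarrow> (uword \<Rightarrow>\<^sub>0 complex) \<Rightarrow> uplus_elem" where
  "cls N f = rel_ideal N +>\<^bsub>free_alg N\<^esub> f"

abbreviation wcls :: "nat \<Rightarrow> uword \<Rightarrow> uplus_elem" where
  "wcls N w \<equiv> cls N (Poly_Mapping.single w 1)"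

lemma free_unitary_star_alg_eq: "free_unitary_star_alg N = star_quot (free_alg N) (rel_ideal N)"
  by (simp add: free_unitary_star_alg_def presented_star_alg_def)

lemma star_algebra_free_unitary_star_alg: "star_algebra (free_unitary_star_alg N)"
  unfolding free_unitary_star_alg_eq
  by (rule star_algebra_star_quot[OF star_algebra_free ideal_rel rel_star])

lemma cls_carrier: "f \<in> carrier (free_alg N) \<Longrightarrow> cls N f \<in> carrier (free_unitary_star_alg N)"
  unfolding cls_def free_unitary_star_alg_eq by (rule coset_carrier[OF star_algebra_free ideal_rel rel_star])

lemma wcls_carrier: "w \<in> uwords N \<Longrightarrow> wcls N w \<in> carrier (free_unitary_star_alg N)"
  by (rule cls_carrier) simp

lemma cls_carrierE:
  assumes "x \<in> carrier (free_unitary_star_alg N)"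
  obtains f where "f \<in> carrier (free_alg N)" "x = cls N f"
  using coset_carrierE[OF star_algebra_free ideal_rel rel_star] assms
  unfolding cls_def free_unitary_star_alg_eq by blast

lemma cls_add: "f \<in> carrier (free_alg N) \<Longrightarrow> g \<in> carrier (free_alg N) \<Longrightarrow>
    cls N f \<oplus>\<^bsub>free_unitary_star_alg N\<^esub> cls N g = cls N (f + g)"
  using coset_add[OF star_algebra_free ideal_rel rel_star, of f N g]
  unfolding cls_def free_unitary_star_alg_eq by simp

lemma cls_mult: "f \<in> carrier (free_alg N) \<Longrightarrow> g \<in> carrier (free_alg N) \<Longrightarrow>
    cls N f \<otimes>\<^bsub>free_unitary_star_alg N\<^esub> cls N g = cls N (f \<otimes>\<^bsub>free_alg N\<^esub> g)"
  using coset_mult[OF star_algebra_free ideal_rel rel_star, of f N g]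
  unfolding cls_def free_unitary_star_alg_eq by simp

lemma cls_smult: "f \<in> carrier (free_alg N) \<Longrightarrow>
    c \<odot>\<^bsub>free_unitary_star_alg N\<^esub> cls N f = cls N (Poly_Mapping.map ((*) c) f)"
  using coset_smult[OF star_algebra_free ideal_rel rel_star, of f N c]
  unfolding cls_def free_unitary_star_alg_eq by simp

lemma cls_star: "f \<in> carrier (free_alg N) \<Longrightarrow>
    star (free_unitary_star_alg N) (cls N f) = cls N (star (free_alg N) f)"
  using coset_star[OF star_algebra_free ideal_rel rel_star, of f N]
  unfolding cls_def free_unitary_star_alg_eq by simp

lemma single_mult: "Poly_Mapping.single v 1 \<otimes>\<^bsub>free_alg N\<^esub> Poly_Mapping.single w 1 = Poly_Mapping.single (v @ w) 1"
  by (rule lin_eqI) simp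

lemma single_star: "star (free_alg N) (Poly_Mapping.single w 1) = Poly_Mapping.single (adj w) 1"
  by (rule lin_eqI) simp

lemma wcls_mult: "v \<in> uwords N \<Longrightarrow> w \<in> uwords N \<Longrightarrow>
    wcls N v \<otimes>\<^bsub>free_unitary_star_alg N\<^esub> wcls N w = wcls N (v @ w)"
  by (simp add: cls_mult single_mult)

lemma wcls_star: "w \<in> uwords N \<Longrightarrow> star (free_unitary_star_alg N) (wcls N w) = wcls N (adj w)"
  by (simp add: cls_star single_star)

lemma wcls_Nil: "wcls N [] = \<one>\<^bsub>free_unitary_star_alg N\<^esub>"
  by (simp add: cls_def free_unitary_star_alg_eq)

lemma cls_zero: "f \<in> rel_ideal N \<Longrightarrow> cls N f = \<zero>\<^bsub>free_unitary_star_alg N\<^esub>"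
proof -
  interpret ideal "rel_ideal N" "free_alg N" by (rule ideal_rel)
  assume "f \<in> rel_ideal N"
  then show ?thesis
    using a_rcos_const by (simp add: cls_def free_unitary_star_alg_eq)
qed

lemma free_unitary_gen_eq: "free_unitary_gen N i j = wcls N [((i, j), False)]"
  by (simp add: free_unitary_gen_def presented_gen_def cls_def)

lemma functional_expansion:
  assumes "linear_functional (free_alg N) L" "f \<in> carrier (free_alg N)"
  shows "L f = lin (\<lambda>w. L (Poly_Mapping.single w 1)) f"
proof -
  have zero: "L 0 = 0"
    using linear_functional_zero[OF assms(1)] by simp
  have scale: "L (Poly_Mapping.single w c) = c * L (Poly_Mapping.single w 1)" if "w \<in> uwords N" for w c
  proof -
    have "L (c \<odot>\<^bsub>free_alg N\<^esub> Poly_Mapping.single w 1) = c * L (Poly_Mapping.single w 1)"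
      using assms(1) that unfolding linear_functional_def by (simp del: free_star_alg_simps(5))
    then show ?thesis
      by simp
  qed
  have "L (\<Sum>w\<in>S. Poly_Mapping.single w (h w)) = (\<Sum>w\<in>S. h w * L (Poly_Mapping.single w 1)) \<and>
      (\<Sum>w\<in>S. Poly_Mapping.single w (h w)) \<in> carrier (free_alg N)"
    if "finite S" "S \<subseteq> uwords N" for S h
    using that
  proof (induction S rule: finite_induct)
    case empty
    then show ?case
      using zero by simp
  next
    case (insert w S)
    have w: "Poly_Mapping.single w (h w) \<in> carrier (free_alg N)"
      using insert.prems by simp
    have S: "(\<Sum>w\<in>S. Poly_Mapping.single w (h w)) \<in> carrier (free_alg N)"
      using insert by simp
    have "L (Poly_Mapping.single w (h w) \<oplus>\<^bsub>free_alg N\<^esub> (\<Sum>w\<in>S. Poly_Mapping.single w (h w))) =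
        L (Poly_Mapping.single w (h w)) + L (\<Sum>w\<in>S. Poly_Mapping.single w (h w))"
      using assms(1) w S unfolding linear_functional_def by blast
    moreover have "Poly_Mapping.single w (h w) \<oplus>\<^bsub>free_alg N\<^esub> (\<Sum>w\<in>S. Poly_Mapping.single w (h w)) \<in> carrier (free_alg N)"
      by (rule ring.ring_simprules(1)[OF star_algebraD(1)[OF star_algebra_free] w S])
    ultimately show ?case
      using insert scale[of w "h w"] by simp
  qed
  note * = this
  have "f = (\<Sum>w\<in>Poly_Mapping.keys f. Poly_Mapping.single w (Poly_Mapping.lookup f w))"
    by (rule lin_eqI) (simp add: lin_sum lin_def[of _ f])
  then show ?thesis
    using *[of "Poly_Mapping.keys f" "Poly_Mapping.lookup f"] assms(2) unfolding lin_def by simp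
qed

lemma functional_cls:
  assumes \<theta>: "linear_functional (free_unitary_star_alg N) \<theta>"
  shows "f \<in> carrier (free_alg N) \<Longrightarrow> \<theta> (cls N f) = lin (\<lambda>w. \<theta> (wcls N w)) f"
    "unitary_functional N (\<lambda>w. \<theta> (wcls N w))"
proof -
  have L: "linear_functional (free_alg N) (\<lambda>f. \<theta> (cls N f))"
    using \<theta> cls_carrier[of _ N] unfolding linear_functional_def
    by (auto simp flip: cls_add cls_smult)
  show exp: "\<theta> (cls N f) = lin (\<lambda>w. \<theta> (wcls N w)) f" if "f \<in> carrier (free_alg N)" for f
    by (rule functional_expansion[OF L that])
  interpret R: ring "free_unitary_star_alg N" by (rule star_algebraD(1)[OF star_algebra_free_unitary_star_alg])
  show "unitary_functional N (\<lambda>w. \<theta> (wcls N w))"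
  proof (rule vanish_unitary_functional)
    fix f assume f: "f \<in> rel_ideal N"
    then have "lin (\<lambda>w. \<theta> (wcls N w)) f = \<theta> (cls N f)"
      using exp[OF rel_carrier[OF f]] by simp
    also have "\<dots> = 0"
      unfolding cls_zero[OF f] by (rule linear_functional_zero[OF \<theta>]) auto
    finally show "lin (\<lambda>w. \<theta> (wcls N w)) f = 0" .
  qed
qed

text \<open>\<open>presented_hom\<close> evaluates an arbitrary representative; under a functional the choice does
  not matter as soon as the values on words satisfy the relations.\<close>

lemma presented_hom_functional:
  assumes C: "abelian_monoid C" "\<And>c x. x \<in> carrier C \<Longrightarrow> c \<odot>\<^bsub>C\<^esub> x \<in> carrier C"
    and \<theta>: "linear_functional C \<theta>"
    and \<Phi>: "\<And>w. w \<in> uwords N \<Longrightarrow> word_eval C \<Phi> w \<in> carrier C"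
    and f: "f \<in> carrier (free_alg N)"
  shows "presented_hom C \<Phi> (cls N f) \<in> carrier C"
    "unitary_functional N \<phi> \<Longrightarrow> (\<And>w. w \<in> uwords N \<Longrightarrow> \<theta> (word_eval C \<Phi> w) = \<phi> w) \<Longrightarrow>
      \<theta> (presented_hom C \<Phi> (cls N f)) = lin \<phi> f"
proof -
  interpret ideal "rel_ideal N" "free_alg N" by (rule ideal_rel)
  define g where "g = (SOME f'. f' \<in> cls N f)"
  have "f \<in> cls N f"
    unfolding cls_def using a_rcos_self[OF f] .
  then have "g \<in> cls N f"
    unfolding g_def by (rule someI)
  then obtain n where n: "n \<in> rel_ideal N" "g = n + f"
    unfolding cls_def a_r_coset_def' by auto
  have g: "Poly_Mapping.keys g \<subseteq> uwords N"
    using rel_carrier[OF n(1)] f a_closed[of n f] n(2) by simp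
  have eq: "presented_hom C \<Phi> (cls N f) =
      (\<Oplus>\<^bsub>C\<^esub>w\<in>Poly_Mapping.keys g. Poly_Mapping.lookup g w \<odot>\<^bsub>C\<^esub> word_eval C \<Phi> w)"
    by (simp add: presented_hom_def g_def Let_def)
  have fs: "presented_hom C \<Phi> (cls N f) \<in> carrier C \<and> \<theta> (presented_hom C \<Phi> (cls N f)) =
      (\<Sum>w\<in>Poly_Mapping.keys g. \<theta> (Poly_Mapping.lookup g w \<odot>\<^bsub>C\<^esub> word_eval C \<Phi> w))"
    unfolding eq using g by (intro linear_functional_finsum[OF C(1) \<theta>] C(2) \<Phi>) auto
  then show "presented_hom C \<Phi> (cls N f) \<in> carrier C" ..
  assume \<phi>: "unitary_functional N \<phi>" and eval: "\<And>w. w \<in> uwords N \<Longrightarrow> \<theta> (word_eval C \<Phi> w) = \<phi> w"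
  have "\<theta> (presented_hom C \<Phi> (cls N f)) = lin \<phi> g"
    unfolding fs[THEN conjunct2] lin_def
  proof (intro sum.cong refl)
    fix w assume "w \<in> Poly_Mapping.keys g"
    then have w: "w \<in> uwords N"
      using g by blast
    have "\<theta> (Poly_Mapping.lookup g w \<odot>\<^bsub>C\<^esub> word_eval C \<Phi> w) = Poly_Mapping.lookup g w * \<theta> (word_eval C \<Phi> w)"
      using \<theta> \<Phi>[OF w] unfolding linear_functional_def by blast
    then show "\<theta> (Poly_Mapping.lookup g w \<odot>\<^bsub>C\<^esub> word_eval C \<Phi> w) = Poly_Mapping.lookup g w * \<phi> w"
      using eval[OF w] by simp
  qed
  also have "\<dots> = lin \<phi> f"
    using n unitary_functional_vanish[OF \<phi> n(1)] by simp
  finally show "\<theta> (presented_hom C \<Phi> (cls N f)) = lin \<phi> f" .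
qed

lemma free_unitary_simps [simp]:
  "carrier (free_unitary N) = carrier (free_unitary_star_alg N)"
  "mult (free_unitary N) = mult (free_unitary_star_alg N)"
  "one (free_unitary N) = one (free_unitary_star_alg N)"
  "zero (free_unitary N) = zero (free_unitary_star_alg N)"
  "add (free_unitary N) = add (free_unitary_star_alg N)"
  "smult (free_unitary N) = smult (free_unitary_star_alg N)"
  "star (free_unitary N) = star (free_unitary_star_alg N)"
  "comult (free_unitary N) =
    presented_hom (tensor_alg (free_unitary_star_alg N) (free_unitary_star_alg N))
      (\<lambda>(i, j). \<Oplus>\<^bsub>tensor_alg (free_unitary_star_alg N) (free_unitary_star_alg N)\<^esub>k\<in>{..<N}.
        tens (free_unitary_star_alg N) (free_unitary_star_alg N) (free_unitary_gen N i k) (free_unitary_gen N k j))"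
  "counit (free_unitary N) = presented_hom complex_alg (\<lambda>(i, j). if i = j then 1 else 0)"
  by (simp_all add: free_unitary_def Let_def star_alg.defs hopf_star_alg.defs)

lemma star_algebra_cong:
  assumes A: "star_algebra A" and eq: "carrier B = carrier A" "mult B = mult A" "one B = one A" "zero B = zero A"
    "add B = add A" "smult B = smult A" "star B = star A"
  shows "star_algebra B"
proof (rule star_algebraI)
  show "ring B"
    by (rule ring_cong[OF star_algebraD(1)[OF A]]) (simp_all add: eq)
qed (simp_all add: eq star_algebraD[OF A])

lemma star_algebra_free_unitary: "star_algebra (free_unitary N)"
  by (rule star_algebra_cong[OF star_algebra_free_unitary_star_alg]) simp_all

section \<open>The comultiplication as convolution\<close>

text \<open>The transpose of the comultiplication on words, where the entry \<open>(a, b)\<close>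
  goes to the sum over \<open>c\<close> of \<open>(a, c)\<close> tensor \<open>(c, b)\<close>.
  Taking \<open>G\<close> in two variables covers bilinear forms that are not products of
  functionals.\<close>

definition convolve :: "nat \<Rightarrow> (uword \<Rightarrow> uword \<Rightarrow> complex) \<Rightarrow> uword \<Rightarrow> complex" where
  "convolve N G w = (\<Sum>c\<in>vecs N (map snd w). G (uw (row w) c) (uw c (col w)))"

lemma row_append [simp]: "row (v @ w) = row v @ row w" and row_Cons [simp]: "row (l # w) = (fst (fst l), snd l) # row w"
  and row_Nil [simp]: "row [] = []"
  by (auto simp: row_def)

lemma col_append [simp]: "col (v @ w) = col v @ col w" and col_Cons [simp]: "col (l # w) = (snd (fst l), snd l) # col w"
  and col_Nil [simp]: "col [] = []"
  by (auto simp: col_def)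

lemma length_row_col [simp]: "length (row w) = length w" "length (col w) = length w"
  by (auto simp: row_def col_def)

lemma convolve_append:
  "convolve N G (v @ w) = (\<Sum>c\<in>vecs N (map snd v). \<Sum>d\<in>vecs N (map snd w).
    G (uw (row v) c @ uw (row w) d) (uw c (col v) @ uw d (col w)))"
  unfolding convolve_def map_append sum_vecs_append
  by (intro sum.cong refl) (simp add: uw_append length_vecs)

lemma convolve_two:
  "convolve N G (v @ ((i, k), e) # ((j, l), e') # w) =
    (\<Sum>c\<in>vecs N (map snd v). \<Sum>d\<in>vecs N (map snd w). \<Sum>m<N. \<Sum>n<N.
    G (uw (row v) c @ ((i, m), e) # ((j, n), e') # uw (row w) d)
      (uw c (col v) @ ((m, k), e) # ((n, l), e') # uw d (col w)))"
proof -
  have "convolve N G (v @ ((i, k), e) # ((j, l), e') # w) =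
    (\<Sum>c\<in>vecs N (map snd v). \<Sum>m<N. \<Sum>n<N. \<Sum>d\<in>vecs N (map snd w).
    G (uw (row v) c @ ((i, m), e) # ((j, n), e') # uw (row w) d)
      (uw c (col v) @ ((m, k), e) # ((n, l), e') # uw d (col w)))"
    unfolding convolve_append by (simp add: sum_vecs_Cons)
  also have "\<dots> = (\<Sum>c\<in>vecs N (map snd v). \<Sum>m<N. \<Sum>d\<in>vecs N (map snd w). \<Sum>n<N.
    G (uw (row v) c @ ((i, m), e) # ((j, n), e') # uw (row w) d)
      (uw c (col v) @ ((m, k), e) # ((n, l), e') # uw d (col w)))"
    by (intro sum.cong refl sum.swap)
  also have "\<dots> = (\<Sum>c\<in>vecs N (map snd v). \<Sum>d\<in>vecs N (map snd w). \<Sum>m<N. \<Sum>n<N.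
    G (uw (row v) c @ ((i, m), e) # ((j, n), e') # uw (row w) d)
      (uw c (col v) @ ((m, k), e) # ((n, l), e') # uw d (col w)))"
    by (intro sum.cong refl sum.swap)
  finally show ?thesis .
qed

lemma sum_swap4:
  "(\<Sum>k\<in>K. \<Sum>a\<in>A. \<Sum>b\<in>B. \<Sum>m\<in>M. \<Sum>n\<in>M'. h k a b m n) =
    (\<Sum>a\<in>A. \<Sum>b\<in>B. \<Sum>m\<in>M. \<Sum>n\<in>M'. \<Sum>k\<in>K. h k a b m n :: complex)"
proof -
  have 1: "(\<Sum>k\<in>K. \<Sum>m\<in>M. \<Sum>n\<in>M'. f k m n) = (\<Sum>m\<in>M. \<Sum>n\<in>M'. \<Sum>k\<in>K. f k m n)" for f :: "_ \<Rightarrow> _ \<Rightarrow> _ \<Rightarrow> complex"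
    by (subst sum.swap) (intro sum.cong refl sum.swap)
  have "(\<Sum>k\<in>K. \<Sum>a\<in>A. \<Sum>b\<in>B. \<Sum>m\<in>M. \<Sum>n\<in>M'. h k a b m n) =
      (\<Sum>a\<in>A. \<Sum>k\<in>K. \<Sum>b\<in>B. \<Sum>m\<in>M. \<Sum>n\<in>M'. h k a b m n)"
    by (rule sum.swap)
  also have "\<dots> = (\<Sum>a\<in>A. \<Sum>b\<in>B. \<Sum>k\<in>K. \<Sum>m\<in>M. \<Sum>n\<in>M'. h k a b m n)"
    by (intro sum.cong refl sum.swap)
  finally show ?thesis
    unfolding 1 .
qed

lemma sum_delta_pair: "(\<Sum>m<N. \<Sum>n<N. if m = n then f m n else 0) = (\<Sum>m<(N::nat). f m m :: complex)"
  by (intro sum.cong refl) (simp add: sum.delta')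

text \<open>The comultiplication respects the relations. A row relation first collapses in the
  second leg, which identifies the two summation indices, and then remains as a row relation in the
  first; for a column relation the legs change places.\<close>

lemma convolve_unitary:
  assumes G1: "\<And>w. w \<in> uwords N \<Longrightarrow> unitary_functional N (\<lambda>v. G v w)"
    and G2: "\<And>v. v \<in> uwords N \<Longrightarrow> unitary_functional N (G v)"
  shows "unitary_functional N (convolve N G)"
  unfolding unitary_functional_def
proof (intro ballI allI impI conjI)
  fix v w i j e assume v: "v \<in> uwords N" and w: "w \<in> uwords N" and ij: "i < N" "j < N"
  have mem: "uw (row v) c \<in> uwords N" "uw c (col v) \<in> uwords N" if "c \<in> vecs N (map snd v)" for c
    using that row_col_vecs[OF v] by (auto intro: uw_vecs)
  have mem': "uw (row w) d \<in> uwords N" "uw d (col w) \<in> uwords N" if "d \<in> vecs N (map snd w)" for d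
    using that row_col_vecs[OF w] by (auto intro: uw_vecs)
  let ?C = "vecs N (map snd v)" and ?D = "vecs N (map snd w)"
  have "(\<Sum>k<N. convolve N G (v @ [((i, k), e), ((j, k), \<not> e)] @ w)) =
      (\<Sum>c\<in>?C. \<Sum>d\<in>?D. \<Sum>m<N. \<Sum>n<N. \<Sum>k<N.
      G (uw (row v) c @ ((i, m), e) # ((j, n), \<not> e) # uw (row w) d)
        (uw c (col v) @ ((m, k), e) # ((n, k), \<not> e) # uw d (col w)))"
    unfolding append_Cons append_Nil convolve_two by (rule sum_swap4)
  also have "\<dots> = (\<Sum>c\<in>?C. \<Sum>d\<in>?D. \<Sum>m<N. \<Sum>n<N. if m = n then
      G (uw (row v) c @ ((i, m), e) # ((j, n), \<not> e) # uw (row w) d) (uw c (col v) @ uw d (col w)) else 0)"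
    using mem mem' ij by (intro sum.cong refl unitary_functionalD(1)[OF G2]) auto
  also have "\<dots> = (\<Sum>c\<in>?C. \<Sum>d\<in>?D. \<Sum>m<N.
      G (uw (row v) c @ ((i, m), e) # ((j, m), \<not> e) # uw (row w) d) (uw c (col v) @ uw d (col w)))"
    unfolding sum_delta_pair ..
  also have "\<dots> = (\<Sum>c\<in>?C. \<Sum>d\<in>?D. if i = j then
      G (uw (row v) c @ uw (row w) d) (uw c (col v) @ uw d (col w)) else 0)"
    using mem mem' ij by (intro sum.cong refl unitary_functionalD(1)[OF G1]) auto
  also have "\<dots> = (if i = j then convolve N G (v @ w) else 0)"
    by (simp add: convolve_append)
  finally show "(\<Sum>k<N. convolve N G (v @ [((i, k), e), ((j, k), \<not> e)] @ w)) =
      (if i = j then convolve N G (v @ w) else 0)" .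
  have "(\<Sum>k<N. convolve N G (v @ [((k, i), e), ((k, j), \<not> e)] @ w)) =
      (\<Sum>c\<in>?C. \<Sum>d\<in>?D. \<Sum>m<N. \<Sum>n<N. \<Sum>k<N.
      G (uw (row v) c @ ((k, m), e) # ((k, n), \<not> e) # uw (row w) d)
        (uw c (col v) @ ((m, i), e) # ((n, j), \<not> e) # uw d (col w)))"
    unfolding append_Cons append_Nil convolve_two by (rule sum_swap4)
  also have "\<dots> = (\<Sum>c\<in>?C. \<Sum>d\<in>?D. \<Sum>m<N. \<Sum>n<N. if m = n then
      G (uw (row v) c @ uw (row w) d) (uw c (col v) @ ((m, i), e) # ((n, j), \<not> e) # uw d (col w)) else 0)"
    using mem mem' ij by (intro sum.cong refl unitary_functionalD(2)[OF G1]) auto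
  also have "\<dots> = (\<Sum>c\<in>?C. \<Sum>d\<in>?D. \<Sum>m<N.
      G (uw (row v) c @ uw (row w) d) (uw c (col v) @ ((m, i), e) # ((m, j), \<not> e) # uw d (col w)))"
    unfolding sum_delta_pair ..
  also have "\<dots> = (\<Sum>c\<in>?C. \<Sum>d\<in>?D. if i = j then
      G (uw (row v) c @ uw (row w) d) (uw c (col v) @ uw d (col w)) else 0)"
    using mem mem' ij by (intro sum.cong refl unitary_functionalD(2)[OF G2]) auto
  also have "\<dots> = (if i = j then convolve N G (v @ w) else 0)"
    by (simp add: convolve_append)
  finally show "(\<Sum>k<N. convolve N G (v @ [((k, i), e), ((k, j), \<not> e)] @ w)) =
      (if i = j then convolve N G (v @ w) else 0)" .
qed

lemma linear_functional_star:
  assumes A: "star_algebra A" and \<theta>: "linear_functional A \<theta>"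
  shows "linear_functional A (\<lambda>x. cnj (\<theta> (star A x)))"
  using \<theta> unfolding linear_functional_def by (auto simp: star_algebraD[OF A])

section \<open>The comultiplication and counit of the free unitary group on words\<close>

abbreviation uplus :: "nat \<Rightarrow> uplus_elem star_alg" where
  "uplus N \<equiv> free_unitary_star_alg N"

abbreviation uplus2 :: "nat \<Rightarrow> (uplus_elem, uplus_elem) tensor star_alg" where
  "uplus2 N \<equiv> tensor_alg (uplus N) (uplus N)"

definition comult_gen :: "nat \<Rightarrow> nat \<times> nat \<Rightarrow> (uplus_elem, uplus_elem) tensor" where
  "comult_gen N = (\<lambda>(i, j). \<Oplus>\<^bsub>uplus2 N\<^esub>k\<in>{..<N}.
    tens (uplus N) (uplus N) (free_unitary_gen N i k) (free_unitary_gen N k j))"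

lemma star_algebra_uplus2: "star_algebra (uplus2 N)"
  by (rule star_algebra_tensor_alg[OF star_algebra_free_unitary_star_alg star_algebra_free_unitary_star_alg])

lemma abelian_monoid_star_algebra: "star_algebra A \<Longrightarrow> abelian_monoid A"
  using abelian_group.axioms(1) ring.is_abelian_group star_algebraD(1) by blast

text \<open>The induction varies \<gamma>: left multiplication by a product tensor turns \<gamma>
  into a form with both arguments multiplied from the left, evaluated on the remaining word.\<close>

lemma word_eval_comult:
  assumes "w \<in> uwords N" "bilinear_form (uplus N) (uplus N) \<gamma>"
  shows "word_eval (uplus2 N) (comult_gen N) w \<in> carrier (uplus2 N) \<and>
    tfun \<gamma> (word_eval (uplus2 N) (comult_gen N) w) = convolve N (\<lambda>v w. \<gamma> (wcls N v) (wcls N w)) w"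
  using assms
proof (induction w arbitrary: \<gamma>)
  note A = star_algebra_free_unitary_star_alg[of N]
  note T = star_algebra_uplus2[of N]
  interpret A: ring "uplus N" by (rule star_algebraD(1)[OF A])
  interpret T: ring "uplus2 N" by (rule star_algebraD(1)[OF T])
  {
    case Nil
    have "\<one>\<^bsub>uplus2 N\<^esub> = tens (uplus N) (uplus N) \<one>\<^bsub>uplus N\<^esub> \<one>\<^bsub>uplus N\<^esub>"
      by (simp add: tensor_alg_def tens_def pair_alg_def DirProd_def)
    then have "tfun \<gamma> \<one>\<^bsub>uplus2 N\<^esub> = \<gamma> \<one>\<^bsub>uplus N\<^esub> \<one>\<^bsub>uplus N\<^esub>"
      using tfun_tens[OF A A Nil(2)] by simp
    then show ?case
      by (simp add: convolve_def wcls_Nil)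
  next
    case (Cons l w)
    obtain i j e where l: "l = ((i, j), e)"
      by (cases l) auto
    have lw: "i < N" "j < N" "w \<in> uwords N"
      using Cons.prems(1) by (auto simp: l)
    let ?u = "free_unitary_gen N"
    let ?x = "\<lambda>k. wcls N [((i, k), e)]" and ?y = "\<lambda>k. wcls N [((k, j), e)]"
    let ?L = "if e then star (uplus2 N) (comult_gen N (i, j)) else comult_gen N (i, j)"
    let ?Y = "word_eval (uplus2 N) (comult_gen N) w"
    note IH = Cons.IH[OF lw(3)]
    have Y: "?Y \<in> carrier (uplus2 N)"
      using IH[OF Cons.prems(2)] by simp
    have xy: "?x k \<in> carrier (uplus N)" "?y k \<in> carrier (uplus N)" if "k < N" for k
      using that lw by (auto intro!: wcls_carrier)
    have u: "?u i k \<in> carrier (uplus N)" "?u k j \<in> carrier (uplus N)" if "k < N" for k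
      using that lw by (auto simp: free_unitary_gen_eq intro!: wcls_carrier)
    have tu: "tens (uplus N) (uplus N) (?u i k) (?u k j) \<in> carrier (uplus2 N)" if "k < N" for k
      using tens_carrier[OF A A u(1)[OF that] u(2)[OF that]] .
    have gen: "comult_gen N (i, j) \<in> carrier (uplus2 N)"
      unfolding comult_gen_def using tu by (auto intro!: T.finsum_closed)
    have L: "?L \<in> carrier (uplus2 N)"
      using gen star_algebraD(9)[OF T] by simp
    have sum: "\<theta> ?L = (\<Sum>k<N. \<theta> (tens (uplus N) (uplus N) (?x k) (?y k)))"
      if \<theta>: "linear_functional (uplus2 N) \<theta>" for \<theta>
    proof (cases e)
      case False
      then show ?thesis
        using linear_functional_finsum[OF abelian_monoid_star_algebra[OF T] \<theta>, of "{..<N}"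
            "\<lambda>k. tens (uplus N) (uplus N) (?u i k) (?u k j)"] tu
        by (simp add: comult_gen_def free_unitary_gen_eq)
    next
      case True
      \<comment> \<open>The star is conjugate-linear, so the sum is taken with a linear functional
        that is conjugated back at the end.\<close>
      have "cnj (\<theta> (star (uplus2 N) (comult_gen N (i, j)))) =
          (\<Sum>k<N. cnj (\<theta> (star (uplus2 N) (tens (uplus N) (uplus N) (?u i k) (?u k j)))))"
        using linear_functional_finsum[OF abelian_monoid_star_algebra[OF T] linear_functional_star[OF T \<theta>], of "{..<N}"
            "\<lambda>k. tens (uplus N) (uplus N) (?u i k) (?u k j)"] tu
        by (simp add: comult_gen_def)
      also have "\<dots> = (\<Sum>k<N. cnj (\<theta> (tens (uplus N) (uplus N) (?x k) (?y k))))"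
      proof (intro sum.cong refl)
        fix k assume "k \<in> {..<N}"
        then have k: "k < N" by simp
        have "star (uplus N) (?u i k) = ?x k" "star (uplus N) (?u k j) = ?y k"
          using k lw True by (simp_all add: free_unitary_gen_eq wcls_star)
        then show "cnj (\<theta> (star (uplus2 N) (tens (uplus N) (uplus N) (?u i k) (?u k j)))) =
            cnj (\<theta> (tens (uplus N) (uplus N) (?x k) (?y k)))"
          using star_tens[OF A A u(1)[OF k] u(2)[OF k]] by simp
      qed
      finally show ?thesis
        using True by (simp flip: cnj_sum)
    qed
    have "tfun \<gamma> (?L \<otimes>\<^bsub>uplus2 N\<^esub> ?Y) =
        (\<Sum>k<N. tfun \<gamma> (tens (uplus N) (uplus N) (?x k) (?y k) \<otimes>\<^bsub>uplus2 N\<^esub> ?Y))"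
      using sum[OF linear_functional_mult(1)[OF T linear_functional_tfun[OF A A Cons.prems(2)] Y]] .
    also have "\<dots> = (\<Sum>k<N. tfun (\<lambda>c d. \<gamma> (?x k \<otimes>\<^bsub>uplus N\<^esub> c) (?y k \<otimes>\<^bsub>uplus N\<^esub> d)) ?Y)"
      using xy by (intro sum.cong refl tfun_mult_tens[OF A A Cons.prems(2) _ _ Y]) auto
    also have "\<dots> = (\<Sum>k<N. convolve N (\<lambda>v w. \<gamma> (?x k \<otimes>\<^bsub>uplus N\<^esub> wcls N v) (?y k \<otimes>\<^bsub>uplus N\<^esub> wcls N w)) w)"
      using xy by (intro sum.cong refl conjunct2[OF IH] bilinear_form_mult(1)[OF A A Cons.prems(2)]) auto
    also have "\<dots> = (\<Sum>k<N. \<Sum>c\<in>vecs N (map snd w).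
        \<gamma> (wcls N (((i, k), e) # uw (row w) c)) (wcls N (((k, j), e) # uw c (col w))))"
    proof (unfold convolve_def, intro sum.cong refl)
      fix k c assume k: "k \<in> {..<N}" and c: "c \<in> vecs N (map snd w)"
      have "uw (row w) c \<in> uwords N" "uw c (col w) \<in> uwords N"
        using row_col_vecs[OF lw(3)] c by (auto intro: uw_vecs)
      then show "\<gamma> (?x k \<otimes>\<^bsub>uplus N\<^esub> wcls N (uw (row w) c)) (?y k \<otimes>\<^bsub>uplus N\<^esub> wcls N (uw c (col w))) =
          \<gamma> (wcls N (((i, k), e) # uw (row w) c)) (wcls N (((k, j), e) # uw c (col w)))"
        using k lw by (simp add: wcls_mult)
    qed
    also have "\<dots> = convolve N (\<lambda>v w. \<gamma> (wcls N v) (wcls N w)) (l # w)"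
      by (simp add: convolve_def sum_vecs_Cons l)
    finally have val: "tfun \<gamma> (?L \<otimes>\<^bsub>uplus2 N\<^esub> ?Y) = convolve N (\<lambda>v w. \<gamma> (wcls N v) (wcls N w)) (l # w)" .
    have step: "word_eval (uplus2 N) (comult_gen N) (l # w) = ?L \<otimes>\<^bsub>uplus2 N\<^esub> ?Y"
      by (simp add: l)
    show ?case
      unfolding step using T.m_closed[OF L Y] val by (rule conjI)
  }
qed

lemma bilinear_form_zero: "bilinear_form A B (\<lambda>_ _. 0)"
  by (rule bilinear_formI) auto

text \<open>\<open>convolve_unitary\<close> makes the choice of a representative in
  \<open>presented_hom\<close> invisible to every bilinear form.\<close>

lemma comult_functional:
  assumes f: "f \<in> carrier (free_alg N)"
  shows "comult (free_unitary N) (cls N f) \<in> carrier (uplus2 N)"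
    "bilinear_form (uplus N) (uplus N) \<gamma> \<Longrightarrow>
      tfun \<gamma> (comult (free_unitary N) (cls N f)) = lin (convolve N (\<lambda>v w. \<gamma> (wcls N v) (wcls N w))) f"
proof -
  note A = star_algebra_free_unitary_star_alg[of N]
  note T = star_algebra_uplus2[of N]
  have eq: "comult (free_unitary N) = presented_hom (uplus2 N) (comult_gen N)"
    by (simp add: comult_gen_def)
  have w: "word_eval (uplus2 N) (comult_gen N) w \<in> carrier (uplus2 N)" if "w \<in> uwords N" for w
    using word_eval_comult[OF that bilinear_form_zero] by simp
  note am = abelian_monoid_star_algebra[OF T]
  show "comult (free_unitary N) (cls N f) \<in> carrier (uplus2 N)"
    unfolding eq
    by (rule presented_hom_functional(1)[OF am _ linear_functional_tfun[OF A A bilinear_form_zero] _ f])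
      (fact star_algebraD(2)[OF T] w)+
  assume \<gamma>: "bilinear_form (uplus N) (uplus N) \<gamma>"
  show "tfun \<gamma> (comult (free_unitary N) (cls N f)) = lin (convolve N (\<lambda>v w. \<gamma> (wcls N v) (wcls N w))) f"
    unfolding eq
  proof (rule presented_hom_functional(2)[OF am _ linear_functional_tfun[OF A A \<gamma>] _ f])
    show "unitary_functional N (convolve N (\<lambda>v w. \<gamma> (wcls N v) (wcls N w)))"
    proof (rule convolve_unitary)
      fix w assume "w \<in> uwords N"
      then have "linear_functional (uplus N) (\<lambda>x. \<gamma> x (wcls N w))" "linear_functional (uplus N) (\<gamma> (wcls N w))"
        using \<gamma> wcls_carrier unfolding bilinear_form_def by blast+
      then show "unitary_functional N (\<lambda>v. \<gamma> (wcls N v) (wcls N w))"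
        "unitary_functional N (\<lambda>v. \<gamma> (wcls N w) (wcls N v))"
        using functional_cls(2) by blast+
    qed
    show "tfun \<gamma> (word_eval (uplus2 N) (comult_gen N) w) = convolve N (\<lambda>v w. \<gamma> (wcls N v) (wcls N w)) w"
      if "w \<in> uwords N" for w
      using word_eval_comult[OF that \<gamma>] by simp
  qed (fact star_algebraD(2)[OF T] w)+
qed

lemma linear_functional_complex: "linear_functional complex_alg (\<lambda>x. x)"
  by (simp add: linear_functional_def complex_alg_def)

text \<open>The counit is evaluation at the identity matrix.\<close>

lemma counit_wcls:
  assumes "w \<in> uwords N"
  shows "counit (free_unitary N) (wcls N w) = of_bool (row w = col w)"
proof -
  define g where "g i j = (of_bool (i < N \<and> j < N \<and> i = j) :: complex)" for i j
  have "(\<Sum>k<N. g a k * cnj (g b k)) = (if a = b then 1 else 0) \<and>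
      (\<Sum>k<N. cnj (g k a) * g k b) = (if a = b then 1 else 0)" if "a < N" "b < N" for a b
  proof -
    have "(\<Sum>k<N. g a k * cnj (g b k)) = (\<Sum>k<N. if k = a then of_bool (a = b) else 0)"
      "(\<Sum>k<N. cnj (g k a) * g k b) = (\<Sum>k<N. if k = a then of_bool (a = b) else 0)"
      by (auto simp: g_def intro!: sum.cong)
    then show ?thesis
      using that by auto
  qed
  then have g: "g \<in> carrier (unitary_group N)"
    by (auto simp: unitary_group_def g_def)
  have ev: "word_eval complex_alg (\<lambda>(i, j). if i = j then 1 else 0) w = ev g w" if "w \<in> uwords N" for w
    using that by (induction w) (auto simp: complex_alg_def g_def)
  interpret cring complex_alg by (rule complex_alg_cring)
  have carrier: "x \<in> carrier complex_alg" for x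
    by (simp add: complex_alg_def)
  have "Poly_Mapping.single w 1 \<in> carrier (free_alg N)"
    using assms by simp
  then have "presented_hom complex_alg (\<lambda>(i, j). if i = j then 1 else 0) (wcls N w) = lin (ev g) (Poly_Mapping.single w 1)"
    by (rule presented_hom_functional(2)[OF abelian_monoid_axioms carrier linear_functional_complex carrier
        _ unitary_functional_ev[OF g] ev])
  moreover have "ev g w = of_bool (row w = col w)"
    using assms by (induction w) (auto simp: g_def)
  ultimately show ?thesis
    by simp
qed

section \<open>Functionals on a quotient\<close>

lemma star_zero:
  assumes "star_algebra A"
  shows "star A \<zero>\<^bsub>A\<^esub> = \<zero>\<^bsub>A\<^esub>"
proof -
  interpret ring A by (rule star_algebraD(1)[OF assms])
  show ?thesis
    using star_algebraD(12)[OF assms, of "\<zero>\<^bsub>A\<^esub>" "\<zero>\<^bsub>A\<^esub>"] star_algebraD(9)[OF assms, of "\<zero>\<^bsub>A\<^esub>"] by simp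
qed

context
  fixes N :: nat and Q :: "('q, 't) hopf_star_alg_scheme" and q :: "uplus_elem \<Rightarrow> 'q"
  assumes quot: "hopf_star_quotient (free_unitary N) Q q"
begin

lemma star_algebra_Q: "star_algebra Q"
  using quot by (simp add: hopf_star_quotient_def hopf_star_algebra_def)

interpretation Q: ring Q by (rule star_algebraD(1)[OF star_algebra_Q])
interpretation U: ring "uplus N" by (rule star_algebraD(1)[OF star_algebra_free_unitary_star_alg])

lemma q_hom:
  "x \<in> carrier (uplus N) \<Longrightarrow> q x \<in> carrier Q"
  "x \<in> carrier (uplus N) \<Longrightarrow> y \<in> carrier (uplus N) \<Longrightarrow> q (x \<oplus>\<^bsub>uplus N\<^esub> y) = q x \<oplus>\<^bsub>Q\<^esub> q y"
  "x \<in> carrier (uplus N) \<Longrightarrow> y \<in> carrier (uplus N) \<Longrightarrow> q (x \<otimes>\<^bsub>uplus N\<^esub> y) = q x \<otimes>\<^bsub>Q\<^esub> q y"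
  "q \<one>\<^bsub>uplus N\<^esub> = \<one>\<^bsub>Q\<^esub>"
  "x \<in> carrier (uplus N) \<Longrightarrow> q (c \<odot>\<^bsub>uplus N\<^esub> x) = c \<odot>\<^bsub>Q\<^esub> q x"
  "x \<in> carrier (uplus N) \<Longrightarrow> q (star (uplus N) x) = star Q (q x)"
  using quot unfolding hopf_star_quotient_def hopf_star_hom_def star_hom_def ring_hom_def by auto

lemma q_surj:
  assumes "y \<in> carrier Q"
  obtains f where "f \<in> carrier (free_alg N)" "q (cls N f) = y"
proof -
  obtain x where "x \<in> carrier (uplus N)" "q x = y"
    using assms quot unfolding hopf_star_quotient_def by (metis free_unitary_simps(1) imageE)
  then show ?thesis
    using that by (auto elim: cls_carrierE)
qed

definition kernel_words :: "(uword \<Rightarrow>\<^sub>0 complex) set" where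
  "kernel_words = {f \<in> carrier (free_alg N). q (cls N f) = \<zero>\<^bsub>Q\<^esub>}"

text \<open>On words of \<open>uwords N\<close> these are the functionals that factor through
  \<open>q\<close>; \<open>functional_q\<close> and \<open>annihilator_functional\<close> give the
  two directions.\<close>

definition annihilator :: "(uword \<Rightarrow> complex) set" where
  "annihilator = {\<phi>. \<forall>f\<in>kernel_words. lin \<phi> f = 0}"

lemma pullback: "linear_functional Q \<theta> \<Longrightarrow> linear_functional (uplus N) (\<lambda>x. \<theta> (q x))"
  unfolding linear_functional_def by (auto simp: q_hom)

lemma functional_q:
  assumes "linear_functional Q \<theta>"
  shows "f \<in> carrier (free_alg N) \<Longrightarrow> \<theta> (q (cls N f)) = lin (\<lambda>w. \<theta> (q (wcls N w))) f"
    "unitary_functional N (\<lambda>w. \<theta> (q (wcls N w)))"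
    "(\<lambda>w. \<theta> (q (wcls N w))) \<in> annihilator"
proof -
  note F = functional_cls[OF pullback[OF assms]]
  show 1: "f \<in> carrier (free_alg N) \<Longrightarrow> \<theta> (q (cls N f)) = lin (\<lambda>w. \<theta> (q (wcls N w))) f" for f
    by (rule F(1))
  show "unitary_functional N (\<lambda>w. \<theta> (q (wcls N w)))"
    by (rule F(2))
  show "(\<lambda>w. \<theta> (q (wcls N w))) \<in> annihilator"
    unfolding annihilator_def
  proof (intro CollectI ballI)
    fix f assume "f \<in> kernel_words"
    then show "lin (\<lambda>w. \<theta> (q (wcls N w))) f = 0"
      using 1[of f, symmetric] linear_functional_zero[OF assms] by (simp add: kernel_words_def)
  qed
qed

text \<open>Words span \<open>Q\<close>, and two representatives of one element of \<open>Q\<close>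
  differ by an element on which \<phi> vanishes.\<close>

lemma annihilator_functional:
  assumes \<phi>: "\<phi> \<in> annihilator"
  shows "\<exists>\<theta>. linear_functional Q \<theta> \<and> (\<forall>f\<in>carrier (free_alg N). \<theta> (q (cls N f)) = lin \<phi> f)"
proof -
  have eq: "lin \<phi> f = lin \<phi> g"
    if f: "f \<in> carrier (free_alg N)" and g: "g \<in> carrier (free_alg N)" and fg: "q (cls N f) = q (cls N g)" for f g
  proof -
    have d: "f - g \<in> carrier (free_alg N)"
      using f g keys_diff[of f g] by auto
    have "q (cls N (f - g + g)) = q (cls N (f - g)) \<oplus>\<^bsub>Q\<^esub> q (cls N g)"
      using q_hom(2)[OF cls_carrier[OF d] cls_carrier[OF g]] by (simp add: cls_add[OF d g])
    then have "q (cls N (f - g)) \<oplus>\<^bsub>Q\<^esub> q (cls N g) = q (cls N g)"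
      using fg by simp
    then have "q (cls N (f - g)) = \<zero>\<^bsub>Q\<^esub>"
      using q_hom(1)[OF cls_carrier[OF d]] q_hom(1)[OF cls_carrier[OF g]] by simp
    then have "lin \<phi> (f - g) = 0"
      using \<phi> d unfolding annihilator_def kernel_words_def by blast
    then show ?thesis
      by simp
  qed
  define \<theta> where "\<theta> y = lin \<phi> (SOME f. f \<in> carrier (free_alg N) \<and> q (cls N f) = y)" for y
  have val: "\<theta> (q (cls N f)) = lin \<phi> f" if f: "f \<in> carrier (free_alg N)" for f
  proof -
    have "(SOME g. g \<in> carrier (free_alg N) \<and> q (cls N g) = q (cls N f)) \<in> carrier (free_alg N) \<and>
        q (cls N (SOME g. g \<in> carrier (free_alg N) \<and> q (cls N g) = q (cls N f))) = q (cls N f)"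
      by (rule someI[of "\<lambda>g. g \<in> carrier (free_alg N) \<and> q (cls N g) = q (cls N f)" f]) (use f in blast)
    then show ?thesis
      unfolding \<theta>_def using eq f by blast
  qed
  have "linear_functional Q \<theta>"
    unfolding linear_functional_def
  proof (intro conjI ballI allI)
    fix y assume "y \<in> carrier Q"
    then obtain f where f: "f \<in> carrier (free_alg N)" "q (cls N f) = y"
      by (rule q_surj)
    have s: "Poly_Mapping.map ((*) c) f \<in> carrier (free_alg N)" for c
      using star_algebraD(2)[OF star_algebra_free f(1), of c] by simp
    show "\<theta> (c \<odot>\<^bsub>Q\<^esub> y) = c * \<theta> y" for c
      using val[OF s[of c]] val[OF f(1)] q_hom(5)[OF cls_carrier[OF f(1)], of c] f(2)
      by (simp add: cls_smult[OF f(1)])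
    fix z assume "z \<in> carrier Q"
    then obtain g where g: "g \<in> carrier (free_alg N)" "q (cls N g) = z"
      by (rule q_surj)
    have "f + g \<in> carrier (free_alg N)"
      using ring.ring_simprules(1)[OF star_algebraD(1)[OF star_algebra_free] f(1) g(1)] by simp
    from val[OF this] show "\<theta> (y \<oplus>\<^bsub>Q\<^esub> z) = \<theta> y + \<theta> z"
      using val[OF f(1)] val[OF g(1)] q_hom(2)[OF cls_carrier[OF f(1)] cls_carrier[OF g(1)]] f(2) g(2)
      by (simp add: cls_add[OF f(1) g(1)])
  qed
  then show ?thesis
    using val by blast
qed

lemma star_algebra_QQ: "star_algebra (tensor_alg Q Q)"
  by (rule star_algebra_tensor_alg[OF star_algebra_Q star_algebra_Q])

text \<open>\<open>q\<close> intertwines the comultiplications, so that of \<open>Q\<close> is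
  computed on representatives by convolution.\<close>

lemma comult_q:
  assumes \<beta>: "bilinear_form Q Q \<beta>" and f: "f \<in> carrier (free_alg N)"
  shows "tfun \<beta> (comult Q (q (cls N f))) = lin (convolve N (\<lambda>v w. \<beta> (q (wcls N v)) (q (wcls N w)))) f"
proof -
  note A = star_algebra_free_unitary_star_alg[of N]
  let ?X = "comult (free_unitary N) (cls N f)"
  have "comult Q (q (cls N f)) = tensor_lift (tensor_alg Q Q) (\<lambda>a b. tens Q Q (q a) (q b)) ?X"
    using quot cls_carrier[OF f] unfolding hopf_star_quotient_def hopf_star_hom_def by simp
  then have "tfun \<beta> (comult Q (q (cls N f))) = tfun (\<lambda>a b. tfun \<beta> (tens Q Q (q a) (q b))) ?X"
    using tensor_lift_functional[OF A A abelian_monoid_star_algebra[OF star_algebra_QQ]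
        star_algebraD(2)[OF star_algebra_QQ] linear_functional_tfun[OF star_algebra_Q star_algebra_Q \<beta>]
        comult_functional(1)[OF f], of "\<lambda>a b. tens Q Q (q a) (q b)"]
      tens_carrier[OF star_algebra_Q star_algebra_Q] q_hom(1)
    by simp
  also have "\<dots> = tfun (\<lambda>a b. \<beta> (q a) (q b)) ?X"
    using q_hom(1) by (intro tfun_cong[OF A A comult_functional(1)[OF f]]
        tfun_tens[OF star_algebra_Q star_algebra_Q \<beta>]) auto
  also have "\<dots> = lin (convolve N (\<lambda>v w. \<beta> (q (wcls N v)) (q (wcls N w)))) f"
    by (rule comult_functional(2)[OF f], rule bilinear_formI)
      (simp_all add: q_hom bilinear_formD[OF \<beta>])
  finally show ?thesis .
qed

lemma comult_Q_closed: "y \<in> carrier Q \<Longrightarrow> comult Q y \<in> carrier (tensor_alg Q Q)"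
  using quot unfolding hopf_star_quotient_def hopf_star_algebra_def star_hom_def ring_hom_def by auto

lemma comult_Q_zero: "comult Q \<zero>\<^bsub>Q\<^esub> = \<zero>\<^bsub>tensor_alg Q Q\<^esub>"
proof (rule ring_hom_zero)
  show "comult Q \<in> ring_hom Q (tensor_alg Q Q)"
    using quot unfolding hopf_star_quotient_def hopf_star_algebra_def star_hom_def by auto
qed (rule star_algebraD(1) star_algebra_Q star_algebra_QQ)+

text \<open>The convolution is the product form of the two functionals on \<open>Q\<close> applied
  to the comultiplication, which sends 0 to 0.\<close>

lemma annihilator_conv:
  assumes "\<phi> \<in> annihilator" "\<psi> \<in> annihilator"
  shows "conv N \<phi> \<psi> \<in> annihilator"
  unfolding annihilator_def
proof (intro CollectI ballI)
  fix f assume "f \<in> kernel_words"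
  then have f: "f \<in> carrier (free_alg N)" "q (cls N f) = \<zero>\<^bsub>Q\<^esub>"
    by (auto simp: kernel_words_def)
  obtain \<theta>1 where \<theta>1: "linear_functional Q \<theta>1" "\<forall>f\<in>carrier (free_alg N). \<theta>1 (q (cls N f)) = lin \<phi> f"
    using annihilator_functional[OF assms(1)] by blast
  obtain \<theta>2 where \<theta>2: "linear_functional Q \<theta>2" "\<forall>f\<in>carrier (free_alg N). \<theta>2 (q (cls N f)) = lin \<psi> f"
    using annihilator_functional[OF assms(2)] by blast
  have \<beta>: "bilinear_form Q Q (\<lambda>a b. \<theta>1 a * \<theta>2 b)"
    using \<theta>1(1) \<theta>2(1) unfolding linear_functional_def
    by (intro bilinear_formI) (simp_all add: algebra_simps)
  have "lin (convolve N (\<lambda>v w. \<theta>1 (q (wcls N v)) * \<theta>2 (q (wcls N w)))) f = 0"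
  proof -
    interpret T: ring "tensor_alg Q Q" by (rule star_algebraD(1)[OF star_algebra_QQ])
    have "lin (convolve N (\<lambda>v w. \<theta>1 (q (wcls N v)) * \<theta>2 (q (wcls N w)))) f =
        tfun (\<lambda>a b. \<theta>1 a * \<theta>2 b) \<zero>\<^bsub>tensor_alg Q Q\<^esub>"
      using comult_q[OF \<beta> f(1)] f(2) comult_Q_zero by simp
    also have "\<dots> = 0"
      by (rule linear_functional_zero[OF linear_functional_tfun[OF star_algebra_Q star_algebra_Q \<beta>]]) auto
    finally show ?thesis .
  qed
  moreover have "lin (convolve N (\<lambda>v w. \<theta>1 (q (wcls N v)) * \<theta>2 (q (wcls N w)))) f = lin (conv N \<phi> \<psi>) f"
  proof (rule lin_cong)
    fix u assume "u \<in> Poly_Mapping.keys f"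
    then have u: "row u \<in> vecs N (map snd u)" "col u \<in> vecs N (map snd u)"
      using f(1) row_col_vecs[of u N] by auto
    have "\<theta>1 (q (wcls N v)) = \<phi> v" "\<theta>2 (q (wcls N v)) = \<psi> v" if "v \<in> uwords N" for v
      using bspec[OF \<theta>1(2), of "Poly_Mapping.single v 1"] bspec[OF \<theta>2(2), of "Poly_Mapping.single v 1"] that
      by simp_all
    then show "convolve N (\<lambda>v w. \<theta>1 (q (wcls N v)) * \<theta>2 (q (wcls N w))) u = conv N \<phi> \<psi> u"
      unfolding convolve_def conv_def using u by (intro sum.cong refl arg_cong2[of _ _ _ _ "(*)"]) (simp_all add: uw_vecs)
  qed
  ultimately show "lin (conv N \<phi> \<psi>) f = 0"
    by simp
qed

lemma annihilator_star:
  assumes "\<phi> \<in> annihilator"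
  shows "(\<lambda>w. cnj (\<phi> (adj w))) \<in> annihilator"
  unfolding annihilator_def
proof (intro CollectI ballI)
  fix f assume "f \<in> kernel_words"
  then have f: "f \<in> carrier (free_alg N)" "q (cls N f) = \<zero>\<^bsub>Q\<^esub>"
    by (auto simp: kernel_words_def)
  have "star (free_alg N) f \<in> carrier (free_alg N)"
    by (rule star_algebraD(9)[OF star_algebra_free f(1)])
  moreover have "q (cls N (star (free_alg N) f)) = \<zero>\<^bsub>Q\<^esub>"
    using q_hom(6)[OF cls_carrier[OF f(1)]] cls_star[OF f(1)] f(2) star_zero[OF star_algebra_Q] by simp
  ultimately have "lin \<phi> (star (free_alg N) f) = 0"
    using assms unfolding annihilator_def kernel_words_def by blast
  then show "lin (\<lambda>w. cnj (\<phi> (adj w))) f = 0"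
    by simp
qed

text \<open>The antipode is forced to send a unitary corepresentation matrix to its adjoint.\<close>

lemma antipode_annihilator:
  assumes \<phi>: "\<phi> \<in> annihilator"
  shows "\<exists>\<psi>\<in>annihilator. \<forall>x. \<forall>a\<in>vecs N x. \<forall>b\<in>vecs N x. \<psi> (uw a b) = \<phi> (adj (uw b a))"
proof -
  obtain S where S: "S \<in> carrier Q \<rightarrow> carrier Q"
    "\<forall>x\<in>carrier Q. \<forall>y\<in>carrier Q. S (x \<oplus>\<^bsub>Q\<^esub> y) = S x \<oplus>\<^bsub>Q\<^esub> S y"
    "\<forall>c. \<forall>x\<in>carrier Q. S (c \<odot>\<^bsub>Q\<^esub> x) = c \<odot>\<^bsub>Q\<^esub> S x"
    "\<forall>x\<in>carrier Q. tensor_lift Q (\<lambda>a b. S a \<otimes>\<^bsub>Q\<^esub> b) (comult Q x) = counit Q x \<odot>\<^bsub>Q\<^esub> \<one>\<^bsub>Q\<^esub> \<and>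
      tensor_lift Q (\<lambda>a b. a \<otimes>\<^bsub>Q\<^esub> S b) (comult Q x) = counit Q x \<odot>\<^bsub>Q\<^esub> \<one>\<^bsub>Q\<^esub>"
  proof -
    have "hopf_star_algebra Q"
      using quot by (simp add: hopf_star_quotient_def)
    then show thesis
      unfolding hopf_star_algebra_def by (elim conjE exE) (rule that; assumption)
  qed
  have Sc: "S x \<in> carrier Q" if "x \<in> carrier Q" for x
    using S(1) that by auto
  obtain \<theta> where \<theta>: "linear_functional Q \<theta>" "\<forall>f\<in>carrier (free_alg N). \<theta> (q (cls N f)) = lin \<phi> f"
    using annihilator_functional[OF \<phi>] by blast
  have \<theta>w: "\<theta> (q (wcls N w)) = \<phi> w" if "w \<in> uwords N" for w
    using bspec[OF \<theta>(2), of "Poly_Mapping.single w 1"] that by simp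
  have qw: "q (wcls N w) \<in> carrier Q" if "w \<in> uwords N" for w
    using q_hom(1)[OF wcls_carrier[OF that]] .
  have \<theta>S: "linear_functional Q (\<lambda>x. \<theta> (S x))"
    using \<theta>(1) S(2,3) Sc unfolding linear_functional_def by simp
  \<comment> \<open>The antipode axiom on a matrix entry, read through a functional: the
    comultiplication gives the sum over \<open>c\<close>, the counit the Kronecker delta.\<close>
  have antipode: "(\<Sum>c\<in>vecs N x. \<eta> (S (q (wcls N (uw a c))) \<otimes>\<^bsub>Q\<^esub> q (wcls N (uw c b)))) = (if a = b then \<eta> \<one>\<^bsub>Q\<^esub> else 0)"
    if \<eta>: "linear_functional Q \<eta>" and a: "a \<in> vecs N x" and b: "b \<in> vecs N x" for \<eta> a b x
  proof -
    let ?w = "uw a b" and ?\<beta> = "\<lambda>s t. \<eta> (S s \<otimes>\<^bsub>Q\<^esub> t)"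
    have w: "?w \<in> uwords N" "Poly_Mapping.single ?w 1 \<in> carrier (free_alg N)"
      using a b by (simp_all add: uw_vecs)
    have ab: "map snd a = map snd b" "map snd a = x"
      using a b by (auto simp: vecs_def)
    have "map snd (row ?w) = map snd ?w"
      by (simp add: row_def comp_def)
    then have snd_w: "map snd ?w = x" "row ?w = a" "col ?w = b"
      using ab row_uw[OF ab(1)] col_uw[OF ab(1)] by simp_all
    have add: "\<eta> (s \<oplus>\<^bsub>Q\<^esub> t) = \<eta> s + \<eta> t" if "s \<in> carrier Q" "t \<in> carrier Q" for s t
      using \<eta> that unfolding linear_functional_def by blast
    have scale: "\<eta> (c \<odot>\<^bsub>Q\<^esub> s) = c * \<eta> s" if "s \<in> carrier Q" for s c
      using \<eta> that unfolding linear_functional_def by blast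
    have \<beta>: "bilinear_form Q Q ?\<beta>"
      using Sc by (intro bilinear_formI)
        (simp_all add: S(2,3) Q.l_distr Q.r_distr star_algebraD[OF star_algebra_Q] add scale)
    have "tfun ?\<beta> (comult Q (q (wcls N ?w))) = \<eta> (tensor_lift Q (\<lambda>s t. S s \<otimes>\<^bsub>Q\<^esub> t) (comult Q (q (wcls N ?w))))"
      using tensor_lift_functional[OF star_algebra_Q star_algebra_Q abelian_monoid_star_algebra[OF star_algebra_Q]
          star_algebraD(2)[OF star_algebra_Q] \<eta> comult_Q_closed[OF qw[OF w(1)]], of "\<lambda>s t. S s \<otimes>\<^bsub>Q\<^esub> t"] Sc
      by simp
    also have "\<dots> = counit Q (q (wcls N ?w)) * \<eta> \<one>\<^bsub>Q\<^esub>"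
      using bspec[OF S(4) qw[OF w(1)]] scale by simp
    also have "counit Q (q (wcls N ?w)) = counit (free_unitary N) (wcls N ?w)"
      using quot wcls_carrier[OF w(1)] unfolding hopf_star_quotient_def hopf_star_hom_def by simp
    also have "\<dots> = of_bool (a = b)"
      using counit_wcls[OF w(1)] snd_w by simp
    finally have "tfun ?\<beta> (comult Q (q (wcls N ?w))) = (if a = b then \<eta> \<one>\<^bsub>Q\<^esub> else 0)"
      by simp
    moreover have "tfun ?\<beta> (comult Q (q (wcls N ?w))) =
        (\<Sum>c\<in>vecs N x. \<eta> (S (q (wcls N (uw a c))) \<otimes>\<^bsub>Q\<^esub> q (wcls N (uw c b))))"
      using comult_q[OF \<beta> w(2)] by (simp add: convolve_def snd_w)
    ultimately show ?thesis
      by simp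
  qed
  \<comment> \<open>The sum over \<open>b\<close> and \<open>c\<close> of the products of
    \<open>S\<close> of the entry \<open>(a, c)\<close>, the entry \<open>(c, b)\<close> and the
    adjoint of the entry \<open>(d, b)\<close> is evaluated in both orders. Over \<open>c\<close>
    first the antipode axiom leaves the adjoint of \<open>(d, a)\<close>, over \<open>b\<close>
    first unitarity leaves \<open>S\<close> of \<open>(a, d)\<close>.\<close>
  have *: "\<theta> (S (q (wcls N (uw a d)))) = \<phi> (adj (uw d a))" if a: "a \<in> vecs N x" and d: "d \<in> vecs N x" for a d x
  proof -
    define z where "z b = q (wcls N (adj (uw d b)))" for b
    have z: "z b \<in> carrier Q" if "b \<in> vecs N x" for b
      unfolding z_def using that d by (intro qw) (simp add: uw_vecs)
    have uv: "uw c b \<in> uwords N" if "c \<in> vecs N x" "b \<in> vecs N x" for b c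
      using that by (rule uw_vecs)
    have "\<phi> (adj (uw d a)) = (\<Sum>b\<in>vecs N x. if a = b then \<theta> (z b) else 0)"
      using a d by (simp add: z_def \<theta>w uv)
    also have "\<dots> = (\<Sum>b\<in>vecs N x. \<Sum>c\<in>vecs N x.
        \<theta> ((S (q (wcls N (uw a c))) \<otimes>\<^bsub>Q\<^esub> q (wcls N (uw c b))) \<otimes>\<^bsub>Q\<^esub> z b))"
      using antipode[OF linear_functional_mult(1)[OF star_algebra_Q \<theta>(1) z] a] z
      by (intro sum.cong refl) simp
    also have "\<dots> = (\<Sum>c\<in>vecs N x. \<Sum>b\<in>vecs N x.
        \<theta> ((S (q (wcls N (uw a c))) \<otimes>\<^bsub>Q\<^esub> q (wcls N (uw c b))) \<otimes>\<^bsub>Q\<^esub> z b))"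
      by (rule sum.swap)
    also have "\<dots> = (\<Sum>c\<in>vecs N x. if c = d then \<theta> (S (q (wcls N (uw a d)))) else 0)"
    proof (intro sum.cong refl)
      fix c assume c: "c \<in> vecs N x"
      have s: "S (q (wcls N (uw a c))) \<in> carrier Q"
        using Sc qw uv a c by blast
      define \<rho> where "\<rho> w = \<theta> (S (q (wcls N (uw a c))) \<otimes>\<^bsub>Q\<^esub> q (wcls N w))" for w
      have \<rho>: "unitary_functional N \<rho>"
        unfolding \<rho>_def by (rule functional_q(2)[OF linear_functional_mult(2)[OF star_algebra_Q \<theta>(1) s]])
      have "\<theta> ((S (q (wcls N (uw a c))) \<otimes>\<^bsub>Q\<^esub> q (wcls N (uw c b))) \<otimes>\<^bsub>Q\<^esub> z b) =
          \<rho> ([] @ uw c b @ adj (uw d b) @ [])" if b: "b \<in> vecs N x" for b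
      proof -
        have "q (wcls N (uw c b)) \<otimes>\<^bsub>Q\<^esub> z b = q (wcls N (uw c b @ adj (uw d b)))"
          using uv[OF c b] uv[OF d b] unfolding z_def
          by (simp add: q_hom(3)[symmetric] wcls_carrier wcls_mult)
        then show ?thesis
          using s qw[OF uv[OF c b]] z[OF b] by (simp add: \<rho>_def Q.m_assoc)
      qed
      then have "(\<Sum>b\<in>vecs N x. \<theta> ((S (q (wcls N (uw a c))) \<otimes>\<^bsub>Q\<^esub> q (wcls N (uw c b))) \<otimes>\<^bsub>Q\<^esub> z b)) =
          (if c = d then \<rho> ([] @ []) else 0)"
        using row_unitary[OF \<rho>, of "[]" "[]" c x d] c d by simp
      also have "\<rho> ([] @ []) = \<theta> (S (q (wcls N (uw a c))))"
        using s by (simp add: \<rho>_def wcls_Nil q_hom(4))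
      finally show "(\<Sum>b\<in>vecs N x. \<theta> ((S (q (wcls N (uw a c))) \<otimes>\<^bsub>Q\<^esub> q (wcls N (uw c b))) \<otimes>\<^bsub>Q\<^esub> z b)) =
          (if c = d then \<theta> (S (q (wcls N (uw a d)))) else 0)"
        by auto
    qed
    also have "\<dots> = \<theta> (S (q (wcls N (uw a d))))"
      using d by simp
    finally show ?thesis
      by simp
  qed
  show ?thesis
    by (intro bexI[OF _ functional_q(3)[OF \<theta>S]] allI ballI) (rule *)
qed

text \<open>The star contributes a conjugate and an adjoint word; the antipode undoes the adjoint
  while exchanging rows and columns. What remains is the conjugate transpose.\<close>

lemma annihilator_dagger:
  assumes "\<phi> \<in> annihilator"
  shows "dagger \<phi> \<in> annihilator"
proof -
  obtain \<psi> where \<psi>: "\<psi> \<in> annihilator"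
    "\<forall>x. \<forall>a\<in>vecs N x. \<forall>b\<in>vecs N x. \<psi> (uw a b) = cnj (\<phi> (adj (adj (uw b a))))"
    by (rule bexE[OF antipode_annihilator[OF annihilator_star[OF assms]]])
  have "lin (dagger \<phi>) f = lin \<psi> f" if f: "f \<in> kernel_words" for f
  proof (rule lin_cong)
    fix u assume "u \<in> Poly_Mapping.keys f"
    then have u: "row u \<in> vecs N (map snd u)" "col u \<in> vecs N (map snd u)"
      using f row_col_vecs[of u N] by (auto simp: kernel_words_def)
    show "dagger \<phi> u = \<psi> u"
      using bspec[OF bspec[OF spec[OF \<psi>(2)] u(1)] u(2)] by (simp add: dagger_def uw_row_col)
  qed
  then show ?thesis
    using \<psi>(1) by (simp add: annihilator_def)
qed

lemma fun_subspace_annihilator: "fun_subspace annihilator"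
proof -
  have "lin (\<lambda>_. 0) f = 0" for f :: "uword \<Rightarrow>\<^sub>0 complex"
    by (simp add: lin_def)
  then show ?thesis
    unfolding fun_subspace_def annihilator_def by (simp add: lin_fun_add lin_fun_scale)
qed

text \<open>\<open>B\<close> is not known to be a ring, so \<open>\<psi> \<zero>\<close> is only known to be idempotent.\<close>

lemma factor_vanish:
  assumes fac: "factors_through (free_unitary N) B \<pi> Q q" and f: "f \<in> kernel_words"
  shows "\<pi> (cls N f) \<oplus>\<^bsub>B\<^esub> \<pi> (cls N f) = \<pi> (cls N f)"
proof -
  obtain \<psi> where \<psi>: "hopf_star_hom Q B \<psi>" "\<forall>x\<in>carrier (uplus N). \<pi> x = \<psi> (q x)"
    using fac unfolding factors_through_def free_unitary_simps by blast
  have "\<pi> (cls N f) = \<psi> \<zero>\<^bsub>Q\<^esub>"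
    using bspec[OF \<psi>(2) cls_carrier[of f N]] f by (simp add: kernel_words_def)
  moreover have "\<psi> (\<zero>\<^bsub>Q\<^esub> \<oplus>\<^bsub>Q\<^esub> \<zero>\<^bsub>Q\<^esub>) = \<psi> \<zero>\<^bsub>Q\<^esub> \<oplus>\<^bsub>B\<^esub> \<psi> \<zero>\<^bsub>Q\<^esub>"
    using \<psi>(1) ring_hom_add[of \<psi> Q B "\<zero>\<^bsub>Q\<^esub>" "\<zero>\<^bsub>Q\<^esub>"] by (simp add: hopf_star_hom_def star_hom_def)
  ultimately show ?thesis
    by simp
qed

text \<open>An element equal to its own double is killed by every additive \<theta>.\<close>

lemma factor_annihilator:
  assumes fac: "factors_through (free_unitary N) B \<pi> Q q"
    and \<theta>: "\<And>x y. x \<in> carrier B \<Longrightarrow> y \<in> carrier B \<Longrightarrow> \<theta> (x \<oplus>\<^bsub>B\<^esub> y) = \<theta> x + \<theta> y"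
    and \<pi>: "\<And>f. f \<in> carrier (free_alg N) \<Longrightarrow> \<pi> (cls N f) \<in> carrier B \<and> \<theta> (\<pi> (cls N f)) = lin \<phi> f"
  shows "\<phi> \<in> annihilator"
  unfolding annihilator_def
proof (intro CollectI ballI)
  fix f assume f: "f \<in> kernel_words"
  then have "\<pi> (cls N f) \<in> carrier B" "\<theta> (\<pi> (cls N f)) = lin \<phi> f"
    using \<pi>[of f] by (simp_all add: kernel_words_def)
  then show "lin \<phi> f = 0"
    using factor_vanish[OF fac f] \<theta>[of "\<pi> (cls N f)" "\<pi> (cls N f)"] by simp
qed

end

section \<open>Representative functions\<close>

lemma representative_functionsI:
  fixes J :: "'j set" and G :: "('g::topological_space, 'r) monoid_scheme"
  assumes J: "finite J"
    and cont: "\<And>i j. i \<in> J \<Longrightarrow> j \<in> J \<Longrightarrow> continuous_on (carrier G) (\<lambda>g. \<rho> g i j)"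
    and one: "\<And>i j. i \<in> J \<Longrightarrow> j \<in> J \<Longrightarrow> \<rho> \<one>\<^bsub>G\<^esub> i j = (if i = j then 1 else 0)"
    and mult: "\<And>g h i j. g \<in> carrier G \<Longrightarrow> h \<in> carrier G \<Longrightarrow> i \<in> J \<Longrightarrow> j \<in> J \<Longrightarrow>
      \<rho> (g \<otimes>\<^bsub>G\<^esub> h) i j = (\<Sum>k\<in>J. \<rho> g i k * \<rho> h k j)"
    and f: "\<And>g. f g = (if g \<in> carrier G then \<Sum>i\<in>J. \<Sum>j\<in>J. c i j * \<rho> g i j else 0)"
  shows "f \<in> representative_functions G"
proof -
  obtain e where e: "bij_betw e {..<card J} J"
    using ex_bij_betw_nat_finite[OF J] by (auto simp: atLeast0LessThan)
  have mem: "e i \<in> J" if "i < card J" for i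
    using bij_betwE[OF e] that by blast
  have inj: "e i = e j \<longleftrightarrow> i = j" if "i < card J" "j < card J" for i j
    using e that by (auto simp: bij_betw_def inj_on_def)
  have "continuous_rep G (card J) (\<lambda>g i j. \<rho> g (e i) (e j))"
    unfolding continuous_rep_def
  proof (intro conjI allI impI ballI)
    fix g h i j assume *: "g \<in> carrier G" "h \<in> carrier G" "i < card J" "j < card J"
    show "\<rho> (g \<otimes>\<^bsub>G\<^esub> h) (e i) (e j) = (\<Sum>k<card J. \<rho> g (e i) (e k) * \<rho> h (e k) (e j))"
      using mult[OF *(1,2) mem[OF *(3)] mem[OF *(4)]]
        sum.reindex_bij_betw[OF e, of "\<lambda>k. \<rho> g (e i) k * \<rho> h k (e j)"] by simp
  qed (simp_all add: cont one mem inj)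
  moreover have "f = (\<lambda>g. if g \<in> carrier G
      then \<Sum>i<card J. \<Sum>j<card J. c (e i) (e j) * \<rho> g (e i) (e j) else 0)"
  proof
    fix g
    have "(\<Sum>i\<in>J. \<Sum>j\<in>J. c i j * \<rho> g i j) = (\<Sum>i<card J. \<Sum>j\<in>J. c (e i) j * \<rho> g (e i) j)"
      by (rule sum.reindex_bij_betw[OF e, symmetric])
    also have "\<dots> = (\<Sum>i<card J. \<Sum>j<card J. c (e i) (e j) * \<rho> g (e i) (e j))"
      by (intro sum.cong refl sum.reindex_bij_betw[OF e, symmetric])
    finally show "f g = (if g \<in> carrier G
        then \<Sum>i<card J. \<Sum>j<card J. c (e i) (e j) * \<rho> g (e i) (e j) else 0)"
      by (simp add: f)
  qed
  ultimately show ?thesis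
    unfolding representative_functions_def
    by (intro CollectI exI[of _ "card J"] exI[of _ "\<lambda>g i j. \<rho> g (e i) (e j)"] exI[of _ "\<lambda>i j. c (e i) (e j)"] conjI)
qed

lemma continuous_repD:
  assumes "continuous_rep G d \<rho>"
  shows "\<And>i j. i < d \<Longrightarrow> j < d \<Longrightarrow> continuous_on (carrier G) (\<lambda>g. \<rho> g i j)"
    "\<And>i j. i < d \<Longrightarrow> j < d \<Longrightarrow> \<rho> \<one>\<^bsub>G\<^esub> i j = (if i = j then 1 else 0)"
    "\<And>g h i j. g \<in> carrier G \<Longrightarrow> h \<in> carrier G \<Longrightarrow> i < d \<Longrightarrow> j < d \<Longrightarrow>
      \<rho> (g \<otimes>\<^bsub>G\<^esub> h) i j = (\<Sum>k<d. \<rho> g i k * \<rho> h k j)"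
  using assms unfolding continuous_rep_def by auto

lemma representative_functionsE:
  fixes G :: "('g::topological_space, 'r) monoid_scheme"
  assumes "f \<in> representative_functions G"
  obtains d \<rho> c where "continuous_rep G d \<rho>"
    "f = (\<lambda>g. if g \<in> carrier G then \<Sum>i<d. \<Sum>j<d. c i j * \<rho> g i j else 0)"
  using assms unfolding representative_functions_def by blast

context
  fixes G :: "('g::topological_space, 'r) monoid_scheme"
begin

lemma representative_one: "(\<lambda>g. if g \<in> carrier G then 1 else 0) \<in> representative_functions G"
  by (rule representative_functionsI[of "{()}" G "\<lambda>_ _ _. 1" _ "\<lambda>_ _. 1"]) auto

lemma representative_scale:
  assumes "f \<in> representative_functions G"
  shows "(\<lambda>g. a * f g) \<in> representative_functions G"
proof -
  obtain d \<rho> and c :: "nat \<Rightarrow> nat \<Rightarrow> complex" where rep: "continuous_rep G d \<rho>"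
    and f: "f = (\<lambda>g. if g \<in> carrier G then \<Sum>i<d. \<Sum>j<d. c i j * \<rho> g i j else 0)"
    using assms by (rule representative_functionsE)
  note * = continuous_repD[OF rep]
  show ?thesis
    by (rule representative_functionsI[of "{..<d}" G \<rho> _ "\<lambda>i j. a * c i j"])
      (use * in \<open>simp_all add: f sum_distrib_left mult_ac\<close>)
qed

lemma representative_cnj:
  assumes "f \<in> representative_functions G"
  shows "(\<lambda>g. cnj (f g)) \<in> representative_functions G"
proof -
  obtain d \<rho> and c :: "nat \<Rightarrow> nat \<Rightarrow> complex" where rep: "continuous_rep G d \<rho>"
    and f: "f = (\<lambda>g. if g \<in> carrier G then \<Sum>i<d. \<Sum>j<d. c i j * \<rho> g i j else 0)"
    using assms by (rule representative_functionsE)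
  note * = continuous_repD[OF rep]
  show ?thesis
    by (rule representative_functionsI[of "{..<d}" G "\<lambda>g i j. cnj (\<rho> g i j)" _ "\<lambda>i j. cnj (c i j)"])
      (use * in \<open>auto simp: f intro: continuous_on_cnj\<close>)
qed

text \<open>The direct sum of the two representations, with block diagonal coefficients.\<close>

lemma representative_add:
  assumes "f \<in> representative_functions G" "f' \<in> representative_functions G"
  shows "(\<lambda>g. f g + f' g) \<in> representative_functions G"
proof -
  obtain d \<rho> and c :: "nat \<Rightarrow> nat \<Rightarrow> complex" where rep: "continuous_rep G d \<rho>"
    and f: "f = (\<lambda>g. if g \<in> carrier G then \<Sum>i<d. \<Sum>j<d. c i j * \<rho> g i j else 0)"
    using assms(1) by (rule representative_functionsE)
  note * = continuous_repD[OF rep]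
  obtain d' \<rho>' and c' :: "nat \<Rightarrow> nat \<Rightarrow> complex" where rep': "continuous_rep G d' \<rho>'"
    and f': "f' = (\<lambda>g. if g \<in> carrier G then \<Sum>i<d'. \<Sum>j<d'. c' i j * \<rho>' g i j else 0)"
    using assms(2) by (rule representative_functionsE)
  note ** = continuous_repD[OF rep']
  define block where "block m m' p r = (case p of
      Inl i \<Rightarrow> (case r of Inl j \<Rightarrow> m i j | Inr _ \<Rightarrow> (0 :: complex))
    | Inr i \<Rightarrow> (case r of Inl _ \<Rightarrow> 0 | Inr j \<Rightarrow> m' i j))" for m m' :: "nat \<Rightarrow> nat \<Rightarrow> complex" and p r
  have block [simp]: "block m m' (Inl i) (Inl j) = m i j" "block m m' (Inl i) (Inr k) = 0"
    "block m m' (Inr k) (Inl j) = 0" "block m m' (Inr k) (Inr l) = m' k l" for m m' i j k l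
    by (simp_all add: block_def)
  show ?thesis
    by (rule representative_functionsI[of "{..<d} <+> {..<d'}" G "\<lambda>g. block (\<rho> g) (\<rho>' g)" _ "block c c'"])
      (use * ** in \<open>auto simp: f f' sum.Plus split: if_splits\<close>)
qed

text \<open>The tensor product of the two representations, with Kronecker products of matrices and
  coefficients.\<close>

lemma representative_mult:
  assumes "f \<in> representative_functions G" "f' \<in> representative_functions G"
  shows "(\<lambda>g. f g * f' g) \<in> representative_functions G"
proof -
  obtain d \<rho> and c :: "nat \<Rightarrow> nat \<Rightarrow> complex" where rep: "continuous_rep G d \<rho>"
    and f: "f = (\<lambda>g. if g \<in> carrier G then \<Sum>i<d. \<Sum>j<d. c i j * \<rho> g i j else 0)"
    using assms(1) by (rule representative_functionsE)
  note * = continuous_repD[OF rep]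
  obtain d' \<rho>' and c' :: "nat \<Rightarrow> nat \<Rightarrow> complex" where rep': "continuous_rep G d' \<rho>'"
    and f': "f' = (\<lambda>g. if g \<in> carrier G then \<Sum>i<d'. \<Sum>j<d'. c' i j * \<rho>' g i j else 0)"
    using assms(2) by (rule representative_functionsE)
  note ** = continuous_repD[OF rep']
  let ?kron = "\<lambda>m m' (p :: nat \<times> nat) r. m (fst p) (fst r) * m' (snd p) (snd r)"
  have sum_pairs: "(\<Sum>p\<in>{..<d} \<times> {..<d'}. F (fst p) * F' (snd p)) = (\<Sum>i<d. F i) * (\<Sum>j<d'. F' j)"
    for F F' :: "nat \<Rightarrow> complex"
    by (simp add: sum_product sum.cartesian_product case_prod_beta)
  show ?thesis
  proof (rule representative_functionsI[of "{..<d} \<times> {..<d'}" G "\<lambda>g. ?kron (\<rho> g) (\<rho>' g)" _ "?kron c c'"])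
    fix p r assume pr: "p \<in> {..<d} \<times> {..<d'}" "r \<in> {..<d} \<times> {..<d'}"
    show "continuous_on (carrier G) (\<lambda>g. ?kron (\<rho> g) (\<rho>' g) p r)"
      using pr by (intro continuous_on_mult *(1) **(1)) auto
    show "?kron (\<rho> \<one>\<^bsub>G\<^esub>) (\<rho>' \<one>\<^bsub>G\<^esub>) p r = (if p = r then 1 else 0)"
      using pr by (auto simp: *(2) **(2) split: if_splits)
    fix g h assume gh: "g \<in> carrier G" "h \<in> carrier G"
    show "?kron (\<rho> (g \<otimes>\<^bsub>G\<^esub> h)) (\<rho>' (g \<otimes>\<^bsub>G\<^esub> h)) p r =
        (\<Sum>k\<in>{..<d} \<times> {..<d'}. ?kron (\<rho> g) (\<rho>' g) p k * ?kron (\<rho> h) (\<rho>' h) k r)"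
      using pr gh *(3)[of g h "fst p" "fst r"] **(3)[of g h "snd p" "snd r"]
        sum_pairs[of "\<lambda>k. \<rho> g (fst p) k * \<rho> h k (fst r)" "\<lambda>k. \<rho>' g (snd p) k * \<rho>' h k (snd r)"]
      by (auto simp: mult_ac)
  next
    fix g
    have "(\<Sum>i<d. \<Sum>j<d. c i j * \<rho> g i j) * (\<Sum>i<d'. \<Sum>j<d'. c' i j * \<rho>' g i j) =
        (\<Sum>p\<in>{..<d} \<times> {..<d'}. (\<Sum>j<d. c (fst p) j * \<rho> g (fst p) j) * (\<Sum>j<d'. c' (snd p) j * \<rho>' g (snd p) j))"
      using sum_pairs[of "\<lambda>i. \<Sum>j<d. c i j * \<rho> g i j" "\<lambda>i. \<Sum>j<d'. c' i j * \<rho>' g i j"] by simp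
    also have "\<dots> = (\<Sum>p\<in>{..<d} \<times> {..<d'}. \<Sum>r\<in>{..<d} \<times> {..<d'}. ?kron c c' p r * ?kron (\<rho> g) (\<rho>' g) p r)"
    proof (intro sum.cong refl)
      fix p
      show "(\<Sum>j<d. c (fst p) j * \<rho> g (fst p) j) * (\<Sum>j<d'. c' (snd p) j * \<rho>' g (snd p) j) =
          (\<Sum>r\<in>{..<d} \<times> {..<d'}. ?kron c c' p r * ?kron (\<rho> g) (\<rho>' g) p r)"
        using sum_pairs[of "\<lambda>j. c (fst p) j * \<rho> g (fst p) j" "\<lambda>j. c' (snd p) j * \<rho>' g (snd p) j"]
        by (simp add: mult_ac)
    qed
    finally show "f g * f' g = (if g \<in> carrier G then
        \<Sum>p\<in>{..<d} \<times> {..<d'}. \<Sum>r\<in>{..<d} \<times> {..<d'}. ?kron c c' p r * ?kron (\<rho> g) (\<rho>' g) p r else 0)"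
      by (simp add: f f')
  qed simp
qed

lemma representative_hopf_simps [simp]:
  "carrier (representative_hopf G) = representative_functions G"
  "mult (representative_hopf G) = (\<lambda>f f' g. f g * f' g)"
  "one (representative_hopf G) = (\<lambda>g. if g \<in> carrier G then 1 else 0)"
  "zero (representative_hopf G) = (\<lambda>g. 0)"
  "add (representative_hopf G) = (\<lambda>f f' g. f g + f' g)"
  "smult (representative_hopf G) = (\<lambda>c f g. c * f g)"
  "star (representative_hopf G) = (\<lambda>f g. cnj (f g))"
  by (simp_all add: representative_hopf_def representative_star_alg_def Let_def star_alg.defs hopf_star_alg.defs)

lemma abelian_monoid_representative: "abelian_monoid (representative_hopf G)"
proof (rule abelian_monoidI)
  show "\<zero>\<^bsub>representative_hopf G\<^esub> \<in> carrier (representative_hopf G)"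
    using representative_scale[OF representative_one, of 0] by simp
qed (simp_all add: representative_add add_ac)

lemma linear_functional_eval: "linear_functional (representative_hopf G) (\<lambda>f. f g)"
  by (simp add: linear_functional_def)

end

section \<open>Points of \<open>U_N\<close> as functionals on the quotient\<close>

lemma unitary_coordinate_representative:
  assumes "i < N" "j < N"
  shows "unitary_coordinate N i j \<in> representative_functions (unitary_group N)"
proof (rule representative_functionsI[of "{..<N}" _ "\<lambda>g. g" _ "\<lambda>k l. of_bool (k = i \<and> l = j)"])
  fix k l
  show "continuous_on (carrier (unitary_group N)) (\<lambda>g. g k l)"
    using continuous_on_compose2[OF continuous_on_product_coordinates[of l] continuous_on_product_coordinates[of k]]
    by (rule continuous_on_subset) auto
next
  fix g :: "nat \<Rightarrow> nat \<Rightarrow> complex"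
  have "(\<Sum>k<N. \<Sum>l<N. of_bool (k = i \<and> l = j) * g k l) = (\<Sum>k<N. \<Sum>l<N. if l = j then if k = i then g k l else 0 else 0)"
    by (intro sum.cong refl) auto
  also have "\<dots> = g i j"
    using assms by simp
  finally show "unitary_coordinate N i j g = (if g \<in> carrier (unitary_group N)
      then \<Sum>k<N. \<Sum>l<N. of_bool (k = i \<and> l = j) * g k l else 0)"
    by (simp add: unitary_coordinate_def)
qed (auto simp: unitary_group_def)

lemma word_eval_representative:
  assumes "w \<in> uwords N"
  shows "word_eval (representative_hopf (unitary_group N)) (\<lambda>(i, j). unitary_coordinate N i j) w
      \<in> representative_functions (unitary_group N)"
  using assms
  by (induction w)
    (auto simp: representative_one intro!: representative_mult representative_cnj unitary_coordinate_representative)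

lemma word_eval_ev:
  assumes "g \<in> carrier (unitary_group N)"
  shows "word_eval (representative_hopf (unitary_group N)) (\<lambda>(i, j). unitary_coordinate N i j) w g = ev g w"
  using assms by (induction w) (auto simp: unitary_coordinate_def)

theorem ev_annihilator:
  assumes quot: "hopf_star_quotient (free_unitary N) Q q"
    and fac: "factors_through (free_unitary N) (representative_hopf (unitary_group N)) (to_unitary N) Q q"
    and g: "g \<in> carrier (unitary_group N)"
  shows "ev g \<in> annihilator N Q q"
proof (rule factor_annihilator[OF quot fac, of "\<lambda>f. f g"])
  fix f assume f: "f \<in> carrier (free_alg N)"
  note hom = presented_hom_functional[OF abelian_monoid_representative _ linear_functional_eval[of _ g] _ f,
      of "unitary_group N" "\<lambda>(i, j). unitary_coordinate N i j"]
  show "to_unitary N (cls N f) \<in> carrier (representative_hopf (unitary_group N)) \<and> to_unitary N (cls N f) g = lin (ev g) f"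
    unfolding to_unitary_def
    using hom(1) hom(2)[OF _ _ unitary_functional_ev[OF g] word_eval_ev[OF g]]
    by (simp add: representative_scale word_eval_representative)
qed simp

section \<open>The corner\<close>

text \<open>The relations make all representatives of a class agree, so the choice in the definition
  of \<theta> is harmless.\<close>

lemma functional_descends:
  assumes \<phi>: "unitary_functional M \<phi>"
  shows "\<exists>\<theta>. linear_functional (uplus M) \<theta> \<and> (\<forall>f\<in>carrier (free_alg M). \<theta> (cls M f) = lin \<phi> f)"
proof -
  define \<theta> where "\<theta> X = lin \<phi> (SOME f. f \<in> X)" for X
  have val: "\<theta> (cls M f) = lin \<phi> f" if f: "f \<in> carrier (free_alg M)" for f
  proof -
    interpret ideal "rel_ideal M" "free_alg M" by (rule ideal_rel)
    have "f \<in> cls M f"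
      unfolding cls_def using a_rcos_self[OF f] .
    then have "(SOME f'. f' \<in> cls M f) \<in> cls M f"
      by (rule someI)
    then obtain n where "n \<in> rel_ideal M" "(SOME f'. f' \<in> cls M f) = n + f"
      unfolding cls_def a_r_coset_def' by auto
    then show ?thesis
      using unitary_functional_vanish[OF \<phi>] by (simp add: \<theta>_def)
  qed
  have "linear_functional (uplus M) \<theta>"
    unfolding linear_functional_def
  proof (intro conjI ballI allI)
    fix x assume "x \<in> carrier (uplus M)"
    then obtain f where f: "f \<in> carrier (free_alg M)" "x = cls M f"
      by (rule cls_carrierE)
    have s: "Poly_Mapping.map ((*) c) f \<in> carrier (free_alg M)" for c
      using star_algebraD(2)[OF star_algebra_free f(1), of c] by simp
    show "\<theta> (c \<odot>\<^bsub>uplus M\<^esub> x) = c * \<theta> x" for c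
      using val[OF s[of c]] val[OF f(1)] by (simp add: f(2) cls_smult[OF f(1)])
    fix y assume "y \<in> carrier (uplus M)"
    then obtain g where g: "g \<in> carrier (free_alg M)" "y = cls M g"
      by (rule cls_carrierE)
    have "f + g \<in> carrier (free_alg M)"
      using ring.ring_simprules(1)[OF star_algebraD(1)[OF star_algebra_free] f(1) g(1)] by simp
    from val[OF this] show "\<theta> (x \<oplus>\<^bsub>uplus M\<^esub> y) = \<theta> x + \<theta> y"
      using val[OF f(1)] val[OF g(1)] by (simp add: f(2) g(2) cls_add[OF f(1) g(1)])
  qed
  then show ?thesis
    using val by blast
qed

definition corner_gen :: "nat \<Rightarrow> nat \<times> nat \<Rightarrow> uplus_elem" where
  "corner_gen M = (\<lambda>(i, j). if i < M \<and> j < M then free_unitary_gen M i j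
    else if i = M \<and> j = M then \<one>\<^bsub>free_unitary M\<^esub> else \<zero>\<^bsub>free_unitary M\<^esub>)"

lemma corner_filter:
  "\<forall>l\<in>set w. fst (fst l) < M \<and> snd (fst l) < M \<or> fst (fst l) = M \<and> snd (fst l) = M \<Longrightarrow>
    filter (\<lambda>l. fst (fst l) < M) w \<in> uwords M"
  by (induction w) auto

text \<open>Letters at the last diagonal entry become 1 and drop out; any other letter outside the
  block kills the word.\<close>

lemma word_eval_corner:
  "word_eval (free_unitary M) (corner_gen M) w =
    (if \<forall>l\<in>set w. fst (fst l) < M \<and> snd (fst l) < M \<or> fst (fst l) = M \<and> snd (fst l) = M
     then wcls M (filter (\<lambda>l. fst (fst l) < M) w) else \<zero>\<^bsub>uplus M\<^esub>)"
proof (induction w)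
  case Nil
  then show ?case
    by (simp add: wcls_Nil)
next
  case (Cons l w)
  interpret R: ring "uplus M" by (rule star_algebraD(1)[OF star_algebra_free_unitary_star_alg])
  obtain i j e where l: "l = ((i, j), e)"
    by (metis prod.exhaust)
  let ?a = "if snd l then star (uplus M) (corner_gen M (fst l)) else corner_gen M (fst l)"
  let ?P = "\<forall>l\<in>set w. fst (fst l) < M \<and> snd (fst l) < M \<or> fst (fst l) = M \<and> snd (fst l) = M"
  let ?v = "filter (\<lambda>l. fst (fst l) < M) w"
  note v = corner_filter[of w M]
  have closed: "(if ?P then wcls M ?v else \<zero>\<^bsub>uplus M\<^esub>) \<in> carrier (uplus M)"
    using wcls_carrier[OF v] by auto
  have step: "word_eval (free_unitary M) (corner_gen M) (l # w) =
      ?a \<otimes>\<^bsub>uplus M\<^esub> (if ?P then wcls M ?v else \<zero>\<^bsub>uplus M\<^esub>)"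
    using Cons.IH by simp
  consider "i < M" "j < M" | "i = M" "j = M" | "\<not> (i < M \<and> j < M)" "\<not> (i = M \<and> j = M)"
    by linarith
  then show ?case
  proof cases
    case 1
    have "?a = wcls M [l]"
      using 1 by (simp add: l corner_gen_def free_unitary_gen_eq wcls_star)
    then show ?thesis
      unfolding step using 1 wcls_mult[of "[l]" M ?v] v wcls_carrier[of "[l]" M] by (auto simp: l)
  next
    case 2
    have "?a = \<one>\<^bsub>uplus M\<^esub>"
      using 2 wcls_star[of "[]" M] by (simp add: l corner_gen_def wcls_Nil)
    then show ?thesis
      unfolding step using 2 R.l_one[OF closed] by (auto simp: l)
  next
    case 3
    have "?a = \<zero>\<^bsub>uplus M\<^esub>"
      using 3 star_zero[OF star_algebra_free_unitary_star_alg, of M] by (auto simp: l corner_gen_def)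
    then show ?thesis
      unfolding step using 3 R.l_null[OF closed] by (auto simp: l)
  qed
qed

text \<open>The functional \<open>tor s t\<close> of the corner pulls back to
  \<open>tor s t\<close>. The letters that drop out have index \<open>N - 1\<close>, which is at
  least 2 and so a trivial generator, and a word killed by the corner map contains an off-diagonal
  letter.\<close>

theorem tor_annihilator:
  assumes quot: "hopf_star_quotient (free_unitary N) Q q" and N: "N \<ge> 3"
    and fac: "factors_through (free_unitary N) (free_unitary (N - 1)) (to_corner N) Q q"
    and s: "reduced_word s"
  shows "tor s t \<in> annihilator N Q q"
proof -
  define M where "M = N - 1"
  have M: "M \<ge> 2" "N = Suc M"
    using N by (simp_all add: M_def)
  interpret R: ring "uplus M" by (rule star_algebraD(1)[OF star_algebra_free_unitary_star_alg])
  have to_corner: "to_corner N = presented_hom (free_unitary M) (corner_gen M)"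
    unfolding to_corner_def corner_gen_def M_def by (rule refl)
  obtain \<theta> where \<theta>: "linear_functional (uplus M) \<theta>" "\<forall>f\<in>carrier (free_alg M). \<theta> (cls M f) = lin (tor s t) f"
    using functional_descends[OF unitary_functional_tor[OF s]] by blast
  have \<theta>': "linear_functional (free_unitary M) \<theta>"
    using \<theta>(1) by (simp add: linear_functional_def)
  have closed: "word_eval (free_unitary M) (corner_gen M) w \<in> carrier (free_unitary M)" for w
    using wcls_carrier[OF corner_filter[of w M]] by (simp add: word_eval_corner)
  have eval: "\<theta> (word_eval (free_unitary M) (corner_gen M) w) = tor s t w" if w: "w \<in> uwords N" for w
  proof (cases "\<forall>l\<in>set w. fst (fst l) < M \<and> snd (fst l) < M \<or> fst (fst l) = M \<and> snd (fst l) = M")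
    case True
    let ?v = "filter (\<lambda>l. fst (fst l) < M) w"
    have "\<theta> (word_eval (free_unitary M) (corner_gen M) w) = tor s t ?v"
      using True bspec[OF \<theta>(2), of "Poly_Mapping.single ?v 1"] corner_filter[OF True] by (simp add: word_eval_corner)
    moreover have "filter low (row ?v) = filter low (row w)"
      using M(1) by (induction w) auto
    moreover have "(\<forall>l\<in>set ?v. fst (fst l) = snd (fst l)) \<longleftrightarrow> (\<forall>l\<in>set w. fst (fst l) = snd (fst l))"
      using True by (induction w) auto
    ultimately show ?thesis
      by (simp add: tor_def)
  next
    case False
    then obtain l where l: "l \<in> set w" "\<not> (fst (fst l) < M \<and> snd (fst l) < M \<or> fst (fst l) = M \<and> snd (fst l) = M)"
      by blast
    have "fst (fst l) < Suc M \<and> snd (fst l) < Suc M"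
      using w l(1) M(2) by (auto simp: uwords_def mem_Times_iff)
    then have "fst (fst l) \<noteq> snd (fst l)"
      using l(2) by linarith
    then have "tor s t w = 0"
      using l(1) by (auto simp: tor_def)
    moreover have "\<theta> (word_eval (free_unitary M) (corner_gen M) w) = 0"
      using linear_functional_zero[OF \<theta>(1)] unfolding word_eval_corner if_not_P[OF False] by simp
    ultimately show ?thesis
      by simp
  qed
  have am: "abelian_monoid (free_unitary M)"
    by (rule abelian_monoid_star_algebra[OF star_algebra_free_unitary])
  show ?thesis
  proof (rule factor_annihilator[OF quot fac, of \<theta>])
    show "\<theta> (x \<oplus>\<^bsub>free_unitary (N - 1)\<^esub> y) = \<theta> x + \<theta> y"
      if "x \<in> carrier (free_unitary (N - 1))" "y \<in> carrier (free_unitary (N - 1))" for x y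
      using \<theta>' that by (simp add: linear_functional_def M_def)
    fix f assume f: "f \<in> carrier (free_alg N)"
    note hom = presented_hom_functional[OF am star_algebraD(2)[OF star_algebra_free_unitary] \<theta>' closed f]
    show "to_corner N (cls N f) \<in> carrier (free_unitary (N - 1)) \<and> \<theta> (to_corner N (cls N f)) = lin (tor s t) f"
      using hom(1) hom(2)[OF _ unitary_functional_tor[OF s] eval]
      unfolding to_corner M_def[symmetric] by simp
  qed
qed

section \<open>Separating points outside of the relation ideal\<close>

text \<open>A basis of \<open>I\<close> together with \<open>h\<close> is independent; the linear
  map that is 1 at \<open>h\<close> and 0 on the basis of \<open>I\<close> has the form
  \<open>lin \<psi>\<close>, where \<psi> records its values on single basis elements.\<close>

lemma poly_mapping_separation:
  fixes h :: "'m \<Rightarrow>\<^sub>0 complex"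
  assumes zero: "0 \<in> I" and add: "\<And>f g. f \<in> I \<Longrightarrow> g \<in> I \<Longrightarrow> f + g \<in> I"
    and scale: "\<And>c f. f \<in> I \<Longrightarrow> Poly_Mapping.map ((*) c) f \<in> I" and h: "h \<notin> I"
  shows "\<exists>\<psi>. (\<forall>f\<in>I. lin \<psi> f = 0) \<and> lin \<psi> h \<noteq> 0"
proof -
  let ?scale = "\<lambda>c :: complex. Poly_Mapping.map ((*) c) :: ('m \<Rightarrow>\<^sub>0 complex) \<Rightarrow> _"
  interpret V: vector_space ?scale
    by unfold_locales (rule lin_eqI; simp add: algebra_simps)+
  interpret C: vector_space "(*) :: complex \<Rightarrow> complex \<Rightarrow> complex"
    by unfold_locales (simp_all add: algebra_simps)
  interpret VC: vector_space_pair ?scale "(*) :: complex \<Rightarrow> complex \<Rightarrow> complex" ..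
  have I: "V.subspace I"
    using zero add scale by (simp add: V.subspace_def)
  obtain B where B: "B \<subseteq> I" "V.independent B" "I \<subseteq> V.span B"
    using V.maximal_independent_subset by blast
  have spanB: "V.span B = I"
    using B(1,3) V.span_minimal[OF B(1) I] by blast
  have ind: "V.independent (insert h B)"
    using B(2) h spanB by (simp add: V.independent_insertI)
  define L where "L = VC.construct (insert h B) (\<lambda>b. if b = h then 1 else (0 :: complex))"
  have lin_L: "Vector_Spaces.linear ?scale (*) L"
    unfolding L_def by (rule VC.linear_construct[OF ind])
  have Lh: "L h = 1"
    unfolding L_def by (subst VC.construct_basis[OF ind]) simp_all
  have LB: "L b = 0" if "b \<in> B" for b
    unfolding L_def using that h B(1) by (subst VC.construct_basis[OF ind]) auto
  interpret L: Vector_Spaces.linear ?scale "(*) :: complex \<Rightarrow> complex \<Rightarrow> complex" L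
    by (rule lin_L)
  have L_eq: "L f = lin (\<lambda>m. L (Poly_Mapping.single m 1)) f" for f
  proof -
    have "f = (\<Sum>m\<in>Poly_Mapping.keys f. ?scale (Poly_Mapping.lookup f m) (Poly_Mapping.single m 1))"
      by (rule lin_eqI) (simp add: lin_sum lin_def[of _ f])
    then have "L f = L (\<Sum>m\<in>Poly_Mapping.keys f. ?scale (Poly_Mapping.lookup f m) (Poly_Mapping.single m 1))"
      by (rule arg_cong)
    then show ?thesis
      unfolding L.sum L.scale lin_def .
  qed
  have "L f = 0" if "f \<in> I" for f
    using V.span_induct[of f B "\<lambda>f. L f = 0"] that spanB LB
    by (auto simp: V.subspace_def L.add L.scale)
  then show ?thesis
    using L_eq Lh by (metis zero_neq_one)
qed

lemma rel_ideal_separation: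
  assumes "f \<in> carrier (free_alg N)" "f \<notin> rel_ideal N"
  obtains \<psi> where "unitary_functional N \<psi>" "lin \<psi> f \<noteq> 0"
proof -
  interpret ideal "rel_ideal N" "free_alg N" by (rule ideal_rel)
  have "\<exists>\<psi>. (\<forall>f\<in>rel_ideal N. lin \<psi> f = 0) \<and> lin \<psi> f \<noteq> 0"
  proof (rule poly_mapping_separation)
    show "0 \<in> rel_ideal N"
      using additive_subgroup.zero_closed[OF is_additive_subgroup] by simp
    show "g + k \<in> rel_ideal N" if "g \<in> rel_ideal N" "k \<in> rel_ideal N" for g k
      using additive_subgroup.a_closed[OF is_additive_subgroup that] by simp
    show "Poly_Mapping.map ((*) c) g \<in> rel_ideal N" if "g \<in> rel_ideal N" for c g
      using ideal_scale[OF star_algebra_free ideal_rel rel_star that, of c] by simp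
  qed (rule assms)
  then show thesis
    using that vanish_unitary_functional by blast
qed

theorem proposition2p1:
  fixes N :: nat
  assumes "N \<ge> 3"
  shows "topologically_generated_by (free_unitary N)
    (representative_hopf (unitary_group N)) (to_unitary N)
    (free_unitary (N - 1)) (to_corner N)"
  unfolding topologically_generated_by_def
proof (intro notI, elim exE conjE)
  fix Q :: "uplus_elem set hopf_star_alg" and q
  assume quot: "hopf_star_quotient (free_unitary N) Q q" and ninj: "\<not> inj_on q (carrier (free_unitary N))"
    and fac: "factors_through (free_unitary N) (representative_hopf (unitary_group N)) (to_unitary N) Q q"
      "factors_through (free_unitary N) (free_unitary (N - 1)) (to_corner N) Q q"
  interpret F: ring "free_alg N" by (rule star_algebraD(1)[OF star_algebra_free])
  interpret Q: ring Q by (rule star_algebraD(1)[OF star_algebra_Q[OF quot]])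
  interpret U: ring "uplus N" by (rule star_algebraD(1)[OF star_algebra_free_unitary_star_alg])
  obtain x y where xy: "x \<in> carrier (uplus N)" "y \<in> carrier (uplus N)" "q x = q y" "x \<noteq> y"
    using ninj unfolding inj_on_def free_unitary_simps by blast
  have d: "x \<ominus>\<^bsub>uplus N\<^esub> y \<in> carrier (uplus N)"
    using xy by simp
  have xd: "x = (x \<ominus>\<^bsub>uplus N\<^esub> y) \<oplus>\<^bsub>uplus N\<^esub> y"
    using xy by (simp add: U.minus_eq U.a_assoc U.l_neg)
  have "q x = q (x \<ominus>\<^bsub>uplus N\<^esub> y) \<oplus>\<^bsub>Q\<^esub> q y"
    by (subst xd) (rule q_hom(2)[OF quot d xy(2)])
  then have qd: "q (x \<ominus>\<^bsub>uplus N\<^esub> y) = \<zero>\<^bsub>Q\<^esub>"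
    using xy(3) q_hom(1)[OF quot d] q_hom(1)[OF quot xy(2)] by simp
  obtain f where f: "f \<in> carrier (free_alg N)" "x \<ominus>\<^bsub>uplus N\<^esub> y = cls N f"
    using d by (rule cls_carrierE)
  have ker: "f \<in> kernel_words N Q q"
    using f qd by (simp add: kernel_words_def[OF quot])
  have "f \<notin> rel_ideal N"
  proof
    assume "f \<in> rel_ideal N"
    then have "x \<ominus>\<^bsub>uplus N\<^esub> y = \<zero>\<^bsub>uplus N\<^esub>"
      using cls_zero f(2) by metis
    then show False
      using xd xy(2,4) by simp
  qed
  then obtain \<psi> where \<psi>: "unitary_functional N \<psi>" "lin \<psi> f \<noteq> 0"
    by (rule rel_ideal_separation[OF f(1)])
  \<comment> \<open>Only the finitely many words of \<open>f\<close> matter, so agreement on them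
    already transfers the value of \<psi> at \<open>f\<close>.\<close>
  have "\<exists>\<phi>\<in>annihilator N Q q. \<forall>w\<in>Poly_Mapping.keys f. \<phi> w = \<psi> w"
  proof (rule functional_approximation)
    show "fun_subspace (annihilator N Q q)"
      by (rule fun_subspace_annihilator[OF quot])
  qed (use f assms in \<open>auto intro: annihilator_conv[OF quot] annihilator_dagger[OF quot]
      ev_annihilator[OF quot fac(1)] tor_annihilator[OF quot assms fac(2)] \<psi>\<close>)
  then obtain \<phi> where \<phi>: "\<phi> \<in> annihilator N Q q" "\<forall>w\<in>Poly_Mapping.keys f. \<phi> w = \<psi> w"
    by blast
  have "lin \<psi> f = lin \<phi> f"
    using \<phi>(2) by (intro lin_cong) simp
  also have "\<dots> = 0"
    using \<phi>(1) ker by (simp add: annihilator_def[OF quot])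
  finally show False
    using \<psi>(2) by contradiction
qed

end
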